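(* Let $R$ be a commutative ring with identity, $n,r$ positive integers and $\lambda\in\Lambda^+(n;r)$. Then the complex $B_*(W^R_\lambda)=\big(S_R(n,r)\otimes_{S^+_R(n,r)}B^+_k(R_\lambda),\ \mathrm{id}\otimes\partial_k\big)_{k\ge -1}$ (with $B_{-1}(W^R_\lambda)=W^R_\lambda$) is a projective resolution of the Weyl module $W^R_\lambda$ over $S_R(n,r)$; that is, it is exact and $B_k(W^R_\lambda)$ is a projective $S_R(n,r)$-module for every $k\ge 0$.
   Context: Notation. $\mathbf{n}=\{1,\dots,n\}$, $I(n,r)=\mathbf{n}^r$, with right $\Sigma_r$-action $(i\sigma)_q=i_{\sigma(q)}$. $\Lambda(n;r)$ is the set of compositions $\lambda=(\lambda_1,\dots,\lambda_n)\in\mathbb{N}_0^n$ with $\sum_s\lambda_s=r$, and $\Lambda^+(n;r)$ those with $\lambda_1\ge\dots\ge\lambda_n$. $\Lambda(n,n;r)$ is the set of $n\times n$ matrices $\omega=(\omega_{st})$ of nonnegative integers with total sum $r$. For $i,j\in I(n,r)$ let $\operatorname{wt}(i,j)\in\Lambda(n,n;r)$, $\operatorname{wt}(i,j)_{st}=\#\{q: i_q=s,\ j_q=t\}$, and write $(i,j)\in\omega$ if $\operatorname{wt}(i,j)=\omega$. Schur algebra. $(R^n)^{\otimes r}$ has $R$-basis $e_i=e_{i_1}\otimes\cdots\otimes e_{i_r}$ ($i\in I(n,r)$), and right $\Sigma_r$-action $e_i\sigma=e_{i\sigma}$. $S_R(n,r)=\mathrm{End}_{R\Sigma_r}((R^n)^{\otimes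 r})$. For $i,j\in I(n,r)$ let $e_{i,j}$ be the endomorphism $e_k\mapsto\delta_{jk}e_i$, and for $\omega\in\Lambda(n,n;r)$ put $\xi_\omega=\sum_{(i,j)\in\omega}e_{i,j}$; these form an $R$-basis of $S_R(n,r)$. For $\lambda\in\Lambda(n;r)$, $\xi_\lambda:=\xi_{\mathrm{diag}(\lambda)}$; these are orthogonal idempotents summing to $1$. Borel–Schur algebra. For $s\ge0$ let $\Lambda^s(n,n;r)$ be the set of upper triangular $\omega\in\Lambda(n,n;r)$ with $\sum_{1\le k\le l\le n}(l-k)\omega_{kl}\ge s$, and $J^R_s(n,r)$ the $R$-span of $\{\xi_\omega:\omega\in\Lambda^s(n,n;r)\}$. $S^+_R(n,r):=J^R_0(n,r)$ is a subalgebra of $S_R(n,r)$ and $J_R:=J^R_1(n,r)$ is an ideal of it; $L_{n,r}:=\bigoplus_{\lambda\in\Lambda(n;r)}R\xi_\lambda$ and $S^+_R(n,r)=L_{n,r}\oplus J_R$. For $\lambda\in\Lambda(n;r)$, $R_\lambda$ is the rank one $S^+_R(n,r)$-module $R$ on which $\xi_\lambda$ acts as identity and $\xi_\mu$ ($\mu\ne\lambda$) and all elements of $J_R$ act as zero. For $\lambda\in\Lambda^+(n;r)$ the Weyl module is $W^R_\lambda:=S_R(n,r)\otimes_{S^+_R(n,r)}R_\lambda$. Reduced bar resolution. Put $B^+_{-1}(R_\lambda)=R_\lambda$ and for $k\ge0$, $B^+_k(R_\lambda)=S^+_R(n,r)\otimes J_R\otimes\cdots\otimes J_R\otimes R_\lambda$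 ($k$ copies of $J_R$, all tensor products over $L_{n,r}$), a left $S^+_R(n,r)$-module via the first factor. The differential is $\partial_k=\sum_{t=0}^k(-1)^td_{k,t}$, where $d_{0,0}(a\otimes m)=am$, and for $k\ge1$: $d_{k,0}(a\otimes a_1\otimes\cdots\otimes a_k\otimes m)=aa_1\otimes a_2\otimes\cdots\otimes a_k\otimes m$, $d_{k,j}(\dots)=a\otimes a_1\otimes\cdots\otimes a_ja_{j+1}\otimes\cdots\otimes a_k\otimes m$ for $1\le j\le k-1$, and $d_{k,k}(\dots)=a\otimes a_1\otimes\cdots\otimes a_{k-1}\otimes a_km$. *)

theory Defs
  imports "HOL-Library.FuncSet" "HOL-Combinatorics.Permutations"
begin

type_synonym 'a vec = "nat list \<Rightarrow> 'a"
type_synonym 'a endo = "'a vec \<Rightarrow> 'a vec"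

text \<open>I(n,r): words of length r over {1..n}; positions are 0-based.\<close>
definition Inr :: "nat \<Rightarrow> nat \<Rightarrow> nat list set" where
  "Inr n r = {i. length i = r \<and> set i \<subseteq> {1..n}}"

definition perm_idx :: "nat list \<Rightarrow> (nat \<Rightarrow> nat) \<Rightarrow> nat list" where
  "perm_idx i \<sigma> = map (\<lambda>q. i ! \<sigma> q) [0..<length i]"

text \<open>(R^n)^(tensor r) as functions on I(n,r) (coordinates w.r.t. the basis e_i).\<close>
definition Vsp :: "nat \<Rightarrow> nat \<Rightarrow> ('a::comm_ring_1) vec set" where
  "Vsp n r = {v. \<forall>i. i \<notin> Inr n r \<longrightarrow> v i = 0}"

text \<open>Right action of sigma, the linear extension of e_i sigma = e_(i sigma).\<close>
definition vact :: "nat \<Rightarrow> nat \<Rightarrow> ('a::comm_ring_1) vec \<Rightarrow> (nat \<Rightarrow> nat) \<Rightarrow> 'a vec" where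
  "vact n r v \<sigma> = (\<lambda>k. \<Sum>i\<in>{i\<in>Inr n r. perm_idx i \<sigma> = k}. v i)"

definition Schur :: "nat \<Rightarrow> nat \<Rightarrow> ('a::comm_ring_1) endo set" where
  "Schur n r = {\<phi> \<in> Vsp n r \<rightarrow>\<^sub>E Vsp n r.
     (\<forall>v\<in>Vsp n r. \<forall>w\<in>Vsp n r. \<phi> (\<lambda>i. v i + w i) = (\<lambda>i. \<phi> v i + \<phi> w i)) \<and>
     (\<forall>c. \<forall>v\<in>Vsp n r. \<phi> (\<lambda>i. c * v i) = (\<lambda>i. c * \<phi> v i)) \<and>
     (\<forall>\<sigma>. \<sigma> permutes {..<r} \<longrightarrow>
        (\<forall>v\<in>Vsp n r. \<phi> (vact n r v \<sigma>) = vact n r (\<phi> v) \<sigma>))}"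

definition smul :: "nat \<Rightarrow> nat \<Rightarrow> ('a::comm_ring_1) endo \<Rightarrow> 'a endo \<Rightarrow> 'a endo" where
  "smul n r a b = (\<lambda>v\<in>Vsp n r. a (b v))"

definition sadd :: "nat \<Rightarrow> nat \<Rightarrow> ('a::comm_ring_1) endo \<Rightarrow> 'a endo \<Rightarrow> 'a endo" where
  "sadd n r a b = (\<lambda>v\<in>Vsp n r. \<lambda>i. a v i + b v i)"

definition sone :: "nat \<Rightarrow> nat \<Rightarrow> ('a::comm_ring_1) endo" where
  "sone n r = (\<lambda>v\<in>Vsp n r. v)"

definition wt :: "nat list \<Rightarrow> nat list \<Rightarrow> nat \<Rightarrow> nat \<Rightarrow> nat" where
  "wt i j = (\<lambda>s t. card {q. q < length i \<and> i ! q = s \<and> j ! q = t})"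

definition Mats :: "nat \<Rightarrow> nat \<Rightarrow> (nat \<Rightarrow> nat \<Rightarrow> nat) set" where
  "Mats n r = {\<omega>. (\<forall>s t. s \<notin> {1..n} \<or> t \<notin> {1..n} \<longrightarrow> \<omega> s t = 0)
                  \<and> (\<Sum>s\<in>{1..n}. \<Sum>t\<in>{1..n}. \<omega> s t) = r}"

text \<open>xi_omega = sum of e_(i,j) over (i,j) in omega, where e_(i,j) v = v_j e_i.\<close>
definition xi :: "nat \<Rightarrow> nat \<Rightarrow> (nat \<Rightarrow> nat \<Rightarrow> nat) \<Rightarrow> ('a::comm_ring_1) endo" where
  "xi n r \<omega> = (\<lambda>v\<in>Vsp n r. \<lambda>i. if i \<in> Inr n r
        then (\<Sum>j\<in>{j\<in>Inr n r. wt i j = \<omega>}. v j) else 0)"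

definition MatsUp :: "nat \<Rightarrow> nat \<Rightarrow> nat \<Rightarrow> (nat \<Rightarrow> nat \<Rightarrow> nat) set" where
  "MatsUp n r s = {\<omega>\<in>Mats n r. (\<forall>k l. l < k \<longrightarrow> \<omega> k l = 0) \<and>
        s \<le> (\<Sum>k\<in>{1..n}. \<Sum>l\<in>{k..n}. (l - k) * \<omega> k l)}"

definition xicomb :: "nat \<Rightarrow> nat \<Rightarrow> (nat \<Rightarrow> nat \<Rightarrow> nat) set
     \<Rightarrow> ((nat \<Rightarrow> nat \<Rightarrow> nat) \<Rightarrow> 'a) \<Rightarrow> ('a::comm_ring_1) endo" where
  "xicomb n r M c = (\<lambda>v\<in>Vsp n r. \<lambda>i. \<Sum>\<omega>\<in>M. c \<omega> * xi n r \<omega> v i)"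

definition Jsp :: "nat \<Rightarrow> nat \<Rightarrow> nat \<Rightarrow> ('a::comm_ring_1) endo set" where
  "Jsp n r s = range (xicomb n r (MatsUp n r s))"

definition SchurPlus :: "nat \<Rightarrow> nat \<Rightarrow> ('a::comm_ring_1) endo set" where
  "SchurPlus n r = Jsp n r 0"

definition Jrad :: "nat \<Rightarrow> nat \<Rightarrow> ('a::comm_ring_1) endo set" where
  "Jrad n r = Jsp n r 1"

definition Comps :: "nat \<Rightarrow> nat \<Rightarrow> (nat \<Rightarrow> nat) set" where
  "Comps n r = {lam. (\<forall>s. s \<notin> {1..n} \<longrightarrow> lam s = 0) \<and> (\<Sum>s\<in>{1..n}. lam s) = r}"

definition CompsDom :: "nat \<Rightarrow> nat \<Rightarrow> (nat \<Rightarrow> nat) set" where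
  "CompsDom n r = {lam\<in>Comps n r. \<forall>s t. 1 \<le> s \<and> s \<le> t \<and> t \<le> n \<longrightarrow> lam t \<le> lam s}"

definition diagm :: "(nat \<Rightarrow> nat) \<Rightarrow> nat \<Rightarrow> nat \<Rightarrow> nat" where
  "diagm lam = (\<lambda>s t. if s = t then lam s else 0)"

definition Lsp :: "nat \<Rightarrow> nat \<Rightarrow> ('a::comm_ring_1) endo set" where
  "Lsp n r = range (xicomb n r (diagm ` Comps n r))"

text \<open>The module R_lambda: a = sum c_omega xi_omega in S^+ acts by c_(diag lambda),
  i.e. xi_lambda acts as 1, xi_mu (mu ~= lambda) and J act as 0.\<close>
definition rlam_act :: "nat \<Rightarrow> nat \<Rightarrow> (nat \<Rightarrow> nat) \<Rightarrow> ('a::comm_ring_1) endo \<Rightarrow> 'a \<Rightarrow> 'a" where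
  "rlam_act n r lam a m =
     (SOME c. \<exists>cs. a = xicomb n r (MatsUp n r 0) cs \<and> cs (diagm lam) = c) * m"

section \<open>Generic quotients of free abelian groups (used for tensor products)\<close>

definition free_on :: "'g set \<Rightarrow> ('g \<Rightarrow> int) set" where
  "free_on G = {f. finite {g. f g \<noteq> 0} \<and> (\<forall>g. f g \<noteq> 0 \<longrightarrow> g \<in> G)}"

inductive_set zspan :: "('g \<Rightarrow> int) set \<Rightarrow> ('g \<Rightarrow> int) set" for A where
  zspan_zero: "(\<lambda>g. 0) \<in> zspan A"
| zspan_add: "x \<in> zspan A \<Longrightarrow> a \<in> A \<Longrightarrow> (\<lambda>g. x g + a g) \<in> zspan A"
| zspan_diff: "x \<in> zspan A \<Longrightarrow> a \<in> A \<Longrightarrow> (\<lambda>g. x g - a g) \<in> zspan A"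

definition qcls :: "'g set \<Rightarrow> ('g \<Rightarrow> int) set \<Rightarrow> ('g \<Rightarrow> int) \<Rightarrow> ('g \<Rightarrow> int) set" where
  "qcls G A f = {f' \<in> free_on G. (\<lambda>g. f' g - f g) \<in> zspan A}"

definition quot :: "'g set \<Rightarrow> ('g \<Rightarrow> int) set \<Rightarrow> ('g \<Rightarrow> int) set set" where
  "quot G A = qcls G A ` free_on G"

definition gen1 :: "'g \<Rightarrow> 'g \<Rightarrow> int" where
  "gen1 g = (\<lambda>h. if h = g then 1 else 0)"

definition qrep :: "('g \<Rightarrow> int) set \<Rightarrow> 'g \<Rightarrow> int" where
  "qrep X = (SOME f. f \<in> X)"

definition lin_ext :: "('g \<Rightarrow> 'h \<Rightarrow> int) \<Rightarrow> ('g \<Rightarrow> int) \<Rightarrow> 'h \<Rightarrow> int" where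
  "lin_ext D f = (\<lambda>h. \<Sum>g\<in>{g. f g \<noteq> 0}. f g * D g h)"

definition fadd :: "('g \<Rightarrow> int) \<Rightarrow> ('g \<Rightarrow> int) \<Rightarrow> 'g \<Rightarrow> int" where
  "fadd f f' = (\<lambda>g. f g + f' g)"

type_synonym 'a bgen = "'a endo list \<times> 'a"
type_synonym 'a bplus = "('a bgen \<Rightarrow> int) set"

text \<open>Generators a (x) a_1 (x) ... (x) a_k (x) m, stored as (a # [a_1,...,a_k], m).\<close>
definition slot :: "nat \<Rightarrow> nat \<Rightarrow> nat \<Rightarrow> ('a::comm_ring_1) endo set" where
  "slot n r p = (if p = 0 then SchurPlus n r else Jrad n r)"

definition BGen :: "nat \<Rightarrow> nat \<Rightarrow> nat \<Rightarrow> ('a::comm_ring_1) bgen set" where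
  "BGen n r k = {(as, m). length as = Suc k \<and> (\<forall>p\<le>k. as ! p \<in> slot n r p)}"

text \<open>Relations of the iterated tensor product over L_(n,r).\<close>
definition BRel :: "nat \<Rightarrow> nat \<Rightarrow> (nat \<Rightarrow> nat) \<Rightarrow> nat \<Rightarrow> (('a::comm_ring_1) bgen \<Rightarrow> int) set" where
  "BRel n r lam k =
     {(\<lambda>g. gen1 (as[p := sadd n r x y], m) g - gen1 (as[p := x], m) g - gen1 (as[p := y], m) g)
        | as m p x y. (as, m) \<in> BGen n r k \<and> p \<le> k \<and> x \<in> slot n r p \<and> y \<in> slot n r p}
   \<union> {(\<lambda>g. gen1 (as, m + m') g - gen1 (as, m) g - gen1 (as, m') g)
        | as m m'. (as, m) \<in> BGen n r k}
   \<union> {(\<lambda>g. gen1 (as[p := smul n r (as ! p) l], m) g - gen1 (as[Suc p := smul n r l (as ! Suc p)], m) g)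
        | as m p l. (as, m) \<in> BGen n r k \<and> p < k \<and> l \<in> Lsp n r}
   \<union> {(\<lambda>g. gen1 (as[k := smul n r (as ! k) l], m) g - gen1 (as, rlam_act n r lam l m) g)
        | as m l. (as, m) \<in> BGen n r k \<and> l \<in> Lsp n r}"

definition Bplus :: "nat \<Rightarrow> nat \<Rightarrow> (nat \<Rightarrow> nat) \<Rightarrow> nat \<Rightarrow> ('a::comm_ring_1) bplus set" where
  "Bplus n r lam k = quot (BGen n r k) (BRel n r lam k)"

definition bcls :: "nat \<Rightarrow> nat \<Rightarrow> (nat \<Rightarrow> nat) \<Rightarrow> nat \<Rightarrow> (('a::comm_ring_1) bgen \<Rightarrow> int) \<Rightarrow> 'a bplus" where
  "bcls n r lam k = qcls (BGen n r k) (BRel n r lam k)"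

definition bplus_add :: "nat \<Rightarrow> nat \<Rightarrow> (nat \<Rightarrow> nat) \<Rightarrow> nat \<Rightarrow> ('a::comm_ring_1) bplus \<Rightarrow> 'a bplus \<Rightarrow> 'a bplus" where
  "bplus_add n r lam k X Y = bcls n r lam k (fadd (qrep X) (qrep Y))"

definition bplus_act :: "nat \<Rightarrow> nat \<Rightarrow> (nat \<Rightarrow> nat) \<Rightarrow> nat \<Rightarrow> ('a::comm_ring_1) endo \<Rightarrow> 'a bplus \<Rightarrow> 'a bplus" where
  "bplus_act n r lam k a X =
     bcls n r lam k (lin_ext (\<lambda>(as, m). gen1 (as[0 := smul n r a (as ! 0)], m)) (qrep X))"

definition face :: "nat \<Rightarrow> nat \<Rightarrow> (nat \<Rightarrow> nat) \<Rightarrow> nat \<Rightarrow> nat \<Rightarrow> ('a::comm_ring_1) bgen \<Rightarrow> 'a bgen" where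
  "face n r lam k t g = (case g of (as, m) \<Rightarrow>
     if t < k then (take t as @ [smul n r (as ! t) (as ! Suc t)] @ drop (Suc (Suc t)) as, m)
     else (butlast as, rlam_act n r lam (last as) m))"

definition dplus :: "nat \<Rightarrow> nat \<Rightarrow> (nat \<Rightarrow> nat) \<Rightarrow> nat \<Rightarrow> ('a::comm_ring_1) bplus \<Rightarrow> 'a bplus" where
  "dplus n r lam k X = bcls n r lam (k - 1)
     (lin_ext (\<lambda>g h. \<Sum>t\<le>k. (-1) ^ t * gen1 (face n r lam k t g) h) (qrep X))"

definition dplus0 :: "nat \<Rightarrow> nat \<Rightarrow> (nat \<Rightarrow> nat) \<Rightarrow> ('a::comm_ring_1) bplus \<Rightarrow> 'a" where
  "dplus0 n r lam X = (\<Sum>g\<in>{g. qrep X g \<noteq> 0}.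
      of_int (qrep X g) * rlam_act n r lam (fst g ! 0) (snd g))"

text \<open>Tensor product S (x)_{S^+} N for a left S^+-module N = (Nc, Nadd, Nact).\<close>
definition OGen :: "nat \<Rightarrow> nat \<Rightarrow> 'x set \<Rightarrow> (('a::comm_ring_1) endo \<times> 'x) set" where
  "OGen n r Nc = {(s, x). s \<in> Schur n r \<and> x \<in> Nc}"

definition ORel :: "nat \<Rightarrow> nat \<Rightarrow> 'x set \<Rightarrow> ('x \<Rightarrow> 'x \<Rightarrow> 'x) \<Rightarrow> (('a::comm_ring_1) endo \<Rightarrow> 'x \<Rightarrow> 'x)
     \<Rightarrow> ('a endo \<times> 'x \<Rightarrow> int) set" where
  "ORel n r Nc Nadd Nact =
     {(\<lambda>g. gen1 (sadd n r s s', x) g - gen1 (s, x) g - gen1 (s', x) g)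
        | s s' x. s \<in> Schur n r \<and> s' \<in> Schur n r \<and> x \<in> Nc}
   \<union> {(\<lambda>g. gen1 (s, Nadd x x') g - gen1 (s, x) g - gen1 (s, x') g)
        | s x x'. s \<in> Schur n r \<and> x \<in> Nc \<and> x' \<in> Nc}
   \<union> {(\<lambda>g. gen1 (smul n r s a, x) g - gen1 (s, Nact a x) g)
        | s a x. s \<in> Schur n r \<and> a \<in> SchurPlus n r \<and> x \<in> Nc}"

definition Wlam :: "nat \<Rightarrow> nat \<Rightarrow> (nat \<Rightarrow> nat) \<Rightarrow> (('a::comm_ring_1) endo \<times> 'a \<Rightarrow> int) set set" where
  "Wlam n r lam = quot (OGen n r UNIV) (ORel n r UNIV (+) (rlam_act n r lam))"

definition wcls :: "nat \<Rightarrow> nat \<Rightarrow> (nat \<Rightarrow> nat) \<Rightarrow> (('a::comm_ring_1) endo \<times> 'a \<Rightarrow> int) \<Rightarrow> ('a endo \<times> 'a \<Rightarrow> int) set" where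
  "wcls n r lam = qcls (OGen n r UNIV) (ORel n r UNIV (+) (rlam_act n r lam))"

type_synonym 'a bres = "('a endo \<times> 'a bplus \<Rightarrow> int) set"

definition BGenO :: "nat \<Rightarrow> nat \<Rightarrow> (nat \<Rightarrow> nat) \<Rightarrow> nat \<Rightarrow> (('a::comm_ring_1) endo \<times> 'a bplus) set" where
  "BGenO n r lam k = OGen n r (Bplus n r lam k)"

definition BRelO :: "nat \<Rightarrow> nat \<Rightarrow> (nat \<Rightarrow> nat) \<Rightarrow> nat \<Rightarrow> (('a::comm_ring_1) endo \<times> 'a bplus \<Rightarrow> int) set" where
  "BRelO n r lam k = ORel n r (Bplus n r lam k) (bplus_add n r lam k) (bplus_act n r lam k)"

definition Bres :: "nat \<Rightarrow> nat \<Rightarrow> (nat \<Rightarrow> nat) \<Rightarrow> nat \<Rightarrow> ('a::comm_ring_1) bres set" where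
  "Bres n r lam k = quot (BGenO n r lam k) (BRelO n r lam k)"

definition bocls :: "nat \<Rightarrow> nat \<Rightarrow> (nat \<Rightarrow> nat) \<Rightarrow> nat \<Rightarrow> (('a::comm_ring_1) endo \<times> 'a bplus \<Rightarrow> int) \<Rightarrow> 'a bres" where
  "bocls n r lam k = qcls (BGenO n r lam k) (BRelO n r lam k)"

definition Bzero :: "nat \<Rightarrow> nat \<Rightarrow> (nat \<Rightarrow> nat) \<Rightarrow> nat \<Rightarrow> ('a::comm_ring_1) bres" where
  "Bzero n r lam k = bocls n r lam k (\<lambda>g. 0)"

definition Wzero :: "nat \<Rightarrow> nat \<Rightarrow> (nat \<Rightarrow> nat) \<Rightarrow> (('a::comm_ring_1) endo \<times> 'a \<Rightarrow> int) set" where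
  "Wzero n r lam = wcls n r lam (\<lambda>g. 0)"

definition dres :: "nat \<Rightarrow> nat \<Rightarrow> (nat \<Rightarrow> nat) \<Rightarrow> nat \<Rightarrow> ('a::comm_ring_1) bres \<Rightarrow> 'a bres" where
  "dres n r lam k X = bocls n r lam (k - 1)
     (lin_ext (\<lambda>(s, Y). gen1 (s, dplus n r lam k Y)) (qrep X))"

definition dres0 :: "nat \<Rightarrow> nat \<Rightarrow> (nat \<Rightarrow> nat) \<Rightarrow> ('a::comm_ring_1) bres \<Rightarrow> ('a endo \<times> 'a \<Rightarrow> int) set" where
  "dres0 n r lam X = wcls n r lam
     (lin_ext (\<lambda>(s, Y). gen1 (s, dplus0 n r lam Y)) (qrep X))"

record ('a, 'm) smod =
  mcar :: "'m set"
  madd :: "'m \<Rightarrow> 'm \<Rightarrow> 'm"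
  mzero :: "'m"
  mact :: "'a endo \<Rightarrow> 'm \<Rightarrow> 'm"

definition is_smod :: "nat \<Rightarrow> nat \<Rightarrow> (('a::comm_ring_1), 'm) smod \<Rightarrow> bool" where
  "is_smod n r M \<longleftrightarrow>
     mzero M \<in> mcar M \<and>
     (\<forall>x\<in>mcar M. \<forall>y\<in>mcar M. madd M x y \<in> mcar M) \<and>
     (\<forall>x\<in>mcar M. \<forall>y\<in>mcar M. \<forall>z\<in>mcar M. madd M (madd M x y) z = madd M x (madd M y z)) \<and>
     (\<forall>x\<in>mcar M. \<forall>y\<in>mcar M. madd M x y = madd M y x) \<and>
     (\<forall>x\<in>mcar M. madd M (mzero M) x = x) \<and>
     (\<forall>x\<in>mcar M. \<exists>y\<in>mcar M. madd M x y = mzero M) \<and>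
     (\<forall>s\<in>Schur n r. \<forall>x\<in>mcar M. mact M s x \<in> mcar M) \<and>
     (\<forall>s\<in>Schur n r. \<forall>x\<in>mcar M. \<forall>y\<in>mcar M. mact M s (madd M x y) = madd M (mact M s x) (mact M s y)) \<and>
     (\<forall>s\<in>Schur n r. \<forall>t\<in>Schur n r. \<forall>x\<in>mcar M. mact M (sadd n r s t) x = madd M (mact M s x) (mact M t x)) \<and>
     (\<forall>s\<in>Schur n r. \<forall>t\<in>Schur n r. \<forall>x\<in>mcar M. mact M (smul n r s t) x = mact M s (mact M t x)) \<and>
     (\<forall>x\<in>mcar M. mact M (sone n r) x = x)"

definition smod_hom :: "nat \<Rightarrow> nat \<Rightarrow> (('a::comm_ring_1), 'm) smod \<Rightarrow> ('a, 'p) smod \<Rightarrow> ('m \<Rightarrow> 'p) \<Rightarrow> bool" where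
  "smod_hom n r M N h \<longleftrightarrow>
     (\<forall>x\<in>mcar M. h x \<in> mcar N) \<and>
     (\<forall>x\<in>mcar M. \<forall>y\<in>mcar M. h (madd M x y) = madd N (h x) (h y)) \<and>
     (\<forall>s\<in>Schur n r. \<forall>x\<in>mcar M. h (mact M s x) = mact N s (h x))"

text \<open>Projectivity: lifting property against all surjective module maps between
  S_R(n,r)-modules whose carriers live in the (arbitrary) types 'm and 'q.\<close>
definition projective_smod :: "'m itself \<Rightarrow> 'q itself \<Rightarrow> nat \<Rightarrow> nat \<Rightarrow> (('a::comm_ring_1), 'p) smod \<Rightarrow> bool" where
  "projective_smod (_::'m itself) (_::'q itself) n r P \<longleftrightarrow> is_smod n r P \<and>
     (\<forall>(M::('a,'m) smod) (N::('a,'q) smod) g f.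
        is_smod n r M \<and> is_smod n r N \<and> smod_hom n r M N g \<and> g ` mcar M = mcar N \<and>
        smod_hom n r P N f \<longrightarrow>
        (\<exists>h. smod_hom n r P M h \<and> (\<forall>x\<in>mcar P. g (h x) = f x)))"

definition Bmod :: "nat \<Rightarrow> nat \<Rightarrow> (nat \<Rightarrow> nat) \<Rightarrow> nat \<Rightarrow> (('a::comm_ring_1), 'a bres) smod" where
  "Bmod n r lam k =
     \<lparr> mcar = Bres n r lam k,
       madd = (\<lambda>X Y. bocls n r lam k (fadd (qrep X) (qrep Y))),
       mzero = Bzero n r lam k,
       mact = (\<lambda>s X. bocls n r lam k
                 (lin_ext (\<lambda>(t, Y). gen1 (smul n r s t, Y)) (qrep X))) \<rparr>"

end

theory Submission
  imports Defs "HOL-Library.Function_Algebras"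
begin

text \<open>
  In the basis of the matrices \<open>w\<close>, an element of the \<open>k\<close>-th term of the complex is a family of
  \<open>\<Sigma>\<^sub>r\<close>-invariant kernels \<open>F t i j\<close> on pairs of words, indexed by the composable chains
  \<open>t = [w\<^sub>1, \<dots>, w\<^sub>k]\<close> of strictly upper triangular matrices ending in weight \<open>lam\<close>. In this form each term
  is visibly a direct sum of modules generated by idempotents, hence projective.

  For exactness, fix the content of the left word \<open>i\<close>. As a right module over the Borel subalgebra this part of the Schur algebra
  is a tensor product of divided powers of the natural module, one row for each letter. Splitting off the lowest column of
  a row gives short exact sequences between such tensor products and their twists by coordinate characters. When all rows
  start in different columns the product is generated by an idempotent, so the bar complex of \<open>R\<^sub>lam\<close> is contractible on it
  unless its weight is \<open>lam\<close>. The long exact sequences reduce the general case to these staircases, and dominance of \<open>lam\<close>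
  is what makes the induction on the columns close up.
\<close>

section \<open>Words and invariant kernels\<close>

text \<open>Peeling a letter off a row lowers one entry of the leftover weight \<open>mu\<close>,
  which is \<open>lam\<close> minus the twists. If \<open>mu\<close> stays dominant, induction on
  the number of row letters applies. Otherwise the entry was equal to its right neighbour. If both
  were positive, the new \<open>mu\<close> is fixed by the dot action of a simple reflection, and,
  as for a line bundle of degree -1 on a projective line, nothing may survive in any degree. That
  vanishing, \<open>Bc\<close>, is the main obstacle. It is obtained by using the short exact
  sequences in two ways: sub and quotient control the middle term, and sub and middle term control
  the quotient. The second use trades a twist letter back for a row letter and needs acyclicity in
  every degree, degree 0 included, which is what \<open>Ac\<close> means. For dominant
  \<open>mu\<close> only the positive degrees vanish, as degree 0 carries the Weyl module. Divided
  powers appear because kernels are functions constant on orbits of pairs of words; this is also why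
  no division occurs and the ring can be arbitrary.\<close>

abbreviation cont :: "nat list \<Rightarrow> nat \<Rightarrow> nat" where
  "cont j \<equiv> count (mset j)"

abbreviation lle :: "nat list \<Rightarrow> nat list \<Rightarrow> bool" where
  "lle \<equiv> list_all2 (\<le>)"

text \<open>Kernels of equivariant maps are the functions on pairs of words that are constant on
  orbits of the symmetric group. Left words may carry letters of any type, so that the notion also
  covers words of row labels.\<close>

definition linv :: "nat \<Rightarrow> ('l list \<Rightarrow> nat list \<Rightarrow> 'a) \<Rightarrow> bool" where
  "linv r a \<longleftrightarrow> (\<forall>p i j. p permutes {..<r} \<longrightarrow> length i = r \<longrightarrow> length j = r \<longrightarrow>
     a (permute_list p i) (permute_list p j) = a i j)"

lemma linvI:
  assumes "\<And>p i j. p permutes {..<r} \<Longrightarrow> length i = r \<Longrightarrow> length j = r \<Longrightarrow>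
     a (permute_list p i) (permute_list p j) = a i j"
  shows "linv r a"
  using assms by (auto simp: linv_def)

lemma linvD:
  "linv r a \<Longrightarrow> p permutes {..<r} \<Longrightarrow> length i = r \<Longrightarrow> length j = r \<Longrightarrow>
     a (permute_list p i) (permute_list p j) = a i j"
  by (auto simp: linv_def)

lemma finite_Inr [simp]: "finite (Inr n r)"
proof -
  have "Inr n r = {xs. set xs \<subseteq> {1..n} \<and> length xs = r}" by (auto simp: Inr_def)
  then show ?thesis by (simp add: finite_lists_length_eq)
qed

lemma Inr_length: "j \<in> Inr n r \<Longrightarrow> length j = r"
  by (simp add: Inr_def)

lemma permute_list_Inr: "p permutes {..<r} \<Longrightarrow> j \<in> Inr n r \<Longrightarrow> permute_list p j \<in> Inr n r"
  by (auto simp: Inr_def)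

lemma permute_list_inv:
  assumes "p permutes {..<r}" "length i = r"
  shows "permute_list (inv p) (permute_list p i) = i" "permute_list p (permute_list (inv p) i) = i"
proof -
  have q: "inv p permutes {..<r}" using assms(1) by (rule permutes_inv)
  show "permute_list (inv p) (permute_list p i) = i"
    using permute_list_compose[of p i "inv p"] permute_list_compose[of "inv p" i p] assms q
    by (metis permute_list_compose permute_list_id permutes_inv_o(1) )
  show "permute_list p (permute_list (inv p) i) = i"
    using assms q by (metis permute_list_compose permute_list_id permutes_inv_o(2))
qed

lemma sum_Inr_permute:
  assumes "p permutes {..<r}"
  shows "(\<Sum>x\<in>Inr n r. f (permute_list p x)) = (\<Sum>x\<in>Inr n r. f x)"
proof (rule sum.reindex_bij_witness[of _ "permute_list (inv p)" "permute_list p"])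
  have q: "inv p permutes {..<r}" using assms(1) by (rule permutes_inv)
  fix x assume x: "x \<in> Inr n r"
  then show "permute_list (inv p) (permute_list p x) = x" "permute_list p x \<in> Inr n r"
      "permute_list p (permute_list (inv p) x) = x" "permute_list (inv p) x \<in> Inr n r"
    using permute_list_inv[OF assms Inr_length[OF x]] permute_list_Inr[OF assms x] permute_list_Inr[OF q x]
    by blast+
qed auto

lemma lle_Inr: "lle x y \<Longrightarrow> lle y z \<Longrightarrow> x \<in> Inr n r \<Longrightarrow> z \<in> Inr n r \<Longrightarrow> y \<in> Inr n r"
  unfolding Inr_def list_all2_conv_all_nth set_conv_nth subset_iff
  by (auto, metis Suc_le_eq le_trans, metis le_trans)

text \<open>Invariance makes the kernels supported on \<open>Om\<close> a meaningful space.
  Convexity in the right word makes that space a subquotient under upper triangular right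
  multiplication: a path of increasing words cannot leave the region and come back.\<close>

definition region :: "nat \<Rightarrow> nat \<Rightarrow> ('l list \<Rightarrow> nat list \<Rightarrow> bool) \<Rightarrow> bool" where
  "region n r Om \<longleftrightarrow> (\<forall>i j. Om i j \<longrightarrow> length i = r \<and> j \<in> Inr n r) \<and>
     (\<forall>p i j. p permutes {..<r} \<longrightarrow> Om i j \<longrightarrow> Om (permute_list p i) (permute_list p j)) \<and>
     (\<forall>i x y z. Om i x \<longrightarrow> Om i z \<longrightarrow> lle x y \<longrightarrow> lle y z \<longrightarrow> Om i y)"

lemma region_len: "region n r Om \<Longrightarrow> Om i j \<Longrightarrow> length i = r \<and> j \<in> Inr n r \<and> length j = r"
  unfolding region_def using Inr_length by blast

lemma region_convex: "region n r Om \<Longrightarrow> Om i x \<Longrightarrow> Om i z \<Longrightarrow> lle x y \<Longrightarrow> lle y z \<Longrightarrow> Om i y"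
  unfolding region_def by blast

lemma region_perm:
  assumes "region n r Om" "p permutes {..<r}" "length i = r" "length j = r"
  shows "Om (permute_list p i) (permute_list p j) \<longleftrightarrow> Om i j"
proof
  assume "Om i j" then show "Om (permute_list p i) (permute_list p j)"
    using assms unfolding region_def by blast
next
  assume "Om (permute_list p i) (permute_list p j)"
  then have "Om (permute_list (inv p) (permute_list p i)) (permute_list (inv p) (permute_list p j))"
    using assms permutes_inv[OF assms(2)] unfolding region_def by blast
  then show "Om i j" by (simp add: permute_list_inv[OF assms(2)] assms)
qed

section \<open>Complexes of truncated right modules\<close>

text \<open>Abstract form of the bar complex: \<open>B k\<close> indexes the generators in degree
  \<open>k\<close>, \<open>sw t\<close> is the weight of the generator \<open>t\<close>, and
  \<open>de t u\<close> is the kernel of a component of the differential. The features kept are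
  upper triangularity, dominance of all weights over \<open>lam\<close>, and absence of
  \<open>lam\<close> itself in positive degrees.\<close>

locale tri_complex =
  fixes n r :: nat and lam :: "nat \<Rightarrow> nat"
    and B :: "nat \<Rightarrow> 't set" and sw :: "'t \<Rightarrow> nat \<Rightarrow> nat"
    and de :: "'t \<Rightarrow> 't \<Rightarrow> nat list \<Rightarrow> nat list \<Rightarrow> 'a::comm_ring_1"
  assumes finB [simp]: "finite (B k)"
    and de_inv: "linv r (de t u)"
    and de_supp: "t \<in> B (Suc k) \<Longrightarrow> u \<in> B k \<Longrightarrow> de t u x y \<noteq> 0 \<Longrightarrow>
        lle x y \<and> cont x = sw t \<and> cont y = sw u"
    and de_sq: "t \<in> B (Suc (Suc k)) \<Longrightarrow> u \<in> B k \<Longrightarrow> x \<in> Inr n r \<Longrightarrow> y \<in> Inr n r \<Longrightarrow>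
        (\<Sum>t'\<in>B (Suc k). \<Sum>z\<in>Inr n r. de t t' x z * de t' u z y) = 0"
    and dominates: "t \<in> B k \<Longrightarrow> (\<Sum>c\<in>{1..m}. lam c) \<le> (\<Sum>c\<in>{1..m}. sw t c)"
    and sw_strict: "t \<in> B (Suc k) \<Longrightarrow> sw t \<noteq> lam"
    and lam_comp: "lam \<in> Comps n r"
begin

abbreviation "W \<equiv> Inr n r"

text \<open>The complex tensored with the right module spanned by the pairs in \<open>Om\<close>:
  \<open>F t\<close> is the component at the generator \<open>t\<close>, so only right words of its
  weight contribute.\<close>

definition C :: "('l list \<Rightarrow> nat list \<Rightarrow> bool) \<Rightarrow> nat \<Rightarrow> ('t \<Rightarrow> 'l list \<Rightarrow> nat list \<Rightarrow> 'a) set" where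
  "C Om k = {F. (\<forall>t i j. F t i j \<noteq> 0 \<longrightarrow> t \<in> B k \<and> Om i j \<and> cont j = sw t) \<and> (\<forall>t. linv r (F t))}"

definition D :: "('l list \<Rightarrow> nat list \<Rightarrow> bool) \<Rightarrow> nat \<Rightarrow> ('t \<Rightarrow> 'l list \<Rightarrow> nat list \<Rightarrow> 'a)
     \<Rightarrow> 't \<Rightarrow> 'l list \<Rightarrow> nat list \<Rightarrow> 'a" where
  "D Om k F = (\<lambda>u i j. if u \<in> B k \<and> Om i j
      then \<Sum>t\<in>B (Suc k). \<Sum>x\<in>W. F t i x * de t u x j else 0)"

text \<open>In degree 0 every chain is a cycle, so \<open>ex Om 0\<close> says that the differential
  leaving degree 1 is onto, that is, homology vanishes in degree 0 too.\<close>

definition cyc :: "('l list \<Rightarrow> nat list \<Rightarrow> bool) \<Rightarrow> nat \<Rightarrow> ('t \<Rightarrow> 'l list \<Rightarrow> nat list \<Rightarrow> 'a) \<Rightarrow> bool" where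
  "cyc Om k F \<longleftrightarrow> F \<in> C Om k \<and> (case k of 0 \<Rightarrow> True | Suc k' \<Rightarrow> D Om k' F = 0)"

definition ex :: "('l list \<Rightarrow> nat list \<Rightarrow> bool) \<Rightarrow> nat \<Rightarrow> bool" where
  "ex Om k \<longleftrightarrow> (\<forall>F. cyc Om k F \<longrightarrow> (\<exists>G\<in>C Om (Suc k). D Om k G = F))"

definition res :: "('l list \<Rightarrow> nat list \<Rightarrow> bool) \<Rightarrow> ('t \<Rightarrow> 'l list \<Rightarrow> nat list \<Rightarrow> 'a)
     \<Rightarrow> 't \<Rightarrow> 'l list \<Rightarrow> nat list \<Rightarrow> 'a" where
  "res Om F = (\<lambda>t i j. if Om i j then F t i j else 0)"

lemma C_supp: "F \<in> C Om k \<Longrightarrow> F t i j \<noteq> 0 \<Longrightarrow> t \<in> B k \<and> Om i j \<and> cont j = sw t"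
  by (auto simp: C_def)

lemma C_inv: "F \<in> C Om k \<Longrightarrow> linv r (F t)"
  by (auto simp: C_def)

lemma C_0 [simp]: "0 \<in> C Om k"
  by (auto simp: C_def linv_def)

lemma C_combine:
  assumes F: "F \<in> C Om k" and G: "G \<in> C Om k" and f: "f 0 0 = 0"
  shows "(\<lambda>t i j. f (F t i j) (G t i j)) \<in> C Om k"
  unfolding C_def
proof (intro CollectI conjI allI impI)
  fix t i j assume "f (F t i j) (G t i j) \<noteq> 0"
  then have "F t i j \<noteq> 0 \<or> G t i j \<noteq> 0" using f by auto
  then show "t \<in> B k" "Om i j" "cont j = sw t" using C_supp[OF F] C_supp[OF G] by blast+
next
  fix t show "linv r (\<lambda>i j. f (F t i j) (G t i j))"
    using C_inv[OF F, of t] C_inv[OF G, of t] by (simp add: linv_def)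
qed

lemma C_add: "F \<in> C Om k \<Longrightarrow> G \<in> C Om k \<Longrightarrow> F + G \<in> C Om k"
  using C_combine[of F Om k G "(+)"] by (simp add: plus_fun_def)

lemma C_diff: "F \<in> C Om k \<Longrightarrow> G \<in> C Om k \<Longrightarrow> F - G \<in> C Om k"
  using C_combine[of F Om k G "(-)"] by (simp add: fun_diff_def)

lemma D_add: "D Om k (F + G) = D Om k F + D Om k G"
  by (auto simp: D_def fun_eq_iff sum.distrib algebra_simps)

lemma D_diff: "D Om k (F - G) = D Om k F - D Om k G"
  by (auto simp: D_def fun_eq_iff sum_subtractf algebra_simps)

lemma D_0 [simp]: "D Om k 0 = 0"
  by (auto simp: D_def fun_eq_iff)

lemma D_C:
  fixes Om :: "'l list \<Rightarrow> nat list \<Rightarrow> bool"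
  assumes reg: "region n r Om" and F: "F \<in> C Om (Suc k)"
  shows "D Om k F \<in> C Om k"
  unfolding C_def
proof (intro CollectI conjI allI impI)
  fix u i j assume nz: "D Om k F u i j \<noteq> 0"
  then show "u \<in> B k" "Om i j" by (auto simp: D_def split: if_splits)
  have "(\<Sum>t\<in>B (Suc k). \<Sum>x\<in>W. F t i x * de t u x j) \<noteq> 0"
    using nz by (auto simp: D_def split: if_splits)
  then obtain t where t: "t \<in> B (Suc k)" "(\<Sum>x\<in>W. F t i x * de t u x j) \<noteq> 0"
    by (meson sum.not_neutral_contains_not_neutral)
  then obtain x where "F t i x * de t u x j \<noteq> 0"
    by (meson sum.not_neutral_contains_not_neutral)
  then have "de t u x j \<noteq> 0" by auto
  then show "cont j = sw u" using de_supp t \<open>u \<in> B k\<close> by blast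
next
  fix u show "linv r (D Om k F u)"
  proof (rule linvI)
    fix p i and j :: "nat list" assume p: "p permutes {..<r}" and l: "length (i::'l list) = r" "length j = r"
    have "(\<Sum>t\<in>B (Suc k). \<Sum>x\<in>W. F t (permute_list p i) x * de t u x (permute_list p j))
       = (\<Sum>t\<in>B (Suc k). \<Sum>x\<in>W. F t i x * de t u x j)"
    proof (rule sum.cong[OF refl])
      fix t
      have "(\<Sum>x\<in>W. F t (permute_list p i) x * de t u x (permute_list p j))
        = (\<Sum>x\<in>W. F t (permute_list p i) (permute_list p x) * de t u (permute_list p x) (permute_list p j))"
        by (rule sum_Inr_permute[OF p, symmetric])
      also have "\<dots> = (\<Sum>x\<in>W. F t i x * de t u x j)"
        by (rule sum.cong) (use p l linvD[OF C_inv[OF F]] linvD[OF de_inv] in \<open>auto simp: Inr_length\<close>)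
      finally show "(\<Sum>x\<in>W. F t (permute_list p i) x * de t u x (permute_list p j))
         = (\<Sum>x\<in>W. F t i x * de t u x j)" .
    qed
    then show "D Om k F u (permute_list p i) (permute_list p j) = D Om k F u i j"
      using region_perm[OF reg p l] by (simp add: D_def)
  qed
qed

text \<open>Truncating to the region between two differentials loses nothing: a nonzero term has
  \<open>x \<le> z \<le> j\<close> entrywise with both ends in the region, and convexity puts the
  middle word \<open>z\<close> there too.\<close>

lemma sum_D_pass:
  assumes reg: "region n r Om" and F: "F \<in> C Om (Suc (Suc k))" and t': "t' \<in> B (Suc k)" and u: "u \<in> B k"
    and Om: "Om i j" and z: "z \<in> W"
  shows "D Om (Suc k) F t' i z * de t' u z j
     = (\<Sum>t\<in>B (Suc (Suc k)). \<Sum>x\<in>W. F t i x * (de t t' x z * de t' u z j))"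
proof (cases "Om i z")
  case True
  then show ?thesis using t' by (simp add: D_def sum_distrib_right mult.assoc)
next
  case False
  have "F t i x * (de t t' x z * de t' u z j) = 0" if t: "t \<in> B (Suc (Suc k))" for t x
  proof (rule ccontr)
    assume "F t i x * (de t t' x z * de t' u z j) \<noteq> 0"
    then have "F t i x \<noteq> 0" "de t t' x z \<noteq> 0" "de t' u z j \<noteq> 0" by auto
    then have "Om i x" "lle x z" "lle z j" using C_supp[OF F] de_supp t t' u by blast+
    then show False using region_convex[OF reg _ Om] False by blast
  qed
  then show ?thesis using False by (simp add: D_def)
qed

lemma D_D:
  assumes reg: "region n r Om" and F: "F \<in> C Om (Suc (Suc k))"
  shows "D Om k (D Om (Suc k) F) = 0"
proof (intro ext)
  fix u i j
  show "D Om k (D Om (Suc k) F) u i j = 0 u i j"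
  proof (cases "u \<in> B k \<and> Om i j")
    case True
    then have j: "j \<in> W" using region_len[OF reg] by blast
    have "D Om k (D Om (Suc k) F) u i j
      = (\<Sum>t'\<in>B (Suc k). \<Sum>z\<in>W. D Om (Suc k) F t' i z * de t' u z j)"
      using True by (simp add: D_def[of Om k])
    also have "\<dots> = (\<Sum>t'\<in>B (Suc k). \<Sum>z\<in>W. \<Sum>t\<in>B (Suc (Suc k)). \<Sum>x\<in>W. F t i x * (de t t' x z * de t' u z j))"
      by (intro sum.cong refl sum_D_pass[OF reg F]) (use True in auto)
    also have "\<dots> = (\<Sum>t'\<in>B (Suc k). \<Sum>t\<in>B (Suc (Suc k)). \<Sum>z\<in>W. \<Sum>x\<in>W. F t i x * (de t t' x z * de t' u z j))"
      by (intro sum.cong refl sum.swap)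
    also have "\<dots> = (\<Sum>t\<in>B (Suc (Suc k)). \<Sum>t'\<in>B (Suc k). \<Sum>z\<in>W. \<Sum>x\<in>W. F t i x * (de t t' x z * de t' u z j))"
      by (rule sum.swap)
    also have "\<dots> = (\<Sum>t\<in>B (Suc (Suc k)). \<Sum>t'\<in>B (Suc k). \<Sum>x\<in>W. \<Sum>z\<in>W. F t i x * (de t t' x z * de t' u z j))"
      by (intro sum.cong refl sum.swap)
    also have "\<dots> = (\<Sum>t\<in>B (Suc (Suc k)). \<Sum>x\<in>W. \<Sum>t'\<in>B (Suc k). \<Sum>z\<in>W. F t i x * (de t t' x z * de t' u z j))"
      by (intro sum.cong refl sum.swap)
    also have "\<dots> = (\<Sum>t\<in>B (Suc (Suc k)). \<Sum>x\<in>W. F t i x * (\<Sum>t'\<in>B (Suc k). \<Sum>z\<in>W. de t t' x z * de t' u z j))"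
      by (simp add: sum_distrib_left)
    also have "\<dots> = 0"
      using de_sq True j by (intro sum.neutral ballI) simp
    finally show ?thesis by simp
  qed (auto simp: D_def)
qed

lemma res_C:
  assumes "region n r Om'" and F: "F \<in> C Om k"
  shows "res Om' F \<in> C Om' k"
  unfolding C_def
proof (intro CollectI conjI allI impI)
  fix t show "linv r (res Om' F t)"
    using linvD[OF C_inv[OF F]] region_perm[OF assms(1)] by (intro linvI) (simp add: res_def)
qed (use C_supp[OF F] in \<open>auto simp: res_def split: if_splits\<close>)

end

text \<open>The sub is spanned by the words in \<open>Om'\<close>, the quotient by those in \<open>Om''\<close>.\<close>
locale region_split = tri_complex n r lam B sw de
  for n r lam and B :: "nat \<Rightarrow> 't set" and sw and de :: "'t \<Rightarrow> 't \<Rightarrow> nat list \<Rightarrow> nat list \<Rightarrow> 'a::comm_ring_1" +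
  fixes Om Om' Om'' :: "'l list \<Rightarrow> nat list \<Rightarrow> bool"
  assumes reg: "region n r Om" and reg': "region n r Om'" and reg'': "region n r Om''"
    and un: "Om i j \<longleftrightarrow> Om' i j \<or> Om'' i j"
    and disj: "\<not> (Om' i j \<and> Om'' i j)"
    and up: "Om' i x \<Longrightarrow> lle x y \<Longrightarrow> Om i y \<Longrightarrow> Om' i y"
begin

lemma sub_C: "F \<in> C Om' k \<Longrightarrow> F \<in> C Om k" and quo_C: "F \<in> C Om'' k \<Longrightarrow> F \<in> C Om k"
  using un by (auto simp: C_def)

text \<open>The differential only raises the right word and \<open>Om'\<close> is closed upwards in
  \<open>Om\<close>, so a chain on \<open>Om'\<close> has no boundary outside it.\<close>

lemma sub_D:
  assumes F: "F \<in> C Om' (Suc k)" shows "D Om k F = D Om' k F"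
proof (intro ext)
  fix u i j
  show "D Om k F u i j = D Om' k F u i j"
  proof (cases "u \<in> B k \<and> Om i j \<and> \<not> Om' i j")
    case True
    have "F t i x * de t u x j = 0" if "t \<in> B (Suc k)" for t x
      using C_supp[OF F, of t i x] de_supp[OF that, of u x j] up[of i x j] True
      by (cases "F t i x = 0"; cases "de t u x j = 0") auto
    then show ?thesis using True by (simp add: D_def)
  qed (auto simp: D_def un)
qed

lemma quo_D:
  assumes F: "F \<in> C Om (Suc k)" shows "res Om'' (D Om k F) = D Om'' k (res Om'' F)"
proof (intro ext)
  fix u i j
  show "res Om'' (D Om k F) u i j = D Om'' k (res Om'' F) u i j"
  proof (cases "u \<in> B k \<and> Om'' i j")
    case True
    have "F t i x * de t u x j = res Om'' F t i x * de t u x j" if "t \<in> B (Suc k)" for t x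
      using C_supp[OF F, of t i x] de_supp[OF that, of u x j] up[of i x j] True un[of i x] un[of i j] disj[of i j]
      by (cases "F t i x = 0"; cases "de t u x j = 0") (auto simp: res_def)
    then show ?thesis using True by (auto simp: D_def res_def un intro!: sum.cong)
  qed (auto simp: D_def res_def)
qed

lemma res_id: "F \<in> C Om'' k \<Longrightarrow> res Om'' F = F"
  using C_supp[of F Om'' k] unfolding res_def fun_eq_iff by auto

lemma res_zero_sub:
  assumes F: "F \<in> C Om k" and z: "res Om'' F = 0" shows "F \<in> C Om' k"
proof -
  have "F t i j = 0" if "Om'' i j" for t i j
    using z that by (auto simp: res_def fun_eq_iff split: if_splits)
  then show ?thesis using F un unfolding C_def by blast
qed

lemma res_sub_zero: "F \<in> C Om' k \<Longrightarrow> res Om'' F = 0"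
  using disj C_supp[of F Om' k] unfolding res_def fun_eq_iff by (auto; blast)

lemma res_diff: "res Om'' (F - G) = res Om'' F - res Om'' G"
  by (auto simp: res_def fun_eq_iff)

text \<open>Middle term of the long exact sequence: a preimage found in the quotient, viewed as a
  chain on \<open>Om\<close>, accounts for \<open>F\<close> up to a cycle of the sub, which is then
  bounded there.\<close>

lemma ex_total:
  assumes e': "ex Om' k" and e'': "ex Om'' k"
  shows "ex Om k"
  unfolding ex_def
proof (intro allI impI)
  fix F assume c: "cyc Om k F"
  have F: "F \<in> C Om k" using c by (simp add: cyc_def)
  have "cyc Om'' k (res Om'' F)"
  proof (cases k)
    case (Suc k')
    have "D Om'' k' (res Om'' F) = res Om'' (D Om k' F)" using quo_D F Suc by simp
    also have "\<dots> = 0" using c Suc by (simp add: cyc_def res_def fun_eq_iff)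
    finally show ?thesis using res_C[OF reg'' F] Suc by (simp add: cyc_def)
  qed (use res_C[OF reg'' F] in \<open>simp add: cyc_def\<close>)
  then obtain G where G: "G \<in> C Om'' (Suc k)" "D Om'' k G = res Om'' F"
    using e'' unfolding ex_def by blast
  let ?F = "F - D Om k G"
  have DG: "D Om k G \<in> C Om k" using D_C[OF reg] quo_C G by blast
  have "res Om'' ?F = 0"
    using quo_D[OF quo_C[OF G(1)]] res_id[OF G(1)] G by (simp add: res_diff)
  then have F': "?F \<in> C Om' k" by (rule res_zero_sub[OF C_diff[OF F DG]])
  have "cyc Om' k ?F"
  proof (cases k)
    case (Suc k')
    have "D Om' k' ?F = D Om k' ?F" using sub_D F' Suc by metis
    also have "\<dots> = 0" using c D_D[OF reg] quo_C[OF G(1)] Suc by (simp add: D_diff cyc_def)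
    finally show ?thesis using F' Suc by (simp add: cyc_def)
  qed (use F' in \<open>simp add: cyc_def\<close>)
  then obtain H where H: "H \<in> C Om' (Suc k)" "D Om' k H = ?F" using e' unfolding ex_def by blast
  have "D Om k (H + G) = F" using H sub_D by (simp add: D_add)
  then show "\<exists>G\<in>C Om (Suc k). D Om k G = F"
    using C_add[OF sub_C[OF H(1)] quo_C[OF G(1)]] by blast
qed

text \<open>Connecting map: the boundary in \<open>Om\<close> of a cycle of the quotient is a cycle
  of the sub one degree lower. If it bounds there, a correction by a chain of the sub produces a
  cycle of the middle term. In degree 0 there is no boundary to correct.\<close>

lemma ex_quot:
  assumes e: "ex Om k" and e': "\<And>k'. k = Suc k' \<Longrightarrow> ex Om' k'"
  shows "ex Om'' k"
  unfolding ex_def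
proof (intro allI impI)
  fix F assume c: "cyc Om'' k F"
  have F: "F \<in> C Om'' k" using c by (simp add: cyc_def)
  have "\<exists>F'. F' \<in> C Om' k \<and> cyc Om k (F - F')"
  proof (cases k)
    case 0
    then show ?thesis using F quo_C by (intro exI[of _ 0]) (auto simp: cyc_def)
  next
    case (Suc k')
    have DF: "D Om k' F \<in> C Om k'" using D_C[OF reg] quo_C F Suc by blast
    have "res Om'' (D Om k' F) = 0"
      using quo_D[OF quo_C] F Suc res_id c by (simp add: cyc_def)
    then have DF': "D Om k' F \<in> C Om' k'" by (rule res_zero_sub[OF DF])
    have "cyc Om' k' (D Om k' F)"
    proof (cases k')
      case (Suc k'')
      have "D Om' k'' (D Om k' F) = D Om k'' (D Om k' F)" using sub_D DF' Suc by metis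
      also have "\<dots> = 0" using D_D[OF reg] quo_C F Suc \<open>k = Suc k'\<close> by blast
      finally show ?thesis using DF' Suc by (simp add: cyc_def)
    qed (use DF' in \<open>simp add: cyc_def\<close>)
    then obtain G where G: "G \<in> C Om' k" "D Om' k' G = D Om k' F"
      using e' Suc unfolding ex_def by blast
    have "D Om k' (F - G) = 0" using G sub_D Suc by (simp add: D_diff)
    moreover have "F - G \<in> C Om k" by (rule C_diff[OF quo_C[OF F] sub_C[OF G(1)]])
    ultimately show ?thesis using G Suc by (intro exI[of _ G]) (auto simp: cyc_def)
  qed
  then obtain F' where F': "F' \<in> C Om' k" "cyc Om k (F - F')" by blast
  then obtain G where G: "G \<in> C Om (Suc k)" "D Om k G = F - F'" using e unfolding ex_def by blast
  have "D Om'' k (res Om'' G) = F"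
    using quo_D[OF G(1)] G res_id[OF F] res_sub_zero[OF F'(1)] by (simp add: res_diff)
  then show "\<exists>G\<in>C Om'' (Suc k). D Om'' k G = F" using res_C[OF reg'' G(1)] by blast
qed

end

section \<open>Vanishing and isomorphism criteria for regions\<close>

context tri_complex
begin

lemma ex_null:
  assumes "\<And>t i j. t \<in> B k \<Longrightarrow> Om i j \<Longrightarrow> cont j \<noteq> sw t"
  shows "ex Om k"
  unfolding ex_def
proof (intro allI impI)
  fix F assume "cyc Om k F"
  then have F: "F \<in> C Om k" by (simp add: cyc_def)
  have "F = 0" using C_supp[OF F] assms by (intro ext) (metis zero_fun_apply)
  then show "\<exists>G\<in>C Om (Suc k). D Om k G = F" by (intro bexI[of _ 0]) auto
qed

text \<open>\<open>Z i j i'\<close> relates the basis word \<open>(i, j)\<close> of one module to the word \<open>(i', j)\<close> of an isomorphic one.\<close>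
lemma ex_iso:
  fixes Om :: "'l list \<Rightarrow> nat list \<Rightarrow> bool" and Om' :: "'m list \<Rightarrow> nat list \<Rightarrow> bool"
  assumes reg: "region n r Om" and reg': "region n r Om'"
    and tot: "\<And>i j. Om i j \<Longrightarrow> \<exists>i'. Z i j i'" and tot': "\<And>i' j. Om' i' j \<Longrightarrow> \<exists>i. Z i j i'"
    and ZOm: "\<And>i j i'. Z i j i' \<Longrightarrow> Om i j \<and> Om' i' j"
    and Zperm: "\<And>p i j i'. p permutes {..<r} \<Longrightarrow> Z i j i' \<Longrightarrow> Z (permute_list p i) (permute_list p j) (permute_list p i')"
    and uni: "\<And>i j i1 i2. Z i j i1 \<Longrightarrow> Z i j i2 \<Longrightarrow> \<exists>p. p permutes {..<r} \<and> permute_list p i1 = i2 \<and> permute_list p j = j"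
    and uni': "\<And>i1 i2 j i'. Z i1 j i' \<Longrightarrow> Z i2 j i' \<Longrightarrow> \<exists>p. p permutes {..<r} \<and> permute_list p i1 = i2 \<and> permute_list p j = j"
    and down: "\<And>i x j i'. Z i j i' \<Longrightarrow> lle x j \<Longrightarrow> Om i x \<or> Om' i' x \<Longrightarrow> Z i x i'"
    and e: "ex Om k"
  shows "ex Om' k"
proof -
  \<comment> \<open>Correspondence of chains is expressed by a relation because \<open>fw\<close>
    and \<open>bw\<close> choose a partner word; by \<open>uni\<close> and \<open>uni'\<close> two
    choices differ by a permutation fixing \<open>j\<close>, and invariance makes the value
    independent of it.\<close>
  define rel :: "('t \<Rightarrow> 'l list \<Rightarrow> nat list \<Rightarrow> 'a) \<Rightarrow> ('t \<Rightarrow> 'm list \<Rightarrow> nat list \<Rightarrow> 'a) \<Rightarrow> bool"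
    where "rel F F' \<longleftrightarrow> (\<forall>t i j i'. Z i j i' \<longrightarrow> F t i j = F' t i' j)" for F F'
  define fw :: "('t \<Rightarrow> 'l list \<Rightarrow> nat list \<Rightarrow> 'a) \<Rightarrow> 't \<Rightarrow> 'm list \<Rightarrow> nat list \<Rightarrow> 'a"
    where "fw F t i' j = (if Om' i' j then F t (SOME i. Z i j i') j else 0)" for F t i' j
  define bw :: "('t \<Rightarrow> 'm list \<Rightarrow> nat list \<Rightarrow> 'a) \<Rightarrow> 't \<Rightarrow> 'l list \<Rightarrow> nat list \<Rightarrow> 'a"
    where "bw F t i j = (if Om i j then F t (SOME i'. Z i j i') j else 0)" for F t i j
  have len: "Z i j i' \<Longrightarrow> length i = r \<and> length j = r \<and> length i' = r" for i j i'
    using ZOm region_len[OF reg] region_len[OF reg'] by blast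
  have rel_fw: "rel F (fw F)" if F: "F \<in> C Om q" for F q
    unfolding rel_def
  proof (intro allI impI)
    fix t i j i' assume z: "Z i j i'"
    let ?i = "SOME i. Z i j i'"
    have zs: "Z ?i j i'" using z by (rule someI)
    obtain p where p: "p permutes {..<r}" "permute_list p i = ?i" "permute_list p j = j"
      using uni'[OF z zs] by blast
    show "F t i j = fw F t i' j"
      using linvD[OF C_inv[OF F] p(1), of i j t] len[OF z] ZOm[OF z] p by (simp add: fw_def)
  qed
  have rel_bw: "rel (bw F) F" if F: "F \<in> C Om' q" for F q
    unfolding rel_def
  proof (intro allI impI)
    fix t i j i' assume z: "Z i j i'"
    let ?i = "SOME i'. Z i j i'"
    have zs: "Z i j ?i" using z by (rule someI)
    obtain p where p: "p permutes {..<r}" "permute_list p i' = ?i" "permute_list p j = j"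
      using uni[OF z zs] by blast
    show "bw F t i j = F t i' j"
      using linvD[OF C_inv[OF F] p(1), of i' j t] len[OF z] ZOm[OF z] p by (simp add: bw_def)
  qed
  have fw_C: "fw F \<in> C Om' q" if F: "F \<in> C Om q" for F q
    unfolding C_def
  proof (intro CollectI conjI allI impI)
    fix t i' j assume nz: "fw F t i' j \<noteq> 0"
    then show o: "Om' i' j" by (auto simp: fw_def split: if_splits)
    then obtain i where z: "Z i j i'" using tot' by blast
    then have "F t i j \<noteq> 0" using nz rel_fw[OF F] unfolding rel_def by metis
    then show "t \<in> B q" "cont j = sw t" using C_supp[OF F] by blast+
  next
    fix t show "linv r (fw F t)"
    proof (rule linvI)
      fix p i' and j :: "nat list" assume p: "p permutes {..<r}" and l: "length (i' :: 'm list) = r" "length j = r"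
      show "fw F t (permute_list p i') (permute_list p j) = fw F t i' j"
      proof (cases "Om' i' j")
        case True
        then obtain i where z: "Z i j i'" using tot' by blast
        then have "fw F t (permute_list p i') (permute_list p j) = F t (permute_list p i) (permute_list p j)"
          using Zperm[OF p z] rel_fw[OF F] unfolding rel_def by metis
        also have "\<dots> = F t i j" using linvD[OF C_inv[OF F] p] len[OF z] by blast
        also have "\<dots> = fw F t i' j" using z rel_fw[OF F] unfolding rel_def by metis
        finally show ?thesis .
      qed (simp add: fw_def region_perm[OF reg' p l])
    qed
  qed
  have bw_C: "bw F \<in> C Om q" if F: "F \<in> C Om' q" for F q
    unfolding C_def
  proof (intro CollectI conjI allI impI)
    fix t i j assume nz: "bw F t i j \<noteq> 0"
    then show o: "Om i j" by (auto simp: bw_def split: if_splits)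
    then obtain i' where z: "Z i j i'" using tot by blast
    then have "F t i' j \<noteq> 0" using nz rel_bw[OF F] unfolding rel_def by metis
    then show "t \<in> B q" "cont j = sw t" using C_supp[OF F] by blast+
  next
    fix t show "linv r (bw F t)"
    proof (rule linvI)
      fix p i and j :: "nat list" assume p: "p permutes {..<r}" and l: "length (i :: 'l list) = r" "length j = r"
      show "bw F t (permute_list p i) (permute_list p j) = bw F t i j"
      proof (cases "Om i j")
        case True
        then obtain i' where z: "Z i j i'" using tot by blast
        then have "bw F t (permute_list p i) (permute_list p j) = F t (permute_list p i') (permute_list p j)"
          using Zperm[OF p z] rel_bw[OF F] unfolding rel_def by metis
        also have "\<dots> = F t i' j" using linvD[OF C_inv[OF F] p] len[OF z] by blast
        also have "\<dots> = bw F t i j" using z rel_bw[OF F] unfolding rel_def by metis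
        finally show ?thesis .
      qed (simp add: bw_def region_perm[OF reg p l])
    qed
  qed
  \<comment> \<open>Only words \<open>x\<close> below \<open>j\<close> contribute to the value at
    \<open>j\<close>, and by \<open>down\<close> the two left words stay partners along all of
    them.\<close>
  have rel_D: "rel (D Om q F) (D Om' q F')"
    if F: "F \<in> C Om (Suc q)" and F': "F' \<in> C Om' (Suc q)" and R: "rel F F'" for F F' q
    unfolding rel_def
  proof (intro allI impI)
    fix u i j i' assume z: "Z i j i'"
    have "F t i x * de t u x j = F' t i' x * de t u x j" if "u \<in> B q" "t \<in> B (Suc q)" for t x
    proof (cases "de t u x j = 0")
      case False
      then have l: "lle x j" using de_supp that by blast
      show ?thesis
      proof (cases "Om i x \<or> Om' i' x")
        case True
        then show ?thesis using R down[OF z l] unfolding rel_def by metis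
      next
        case False
        then have "F t i x = 0" "F' t i' x = 0" using C_supp[OF F] C_supp[OF F'] by blast+
        then show ?thesis by simp
      qed
    qed simp
    then show "D Om q F u i j = D Om' q F' u i' j" using ZOm[OF z] by (auto simp: D_def intro!: sum.cong)
  qed
  have rel_0: "F = 0" if "F \<in> C Om q" "rel F 0" for F q
  proof (intro ext)
    fix t i j
    show "F t i j = 0 t i j"
    proof (cases "Om i j")
      case True
      then obtain i' where "Z i j i'" using tot by blast
      then show ?thesis using that(2) unfolding rel_def by auto
    next
      case False
      then show ?thesis using C_supp[OF that(1), of t i j] by auto
    qed
  qed
  have rel_uni: "F = G" if "F \<in> C Om' q" "G \<in> C Om' q" "rel H F" "rel H G" for F G H q
  proof (intro ext)
    fix t i' j
    show "F t i' j = G t i' j"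
    proof (cases "Om' i' j")
      case True
      then obtain i where "Z i j i'" using tot' by blast
      then show ?thesis using that(3,4) unfolding rel_def by metis
    next
      case False
      then have "F t i' j = 0" "G t i' j = 0" using C_supp[OF that(1)] C_supp[OF that(2)] by blast+
      then show ?thesis by simp
    qed
  qed
  show ?thesis
    unfolding ex_def
  proof (intro allI impI)
    fix F assume c: "cyc Om' k F"
    then have F: "F \<in> C Om' k" by (simp add: cyc_def)
    have "cyc Om k (bw F)"
    proof (cases k)
      case (Suc q)
      have "rel (D Om q (bw F)) (D Om' q F)" using rel_D bw_C F rel_bw[OF F] Suc by blast
      then have "rel (D Om q (bw F)) 0" using c Suc by (simp add: cyc_def)
      then show ?thesis using rel_0 D_C[OF reg] bw_C[OF F] Suc unfolding cyc_def by auto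
    qed (use bw_C[OF F] in \<open>simp add: cyc_def\<close>)
    then obtain G where G: "G \<in> C Om (Suc k)" "D Om k G = bw F" using e unfolding ex_def by blast
    have "rel (bw F) (D Om' k (fw G))" using rel_D[OF G(1) fw_C[OF G(1)] rel_fw[OF G(1)]] G by simp
    then have "D Om' k (fw G) = F"
      using rel_uni[OF D_C[OF reg' fw_C[OF G(1)]] F] rel_bw[OF F] by blast
    then show "\<exists>G\<in>C Om' (Suc k). D Om' k G = F" using fw_C[OF G(1)] by blast
  qed
qed

end

section \<open>Tensor products of divided powers\<close>

text \<open>A row \<open>Rw l\<close> stands for a divided power of the span of the basis vectors with index at least \<open>cc l\<close>;
  each letter \<open>Fr c\<close> twists by the \<open>c\<close>-th coordinate character.\<close>
datatype lab = Fr nat | Rw nat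

definition al :: "(nat \<Rightarrow> nat) \<Rightarrow> lab \<Rightarrow> nat \<Rightarrow> bool" where
  "al cc l x = (case l of Fr c \<Rightarrow> x = c | Rw l \<Rightarrow> cc l \<le> x)"

lemma al_simps [simp]: "al cc (Fr c) x \<longleftrightarrow> x = c" "al cc (Rw l) x \<longleftrightarrow> cc l \<le> x"
  by (simp_all add: al_def)

text \<open>Invariant functions on these pairs form a tensor product over the distinct letters of
  \<open>nu\<close>: a row of multiplicity m gives the m-th divided power of the span of the basis
  vectors from \<open>cc l\<close> on, and \<open>Fr c\<close> with multiplicity m gives the m-th
  power of the \<open>c\<close>-th coordinate character.\<close>

definition Ome :: "nat \<Rightarrow> nat \<Rightarrow> (nat \<Rightarrow> nat) \<Rightarrow> lab multiset \<Rightarrow> lab list \<Rightarrow> nat list \<Rightarrow> bool" where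
  "Ome n r cc nu i j \<longleftrightarrow> mset i = nu \<and> length i = r \<and> j \<in> Inr n r \<and> list_all2 (al cc) i j"

lemma Ome_perm:
  assumes "p permutes {..<r}" "Ome n r cc nu i j"
  shows "Ome n r cc nu (permute_list p i) (permute_list p j)"
  using assms permute_list_Inr[OF assms(1)]
  by (auto simp: Ome_def list_all2_permute_list_iff Inr_length)

lemma region_Ome: "region n r (Ome n r cc nu)"
  unfolding region_def
proof (intro conjI allI impI)
  fix i x y z assume a: "Ome n r cc nu i x" "Ome n r cc nu i z" "lle x y" "lle y z"
  have "list_all2 (al cc) i y"
    using a unfolding Ome_def list_all2_conv_all_nth al_def
    by (auto split: lab.splits) (metis le_antisym, metis le_trans)
  then show "Ome n r cc nu i y" using a lle_Inr[OF a(3,4)] by (auto simp: Ome_def)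
qed (auto simp: Ome_def Ome_perm[unfolded Ome_def] permute_list_Inr list_all2_permute_list_iff Inr_length)

text \<open>Positions carrying equal letters are interchangeable up to a transposition; this makes
  the choice of the position in \<open>unitmove\<close> immaterial.\<close>

lemma permute_list_transpose_update:
  assumes "q1 < length xs" "q2 < length xs" "xs ! q1 = xs ! q2"
  shows "permute_list (transpose q1 q2) (xs[q1 := v]) = xs[q2 := v]"
  using assms by (intro nth_equalityI) (auto simp: permute_list_def nth_list_update transpose_def)

lemma permute_list_transpose_same:
  assumes "q1 < length xs" "q2 < length xs" "xs ! q1 = xs ! q2"
  shows "permute_list (transpose q1 q2) xs = xs"
  using assms by (intro nth_equalityI) (auto simp: permute_list_def transpose_def)

lemma permute_list_update:
  assumes "p permutes {..<length xs}" "q < length xs"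
  shows "permute_list p (xs[q := v]) = (permute_list p xs)[inv p q := v]"
proof (rule nth_equalityI)
  fix k assume k: "k < length (permute_list p (xs[q := v]))"
  have "p k = q \<longleftrightarrow> inv p q = k" using assms(1) by (metis permutes_inverses)
  moreover have "p k < length xs" using permutes_in_image[OF assms(1)] k by simp
  ultimately show "permute_list p (xs[q := v]) ! k = (permute_list p xs)[inv p q := v] ! k"
    using assms k by (auto simp: permute_list_nth nth_list_update permutes_in_image)
qed simp

lemma transpose_permutes_lessThan: "a < r \<Longrightarrow> b < r \<Longrightarrow> transpose a b permutes {..<(r::nat)}"
  by (intro permutes_swap_id) auto

section \<open>Peeling the lowest column of a row\<close>

definition OmQ :: "nat \<Rightarrow> nat \<Rightarrow> (nat \<Rightarrow> nat) \<Rightarrow> nat \<Rightarrow> lab multiset \<Rightarrow> lab list \<Rightarrow> nat list \<Rightarrow> bool" where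
  "OmQ n r cc l nu i j \<longleftrightarrow> Ome n r cc nu i j \<and> (\<exists>q<r. i ! q = Rw l \<and> j ! q = cc l)"

lemma Ome_al: "Ome n r cc nu i j \<Longrightarrow> q < r \<Longrightarrow> al cc (i ! q) (j ! q)"
  by (auto simp: Ome_def list_all2_conv_all_nth)

lemma Ome_len: "Ome n r cc nu i j \<Longrightarrow> length i = r \<and> length j = r \<and> j \<in> Inr n r"
  by (auto simp: Ome_def Inr_length)

lemma region_OmQ: "region n r (OmQ n r cc l nu)"
  unfolding region_def
proof (intro conjI allI impI)
  fix i x y z assume a: "OmQ n r cc l nu i x" "OmQ n r cc l nu i z" "lle x y" "lle y z"
  have y: "Ome n r cc nu i y" using a region_convex[OF region_Ome] unfolding OmQ_def by blast
  obtain q where q: "q < r" "i ! q = Rw l" "z ! q = cc l" using a unfolding OmQ_def by blast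
  \<comment> \<open>The row letter at \<open>q\<close> sits at its minimum in \<open>z\<close>, so
    the smaller word \<open>y\<close> has the same value there.\<close>
  have "y ! q \<le> z ! q" using a(4) q Ome_len[OF y] by (auto simp: list_all2_conv_all_nth)
  moreover have "cc l \<le> y ! q" using Ome_al[OF y q(1)] q by simp
  ultimately show "OmQ n r cc l nu i y" using y q unfolding OmQ_def by (metis le_antisym)
next
  fix p i j assume p: "p permutes {..<r}" and o: "OmQ n r cc l nu i j"
  then obtain q where q: "q < r" "i ! q = Rw l" "j ! q = cc l" unfolding OmQ_def by blast
  have "inv p q < r" using permutes_inv[OF p] q(1) permutes_in_image by fastforce
  moreover have "p (inv p q) = q" using p by (simp add: permutes_inverses)
  ultimately show "OmQ n r cc l nu (permute_list p i) (permute_list p j)"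
    using o q p Ome_perm[OF p] Ome_len[of n r cc nu i j] unfolding OmQ_def
    by (auto intro!: exI[of _ "inv p q"] simp: permute_list_nth)
qed (auto simp: OmQ_def Ome_def)

lemma Ome_cong:
  assumes "\<And>l. Rw l \<in># nu \<Longrightarrow> cc l = cc' l"
  shows "Ome n r cc nu = Ome n r cc' nu"
proof (intro ext)
  fix i j
  have "list_all2 (al cc) i j \<longleftrightarrow> list_all2 (al cc') i j" if "mset i = nu"
  proof (rule list.rel_cong[OF refl refl])
    fix a b assume "a \<in> set i"
    then have "a \<in># nu" using that by auto
    then show "al cc a b = al cc' a b" using assms by (cases a) auto
  qed
  then show "Ome n r cc nu i j = Ome n r cc' nu i j" by (auto simp: Ome_def)
qed

text \<open>For V spanned by the basis vectors from \<open>c\<close> on and V' by those above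
  \<open>c\<close>, the quotient of the m-th divided power of V by that of V' is the character of
  \<open>c\<close> tensored with the (m-1)-st divided power of V. On words this frees one position
  of the row with the lowest value; the position is not canonical, hence a relation.\<close>

definition unitmove :: "nat \<Rightarrow> nat \<Rightarrow> (nat \<Rightarrow> nat) \<Rightarrow> nat \<Rightarrow> lab multiset \<Rightarrow> lab list \<Rightarrow> nat list \<Rightarrow> lab list \<Rightarrow> bool" where
  "unitmove n r cc l m i j i' \<longleftrightarrow> Ome n r cc (add_mset (Rw l) m) i j \<and>
     (\<exists>q<r. i ! q = Rw l \<and> j ! q = cc l \<and> i' = i[q := Fr (cc l)])"

lemma unitmoveD:
  assumes "unitmove n r cc l m i j i'"
  obtains q where "q < r" "i ! q = Rw l" "j ! q = cc l" "i' = i[q := Fr (cc l)]" "i' ! q = Fr (cc l)" "i = i'[q := Rw l]"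
    "OmQ n r cc l (add_mset (Rw l) m) i j" "Ome n r cc (add_mset (Fr (cc l)) m) i' j"
proof -
  obtain q where o: "Ome n r cc (add_mset (Rw l) m) i j" and q: "q < r" "i ! q = Rw l" "j ! q = cc l" "i' = i[q := Fr (cc l)]"
    using assms unfolding unitmove_def by blast
  have len: "length i = r" "length j = r" using Ome_len[OF o] by auto
  have "mset i' = add_mset (Fr (cc l)) m" using o q len by (simp add: mset_update Ome_def)
  moreover have "list_all2 (al cc) i' j"
    using o q len by (auto simp: Ome_def list_all2_conv_all_nth nth_list_update)
  ultimately have "Ome n r cc (add_mset (Fr (cc l)) m) i' j" using o len q by (auto simp: Ome_def)
  moreover have "i' ! q = Fr (cc l)" using q len by simp
  moreover have "i = i'[q := Rw l]" using q by (metis list_update_id list_update_overwrite)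
  moreover have "OmQ n r cc l (add_mset (Rw l) m) i j" using o q unfolding OmQ_def by blast
  ultimately show ?thesis using that[of q] q by blast
qed

lemma unitmoveI':
  assumes o: "Ome n r cc (add_mset (Fr (cc l)) m) i' j" and q: "q < r" "i' ! q = Fr (cc l)"
  shows "unitmove n r cc l m (i'[q := Rw l]) j i'"
proof -
  have len: "length i' = r" "length j = r" using Ome_len[OF o] by auto
  have jq: "j ! q = cc l" using Ome_al[OF o q(1)] q(2) by simp
  have "mset (i'[q := Rw l]) = add_mset (Rw l) m" using o q len by (simp add: mset_update Ome_def)
  moreover have "list_all2 (al cc) (i'[q := Rw l]) j"
    using o q len jq by (auto simp: Ome_def list_all2_conv_all_nth nth_list_update)
  ultimately have "Ome n r cc (add_mset (Rw l) m) (i'[q := Rw l]) j" using o len by (auto simp: Ome_def)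
  moreover have "i' = (i'[q := Rw l])[q := Fr (cc l)]" using q(2) by (metis list_update_id list_update_overwrite)
  ultimately show ?thesis using q len jq unfolding unitmove_def
    by (intro conjI exI[of _ q]) simp_all
qed

context tri_complex
begin

text \<open>The hypotheses of \<open>ex_iso\<close>. Minimality of the column enters in the last
  one: lowering the right word cannot change a row letter that already has the value
  \<open>cc l\<close>.\<close>

lemma unitmove_facts:
  shows "OmQ n r cc l (add_mset (Rw l) m) i j \<Longrightarrow> \<exists>i'. unitmove n r cc l m i j i'"
    and "Ome n r cc (add_mset (Fr (cc l)) m) i' j \<Longrightarrow> \<exists>i. unitmove n r cc l m i j i'"
    and "unitmove n r cc l m i j i' \<Longrightarrow> OmQ n r cc l (add_mset (Rw l) m) i j \<and> Ome n r cc (add_mset (Fr (cc l)) m) i' j"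
    and "p permutes {..<r} \<Longrightarrow> unitmove n r cc l m i j i' \<Longrightarrow>
       unitmove n r cc l m (permute_list p i) (permute_list p j) (permute_list p i')"
    and "unitmove n r cc l m i j i1 \<Longrightarrow> unitmove n r cc l m i j i2 \<Longrightarrow>
      \<exists>p. p permutes {..<r} \<and> permute_list p i1 = i2 \<and> permute_list p j = j"
    and "unitmove n r cc l m i1 j i' \<Longrightarrow> unitmove n r cc l m i2 j i' \<Longrightarrow>
      \<exists>p. p permutes {..<r} \<and> permute_list p i1 = i2 \<and> permute_list p j = j"
    and "unitmove n r cc l m i j i' \<Longrightarrow> lle x j \<Longrightarrow>
      OmQ n r cc l (add_mset (Rw l) m) i x \<or> Ome n r cc (add_mset (Fr (cc l)) m) i' x \<Longrightarrow> unitmove n r cc l m i x i'"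
proof -
  show "OmQ n r cc l (add_mset (Rw l) m) i j \<Longrightarrow> \<exists>i'. unitmove n r cc l m i j i'"
    by (auto simp: OmQ_def unitmove_def)
  show "\<exists>i. unitmove n r cc l m i j i'" if o: "Ome n r cc (add_mset (Fr (cc l)) m) i' j"
  proof -
    have "Fr (cc l) \<in> set i'" using o by (simp add: Ome_def flip: set_mset_mset)
    then obtain q where "q < r" "i' ! q = Fr (cc l)" using Ome_len[OF o] by (auto simp: in_set_conv_nth)
    then show ?thesis using unitmoveI'[OF o] by blast
  qed
  show "unitmove n r cc l m i j i' \<Longrightarrow> OmQ n r cc l (add_mset (Rw l) m) i j \<and> Ome n r cc (add_mset (Fr (cc l)) m) i' j"
    by (rule unitmoveD, assumption, rule conjI; assumption)
  show "unitmove n r cc l m (permute_list p i) (permute_list p j) (permute_list p i')"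
    if p: "p permutes {..<r}" and z: "unitmove n r cc l m i j i'"
  proof -
    obtain q where o: "Ome n r cc (add_mset (Rw l) m) i j" and q: "q < r" "i ! q = Rw l" "j ! q = cc l" "i' = i[q := Fr (cc l)]"
      using z unfolding unitmove_def by blast
    have len: "length i = r" "length j = r" using Ome_len[OF o] by auto
    have "inv p q < r" using permutes_inv[OF p] q(1) permutes_in_image by fastforce
    moreover have "p (inv p q) = q" using p by (simp add: permutes_inverses)
    ultimately show ?thesis using Ome_perm[OF p o] q len p permute_list_update[of p i q "Fr (cc l)"]
      unfolding unitmove_def by (auto intro!: exI[of _ "inv p q"] simp: permute_list_nth)
  qed
  show "\<exists>p. p permutes {..<r} \<and> permute_list p i1 = i2 \<and> permute_list p j = j"
    if z: "unitmove n r cc l m i j i1" "unitmove n r cc l m i j i2"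
  proof -
    obtain q1 q2 where q: "q1 < r" "i ! q1 = Rw l" "j ! q1 = cc l" "i1 = i[q1 := Fr (cc l)]"
       "q2 < r" "i ! q2 = Rw l" "j ! q2 = cc l" "i2 = i[q2 := Fr (cc l)]"
      using z unfolding unitmove_def by blast
    have len: "length i = r" "length j = r" using z Ome_len unfolding unitmove_def by blast+
    show ?thesis using q len permute_list_transpose_update[of q1 i q2] permute_list_transpose_same[of q1 j q2]
      by (intro exI[of _ "transpose q1 q2"]) (auto simp: transpose_permutes_lessThan)
  qed
  show "\<exists>p. p permutes {..<r} \<and> permute_list p i1 = i2 \<and> permute_list p j = j"
    if z: "unitmove n r cc l m i1 j i'" "unitmove n r cc l m i2 j i'"
  proof -
    obtain q1 where q1: "q1 < r" "j ! q1 = cc l" "i' ! q1 = Fr (cc l)" "i1 = i'[q1 := Rw l]"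
      "Ome n r cc (add_mset (Fr (cc l)) m) i' j" by (rule unitmoveD[OF z(1)], rule that; assumption)
    obtain q2 where q2: "q2 < r" "j ! q2 = cc l" "i' ! q2 = Fr (cc l)" "i2 = i'[q2 := Rw l]"
      by (rule unitmoveD[OF z(2)], rule that; assumption)
    have len: "length i' = r" "length j = r" using q1 Ome_len by blast+
    show ?thesis using q1 q2 len permute_list_transpose_update[of q1 i' q2] permute_list_transpose_same[of q1 j q2]
      by (intro exI[of _ "transpose q1 q2"]) (auto simp: transpose_permutes_lessThan)
  qed
  show "unitmove n r cc l m i x i'" if z: "unitmove n r cc l m i j i'" and l: "lle x j"
      and o: "OmQ n r cc l (add_mset (Rw l) m) i x \<or> Ome n r cc (add_mset (Fr (cc l)) m) i' x"
  proof -
    obtain q where q: "q < r" "i ! q = Rw l" "j ! q = cc l" "i' = i[q := Fr (cc l)]" "i' ! q = Fr (cc l)" "i = i'[q := Rw l]"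
      "Ome n r cc (add_mset (Fr (cc l)) m) i' j" by (rule unitmoveD[OF z], rule that; assumption)
    show ?thesis
    proof (cases "Ome n r cc (add_mset (Fr (cc l)) m) i' x")
      case True
      then show ?thesis using unitmoveI'[OF True q(1,5)] q(6) by metis
    next
      case False
      then have o': "Ome n r cc (add_mset (Rw l) m) i x" using o by (simp add: OmQ_def)
      have "x ! q \<le> j ! q" using l q(1) Ome_len[OF o'] by (auto simp: list_all2_conv_all_nth)
      moreover have "cc l \<le> x ! q" using Ome_al[OF o' q(1)] q(2) by simp
      ultimately have "x ! q = cc l" using q(3) by simp
      then show ?thesis using o' q(1,2,4) unfolding unitmove_def by blast
    qed
  qed
qed

abbreviation exo :: "(nat \<Rightarrow> nat) \<Rightarrow> lab multiset \<Rightarrow> nat \<Rightarrow> bool" where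
  "exo cc nu \<equiv> ex (Ome n r cc nu)"

definition Ac :: "(nat \<Rightarrow> nat) \<Rightarrow> lab multiset \<Rightarrow> bool" where
  "Ac cc nu \<longleftrightarrow> (\<forall>k. exo cc nu k)"

lemma ex_OmQ_iff:
  "ex (OmQ n r cc l (add_mset (Rw l) m)) k \<longleftrightarrow> exo cc (add_mset (Fr (cc l)) m) k" (is "?a \<longleftrightarrow> ?b")
proof
  assume ?a
  from ex_iso[OF region_OmQ region_Ome unitmove_facts(1,2,3,4,5,6,7) this] show ?b .
next
  assume ?b
  note e = this
  let ?Z = "\<lambda>i j i'. unitmove n r cc l m i' j i"
  show ?a
  proof (rule ex_iso[OF region_Ome region_OmQ, where Z = ?Z, OF _ _ _ _ _ _ _ e])
    show "\<exists>i'. ?Z i j i'" if "Ome n r cc (add_mset (Fr (cc l)) m) i j" for i j using unitmove_facts(2)[OF that] .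
    show "\<exists>i. ?Z i j i'" if "OmQ n r cc l (add_mset (Rw l) m) i' j" for i' j using unitmove_facts(1)[OF that] .
    show "Ome n r cc (add_mset (Fr (cc l)) m) i j \<and> OmQ n r cc l (add_mset (Rw l) m) i' j" if "?Z i j i'" for i j i'
      using unitmove_facts(3)[OF that] by blast
    show "?Z (permute_list p i) (permute_list p j) (permute_list p i')" if "p permutes {..<r}" "?Z i j i'" for p i j i'
      using unitmove_facts(4)[OF that] .
    show "\<exists>p. p permutes {..<r} \<and> permute_list p i1 = i2 \<and> permute_list p j = j" if "?Z i j i1" "?Z i j i2" for i j i1 i2
      using unitmove_facts(6)[OF that] .
    show "\<exists>p. p permutes {..<r} \<and> permute_list p i1 = i2 \<and> permute_list p j = j" if "?Z i1 j i'" "?Z i2 j i'" for i1 i2 j i'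
      using unitmove_facts(5)[OF that] .
    show "?Z i x i'" if "?Z i j i'" "lle x j" "Ome n r cc (add_mset (Fr (cc l)) m) i x \<or> OmQ n r cc l (add_mset (Rw l) m) i' x" for i x j i'
      using unitmove_facts(7)[OF that(1,2)] that(3) by blast
  qed
qed

text \<open>The short exact sequence of one row: words avoiding its lowest column form the sub,
  since letters only increase, and words using that column at least once form the quotient.\<close>

lemma Ome_split:
  "region_split n r lam B sw de (Ome n r cc (add_mset (Rw l) m)) (Ome n r (cc(l := Suc (cc l))) (add_mset (Rw l) m))
     (OmQ n r cc l (add_mset (Rw l) m))"
proof unfold_locales
  let ?nu = "add_mset (Rw l) m"
  show "region n r (Ome n r cc ?nu)" "region n r (Ome n r (cc(l := Suc (cc l))) ?nu)" "region n r (OmQ n r cc l ?nu)"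
    by (rule region_Ome region_OmQ)+
  have sub: "Ome n r (cc(l := Suc (cc l))) ?nu i j \<longleftrightarrow> Ome n r cc ?nu i j \<and> (\<forall>q<r. i ! q = Rw l \<longrightarrow> j ! q \<noteq> cc l)" for i j
  proof -
    have "al (cc(l := Suc (cc l))) a x \<longleftrightarrow> al cc a x \<and> (a = Rw l \<longrightarrow> x \<noteq> cc l)" for a x
      by (cases a) auto
    then have "list_all2 (al (cc(l := Suc (cc l)))) i j \<longleftrightarrow> list_all2 (al cc) i j \<and> (\<forall>q<r. i ! q = Rw l \<longrightarrow> j ! q \<noteq> cc l)"
      if "length i = r"
      using that by (auto simp: list_all2_conv_all_nth)
    then show ?thesis unfolding Ome_def by blast
  qed
  show "Ome n r cc ?nu i j \<longleftrightarrow> Ome n r (cc(l := Suc (cc l))) ?nu i j \<or> OmQ n r cc l ?nu i j" for i j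
    unfolding OmQ_def sub by blast
  show "\<not> (Ome n r (cc(l := Suc (cc l))) ?nu i j \<and> OmQ n r cc l ?nu i j)" for i j
    unfolding OmQ_def sub by blast
  show "Ome n r (cc(l := Suc (cc l))) ?nu i y" if a: "Ome n r (cc(l := Suc (cc l))) ?nu i x" "lle x y" "Ome n r cc ?nu i y" for i x y
    unfolding sub
  proof (intro conjI allI impI)
    show "Ome n r cc ?nu i y" by fact
    fix q assume q: "q < r" "i ! q = Rw l"
    have "x ! q \<le> y ! q" using a(2) q Ome_len[OF a(1)] by (auto simp: list_all2_conv_all_nth)
    moreover have "cc l < x ! q" using Ome_al[OF a(1) q(1)] q(2) by simp
    ultimately show "y ! q \<noteq> cc l" by simp
  qed
qed

lemma exo_peel:
  assumes "exo (cc(l := Suc (cc l))) (add_mset (Rw l) m) k" "exo cc (add_mset (Fr (cc l)) m) k"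
  shows "exo cc (add_mset (Rw l) m) k"
  using region_split.ex_total[OF Ome_split assms(1)] assms(2) by (simp add: ex_OmQ_iff)

lemma Ac_peel:
  assumes "Ac (cc(l := Suc (cc l))) (add_mset (Rw l) m)" "Ac cc (add_mset (Fr (cc l)) m)"
  shows "Ac cc (add_mset (Rw l) m)"
  using exo_peel assms by (auto simp: Ac_def)

text \<open>The same sequence solved for its quotient. It gives control over a twist from control
  over a row, the move that keeps the number of twists bounded. Degree \<open>k\<close> of the
  quotient needs degree \<open>k - 1\<close> of the sub, so \<open>Ac\<close> has to cover all
  degrees.\<close>

lemma Ac_boost:
  assumes "Ac (cc(l := Suc (cc l))) (add_mset (Rw l) m)" "Ac cc (add_mset (Rw l) m)"
  shows "Ac cc (add_mset (Fr (cc l)) m)"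
  unfolding Ac_def
proof
  fix k
  show "exo cc (add_mset (Fr (cc l)) m) k"
    using region_split.ex_quot[OF Ome_split, of cc l m k] assms by (simp add: ex_OmQ_iff Ac_def)
qed

lemma Ac_cong: "(\<And>l. Rw l \<in># nu \<Longrightarrow> cc l = cc' l) \<Longrightarrow> Ac cc nu \<longleftrightarrow> Ac cc' nu"
  using Ome_cong[of nu cc cc' n r] by (simp add: Ac_def)

lemma exo_empty:
  assumes "\<And>i j. \<not> Ome n r cc nu i j" shows "exo cc nu k"
  using assms by (intro ex_null) auto

lemma exo_row_out:
  assumes "Rw l \<in># nu" "n < cc l" shows "exo cc nu k"
proof (rule exo_empty)
  fix i j show "\<not> Ome n r cc nu i j"
  proof
    assume o: "Ome n r cc nu i j"
    have "Rw l \<in> set i" using o assms by (simp add: Ome_def flip: set_mset_mset)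
    then obtain q where q: "q < r" "i ! q = Rw l" using Ome_len[OF o] by (auto simp: in_set_conv_nth)
    have "cc l \<le> j ! q" using Ome_al[OF o q(1)] q(2) by simp
    moreover have "j ! q \<in> set j" using q Ome_len[OF o] by simp
    ultimately show False using Ome_len[OF o] assms by (auto simp: Inr_def)
  qed
qed

lemma exo_Fr_out:
  assumes "Fr c \<in># nu" "c \<notin> {1..n}" shows "exo cc nu k"
proof (rule exo_empty)
  fix i j show "\<not> Ome n r cc nu i j"
  proof
    assume o: "Ome n r cc nu i j"
    have "Fr c \<in> set i" using o assms by (simp add: Ome_def flip: set_mset_mset)
    then obtain q where q: "q < r" "i ! q = Fr c" using Ome_len[OF o] by (auto simp: in_set_conv_nth)
    have "c = j ! q" using Ome_al[OF o q(1)] q(2) by simp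
    moreover have "j ! q \<in> set j" using q Ome_len[OF o] by simp
    ultimately show False using Ome_len[OF o] assms by (auto simp: Inr_def)
  qed
qed

lemma Ac_row_out: "Rw l \<in># nu \<Longrightarrow> n < cc l \<Longrightarrow> Ac cc nu"
  and Ac_Fr_out: "Fr c \<in># nu \<Longrightarrow> c \<notin> {1..n} \<Longrightarrow> Ac cc nu"
  using exo_row_out exo_Fr_out by (auto simp: Ac_def)

end

section \<open>Starting columns, twists and rows\<close>

fun colof :: "(nat \<Rightarrow> nat) \<Rightarrow> lab \<Rightarrow> nat" where
  "colof cc (Fr c) = c"
| "colof cc (Rw l) = cc l"

abbreviation Tw :: "lab multiset \<Rightarrow> nat \<Rightarrow> nat" where
  "Tw nu c \<equiv> count nu (Fr c)"

text \<open>Content of the least right word, in which every row letter takes its starting column.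
  For a staircase it is the weight of the idempotent that generates the module.\<close>

definition cl :: "(nat \<Rightarrow> nat) \<Rightarrow> lab multiset \<Rightarrow> nat \<Rightarrow> nat" where
  "cl cc nu = count (image_mset (colof cc) nu)"

definition rows :: "(nat \<Rightarrow> nat) \<Rightarrow> lab multiset \<Rightarrow> nat \<Rightarrow> nat set" where
  "rows cc nu a = {l. Rw l \<in># nu \<and> cc l = a}"

lemma finite_rows [simp]: "finite (rows cc nu a)"
proof -
  have "Rw ` rows cc nu a \<subseteq> set_mset nu" by (auto simp: rows_def)
  then have "finite (Rw ` rows cc nu a)" by (rule finite_subset) simp
  then show ?thesis by (rule finite_imageD) (auto simp: inj_on_def)
qed

lemma rows_raise: "rows (cc(l := Suc a)) nu a = rows cc nu a - {l}"
  by (auto simp: rows_def)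

lemma rows_Fr [simp]: "rows cc (add_mset (Fr c) m) a = rows cc m a"
  by (auto simp: rows_def)

lemma rows_Rw: "rows cc (add_mset (Rw l) m) a = (if cc l = a then insert l (rows cc m a) else rows cc m a)"
  by (auto simp: rows_def)

lemma cl_eq: "cl cc nu c = Tw nu c + (\<Sum>l\<in>rows cc nu c. count nu (Rw l))"
proof -
  have e: "colof cc -` {c} \<inter> set_mset nu = ({Fr c} \<inter> set_mset nu) \<union> Rw ` rows cc nu c" (is "_ = ?A \<union> ?B")
    using colof.elims by (auto simp: rows_def elim!: colof.elims[OF sym])
  have "cl cc nu c = (\<Sum>y\<in>?A \<union> ?B. count nu y)"
    by (simp add: cl_def count_image_mset e)
  also have "\<dots> = (\<Sum>y\<in>?A. count nu y) + (\<Sum>y\<in>?B. count nu y)"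
    by (rule sum.union_disjoint) auto
  also have "(\<Sum>y\<in>?A. count nu y) = Tw nu c"
    by (cases "Fr c \<in># nu") (auto simp: not_in_iff)
  also have "(\<Sum>y\<in>?B. count nu y) = (\<Sum>l\<in>rows cc nu c. count nu (Rw l))"
    by (subst sum.reindex) (auto simp: inj_on_def)
  finally show ?thesis .
qed

lemma fresh_row: "\<exists>l. Rw l \<notin># (nu :: lab multiset)"
proof -
  have "finite (Rw -` set_mset nu)" by (rule finite_vimageI) (auto simp: inj_on_def)
  then obtain l where "l \<notin> Rw -` set_mset nu" using ex_new_if_finite[OF infinite_UNIV_nat] by blast
  then show ?thesis by auto
qed

lemma rows_single:
  assumes "card (rows cc nu a) \<le> 1"
  shows "\<exists>l. (rows cc nu a = {l} \<and> Rw l \<in># nu \<and> cc l = a) \<or> (rows cc nu a = {} \<and> Rw l \<notin># nu)"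
proof (cases "rows cc nu a = {}")
  case False
  then obtain l where "l \<in> rows cc nu a" by blast
  then have "rows cc nu a = {l}" using assms card_le_Suc0_iff_eq[OF finite_rows, of cc nu a] by auto
  then show ?thesis by (auto simp: rows_def)
qed (use fresh_row in auto)

context tri_complex
begin

text \<open>Rows starting in column \<open>a\<close> can be removed one at a time: peeling a row trades its column-\<open>a\<close> letters for
  twists, and once the twist exceeds \<open>lam a\<close> by one, a twist letter is moved back into a fixed row.\<close>
lemma column_induct:
  assumes h1: "\<And>cc nu l. Q cc nu \<Longrightarrow> Rw l \<in># nu \<Longrightarrow> cc l = a \<Longrightarrow> Q (cc(l := Suc a)) nu"
    and h2: "\<And>cc m l. Q cc (add_mset (Rw l) m) \<Longrightarrow> cc l = a \<Longrightarrow> Q cc (add_mset (Fr a) m)"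
    and h3: "\<And>cc m l. Q cc (add_mset (Fr a) m) \<Longrightarrow> cc l = a \<Longrightarrow> Q cc (add_mset (Rw l) m)"
    and h4: "\<And>cc nu l. Q cc nu \<Longrightarrow> Rw l \<notin># nu \<Longrightarrow> Q (cc(l := a)) nu"
    and fin: "\<And>cc nu. Q cc nu \<Longrightarrow> card (rows cc nu a) \<le> 1 \<Longrightarrow> Tw nu a \<le> lam a \<Longrightarrow> Ac cc nu"
    and Q: "Q cc nu" and T: "Tw nu a \<le> Suc (lam a)"
  shows "Ac cc nu"
proof -
  \<comment> \<open>The outer induction is on the number \<open>N\<close> of rows in column
    \<open>a\<close>; the inner one is on the number \<open>S\<close> of letters in those rows other
    than a fixed row \<open>l1\<close>.\<close>
  have "\<forall>cc nu. card (rows cc nu a) = N \<longrightarrow> Q cc nu \<longrightarrow> Tw nu a \<le> Suc (lam a) \<longrightarrow> Ac cc nu" for N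
  proof (induction N rule: less_induct)
    case (less N)
    have inner: "\<forall>cc nu. l1 \<in> rows cc nu a \<longrightarrow> card (rows cc nu a) = N \<longrightarrow> Q cc nu \<longrightarrow> Tw nu a \<le> Suc (lam a) \<longrightarrow>
        (\<Sum>l\<in>rows cc nu a - {l1}. count nu (Rw l)) = S \<longrightarrow> Ac cc nu" for l1 S
    proof (induction S rule: less_induct)
      case (less S)
      note outer = \<open>\<And>y. y < N \<Longrightarrow> \<forall>cc nu. card (rows cc nu a) = y \<longrightarrow> Q cc nu \<longrightarrow> Tw nu a \<le> Suc (lam a) \<longrightarrow> Ac cc nu\<close>
      note IH = less.IH
      have p0: "Ac cc nu" if l1: "l1 \<in> rows cc nu a" and cN: "card (rows cc nu a) = N" and Q: "Q cc nu"
          and T: "Tw nu a \<le> lam a" and S: "(\<Sum>l\<in>rows cc nu a - {l1}. count nu (Rw l)) = S" for cc nu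
      proof (cases "N \<le> 1")
        case True
        then show ?thesis using fin Q T cN by blast
      next
        case False
        then have "rows cc nu a - {l1} \<noteq> {}" using l1 cN by (metis card.empty card.insert_remove finite.emptyI
              finite_rows insert_Diff insert_absorb One_nat_def empty_Diff le_refl)
        then obtain l where l: "l \<in> rows cc nu a" "l \<noteq> l1" by blast
        then have ln: "Rw l \<in># nu" and cl: "cc l = a" by (auto simp: rows_def)
        obtain m where m: "nu = add_mset (Rw l) m" using multi_member_split[OF ln] by blast
        have N1: "card (rows cc nu a - {l}) = N - 1" using l cN by simp
        have NN: "N - 1 < N" using False by simp
        have "Ac (cc(l := Suc a)) nu" using outer[OF NN] N1 h1[OF Q ln cl] T by (simp add: rows_raise)
        moreover have "Ac cc (add_mset (Fr a) m)"
        proof (cases "Rw l \<in># m")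
          case True
          have R: "rows cc (add_mset (Fr a) m) a = rows cc nu a" using True by (auto simp: m rows_def)
          have "(\<Sum>l\<in>rows cc nu a - {l1}. count (add_mset (Fr a) m) (Rw l)) < S"
            unfolding S[symmetric]
          proof (rule sum_strict_mono_ex1)
            show "\<exists>x\<in>rows cc nu a - {l1}. count (add_mset (Fr a) m) (Rw x) < count nu (Rw x)"
              using l by (intro bexI[of _ l]) (auto simp: m)
          qed (auto simp: m)
          then show ?thesis using IH l1 cN h2[OF Q[unfolded m] cl] T R by (fastforce simp: m)
        next
          case False
          have "rows cc (add_mset (Fr a) m) a = rows cc nu a - {l}" using False by (auto simp: m rows_def)
          then show ?thesis using outer[OF NN] N1 h2[OF Q[unfolded m] cl] T by (simp add: m)
        qed
        ultimately show ?thesis using Ac_peel[of cc l m] cl by (simp add: m)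
      qed
      show ?case
      proof (intro allI impI)
        fix cc nu assume l1: "l1 \<in> rows cc nu a" and cN: "card (rows cc nu a) = N" and Q: "Q cc nu"
          and T: "Tw nu a \<le> Suc (lam a)" and S: "(\<Sum>l\<in>rows cc nu a - {l1}. count nu (Rw l)) = S"
        show "Ac cc nu"
        proof (cases "Tw nu a \<le> lam a")
          case True
          then show ?thesis using p0 l1 cN Q S by blast
        next
          case False
          \<comment> \<open>Putting the surplus letter into \<open>l1\<close> changes neither
            \<open>N\<close> nor \<open>S\<close>, as \<open>S\<close> does not count
            \<open>l1\<close>, and returns the twist to \<open>lam a\<close>. Raising
            \<open>l1\<close> afterwards lowers \<open>N\<close>, so both terms needed by
            \<open>Ac_boost\<close> are available.\<close>
          then have T: "Tw nu a = Suc (lam a)" using T by simp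
          then obtain m where m: "nu = add_mset (Fr a) m" by (metis count_inI multi_member_split nat.distinct(1))
          have cl: "cc l1 = a" and l1m: "Rw l1 \<in># m" using l1 by (auto simp: rows_def m)
          have R: "rows cc (add_mset (Rw l1) m) a = rows cc nu a" using l1m by (auto simp: m rows_def)
          have S': "(\<Sum>l\<in>rows cc nu a - {l1}. count (add_mset (Rw l1) m) (Rw l)) = S"
            unfolding S[symmetric] by (rule sum.cong) (auto simp: m)
          have Q': "Q cc (add_mset (Rw l1) m)" using h3 Q cl m by blast
          have a1: "Ac cc (add_mset (Rw l1) m)" using p0[of cc "add_mset (Rw l1) m"] l1 cN Q' T S' R by (simp add: m)
          have N1: "card (rows cc nu a - {l1}) < N" using l1 cN by (metis card_Diff1_less finite_rows)
          have "Ac (cc(l1 := Suc a)) (add_mset (Rw l1) m)"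
            using outer[OF N1] h1[OF Q' _ cl] R T by (simp add: m rows_raise)
          then show ?thesis using Ac_boost[of cc l1 m] a1 cl by (simp add: m)
        qed
      qed
    qed
    show ?case
    proof (intro allI impI)
      fix cc nu assume cN: "card (rows cc nu a) = N" and Q: "Q cc nu" and T: "Tw nu a \<le> Suc (lam a)"
      show "Ac cc nu"
      proof (cases "rows cc nu a = {}")
        case False
        then show ?thesis using inner cN Q T by blast
      next
        case True
        show ?thesis
        proof (cases "Tw nu a \<le> lam a")
          case False
          then have T: "Tw nu a = Suc (lam a)" using T by simp
          then obtain m where m: "nu = add_mset (Fr a) m" by (metis count_inI multi_member_split nat.distinct(1))
          obtain l where l: "Rw l \<notin># nu" using fresh_row by blast
          let ?c = "cc(l := a)"
          have Q1: "Q ?c nu" by (rule h4[OF Q l])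
          have Q2: "Q ?c (add_mset (Rw l) m)" using h3 Q1 by (simp add: m)
          have R: "rows ?c (add_mset (Rw l) m) a = {l}" using True l by (auto simp: rows_def m)
          have a1: "Ac ?c (add_mset (Rw l) m)" by (rule fin[OF Q2]) (use R T in \<open>auto simp: m\<close>)
          have Q3: "Q (?c(l := Suc a)) (add_mset (Rw l) m)" by (rule h1[OF Q2]) auto
          have "rows (?c(l := Suc a)) (add_mset (Rw l) m) a = {}" using R by (metis rows_raise Diff_cancel)
          then have a2: "Ac (?c(l := Suc a)) (add_mset (Rw l) m)"
            by (intro fin[OF Q3]) (use T in \<open>auto simp: m\<close>)
          have "Ac ?c nu" using Ac_boost[of ?c l m] a1 a2 by (simp add: m)
          moreover have "Ac cc nu \<longleftrightarrow> Ac ?c nu" by (rule Ac_cong) (use l in auto)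
          ultimately show ?thesis by blast
        qed (use fin Q True in simp)
      qed
    qed
  qed
  then show ?thesis using Q T by blast
qed

section \<open>Vanishing caused by a column count different from \<open>lam\<close>\<close>

definition PN :: "nat \<Rightarrow> (nat \<Rightarrow> nat) \<Rightarrow> lab multiset \<Rightarrow> bool" where
  "PN s cc nu \<longleftrightarrow> (\<forall>l. Rw l \<in># nu \<longrightarrow> 1 \<le> cc l) \<and> (\<forall>c\<in>{1..s}. card (rows cc nu c) \<le> 1) \<and>
     (\<forall>c\<le>s. Tw nu c \<le> lam c) \<and> (\<forall>c>s. Tw nu c \<le> Suc (lam c)) \<and> (\<exists>c\<in>{1..s}. cl cc nu c \<noteq> lam c)"

end

text \<open>Staircases enter as a hypothesis, which keeps the column inductions independent of the
  actual bar complex; \<open>bar_staircase\<close> discharges it.\<close>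

locale acyclic_base = tri_complex n r lam B sw de
  for n r lam and B :: "nat \<Rightarrow> 't set" and sw and de :: "'t \<Rightarrow> 't \<Rightarrow> nat list \<Rightarrow> nat list \<Rightarrow> 'a::comm_ring_1" +
  assumes base: "set_mset nu \<subseteq> range Rw \<Longrightarrow> inj_on cc {l. Rw l \<in># nu} \<Longrightarrow> (\<And>l. Rw l \<in># nu \<Longrightarrow> cc l \<in> {1..n}) \<Longrightarrow>
     cl cc nu \<noteq> lam \<Longrightarrow> Ac cc nu"
begin

lemma mismatch_staircase:
  assumes N: "PN n cc nu" and z: "\<And>c. c \<le> n \<Longrightarrow> Tw nu c = 0"
  shows "Ac cc nu"
proof (cases "(\<exists>c. Fr c \<in># nu) \<or> (\<exists>l. Rw l \<in># nu \<and> n < cc l)")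
  case True
  then show ?thesis
  proof
    assume "\<exists>c. Fr c \<in># nu"
    then obtain c where c: "Fr c \<in># nu" by blast
    then have "\<not> c \<le> n" using z by (metis count_eq_zero_iff)
    then show ?thesis using Ac_Fr_out[OF c] by simp
  qed (use Ac_row_out in blast)
next
  case False
  show ?thesis
  proof (rule base)
    show "set_mset nu \<subseteq> range Rw"
    proof
      fix x assume "x \<in># nu" then show "x \<in> range Rw" using False by (cases x) auto
    qed
    show rg: "cc l \<in> {1..n}" if "Rw l \<in># nu" for l
      using N False that by (force simp: PN_def)
    show "inj_on cc {l. Rw l \<in># nu}"
    proof (rule inj_onI)
      fix x y assume a: "x \<in> {l. Rw l \<in># nu}" "y \<in> {l. Rw l \<in># nu}" "cc x = cc y"
      then have "card (rows cc nu (cc x)) \<le> 1" using N rg unfolding PN_def by blast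
      moreover have "x \<in> rows cc nu (cc x)" "y \<in> rows cc nu (cc x)" using a by (auto simp: rows_def)
      ultimately show "x = y" using card_le_Suc0_iff_eq[OF finite_rows] by fastforce
    qed
    show "cl cc nu \<noteq> lam" using N by (auto simp: PN_def)
  qed
qed

text \<open>Downward induction on the first column \<open>a\<close> that may carry twists, ending at
  staircases. Moving a twist letter into the only row of its column preserves \<open>cl\<close>,
  hence the mismatch. Raising that row instead leaves fewer than \<open>lam a\<close> letters in
  column \<open>a\<close>, which is a new mismatch. \<open>Ac_boost\<close> combines the two. Column
  \<open>Suc s\<close> may hold several rows and needs \<open>column_induct\<close> first.\<close>

lemma mismatch_level:
  assumes "1 \<le> a" "a \<le> Suc n"
  shows "\<forall>s cc nu. a \<le> Suc s \<longrightarrow> s \<le> n \<longrightarrow> PN s cc nu \<longrightarrow> (\<forall>c<a. Tw nu c = 0) \<longrightarrow> Ac cc nu"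
  using assms(2,1)
proof (induction rule: inc_induct)
  case base
  show ?case
  proof (intro allI impI)
    fix s cc nu assume a: "Suc n \<le> Suc s" "s \<le> n" "PN s cc nu" "\<forall>c<Suc n. Tw nu c = 0"
    then have "s = n" by simp
    then show "Ac cc nu" using mismatch_staircase a by auto
  qed
next
  case (step a)
  then have a1: "1 \<le> a" and an: "a \<le> n" by auto
  have IH: "Ac cc nu" if "Suc a \<le> Suc s" "s \<le> n" "PN s cc nu" "\<forall>c<Suc a. Tw nu c = 0" for s cc nu
    using step that by auto
  have S1: "\<forall>s cc nu. Tw nu a = t \<longrightarrow> a \<le> s \<longrightarrow> s \<le> n \<longrightarrow> PN s cc nu \<longrightarrow> (\<forall>c<a. Tw nu c = 0) \<longrightarrow> Ac cc nu" for t
  proof (induction t)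
    case 0
    then show ?case using IH by (auto simp: less_Suc_eq)
  next
    case (Suc t)
    show ?case
    proof (intro allI impI)
      fix s cc nu assume T: "Tw nu a = Suc t" and s: "a \<le> s" "s \<le> n" and N: "PN s cc nu" and z: "\<forall>c<a. Tw nu c = 0"
      obtain m where m: "nu = add_mset (Fr a) m" using T by (metis count_inI multi_member_split nat.distinct(1))
      have "card (rows cc nu a) \<le> 1" using N s a1 by (auto simp: PN_def)
      then obtain l where l: "(rows cc nu a = {l} \<and> Rw l \<in># nu \<and> cc l = a) \<or> (rows cc nu a = {} \<and> Rw l \<notin># nu)"
        using rows_single by blast
      let ?c = "cc(l := a)" let ?c' = "?c(l := Suc a)" let ?n = "add_mset (Rw l) m"
      have eq: "cc x = ?c x" if "Rw x \<in># nu" for x using l that by auto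
      have Tlam: "Suc t \<le> lam a" using N s T unfolding PN_def by metis
      \<comment> \<open>A twist in column \<open>a\<close> and a letter of a row starting there
        count equally in \<open>cl\<close>.\<close>
      have img: "image_mset (colof ?c) ?n = image_mset (colof cc) nu"
      proof -
        have "image_mset (colof ?c) m = image_mset (colof cc) m"
        proof (rule image_mset_cong)
          fix x assume "x \<in># m" then show "colof ?c x = colof cc x" using eq by (cases x) (auto simp: m)
        qed
        then show ?thesis by (simp add: m)
      qed
      have rows1: "rows ?c ?n c = rows cc nu c" if "c \<noteq> a" for c
        using that eq l by (auto simp: rows_def m)
      have rowsa: "rows ?c ?n a = {l}" using l by (auto simp: rows_def m)
      have T': "Tw ?n c = (if c = a then t else Tw nu c)" for c using T by (auto simp: m)
      have pos: "1 \<le> ?c x" if "Rw x \<in># ?n" for x using that N a1 by (auto simp: PN_def m)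
      have "PN s ?c ?n"
        unfolding PN_def
      proof (intro conjI)
        show "\<forall>c\<in>{1..s}. card (rows ?c ?n c) \<le> 1"
        proof
          fix c assume c: "c \<in> {1..s}"
          show "card (rows ?c ?n c) \<le> 1"
            using N rowsa rows1[of c] c by (cases "c = a") (auto simp: PN_def)
        qed
        show "\<exists>c\<in>{1..s}. cl ?c ?n c \<noteq> lam c" using N img by (auto simp: PN_def cl_def)
      qed (use N pos T' Tlam T s in \<open>auto simp: PN_def\<close>)
      then have A1: "Ac ?c ?n" using Suc.IH[rule_format, of ?n s ?c] s z T' by simp
      have rows2: "rows ?c' ?n c = rows cc nu c" if "c < a" for c
        using that eq l by (auto simp: rows_def m)
      have rows2a: "rows ?c' ?n a = {}" using rowsa rows_raise[of ?c l a ?n] by simp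
      have "cl ?c' ?n a = t" using rows2a T' by (simp add: cl_eq)
      then have mis: "cl ?c' ?n a \<noteq> lam a" using Tlam by simp
      \<comment> \<open>Column \<open>a\<close> itself is now the mismatch, so \<open>s\<close> is
        cut back to \<open>a\<close>. This is necessary because the raised row may have joined
        another row in column \<open>Suc a\<close>.\<close>
      have "PN a ?c' ?n"
        unfolding PN_def
      proof (intro conjI)
        show "\<forall>l'. Rw l' \<in># ?n \<longrightarrow> 1 \<le> ?c' l'"
        proof (intro allI impI)
          fix l' assume "Rw l' \<in># ?n" then show "1 \<le> ?c' l'" using pos[of l'] by (cases "l' = l") auto
        qed
        show "\<forall>c\<in>{1..a}. card (rows ?c' ?n c) \<le> 1"
        proof
          fix c assume c: "c \<in> {1..a}"
          show "card (rows ?c' ?n c) \<le> 1"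
            using N s rows2a rows2[of c] c by (cases "c = a") (auto simp: PN_def)
        qed
        show "\<exists>c\<in>{1..a}. cl ?c' ?n c \<noteq> lam c" using mis a1 by auto
        show "\<forall>c\<le>a. Tw ?n c \<le> lam c" using N T' Tlam s by (auto simp: PN_def)
        show "\<forall>c>a. Tw ?n c \<le> Suc (lam c)"
          using N T' by (auto simp: PN_def) (metis le_SucI not_le)
      qed
      then have A2: "Ac ?c' ?n" using Suc.IH[rule_format, of ?n a ?c'] an z T' by simp
      have "Ac ?c nu" using Ac_boost[of ?c l m] A1 A2 by (simp add: m)
      moreover have "Ac cc nu \<longleftrightarrow> Ac ?c nu" by (rule Ac_cong) (use eq in auto)
      ultimately show "Ac cc nu" by blast
    qed
  qed
  show ?case
  proof (intro allI impI)
    fix s cc nu assume s: "a \<le> Suc s" "s \<le> n" and N: "PN s cc nu" and z: "\<forall>c<a. Tw nu c = 0"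
    show "Ac cc nu"
    proof (cases "a \<le> s")
      case True
      then show ?thesis using S1 s N z by blast
    next
      case False
      then have sa: "a = Suc s" using s by simp
      \<comment> \<open>Column \<open>a\<close> is the first one past \<open>s\<close> and may hold
        many rows. \<open>Q\<close> is silent about the twist in column \<open>a\<close>, which
        \<open>column_induct\<close> changes; once at most one row is left there, \<open>s\<close>
        can be extended to \<open>a\<close>.\<close>
      define Q where "Q = (\<lambda>cc nu. (\<forall>l. Rw l \<in># nu \<longrightarrow> 1 \<le> cc l) \<and> (\<forall>c\<in>{1..s}. card (rows cc nu c) \<le> 1) \<and>
         (\<forall>c>a. Tw nu c \<le> Suc (lam c)) \<and> (\<exists>c\<in>{1..s}. cl cc nu c \<noteq> lam c) \<and> (\<forall>c<a. Tw nu c = 0))"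
      have rows_eq: "rows cc' nu' c = rows cc nu c \<and> cl cc' nu' c = cl cc nu c"
        if "c < a" "\<And>l. Rw l \<in># nu' \<and> cc' l = c \<longleftrightarrow> Rw l \<in># nu \<and> cc l = c"
          "\<And>l. Rw l \<in># nu \<Longrightarrow> cc l = c \<Longrightarrow> count nu' (Rw l) = count nu (Rw l)" "Tw nu' c = Tw nu c" for c cc nu cc' nu'
      proof -
        have "rows cc' nu' c = rows cc nu c" using that by (auto simp: rows_def)
        then show ?thesis using that by (auto simp: cl_eq rows_def intro!: sum.cong)
      qed
      show ?thesis
      proof (rule column_induct[of Q])
        show "Q cc nu" using N z by (auto simp: Q_def PN_def sa)
        show "Tw nu a \<le> Suc (lam a)" using N by (auto simp: PN_def sa)
      next
        fix cc nu assume q: "Q cc nu" "card (rows cc nu a) \<le> 1" "Tw nu a \<le> lam a"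
        have "PN a cc nu"
          unfolding PN_def
        proof (intro conjI)
          show "\<forall>c\<in>{1..a}. card (rows cc nu c) \<le> 1" using q unfolding Q_def sa by (auto simp: atLeastAtMostSuc_conv)
          show "\<forall>c\<le>a. Tw nu c \<le> lam c" using q unfolding Q_def by (metis le_neq_implies_less le0)
          show "\<exists>c\<in>{1..a}. cl cc nu c \<noteq> lam c" using q unfolding Q_def sa by force
        qed (use q in \<open>auto simp: Q_def\<close>)
        then show "Ac cc nu" using S1[of "Tw nu a"] q an by (auto simp: Q_def)
      next
        fix cc nu l assume q: "Q cc nu" "Rw l \<in># nu" "cc l = a"
        have "rows (cc(l := Suc a)) nu c = rows cc nu c \<and> cl (cc(l := Suc a)) nu c = cl cc nu c" if "c < a" for c
          by (rule rows_eq[OF that]) (use q that in auto)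
        then show "Q (cc(l := Suc a)) nu" using q by (auto simp: Q_def sa)
      next
        fix cc m l assume q: "Q cc (add_mset (Rw l) m)" "cc l = a"
        have "rows cc (add_mset (Fr a) m) c = rows cc (add_mset (Rw l) m) c \<and> cl cc (add_mset (Fr a) m) c = cl cc (add_mset (Rw l) m) c" if "c < a" for c
          by (rule rows_eq[OF that]) (use q that in auto)
        then show "Q cc (add_mset (Fr a) m)" using q by (auto simp: Q_def sa)
      next
        fix cc m l assume q: "Q cc (add_mset (Fr a) m)" "cc l = a"
        have "rows cc (add_mset (Rw l) m) c = rows cc (add_mset (Fr a) m) c \<and> cl cc (add_mset (Rw l) m) c = cl cc (add_mset (Fr a) m) c" if "c < a" for c
          by (rule rows_eq[OF that]) (use q that in auto)
        then show "Q cc (add_mset (Rw l) m)" using q by (auto simp: Q_def sa)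
      next
        fix cc nu l assume q: "Q cc nu" "Rw l \<notin># nu"
        have "rows (cc(l := a)) nu c = rows cc nu c \<and> cl (cc(l := a)) nu c = cl cc nu c" if "c < a" for c
          by (rule rows_eq[OF that]) (use q that in auto)
        then show "Q (cc(l := a)) nu" using q by (auto simp: Q_def sa)
      qed
    qed
  qed
qed

lemma lam_0 [simp]: "lam 0 = 0" and lam_out: "n < c \<Longrightarrow> lam c = 0"
  using lam_comp by (auto simp: Comps_def)

lemma mismatch:
  assumes "PN s cc nu" "s \<le> n" shows "Ac cc nu"
proof -
  have "Tw nu c \<le> lam c" if "c < 1" for c using assms(1) that by (auto simp: PN_def)
  then show ?thesis using mismatch_level[of 1] assms by auto
qed

end

section \<open>Splitting the complex over the left action\<close>

context tri_complex
begin

text \<open>The differential never touches the left word, so fixing its content cuts out a direct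
  summand, which is both a sub and a quotient.\<close>

lemma content_split:
  assumes reg: "region n r Om"
  shows "region_split n r lam B sw de Om (\<lambda>i j. Om i j \<and> mset i \<noteq> nu) (\<lambda>i j. Om i j \<and> mset i = nu)"
    and "region_split n r lam B sw de Om (\<lambda>i j. Om i j \<and> mset i = nu) (\<lambda>i j. Om i j \<and> mset i \<noteq> nu)"
proof -
  have "region n r (\<lambda>i j. Om i j \<and> P (mset i))" for P
    unfolding region_def
  proof (intro conjI allI impI)
    fix p i j assume "p permutes {..<r}" "Om i j \<and> P (mset i)"
    then show "Om (permute_list p i) (permute_list p j)" "P (mset (permute_list p i))"
      using region_perm[OF reg] region_len[OF reg] by auto
  next
    fix i x y z assume "Om i x \<and> P (mset i)" "Om i z \<and> P (mset i)" "lle x y" "lle y z"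
    then show "Om i y" "P (mset i)" using region_convex[OF reg] by blast+
  qed (use region_len[OF reg] in auto)
  note R = this[of "\<lambda>m. m = nu"] this[of "\<lambda>m. m \<noteq> nu"]
  show "region_split n r lam B sw de Om (\<lambda>i j. Om i j \<and> mset i \<noteq> nu) (\<lambda>i j. Om i j \<and> mset i = nu)"
   "region_split n r lam B sw de Om (\<lambda>i j. Om i j \<and> mset i = nu) (\<lambda>i j. Om i j \<and> mset i \<noteq> nu)"
    by (unfold_locales; use R reg in blast)+
qed

lemma ex_content:
  assumes reg: "region n r Om" and e: "ex Om k"
  shows "ex (\<lambda>i j. Om i j \<and> mset i = nu) k" (is "ex ?O k")
  unfolding ex_def
proof (intro allI impI)
  interpret a: region_split n r lam B sw de Om "\<lambda>i j. Om i j \<and> mset i \<noteq> nu" ?O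
    by (rule content_split(1)[OF reg])
  interpret b: region_split n r lam B sw de Om ?O "\<lambda>i j. Om i j \<and> mset i \<noteq> nu"
    by (rule content_split(2)[OF reg])
  fix F assume c: "cyc ?O k F"
  then have F: "F \<in> C ?O k" by (simp add: cyc_def)
  have "cyc Om k F"
    using c a.quo_C b.sub_D by (cases k) (auto simp: cyc_def)
  then obtain G where G: "G \<in> C Om (Suc k)" "D Om k G = F" using e unfolding ex_def by blast
  have "D ?O k (res ?O G) = F" using a.quo_D[OF G(1)] G a.res_id[OF F] by simp
  then show "\<exists>G\<in>C ?O (Suc k). D ?O k G = F" using res_C[OF a.reg'' G(1)] by blast
qed

text \<open>Each row label is replaced by the letter of the right word at its position. The pair
  \<open>(hat i x, x)\<close> is universal: the value of a chain at \<open>(i, x)\<close> acts as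
  the coefficient of this pair from the left.\<close>

definition hat :: "lab list \<Rightarrow> nat list \<Rightarrow> lab list" where
  "hat i j = map2 (\<lambda>l x. case l of Fr c \<Rightarrow> Fr c | Rw _ \<Rightarrow> Rw x) i j"

text \<open>The direct sum over all row contents with the twists of \<open>nu\<close>, every row
  starting in column \<open>s\<close>. Letting all row contents occur at once makes room for the
  left action by kernels in the row labels.\<close>

definition star :: "nat \<Rightarrow> lab multiset \<Rightarrow> lab list \<Rightarrow> nat list \<Rightarrow> bool" where
  "star s nu i j \<longleftrightarrow> (\<forall>c. Tw (mset i) c = Tw nu c) \<and> length i = r \<and> j \<in> W \<and> list_all2 (al (\<lambda>_. s)) i j"

lemma region_star: "region n r (star s nu)"
  unfolding region_def
proof (intro conjI allI impI)
  fix i x y z assume a: "star s nu i x" "star s nu i z" "lle x y" "lle y z"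
  have "list_all2 (al (\<lambda>_. s)) i y"
    using a unfolding star_def list_all2_conv_all_nth al_def
    by (auto split: lab.splits) (metis le_antisym, metis le_trans)
  then show "star s nu i y" using a lle_Inr[OF a(3,4)] by (auto simp: star_def)
qed (auto simp: star_def permute_list_Inr list_all2_permute_list_iff Inr_length)

lemma star_len: "star s nu i j \<Longrightarrow> length i = r \<and> length j = r \<and> j \<in> W"
  by (auto simp: star_def Inr_length)

lemma hat_nth: "length i = r \<Longrightarrow> length x = r \<Longrightarrow> q < r \<Longrightarrow>
    hat i x ! q = (case i ! q of Fr c \<Rightarrow> Fr c | Rw _ \<Rightarrow> Rw (x ! q))"
  by (simp add: hat_def)

lemma hat_length [simp]: "length (hat i x) = min (length i) (length x)"
  by (simp add: hat_def)

lemma hat_hat: "length i = r \<Longrightarrow> length x = r \<Longrightarrow> length y = r \<Longrightarrow> hat (hat i x) y = hat i y"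
  by (rule nth_equalityI) (auto simp: hat_nth split: lab.splits)

lemma hat_perm:
  assumes "p permutes {..<r}" "length i = r" "length x = r"
  shows "hat (permute_list p i) (permute_list p x) = permute_list p (hat i x)"
proof (rule nth_equalityI)
  fix q assume "q < length (hat (permute_list p i) (permute_list p x))"
  then have q: "q < r" using assms by simp
  then have "p q < r" using permutes_in_image[OF assms(1), of q] by simp
  then show "hat (permute_list p i) (permute_list p x) ! q = permute_list p (hat i x) ! q"
    using assms q by (cases "i ! p q") (simp_all add: permute_list_nth hat_nth)
qed (use assms in simp)

lemma hat_Tw:
  assumes "length i = length x" shows "Tw (mset (hat i x)) c = Tw (mset i) c"
  using assms by (induction i x rule: list_induct2) (auto simp: hat_def split: lab.splits)

text \<open>A row position is only required to have a value of at least \<open>s\<close>, whatever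
  its label, so relabelling rows does not affect membership.\<close>

lemma star_hat:
  assumes "star s nu i x" "length j = r"
  shows "star s nu (hat i x) j \<longleftrightarrow> star s nu i j"
proof -
  have l: "length i = r" "length x = r" using star_len[OF assms(1)] by auto
  have "list_all2 (al (\<lambda>_. s)) (hat i x) j \<longleftrightarrow> list_all2 (al (\<lambda>_. s)) i j"
    using l assms(2) by (auto simp: list_all2_conv_all_nth hat_nth al_def split: lab.splits)
  then show ?thesis using l by (simp add: star_def hat_Tw)
qed

lemma col_hat:
  assumes "star s nu i x" shows "map (colof id) (hat i x) = x"
proof -
  have l: "length i = r" "length x = r" "list_all2 (al (\<lambda>_. s)) i x" using assms star_len[OF assms] by (auto simp: star_def)
  show ?thesis
  proof (rule nth_equalityI)
    fix q assume q: "q < length (map (colof id) (hat i x))"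
    then have "al (\<lambda>_. s) (i ! q) (x ! q)" using l by (auto simp: list_all2_conv_all_nth)
    then show "map (colof id) (hat i x) ! q = x ! q" using q l by (cases "i ! q") (auto simp: hat_nth)
  qed (use l in simp)
qed

text \<open>When the right word is spelled out by the labels, its content minus the twists is the
  row content. Hence a weight and a twist pattern leave only one content of the left word.\<close>

lemma star_content:
  assumes "star s nu i x" "star s nu i' x'" "x = map (colof id) i" "x' = map (colof id) i'" "cont x = cont x'"
  shows "mset i = mset i'"
proof (rule multiset_eqI)
  fix a
  have cl: "cont (map (colof id) w) c = Tw (mset w) c + count (mset w) (Rw c)" for w c
  proof (induction w)
    case (Cons a w) then show ?case by (cases a) auto
  qed simp
  have T: "Tw (mset i) c = Tw (mset i') c" for c using assms by (auto simp: star_def)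
  have "count (mset i) (Rw c) = count (mset i') (Rw c)" for c
    using cl[of i c] cl[of i' c] T[of c] assms(3,4,5) by simp
  then show "count (mset i) a = count (mset i') a" using T by (cases a) auto
qed

text \<open>The left-linear map that sends the universal element of each generator \<open>t\<close>
  to \<open>V t\<close>; for \<open>V t = uni s nu t\<close> it is the identity by
  \<open>sum_uni\<close>.\<close>

definition hh :: "nat \<Rightarrow> ('t \<Rightarrow> 't \<Rightarrow> lab list \<Rightarrow> nat list \<Rightarrow> 'a) \<Rightarrow> ('t \<Rightarrow> lab list \<Rightarrow> nat list \<Rightarrow> 'a) \<Rightarrow> 't \<Rightarrow> lab list \<Rightarrow> nat list \<Rightarrow> 'a" where
  "hh k V F = (\<lambda>u i j. \<Sum>t\<in>B k. \<Sum>x\<in>W. F t i x * V t u (hat i x) j)"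

lemma hh_C:
  assumes F: "F \<in> C (star s nu) k" and V: "\<And>t. t \<in> B k \<Longrightarrow> V t \<in> C (star s nu) k'"
  shows "hh k V F \<in> C (star s nu) k'"
  unfolding C_def
proof (intro CollectI conjI allI impI)
  fix u i j assume "hh k V F u i j \<noteq> 0"
  then obtain t where t: "t \<in> B k" "(\<Sum>x\<in>W. F t i x * V t u (hat i x) j) \<noteq> 0"
    unfolding hh_def by (meson sum.not_neutral_contains_not_neutral)
  then obtain x where "F t i x * V t u (hat i x) j \<noteq> 0" by (meson sum.not_neutral_contains_not_neutral)
  then have "F t i x \<noteq> 0" "V t u (hat i x) j \<noteq> 0" by auto
  then have a: "star s nu i x" and b: "u \<in> B k'" "star s nu (hat i x) j" "cont j = sw u"
    using C_supp[OF F] C_supp[OF V[OF t(1)]] by blast+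
  then show "u \<in> B k'" "star s nu i j" "cont j = sw u"
    using star_hat[OF a] star_len[OF b(2)] by auto
next
  fix u show "linv r (hh k V F u)"
  proof (rule linvI)
    fix p and i :: "lab list" and j :: "nat list" assume p: "p permutes {..<r}" and l: "length i = r" "length j = r"
    show "hh k V F u (permute_list p i) (permute_list p j) = hh k V F u i j"
      unfolding hh_def
    proof (rule sum.cong[OF refl])
      fix t assume t: "t \<in> B k"
      have "(\<Sum>x\<in>W. F t (permute_list p i) x * V t u (hat (permute_list p i) x) (permute_list p j))
        = (\<Sum>x\<in>W. F t (permute_list p i) (permute_list p x) * V t u (hat (permute_list p i) (permute_list p x)) (permute_list p j))"
        by (rule sum_Inr_permute[OF p, symmetric])
      also have "\<dots> = (\<Sum>x\<in>W. F t i x * V t u (hat i x) j)"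
      proof (rule sum.cong[OF refl])
        fix x assume x: "x \<in> W"
        then have "length x = r" by (rule Inr_length)
        then show "F t (permute_list p i) (permute_list p x) * V t u (hat (permute_list p i) (permute_list p x)) (permute_list p j)
          = F t i x * V t u (hat i x) j"
          using linvD[OF C_inv[OF F] p] linvD[OF C_inv[OF V[OF t]] p] l by (simp add: hat_perm[OF p])
      qed
      finally show "(\<Sum>x\<in>W. F t (permute_list p i) x * V t u (hat (permute_list p i) x) (permute_list p j))
         = (\<Sum>x\<in>W. F t i x * V t u (hat i x) j)" .
    qed
  qed
qed

text \<open>\<open>D\<close> multiplies from the right and \<open>hh\<close> from the left, so the
  differential may be applied to the values \<open>V t\<close>.\<close>

lemma D_hh:
  assumes F: "F \<in> C (star s nu) k" and o: "star s nu i j" and u: "u \<in> B k"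
  shows "D (star s nu) k (hh k V F) u i j = (\<Sum>t\<in>B k. \<Sum>x\<in>W. F t i x * D (star s nu) k (V t) u (hat i x) j)"
proof -
  have j: "length j = r" using star_len[OF o] by blast
  have "D (star s nu) k (hh k V F) u i j
    = (\<Sum>t'\<in>B (Suc k). \<Sum>z\<in>W. \<Sum>t\<in>B k. \<Sum>x\<in>W. F t i x * (V t t' (hat i x) z * de t' u z j))"
    using o u by (simp add: D_def hh_def sum_distrib_right mult.assoc)
  also have "\<dots> = (\<Sum>t'\<in>B (Suc k). \<Sum>t\<in>B k. \<Sum>z\<in>W. \<Sum>x\<in>W. F t i x * (V t t' (hat i x) z * de t' u z j))"
    by (intro sum.cong refl sum.swap)
  also have "\<dots> = (\<Sum>t\<in>B k. \<Sum>t'\<in>B (Suc k). \<Sum>z\<in>W. \<Sum>x\<in>W. F t i x * (V t t' (hat i x) z * de t' u z j))"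
    by (rule sum.swap)
  also have "\<dots> = (\<Sum>t\<in>B k. \<Sum>t'\<in>B (Suc k). \<Sum>x\<in>W. \<Sum>z\<in>W. F t i x * (V t t' (hat i x) z * de t' u z j))"
    by (intro sum.cong refl sum.swap)
  also have "\<dots> = (\<Sum>t\<in>B k. \<Sum>x\<in>W. \<Sum>t'\<in>B (Suc k). \<Sum>z\<in>W. F t i x * (V t t' (hat i x) z * de t' u z j))"
    by (intro sum.cong refl sum.swap)
  also have "\<dots> = (\<Sum>t\<in>B k. \<Sum>x\<in>W. F t i x * D (star s nu) k (V t) u (hat i x) j)"
  proof (intro sum.cong refl)
    fix t x assume "t \<in> B k" "x \<in> W"
    show "(\<Sum>t'\<in>B (Suc k). \<Sum>z\<in>W. F t i x * (V t t' (hat i x) z * de t' u z j)) = F t i x * D (star s nu) k (V t) u (hat i x) j"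
    proof (cases "F t i x = 0")
      case False
      then have "star s nu i x" using C_supp[OF F] by blast
      then have "star s nu (hat i x) j" using star_hat j o by blast
      then show ?thesis using u by (simp add: D_def sum_distrib_left)
    qed simp
  qed
  finally show ?thesis .
qed

text \<open>The identity kernel placed at the generator \<open>t\<close>: it is supported on the
  pairs whose left labels spell out the right word of weight \<open>sw t\<close>.\<close>

definition uni :: "nat \<Rightarrow> lab multiset \<Rightarrow> 't \<Rightarrow> 't \<Rightarrow> lab list \<Rightarrow> nat list \<Rightarrow> 'a" where
  "uni s nu t u i j = (if u = t \<and> star s nu i j \<and> j = map (colof id) i \<and> cont j = sw t then 1 else 0)"

lemma uni_C: "t \<in> B k \<Longrightarrow> uni s nu t \<in> C (star s nu) k"
  unfolding C_def
proof (intro CollectI conjI allI impI)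
  fix u show "linv r (uni s nu t u)"
  proof (rule linvI)
    fix p and i :: "lab list" and j :: "nat list" assume p: "p permutes {..<r}" and l: "length i = r" "length j = r"
    have "permute_list p j = map (colof id) (permute_list p i) \<longleftrightarrow> j = map (colof id) i"
    proof
      assume a: "permute_list p j = map (colof id) (permute_list p i)"
      have "map (colof id) (permute_list p i) = permute_list p (map (colof id) i)"
        using permute_list_map[of p i "colof id"] p l by simp
      then have "permute_list (inv p) (permute_list p j) = permute_list (inv p) (permute_list p (map (colof id) i))"
        using a by simp
      then show "j = map (colof id) i" using l by (simp add: permute_list_inv[OF p])
    qed (use permute_list_map[of p i "colof id"] p l in simp)
    then show "uni s nu t u (permute_list p i) (permute_list p j) = uni s nu t u i j"
      using region_perm[OF region_star p l] p l by (simp add: uni_def)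
  qed
qed (auto simp: uni_def split: if_splits)

lemma sum_uni:
  assumes F: "F \<in> C (star s nu) k" and o: "star s nu i j"
  shows "(\<Sum>t\<in>B k. \<Sum>x\<in>W. F t i x * uni s nu t u (hat i x) j) = F u i j"
proof -
  have j: "length j = r" "j \<in> W" using star_len[OF o] by blast+
  have e: "F t i x * uni s nu t u (hat i x) j = (if t = u then if x = j then F u i j else 0 else 0)" for t x
  proof (cases "F t i x = 0")
    case False
    then have a: "star s nu i x" "cont x = sw t" using C_supp[OF F] by blast+
    show ?thesis using star_hat[OF a(1) j(1)] col_hat[OF a(1)] a o by (auto simp: uni_def)
  qed auto
  have "(\<Sum>t\<in>B k. \<Sum>x\<in>W. F t i x * uni s nu t u (hat i x) j) = (\<Sum>t\<in>B k. if t = u then F u i j else 0)"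
    unfolding e by (rule sum.cong) (use j in auto)
  also have "\<dots> = F u i j" using C_supp[OF F, of u i j] by (cases "F u i j = 0") auto
  finally show ?thesis .
qed

text \<open>The composite of \<open>D\<close> with \<open>hh k V\<close> is left-linear, so it is
  determined by its values on universal elements.\<close>

lemma sum_corr:
  assumes F: "F \<in> C (star s nu) (Suc k)" and o: "star s nu i j"
  shows "(\<Sum>t\<in>B (Suc k). \<Sum>x\<in>W. F t i x * hh k V (D (star s nu) k (uni s nu t)) u (hat i x) j)
     = hh k V (D (star s nu) k F) u i j"
proof -
  let ?S = "star s nu"
  have l: "length i = r" using star_len[OF o] by blast
  have "F t i x * hh k V (D ?S k (uni s nu t)) u (hat i x) j
      = (\<Sum>t2\<in>B k. \<Sum>y\<in>W. F t i x * ((if ?S i y then de t t2 x y else 0) * V t2 u (hat i y) j))"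
    if t: "t \<in> B (Suc k)" and x: "x \<in> W" for t x
  proof (cases "F t i x = 0")
    case False
    then have a: "?S i x" "cont x = sw t" using C_supp[OF F] by blast+
    have lx: "length x = r" using x by (rule Inr_length)
    have "D ?S k (uni s nu t) t2 (hat i x) y = (if ?S i y then de t t2 x y else 0)" if t2: "t2 \<in> B k" and y: "y \<in> W" for t2 y
    proof (cases "?S i y")
      case True
      have sy: "?S (hat i x) y" using star_hat[OF a(1)] Inr_length[OF y] True by blast
      have e: "uni s nu t t' (hat i x) z * de t' t2 z y = (if t' = t then if z = x then de t t2 x y else 0 else 0)"
        if z: "z \<in> W" for t' z
        using star_hat[OF a(1), of x] lx a col_hat[OF a(1)] by (auto simp: uni_def)
      have "(\<Sum>t'\<in>B (Suc k). \<Sum>z\<in>W. uni s nu t t' (hat i x) z * de t' t2 z y)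
         = (\<Sum>t'\<in>B (Suc k). \<Sum>z\<in>W. if t' = t then if z = x then de t t2 x y else 0 else 0)"
        by (intro sum.cong refl e)
      also have "\<dots> = (\<Sum>t'\<in>B (Suc k). if t' = t then de t t2 x y else 0)"
        by (rule sum.cong) (use x in auto)
      also have "\<dots> = de t t2 x y" using t by simp
      finally show ?thesis using True sy t2 by (simp add: D_def)
    next
      case False
      then have "\<not> ?S (hat i x) y" using star_hat[OF a(1)] Inr_length[OF y] by blast
      then show ?thesis using False by (simp add: D_def)
    qed
    moreover have "hat (hat i x) y = hat i y" if "y \<in> W" for y using hat_hat l lx Inr_length[OF that] by blast
    ultimately show ?thesis by (simp add: hh_def sum_distrib_left)
  qed simp
  then have "(\<Sum>t\<in>B (Suc k). \<Sum>x\<in>W. F t i x * hh k V (D ?S k (uni s nu t)) u (hat i x) j)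
    = (\<Sum>t\<in>B (Suc k). \<Sum>x\<in>W. \<Sum>t2\<in>B k. \<Sum>y\<in>W. F t i x * ((if ?S i y then de t t2 x y else 0) * V t2 u (hat i y) j))"
    by (intro sum.cong refl)
  also have "\<dots> = (\<Sum>t\<in>B (Suc k). \<Sum>t2\<in>B k. \<Sum>x\<in>W. \<Sum>y\<in>W. F t i x * ((if ?S i y then de t t2 x y else 0) * V t2 u (hat i y) j))"
    by (intro sum.cong refl sum.swap)
  also have "\<dots> = (\<Sum>t2\<in>B k. \<Sum>t\<in>B (Suc k). \<Sum>x\<in>W. \<Sum>y\<in>W. F t i x * ((if ?S i y then de t t2 x y else 0) * V t2 u (hat i y) j))"
    by (rule sum.swap)
  also have "\<dots> = (\<Sum>t2\<in>B k. \<Sum>t\<in>B (Suc k). \<Sum>y\<in>W. \<Sum>x\<in>W. F t i x * ((if ?S i y then de t t2 x y else 0) * V t2 u (hat i y) j))"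
    by (intro sum.cong refl sum.swap)
  also have "\<dots> = (\<Sum>t2\<in>B k. \<Sum>y\<in>W. \<Sum>t\<in>B (Suc k). \<Sum>x\<in>W. F t i x * ((if ?S i y then de t t2 x y else 0) * V t2 u (hat i y) j))"
    by (intro sum.cong refl sum.swap)
  also have "\<dots> = hh k V (D ?S k F) u i j"
    unfolding hh_def
  proof (intro sum.cong refl)
    fix t2 y assume "t2 \<in> B k" "y \<in> W"
    then show "(\<Sum>t\<in>B (Suc k). \<Sum>x\<in>W. F t i x * ((if ?S i y then de t t2 x y else 0) * V t2 u (hat i y) j))
      = D ?S k F t2 i y * V t2 u (hat i y) j"
      by (cases "?S i y") (simp_all add: D_def sum_distrib_right mult.assoc)
  qed
  finally show ?thesis .
qed

text \<open>A bounded below exact complex of projective left modules splits. Hence it suffices to test exactness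
  on those row contents whose projective modules occur in the complex.\<close>
lemma ex_by_splitting:
  assumes good: "\<And>k t nu'. t \<in> B k \<Longrightarrow> (\<And>c. Tw nu' c = Tw nu c) \<Longrightarrow> (\<And>c. Rw c \<in># nu' \<Longrightarrow> s \<le> c \<and> c \<le> n) \<Longrightarrow>
      cl id nu' = sw t \<Longrightarrow> Ac (\<lambda>_. s) nu'"
  shows "Ac (\<lambda>_. s) nu"
proof -
  let ?S = "star s nu"
  have Ome_star: "Ome n r (\<lambda>_. s) nu' = (\<lambda>i j. ?S i j \<and> mset i = nu')" if "\<And>c. Tw nu' c = Tw nu c" for nu'
    using that by (auto simp: fun_eq_iff Ome_def star_def)
  \<comment> \<open>The left words in the support of \<open>Z\<close> all have the content of one
    word \<open>i0\<close>, which spells out the weight \<open>sw t\<close>; exactness for that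
    single content is what \<open>good\<close> provides.\<close>
  have lift: "\<exists>V\<in>C ?S (Suc k). D ?S k V = Z"
    if t: "t \<in> B k" and Z: "cyc ?S k Z" and sup: "\<And>u i j. Z u i j \<noteq> 0 \<Longrightarrow> ?S i (map (colof id) i) \<and> cont (map (colof id) i) = sw t"
    for k t Z
  proof (cases "\<exists>i. ?S i (map (colof id) i) \<and> cont (map (colof id) i) = sw t")
    case False
    then have "Z u i j = 0" for u i j using sup[of u i j] by blast
    then have "Z = 0" by (intro ext) simp
    then show ?thesis by (intro bexI[of _ 0]) auto
  next
    case True
    then obtain i0 where i0: "?S i0 (map (colof id) i0)" "cont (map (colof id) i0) = sw t" by blast
    let ?nu = "mset i0"
    have Tw: "Tw ?nu c = Tw nu c" for c using i0 by (auto simp: star_def)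
    let ?O = "\<lambda>i j. ?S i j \<and> mset i = ?nu"
    interpret a: region_split n r lam B sw de ?S ?O "\<lambda>i j. ?S i j \<and> mset i \<noteq> ?nu"
      by (rule content_split(2)[OF region_star])
    have "Ac (\<lambda>_. s) ?nu"
    proof (rule good[OF t Tw])
      fix c assume "Rw c \<in># ?nu"
      then have "Rw c \<in> set i0" by simp
      then obtain q where q: "q < r" "i0 ! q = Rw c" using star_len[OF i0(1)] by (auto simp: in_set_conv_nth)
      have "al (\<lambda>_. s) (i0 ! q) (map (colof id) i0 ! q)" using i0(1) q by (auto simp: star_def list_all2_conv_all_nth)
      moreover have "map (colof id) i0 ! q \<in> {1..n}"
        using star_len[OF i0(1)] q nth_mem[of q "map (colof id) i0"] by (auto simp: Inr_def subset_iff)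
      ultimately show "s \<le> c \<and> c \<le> n" using q star_len[OF i0(1)] by simp
    next
      show "cl id ?nu = sw t" using i0(2) by (simp add: cl_def)
    qed
    then have e: "ex ?O k" unfolding Ac_def Ome_star[OF Tw] by blast
    have ZC: "Z \<in> C ?S k" using Z by (simp add: cyc_def)
    have ZO: "Z \<in> C ?O k"
    proof -
      have "mset i = ?nu" if "Z u i j \<noteq> 0" for u i j
        by (rule star_content[OF _ i0(1) refl refl]) (use sup[OF that] i0(2) in auto)
      then show ?thesis using ZC unfolding C_def by blast
    qed
    have "cyc ?O k Z" using Z ZO a.sub_D by (cases k) (auto simp: cyc_def)
    then obtain V where V: "V \<in> C ?O (Suc k)" "D ?O k V = Z" using e unfolding ex_def by blast
    then show ?thesis using a.sub_C[OF V(1)] a.sub_D[OF V(1)] by (intro bexI[of _ V]) auto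
  qed
  have hh_supp: "\<exists>t x. G t i x \<noteq> 0" if nz: "hh k V G u i j \<noteq> 0" for k V G u i j
  proof (rule ccontr)
    assume "\<not> ?thesis" then have "hh k V G u i j = 0" by (simp add: hh_def)
    then show False using nz by simp
  qed
  have uni_supp: "?S i (map (colof id) i) \<and> cont (map (colof id) i) = sw t" if "uni s nu t u i j \<noteq> 0" for t u i j
    using that by (auto simp: uni_def split: if_splits)
  \<comment> \<open>A contracting homotopy on cycles, built degree by degree by prescribing its
    values on universal elements.\<close>
  have E: "\<exists>V. (\<forall>t\<in>B k. V t \<in> C ?S (Suc k)) \<and> (\<forall>F. cyc ?S k F \<longrightarrow> D ?S k (hh k V F) = F)" for k
  proof (induction k)
    case 0
    have "\<exists>V\<in>C ?S (Suc 0). D ?S 0 V = uni s nu t" if t: "t \<in> B 0" for t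
      by (rule lift[OF t]) (use uni_C[OF t] uni_supp in \<open>auto simp: cyc_def\<close>)
    then obtain V where V: "\<And>t. t \<in> B 0 \<Longrightarrow> V t \<in> C ?S (Suc 0) \<and> D ?S 0 (V t) = uni s nu t" by metis
    have "D ?S 0 (hh 0 V F) = F" if "cyc ?S 0 F" for F
    proof (intro ext)
      fix u i j
      have F: "F \<in> C ?S 0" using that by (simp add: cyc_def)
      show "D ?S 0 (hh 0 V F) u i j = F u i j"
      proof (cases "u \<in> B 0 \<and> ?S i j")
        case True
        then show ?thesis using D_hh[OF F] sum_uni[OF F] V by simp
      next
        case False
        then show ?thesis using C_supp[OF F, of u i j] by (auto simp: D_def)
      qed
    qed
    then show ?case using V by blast
  next
    case (Suc k)
    then obtain Vp where Vp: "\<And>t. t \<in> B k \<Longrightarrow> Vp t \<in> C ?S (Suc k)" and cV: "\<And>F. cyc ?S k F \<Longrightarrow> D ?S k (hh k Vp F) = F"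
      by blast
    \<comment> \<open>The defect of the previous homotopy at a universal element. It is a cycle
      because the previous homotopy contracts the cycle \<open>D (uni t)\<close>, and a preimage of
      it extends the homotopy by one degree.\<close>
    define Z where "Z t = uni s nu t - hh k Vp (D ?S k (uni s nu t))" for t
    have "\<exists>V\<in>C ?S (Suc (Suc k)). D ?S (Suc k) V = Z t" if t: "t \<in> B (Suc k)" for t
    proof (rule lift[OF t])
      have DU: "D ?S k (uni s nu t) \<in> C ?S k" by (rule D_C[OF region_star uni_C[OF t]])
      have "cyc ?S k (D ?S k (uni s nu t))"
        using DU D_D[OF region_star] uni_C[OF t] by (cases k) (auto simp: cyc_def)
      then have "D ?S k (Z t) = 0" by (simp add: Z_def D_diff cV)
      moreover have "Z t \<in> C ?S (Suc k)" unfolding Z_def by (rule C_diff[OF uni_C[OF t] hh_C[OF DU Vp]])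
      ultimately show "cyc ?S (Suc k) (Z t)" by (simp add: cyc_def)
    next
      fix u i j assume "Z t u i j \<noteq> 0"
      then have "uni s nu t u i j \<noteq> 0 \<or> hh k Vp (D ?S k (uni s nu t)) u i j \<noteq> 0" by (auto simp: Z_def)
      \<comment> \<open>\<open>D\<close> and \<open>hh\<close> leave the left word alone, so the
        correction term lives on the same left words as the universal element itself.\<close>
      then have "\<exists>u' j'. uni s nu t u' i j' \<noteq> 0"
      proof
        assume "hh k Vp (D ?S k (uni s nu t)) u i j \<noteq> 0"
        then obtain t' x where "D ?S k (uni s nu t) t' i x \<noteq> 0" using hh_supp by blast
        then show ?thesis by (rule_tac ccontr) (auto simp: D_def split: if_splits)
      qed blast
      then show "?S i (map (colof id) i) \<and> cont (map (colof id) i) = sw t" using uni_supp by blast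
    qed
    then obtain V where V: "\<And>t. t \<in> B (Suc k) \<Longrightarrow> V t \<in> C ?S (Suc (Suc k)) \<and> D ?S (Suc k) (V t) = Z t" by metis
    have "D ?S (Suc k) (hh (Suc k) V F) = F" if c: "cyc ?S (Suc k) F" for F
    proof (intro ext)
      fix u i j
      have F: "F \<in> C ?S (Suc k)" and z: "D ?S k F = 0" using c by (auto simp: cyc_def)
      show "D ?S (Suc k) (hh (Suc k) V F) u i j = F u i j"
      proof (cases "u \<in> B (Suc k) \<and> ?S i j")
        case True
        then have "D ?S (Suc k) (hh (Suc k) V F) u i j = (\<Sum>t\<in>B (Suc k). \<Sum>x\<in>W. F t i x * Z t u (hat i x) j)"
          using D_hh[OF F] V by simp
        also have "\<dots> = (\<Sum>t\<in>B (Suc k). \<Sum>x\<in>W. F t i x * uni s nu t u (hat i x) j)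
          - (\<Sum>t\<in>B (Suc k). \<Sum>x\<in>W. F t i x * hh k Vp (D ?S k (uni s nu t)) u (hat i x) j)"
          by (simp add: Z_def right_diff_distrib sum_subtractf)
        also have "\<dots> = F u i j"
          using sum_uni[OF F] sum_corr[OF F] True z by (simp add: hh_def)
        finally show ?thesis .
      next
        case False
        then show ?thesis using C_supp[OF F, of u i j] by (auto simp: D_def)
      qed
    qed
    then show ?case using V by blast
  qed
  have "ex ?S k" for k
    unfolding ex_def
  proof (intro allI impI)
    fix F assume c: "cyc ?S k F"
    obtain V where V: "\<And>t. t \<in> B k \<Longrightarrow> V t \<in> C ?S (Suc k)" "D ?S k (hh k V F) = F" using E[of k] c by blast
    have "F \<in> C ?S k" using c by (simp add: cyc_def)
    then show "\<exists>G\<in>C ?S (Suc k). D ?S k G = F" using V hh_C by blast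
  qed
  then show ?thesis unfolding Ac_def Ome_star[OF refl] using ex_content[OF region_star] by blast
qed

end

section \<open>Long rows and singular weights\<close>

context acyclic_base
begin

text \<open>Columns below \<open>s\<close> are finished: no row starts there and the twists already
  equal \<open>lam\<close>. Column \<open>s\<close> is under treatment, so its twist is left
  free.\<close>

definition VV :: "nat \<Rightarrow> (nat \<Rightarrow> nat) \<Rightarrow> lab multiset \<Rightarrow> bool" where
  "VV s cc nu \<longleftrightarrow> (\<forall>l. Rw l \<in># nu \<longrightarrow> s \<le> cc l) \<and> (\<forall>c<s. Tw nu c = lam c) \<and> (\<forall>c>s. Tw nu c \<le> lam c)"

lemma VV_D:
  assumes "VV s cc nu"
  shows "Rw l \<in># nu \<Longrightarrow> s \<le> cc l" "c < s \<Longrightarrow> Tw nu c = lam c" "c > s \<Longrightarrow> Tw nu c \<le> lam c"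
  using assms by (auto simp: VV_def)

lemma VV_mismatch:
  assumes V: "VV s cc nu" and s: "1 \<le> s" "s \<le> n" and R: "card (rows cc nu s) \<le> 1" and T: "Tw nu s \<le> lam s"
    and m: "cl cc nu s \<noteq> lam s"
  shows "Ac cc nu"
proof (rule mismatch[OF _ s(2)])
  show "PN s cc nu"
    unfolding PN_def
  proof (intro conjI)
    show "\<forall>l. Rw l \<in># nu \<longrightarrow> 1 \<le> cc l" using VV_D(1)[OF V] s by fastforce
    show "\<forall>c\<in>{1..s}. card (rows cc nu c) \<le> 1"
    proof
      fix c assume c: "c \<in> {1..s}"
      show "card (rows cc nu c) \<le> 1"
      proof (cases "c = s")
        case False
        then have "rows cc nu c = {}" using VV_D(1)[OF V] c by (fastforce simp: rows_def)
        then show ?thesis by simp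
      qed (use R in simp)
    qed
    show "\<forall>c\<le>s. Tw nu c \<le> lam c" using V T by (auto simp: VV_def le_less)
    show "\<forall>c>s. Tw nu c \<le> Suc (lam c)" using V by (auto simp: VV_def intro: le_SucI)
    show "\<exists>c\<in>{1..s}. cl cc nu c \<noteq> lam c" using m s by auto
  qed
qed

text \<open>Refines \<open>column_induct\<close>: with at most one row left in column
  \<open>s\<close>, every count other than \<open>lam s\<close> is a mismatch, so the only case left
  to the caller is an empty column with full twist \<open>lam s\<close>.\<close>

lemma column_close:
  assumes s: "1 \<le> s" "s \<le> n"
    and h1: "\<And>cc nu l. Q cc nu \<Longrightarrow> Rw l \<in># nu \<Longrightarrow> cc l = s \<Longrightarrow> Q (cc(l := Suc s)) nu"
    and h2: "\<And>cc m l. Q cc (add_mset (Rw l) m) \<Longrightarrow> cc l = s \<Longrightarrow> Q cc (add_mset (Fr s) m)"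
    and h3: "\<And>cc m l. Q cc (add_mset (Fr s) m) \<Longrightarrow> cc l = s \<Longrightarrow> Q cc (add_mset (Rw l) m)"
    and h4: "\<And>cc nu l. Q cc nu \<Longrightarrow> Rw l \<notin># nu \<Longrightarrow> Q (cc(l := s)) nu"
    and QV: "\<And>cc nu. Q cc nu \<Longrightarrow> VV s cc nu"
    and fin: "\<And>cc nu. Q cc nu \<Longrightarrow> rows cc nu s = {} \<Longrightarrow> Tw nu s = lam s \<Longrightarrow> Ac cc nu"
    and Q: "Q cc nu" and T: "Tw nu s \<le> Suc (lam s)"
  shows "Ac cc nu"
proof -
  have tm: "\<forall>cc nu. lam s = Tw nu s + d \<longrightarrow> Q cc nu \<longrightarrow> card (rows cc nu s) \<le> 1 \<longrightarrow> Ac cc nu" for d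
  proof (induction d)
    case 0
    show ?case
    proof (intro allI impI)
      fix cc nu assume e: "lam s = Tw nu s + 0" and q: "Q cc nu" and R: "card (rows cc nu s) \<le> 1"
      show "Ac cc nu"
      proof (cases "rows cc nu s = {}")
        case False
        then have "(\<Sum>l\<in>rows cc nu s. count nu (Rw l)) > 0"
          by (intro sum_pos finite_rows) (auto simp: rows_def)
        then have "cl cc nu s \<noteq> lam s" using e unfolding cl_eq by linarith
        then show ?thesis using VV_mismatch[OF QV[OF q] s R] e by simp
      qed (use fin[OF q] e in simp)
    qed
  next
    case (Suc d)
    show ?case
    proof (intro allI impI)
      fix cc nu assume e: "lam s = Tw nu s + Suc d" and q: "Q cc nu" and R: "card (rows cc nu s) \<le> 1"
      show "Ac cc nu"
      proof (cases "cl cc nu s = lam s")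
        case True
        \<comment> \<open>The single row has exactly \<open>Suc d\<close> letters. Raising it leaves
          column \<open>s\<close> short, a mismatch; turning one letter into a twist lowers the
          deficit to \<open>d\<close>.\<close>
        then have "rows cc nu s \<noteq> {}" using e by (auto simp: cl_eq)
        then obtain l where l: "rows cc nu s = {l}" "Rw l \<in># nu" "cc l = s" using rows_single[OF R] by metis
        obtain m where m: "nu = add_mset (Rw l) m" using multi_member_split[OF l(2)] by blast
        have q1: "Q (cc(l := Suc s)) nu" by (rule h1[OF q l(2,3)])
        have r1: "rows (cc(l := Suc s)) nu s = {}" using l by (simp add: rows_raise)
        have "Ac (cc(l := Suc s)) nu"
          by (rule VV_mismatch[OF QV[OF q1] s]) (use r1 e in \<open>auto simp: cl_eq\<close>)
        moreover have "Ac cc (add_mset (Fr s) m)"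
        proof -
          have q2: "Q cc (add_mset (Fr s) m)" by (rule h2[OF q[unfolded m] l(3)])
          have "rows cc (add_mset (Fr s) m) s \<subseteq> {l}" using l(1) by (auto simp: rows_def m)
          then have "card (rows cc (add_mset (Fr s) m) s) \<le> 1" by (metis card_mono finite.emptyI finite_insert is_singletonI is_singleton_altdef)
          then show ?thesis using Suc.IH q2 e by (simp add: m)
        qed
        ultimately show ?thesis using Ac_peel[of cc l m] l by (simp add: m)
      qed (use VV_mismatch[OF QV[OF q] s R] e in simp)
    qed
  qed
  show ?thesis
  proof (rule column_induct[of Q s, OF h1 h2 h3 h4 _ Q T])
    fix cc nu assume "Q cc nu" "card (rows cc nu s) \<le> 1" "Tw nu s \<le> lam s"
    then show "Ac cc nu" using tm[of "lam s - Tw nu s"] by simp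
  qed
qed

abbreviation mu :: "lab multiset \<Rightarrow> nat \<Rightarrow> nat" where
  "mu nu c \<equiv> lam c - Tw nu c"

definition DD :: "nat \<Rightarrow> lab multiset \<Rightarrow> bool" where
  "DD s nu \<longleftrightarrow> (\<forall>c>s. mu nu (Suc c) \<le> mu nu c)"

text \<open>\<open>Hc\<close> and \<open>Zc\<close> express that a row too long for the weight
  remaining in its column forces acyclicity, for a row starting in column \<open>Suc s\<close> or in
  column \<open>s\<close>. They are proved alternately from the last column down. The bound by
  \<open>mu nu (Suc s)\<close> in \<open>Zc\<close> makes a row satisfy \<open>Hc\<close> once it
  has gained a letter and has been raised.\<close>

definition Hc :: "nat \<Rightarrow> bool" where
  "Hc s \<longleftrightarrow> (\<forall>cc nu l. VV s cc nu \<longrightarrow> DD s nu \<longrightarrow> Tw nu s \<le> Suc (lam s) \<longrightarrow> cc l = Suc s \<longrightarrow>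
     mu nu (Suc s) < count nu (Rw l) \<longrightarrow> Ac cc nu)"

definition Zc :: "nat \<Rightarrow> bool" where
  "Zc s \<longleftrightarrow> (\<forall>cc nu l. VV s cc nu \<longrightarrow> DD s nu \<longrightarrow> Tw nu s \<le> Suc (lam s) \<longrightarrow> cc l = s \<longrightarrow>
     mu nu (Suc s) \<le> count nu (Rw l) \<longrightarrow> lam s < count nu (Rw l) + Tw nu s \<longrightarrow> Ac cc nu)"

lemma Hc_last: "Hc n"
  unfolding Hc_def
proof (intro allI impI)
  fix cc nu l assume "cc l = Suc n" "mu nu (Suc n) < count nu (Rw l)"
  then show "Ac cc nu" by (intro Ac_row_out[of l]) (auto intro: count_inI)
qed

text \<open>The moves of \<open>column_close\<close> never touch the long row \<open>l0\<close>,
  which starts one column further. When column \<open>s\<close> is finished, \<open>DD\<close>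
  bounds \<open>mu\<close> at \<open>Suc (Suc s)\<close> by \<open>mu\<close> at
  \<open>Suc s\<close>, and \<open>l0\<close> becomes the long row of
  \<open>Zc (Suc s)\<close>.\<close>

lemma Hc_step:
  assumes s: "1 \<le> s" "s < n" and Z: "Zc (Suc s)"
  shows "Hc s"
  unfolding Hc_def
proof (intro allI impI)
  fix cc nu l0
  assume V: "VV s cc nu" and d: "DD s nu" and T: "Tw nu s \<le> Suc (lam s)" and c: "cc l0 = Suc s"
    and m: "mu nu (Suc s) < count nu (Rw l0)"
  define Q where "Q = (\<lambda>cc nu. VV s cc nu \<and> DD s nu \<and> cc l0 = Suc s \<and> mu nu (Suc s) < count nu (Rw l0))"
  show "Ac cc nu"
  proof (rule column_close[of s Q, OF s(1) less_imp_le[OF s(2)]])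
    show "Q cc nu" using V d c m by (simp add: Q_def)
    show "Tw nu s \<le> Suc (lam s)" by fact
  next
    fix cc nu assume "Q cc nu" then show "VV s cc nu" by (simp add: Q_def)
  next
    fix cc nu assume q: "Q cc nu" and R: "rows cc nu s = {}" and T: "Tw nu s = lam s"
    have "VV (Suc s) cc nu"
      using q R T unfolding Q_def VV_def rows_def by (auto simp: less_Suc_eq) (metis Suc_leI le_neq_implies_less)
    moreover have "DD (Suc s) nu" using q by (auto simp: Q_def DD_def)
    moreover have "mu nu (Suc (Suc s)) \<le> mu nu (Suc s)" using q by (auto simp: Q_def DD_def)
    moreover have "Tw nu (Suc s) \<le> lam (Suc s)" using q by (auto simp: Q_def VV_def)
    moreover have "lam (Suc s) < count nu (Rw l0) + Tw nu (Suc s)" using q unfolding Q_def by linarith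
    ultimately show "Ac cc nu" using Z[unfolded Zc_def, rule_format, of cc nu l0] q unfolding Q_def by simp
  next
    fix cc nu l assume "Q cc nu" "Rw l \<in># nu" "cc l = s"
    then show "Q (cc(l := Suc s)) nu" by (auto simp: Q_def VV_def)
  next
    fix cc m l assume "Q cc (add_mset (Rw l) m)" "cc l = s"
    then show "Q cc (add_mset (Fr s) m)" by (auto simp: Q_def VV_def DD_def split: if_splits)
  next
    fix cc m l assume "Q cc (add_mset (Fr s) m)" "cc l = s"
    then show "Q cc (add_mset (Rw l) m)" by (auto simp: Q_def VV_def DD_def split: if_splits)
  next
    fix cc nu l assume "Q cc nu" "Rw l \<notin># nu"
    then show "Q (cc(l := s)) nu" by (auto simp: Q_def VV_def not_in_iff)
  qed
qed

text \<open>The long row \<open>l1\<close> is kept while the other rows of column \<open>s\<close>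
  are peeled away; a surplus twist returns to \<open>l1\<close> and only lengthens it. Once
  \<open>l1\<close> is alone, its length together with the twists exceeds \<open>lam s\<close>, a
  mismatch.\<close>

lemma Zc_step:
  assumes s: "1 \<le> s" "s \<le> n" and H: "Hc s"
  shows "Zc s"
proof -
  have main: "\<forall>cc nu. VV s cc nu \<longrightarrow> DD s nu \<longrightarrow> Tw nu s \<le> Suc (lam s) \<longrightarrow> cc l1 = s \<longrightarrow>
     mu nu (Suc s) \<le> count nu (Rw l1) \<longrightarrow> lam s < count nu (Rw l1) + Tw nu s \<longrightarrow>
     (\<Sum>l\<in>rows cc nu s - {l1}. count nu (Rw l)) = S \<longrightarrow> Ac cc nu" for l1 S
  proof (induction S rule: less_induct)
    case (less S)
    have p0: "Ac cc nu" if V: "VV s cc nu" and d: "DD s nu" and T: "Tw nu s \<le> lam s" and c: "cc l1 = s"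
      and m1: "mu nu (Suc s) \<le> count nu (Rw l1)" and m2: "lam s < count nu (Rw l1) + Tw nu s"
      and S: "(\<Sum>l\<in>rows cc nu s - {l1}. count nu (Rw l)) = S" for cc nu
    proof (cases "rows cc nu s - {l1} = {}")
      case True
      have "Rw l1 \<in># nu" using m2 T by (intro count_inI) auto
      then have R: "rows cc nu s = {l1}" using True c by (auto simp: rows_def)
      then show ?thesis using VV_mismatch[OF V s _ T] m2 by (simp add: cl_eq)
    next
      case False
      then obtain l where l: "l \<in> rows cc nu s" "l \<noteq> l1" by blast
      then have ln: "Rw l \<in># nu" and cl: "cc l = s" by (auto simp: rows_def)
      obtain m where m: "nu = add_mset (Rw l) m" using multi_member_split[OF ln] by blast
      have "(\<Sum>l\<in>rows (cc(l := Suc s)) nu s - {l1}. count nu (Rw l)) < S"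
      proof -
        have "S = count nu (Rw l) + (\<Sum>l\<in>rows cc nu s - {l1} - {l}. count nu (Rw l))"
          unfolding S[symmetric] by (rule sum.remove) (use l in auto)
        moreover have "rows (cc(l := Suc s)) nu s - {l1} = rows cc nu s - {l1} - {l}" by (auto simp: rows_raise)
        moreover have "count nu (Rw l) > 0" using ln by simp
        ultimately show ?thesis by simp
      qed
      moreover have "VV s (cc(l := Suc s)) nu" using V cl by (auto simp: VV_def)
      ultimately have a1: "Ac (cc(l := Suc s)) nu"
        using less.IH[OF _, rule_format, of _ "cc(l := Suc s)" nu] d T c m1 m2 l by auto
      have "(\<Sum>l\<in>rows cc (add_mset (Fr s) m) s - {l1}. count (add_mset (Fr s) m) (Rw l)) < S"
      proof -
        have "(\<Sum>l\<in>rows cc (add_mset (Fr s) m) s - {l1}. count (add_mset (Fr s) m) (Rw l))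
          \<le> (\<Sum>l\<in>rows cc nu s - {l1}. count (add_mset (Fr s) m) (Rw l))"
          by (rule sum_mono2[OF finite_Diff[OF finite_rows]]) (auto simp: m rows_def)
        also have "\<dots> < S" unfolding S[symmetric]
        proof (rule sum_strict_mono_ex1)
          show "\<exists>x\<in>rows cc nu s - {l1}. count (add_mset (Fr s) m) (Rw x) < count nu (Rw x)"
            using l by (intro bexI[of _ l]) (auto simp: m)
        qed (auto simp: m)
        finally show ?thesis .
      qed
      moreover have "VV s cc (add_mset (Fr s) m)" using V by (auto simp: VV_def m split: if_splits)
      moreover have "DD s (add_mset (Fr s) m)" using d by (auto simp: DD_def m)
      ultimately have "Ac cc (add_mset (Fr s) m)"
        using less.IH[OF _, rule_format, of _ cc "add_mset (Fr s) m"] T c m1 m2 l by (auto simp: m)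
      then show ?thesis using Ac_peel[of cc l m] a1 cl by (simp add: m)
    qed
    show ?case
    proof (intro allI impI)
      fix cc nu assume V: "VV s cc nu" and d: "DD s nu" and T: "Tw nu s \<le> Suc (lam s)" and c: "cc l1 = s"
        and m1: "mu nu (Suc s) \<le> count nu (Rw l1)" and m2: "lam s < count nu (Rw l1) + Tw nu s"
        and S: "(\<Sum>l\<in>rows cc nu s - {l1}. count nu (Rw l)) = S"
      show "Ac cc nu"
      proof (cases "Tw nu s \<le> lam s")
        case True
        then show ?thesis using p0 V d c m1 m2 S by blast
      next
        case False
        then have T: "Tw nu s = Suc (lam s)" using T by simp
        then obtain m where m: "nu = add_mset (Fr s) m" by (metis count_inI multi_member_split nat.distinct(1))
        let ?n = "add_mset (Rw l1) m"
        have V': "VV s cc ?n" using V c by (auto simp: VV_def m split: if_splits)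
        have d': "DD s ?n" using d by (auto simp: DD_def m)
        have "rows cc ?n s - {l1} = rows cc nu s - {l1}" by (auto simp: rows_def m)
        moreover have "(\<Sum>l\<in>rows cc nu s - {l1}. count ?n (Rw l)) = S"
          unfolding S[symmetric] by (rule sum.cong) (auto simp: m)
        ultimately have a1: "Ac cc ?n" using p0[OF V' d' _ c] T m1 by (simp add: m)
        \<comment> \<open>Thanks to the returned letter, the raised row has more than
          \<open>mu nu (Suc s)\<close> letters, as \<open>Hc\<close> requires.\<close>
        have "VV s (cc(l1 := Suc s)) ?n" using V' c by (auto simp: VV_def)
        then have "Ac (cc(l1 := Suc s)) ?n" using H[unfolded Hc_def, rule_format, of "cc(l1 := Suc s)" ?n l1] d' T m1
          by (simp add: m)
        then show ?thesis using Ac_boost[of cc l1 m] a1 c by (simp add: m)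
      qed
    qed
  qed
  then show ?thesis unfolding Zc_def by blast
qed

lemma Zc_all: "1 \<le> s \<Longrightarrow> s \<le> n \<Longrightarrow> Zc s"
proof (rotate_tac 1, induction rule: inc_induct)
  case base
  then show ?case using Zc_step Hc_last by simp
next
  case (step s)
  then show ?case using Zc_step Hc_step by simp
qed

text \<open>The equation on \<open>mu\<close> says that the simple reflection exchanging columns
  \<open>s\<close> and \<open>Suc s\<close> fixes it under the dot action, the case in which Bott's
  theorem predicts vanishing in all degrees. By \<open>ex_by_splitting\<close> only contents
  spelling out a weight of the complex need testing. Dominance gives their rows \<open>s\<close> and
  \<open>Suc s\<close> together at least \<open>mu nu s + mu nu (Suc s)\<close> letters, which is
  one less than twice \<open>mu nu (Suc s)\<close>, so one of the two has at least
  \<open>mu nu (Suc s)\<close> letters and \<open>Zc\<close> applies.\<close>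

lemma Bc_diag:
  assumes s: "1 \<le> s" "s < n" and V: "VV s cc nu" and R: "\<And>l. Rw l \<in># nu \<Longrightarrow> cc l = s"
    and T: "Tw nu s \<le> lam s" and m: "Suc (mu nu s) = mu nu (Suc s)" and d: "DD s nu"
  shows "Ac cc nu"
proof -
  have "Ac (\<lambda>_. s) nu"
  proof (rule ex_by_splitting)
    fix k t nu'
    assume t: "t \<in> B k" and Tw: "\<And>c. Tw nu' c = Tw nu c" and rg: "\<And>c. Rw c \<in># nu' \<Longrightarrow> s \<le> c \<and> c \<le> n"
      and cl: "cl id nu' = sw t"
    have cle: "sw t c = Tw nu c + count nu' (Rw c)" for c
    proof -
      have "rows id nu' c = (if Rw c \<in># nu' then {c} else {})" by (auto simp: rows_def)
      then show ?thesis unfolding cl[symmetric] cl_eq Tw by (auto simp: not_in_iff)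
    qed
    have lo: "sw t c = lam c" if "c < s" for c
    proof -
      have "Rw c \<notin># nu'" using rg that by force
      then show ?thesis using cle VV_D(2)[OF V that] by (simp add: not_in_iff)
    qed
    have spl: "{1..Suc s} = {1..<s} \<union> {s, Suc s}" using s by auto
    have e: "(\<Sum>c\<in>{1..Suc s}. f c) = (\<Sum>c\<in>{1..<s}. f c) + f s + f (Suc s)" for f :: "nat \<Rightarrow> nat"
      unfolding spl by (subst sum.union_disjoint) auto
    have "(\<Sum>c\<in>{1..<s}. lam c) = (\<Sum>c\<in>{1..<s}. sw t c)" by (rule sum.cong) (auto simp: lo)
    then have "lam s + lam (Suc s) \<le> sw t s + sw t (Suc s)"
      using dominates[OF t, of "Suc s"] unfolding e by linarith
    then have "lam s + lam (Suc s) \<le> Tw nu s + Tw nu (Suc s) + count nu' (Rw s) + count nu' (Rw (Suc s))"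
      unfolding cle by linarith
    moreover have "Tw nu (Suc s) \<le> lam (Suc s)" using VV_D(3)[OF V] by simp
    ultimately have "mu nu (Suc s) \<le> count nu' (Rw s) \<or> mu nu (Suc s) \<le> count nu' (Rw (Suc s))"
      using T m by linarith
    then obtain l where l: "mu nu (Suc s) \<le> count nu' (Rw l)" by blast
    have "VV s (\<lambda>_. s) nu'" using V Tw by (auto simp: VV_def)
    moreover have "DD s nu'" using d Tw by (auto simp: DD_def)
    ultimately show "Ac (\<lambda>_. s) nu'"
      using Zc_all[OF s(1) less_imp_le[OF s(2)], unfolded Zc_def, rule_format, of "\<lambda>_. s" nu' l] l T m
      by (simp add: Tw)
  qed
  then show ?thesis using Ac_cong[of nu cc "\<lambda>_. s"] R by blast
qed

text \<open>Rows still starting in column \<open>s\<close> are driven to the right one column at a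
  time by \<open>column_close\<close>, finishing each column on the way, until all of them start in
  the singular column \<open>s'\<close>.\<close>

lemma Bc:
  assumes s: "1 \<le> s" "s \<le> s'" "s' < n" and V: "VV s cc nu" and R: "\<And>l. Rw l \<in># nu \<Longrightarrow> cc l = s \<or> cc l = s'"
    and T: "Tw nu s \<le> lam s" "Tw nu s' \<le> lam s'" and m: "Suc (mu nu s') = mu nu (Suc s')" and d: "DD s' nu"
  shows "Ac cc nu"
proof -
  have "\<forall>cc nu. 1 \<le> s \<longrightarrow> VV s cc nu \<longrightarrow> (\<forall>l. Rw l \<in># nu \<longrightarrow> cc l = s \<or> cc l = s') \<longrightarrow> Tw nu s \<le> lam s \<longrightarrow>
      Tw nu s' \<le> lam s' \<longrightarrow> Suc (mu nu s') = mu nu (Suc s') \<longrightarrow> DD s' nu \<longrightarrow> Ac cc nu"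
    using s(2)
  proof (induction rule: inc_induct)
    case base
    show ?case
    proof (intro allI impI)
      fix cc nu assume "1 \<le> s'" "VV s' cc nu" "\<forall>l. Rw l \<in># nu \<longrightarrow> cc l = s' \<or> cc l = s'" "Tw nu s' \<le> lam s'"
        "Suc (mu nu s') = mu nu (Suc s')" "DD s' nu"
      then show "Ac cc nu" by (intro Bc_diag[OF _ s(3)]) auto
    qed
  next
    case (step s)
    show ?case
    proof (intro allI impI)
      fix cc nu assume s1: "1 \<le> s" and V: "VV s cc nu" and R: "\<forall>l. Rw l \<in># nu \<longrightarrow> cc l = s \<or> cc l = s'"
        and T: "Tw nu s \<le> lam s" "Tw nu s' \<le> lam s'" and m: "Suc (mu nu s') = mu nu (Suc s')" and d: "DD s' nu"
      define Q where "Q = (\<lambda>cc nu. VV s cc nu \<and> (\<forall>l. Rw l \<in># nu \<longrightarrow> cc l = s \<or> cc l = Suc s \<or> cc l = s') \<and>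
         Suc (mu nu s') = mu nu (Suc s') \<and> DD s' nu)"
      have ss: "s < s'" "s < n" using step s by auto
      show "Ac cc nu"
      proof (rule column_close[of s Q, OF s1])
        show "s \<le> n" using ss by simp
        show "Q cc nu" using V R m d by (auto simp: Q_def)
        show "Tw nu s \<le> Suc (lam s)" using T by simp
      next
        fix cc nu assume "Q cc nu" then show "VV s cc nu" by (simp add: Q_def)
      next
        fix cc nu assume q: "Q cc nu" and R: "rows cc nu s = {}" and T: "Tw nu s = lam s"
        have V': "VV (Suc s) cc nu"
          using q R T unfolding Q_def VV_def rows_def by (auto simp: less_Suc_eq) (metis Suc_leI le_neq_implies_less)
        have R': "\<forall>l. Rw l \<in># nu \<longrightarrow> cc l = Suc s \<or> cc l = s'" using q R by (auto simp: Q_def rows_def)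
        have "Tw nu (Suc s) \<le> lam (Suc s)" "Tw nu s' \<le> lam s'" using q ss by (auto simp: Q_def VV_def)
        then show "Ac cc nu" using step.IH V' R' q unfolding Q_def by auto
      next
        fix cc nu l assume "Q cc nu" "Rw l \<in># nu" "cc l = s"
        then show "Q (cc(l := Suc s)) nu" by (auto simp: Q_def VV_def)
      next
        fix cc m l assume "Q cc (add_mset (Rw l) m)" "cc l = s"
        then show "Q cc (add_mset (Fr s) m)" using ss by (auto simp: Q_def VV_def DD_def split: if_splits)
      next
        fix cc m l assume "Q cc (add_mset (Fr s) m)" "cc l = s"
        then show "Q cc (add_mset (Rw l) m)" using ss by (auto simp: Q_def VV_def DD_def split: if_splits)
      next
        fix cc nu l assume "Q cc nu" "Rw l \<notin># nu"
        then show "Q (cc(l := s)) nu" by (auto simp: Q_def VV_def not_in_iff)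
      qed
    qed
  qed
  from this[rule_format, OF s(1) V R T m d] show ?thesis .
qed

lemma Ome_Tw: "Ome n r cc nu i j \<Longrightarrow> Tw nu c \<le> cont j c"
proof -
  assume o: "Ome n r cc nu i j"
  have "list_all2 (al cc) i j \<Longrightarrow> Tw (mset i) c \<le> cont j c"
    by (induction rule: list_all2_induct) auto
  then show ?thesis using o by (auto simp: Ome_def)
qed

lemma sum_cont: "j \<in> W \<Longrightarrow> (\<Sum>c\<in>{1..n}. cont j c) = r"
proof -
  assume j: "j \<in> W"
  have "(\<Sum>c\<in>{1..n}. cont j c) = size (mset j)"
    unfolding size_multiset_overloaded_eq using j
    by (intro sum.mono_neutral_right) (auto simp: Inr_def not_in_iff count_list_0_iff count_mset)
  then show ?thesis using j by (simp add: Inr_length)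
qed

text \<open>From column \<open>s\<close> on, the twists alone exceed \<open>lam\<close>, whereas
  dominance bounds the content of these columns by that of \<open>lam\<close>. So no admissible word
  exists.\<close>

lemma overtwisted_null:
  assumes s: "1 \<le> s" "s \<le> n" and T: "Tw nu s = Suc (lam s)" "\<And>c. c > s \<Longrightarrow> Tw nu c = lam c"
  shows "Ac cc nu"
  unfolding Ac_def
proof (intro allI ex_null notI)
  fix k t i j assume t: "t \<in> B k" and o: "Ome n r cc nu i j" and c: "cont j = sw t"
  have j: "j \<in> W" using Ome_len[OF o] by blast
  have spl: "{1..n} = {1..s - 1} \<union> {s..n}" using s by auto
  have e: "(\<Sum>c\<in>{1..n}. f c) = (\<Sum>c\<in>{1..s-1}. f c) + (\<Sum>c\<in>{s..n}. f c)" for f :: "nat \<Rightarrow> nat"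
    unfolding spl using s by (subst sum.union_disjoint) auto
  have "(\<Sum>c\<in>{s..n}. lam c) < (\<Sum>c\<in>{s..n}. Tw nu c)"
  proof (rule sum_strict_mono_ex1)
    show "\<forall>x\<in>{s..n}. lam x \<le> Tw nu x" using T by (auto simp: le_less)
    show "\<exists>x\<in>{s..n}. lam x < Tw nu x" using T s by (intro bexI[of _ s]) auto
  qed simp
  also have "\<dots> \<le> (\<Sum>c\<in>{s..n}. cont j c)" by (intro sum_mono Ome_Tw[OF o])
  finally have "(\<Sum>c\<in>{1..n}. lam c) < (\<Sum>c\<in>{1..n}. cont j c)"
    using dominates[OF t, of "s - 1"] unfolding e c by linarith
  then show False using sum_cont[OF j] lam_comp by (simp add: Comps_def)
qed

text \<open>Without rows the twists spell out the right word. Its content is at most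
  \<open>lam\<close> with the same total, hence equal to \<open>lam\<close>, and that weight does
  not occur in positive degrees.\<close>

lemma frozen_exact:
  assumes F: "\<And>l. Rw l \<notin># nu" and T: "\<And>c. Tw nu c \<le> lam c"
  shows "exo cc nu (Suc k)"
proof (rule ex_null, rule notI)
  fix t i j assume t: "t \<in> B (Suc k)" and o: "Ome n r cc nu i j" and c: "cont j = sw t"
  have j: "j \<in> W" using Ome_len[OF o] by blast
  have "list_all2 (al cc) i j \<Longrightarrow> (\<forall>l. Rw l \<notin> set i) \<Longrightarrow> Tw (mset i) c = cont j c" for c
  proof (induction rule: list_all2_induct)
    case (Cons x xs y ys)
    then show ?case by (cases x) auto
  qed simp
  moreover have "\<forall>l. Rw l \<notin> set i" "mset i = nu" using F o by (auto simp: Ome_def)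
  ultimately have e: "Tw nu c = cont j c" for c using o by (auto simp: Ome_def)
  have le: "cont j c \<le> lam c" for c using T e by metis
  have "cont j c = lam c" for c
  proof (cases "c \<in> {1..n}")
    case True
    have s: "(\<Sum>c\<in>{1..n}. cont j c) = (\<Sum>c\<in>{1..n}. lam c)" using sum_cont[OF j] lam_comp by (simp add: Comps_def)
    show ?thesis
    proof (rule ccontr)
      assume "cont j c \<noteq> lam c"
      then have "(\<Sum>c\<in>{1..n}. cont j c) < (\<Sum>c\<in>{1..n}. lam c)"
        using le True by (intro sum_strict_mono_ex1) (auto intro!: bexI[of _ c] simp: le_less)
      then show False using s by simp
    qed
  next
    case False
    then have "lam c = 0" using lam_comp by (auto simp: Comps_def)
    then show ?thesis using le[of c] by simp
  qed
  then show False using sw_strict[OF t] c by auto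
qed

definition nrw :: "lab multiset \<Rightarrow> nat" where
  "nrw nu = size {#x \<in># nu. \<exists>l. x = Rw l#}"

lemma nrw_simps [simp]: "nrw (add_mset (Fr c) m) = nrw m" "nrw (add_mset (Rw l) m) = Suc (nrw m)"
  by (auto simp: nrw_def)

text \<open>Induction on the number of row letters. Peeling a letter in column \<open>s\<close>
  lowers \<open>mu\<close> there by one. Afterwards \<open>mu\<close> is again dominant, or singular
  at \<open>s\<close>, where \<open>Bc\<close> applies, or it was zero from \<open>s\<close> on, and
  then no admissible word is left. Positive degrees suffice here because \<open>exo_peel\<close>
  works degree by degree.\<close>

theorem dominant_exact:
  fixes cc :: "nat \<Rightarrow> nat"
  assumes T: "\<And>c. Tw nu c \<le> lam c" and R: "\<And>l. Rw l \<in># nu \<Longrightarrow> cc l = 1"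
    and d: "\<And>c. 1 \<le> c \<Longrightarrow> mu nu (Suc c) \<le> mu nu c"
  shows "exo cc nu (Suc k)"
proof -
  define AA where "AA N \<longleftrightarrow> (\<forall>cc nu. nrw nu = N \<longrightarrow> (\<forall>c. Tw nu c \<le> lam c) \<longrightarrow> (\<forall>l. Rw l \<in># nu \<longrightarrow> cc l = 1) \<longrightarrow>
     (\<forall>c\<ge>1. mu nu (Suc c) \<le> mu nu c) \<longrightarrow> exo cc nu (Suc k))" for N
  \<comment> \<open>Peeling raises a row step by step, so one exceptional row \<open>l0\<close>
    starting in an arbitrary column has to be carried along.\<close>
  define BB where "BB N \<longleftrightarrow> (\<forall>cc nu l0 s. nrw nu = N \<longrightarrow> (\<forall>c. Tw nu c \<le> lam c) \<longrightarrow> (\<forall>l. Rw l \<in># nu \<longrightarrow> l \<noteq> l0 \<longrightarrow> cc l = 1) \<longrightarrow>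
     cc l0 = s \<longrightarrow> 1 \<le> s \<longrightarrow> (\<forall>c\<ge>1. mu nu (Suc c) \<le> mu nu c) \<longrightarrow> Rw l0 \<in># nu \<longrightarrow> exo cc nu (Suc k))" for N
  have AB: "AA N \<and> BB N" for N
  proof (induction N)
    case 0
    have none: "Rw l \<notin># nu" if "nrw nu = 0" for nu l
    proof
      assume l: "Rw l \<in># nu"
      obtain m where m: "nu = add_mset (Rw l) m" using multi_member_split[OF l] by blast
      then show False using that by simp
    qed
    show ?case unfolding AA_def BB_def using frozen_exact none by metis
  next
    case (Suc N)
    note aIH = Suc.IH[THEN conjunct1, unfolded AA_def] and bIH = Suc.IH[THEN conjunct2, unfolded BB_def]
    have B: "exo cc nu (Suc k)"
      if "nrw nu = Suc N" "\<forall>c. Tw nu c \<le> lam c" "\<forall>l. Rw l \<in># nu \<longrightarrow> l \<noteq> l0 \<longrightarrow> cc l = 1" "cc l0 = s" "1 \<le> s"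
        "\<forall>c\<ge>1. mu nu (Suc c) \<le> mu nu c" "Rw l0 \<in># nu" for cc nu l0 s
      using that
    proof (induction "Suc n - s" arbitrary: s cc nu)
      case 0
      then show ?case using exo_row_out[of l0 nu cc] by simp
    next
      case (Suc x)
      then have sn: "s \<le> n" by simp
      note hyp = Suc.prems
      obtain m where m: "nu = add_mset (Rw l0) m" using multi_member_split[OF hyp(7)] by blast
      have e1: "exo (cc(l0 := Suc s)) nu (Suc k)"
        by (rule Suc.hyps(1)[of "Suc s"]) (use hyp Suc.hyps(2) sn in auto)
      define n1 where "n1 = add_mset (Fr s) m"
      have T': "Tw n1 c = (if c = s then Suc (Tw nu c) else Tw nu c)" for c by (simp add: m n1_def)
      have R': "Rw l \<in># n1 \<Longrightarrow> l \<noteq> l0 \<Longrightarrow> cc l = 1" for l using hyp(3) by (auto simp: m n1_def)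
      have e2: "exo cc n1 (Suc k)"
      proof (cases "mu nu (Suc s) < mu nu s")
        case True
        have t: "\<forall>c. Tw n1 c \<le> lam c" using hyp(2) True by (auto simp: T' Suc_le_eq)
        have dd: "\<forall>c\<ge>1. mu n1 (Suc c) \<le> mu n1 c"
        proof (intro allI impI)
          fix c :: nat assume "1 \<le> c"
          then have "mu nu (Suc c) \<le> mu nu c" using hyp(6) by blast
          then show "mu n1 (Suc c) \<le> mu n1 c" using True unfolding T' by (cases "c = s"; cases "Suc c = s") auto
        qed
        show ?thesis
        proof (cases "Rw l0 \<in># n1")
          case True
          then show ?thesis using bIH[rule_format, of n1 l0 cc s] hyp t dd R' by (auto simp: m n1_def)
        next
          case False
          then have "\<forall>l. Rw l \<in># n1 \<longrightarrow> cc l = 1" using R' by metis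
          then show ?thesis using aIH[rule_format, of n1 cc] hyp t dd by (auto simp: m n1_def)
        qed
      next
        case False
        then have eq: "mu nu (Suc s) = mu nu s" using hyp(5,6) by (metis le_neq_implies_less)
        show ?thesis
        proof (cases "mu nu s = 0")
          case True
          have z: "mu nu c = 0" if "s \<le> c" for c using that
          proof (induction rule: dec_induct)
            case (step c) then show ?case using hyp(5,6) by (metis le_trans le_zero_eq)
          qed (use True in simp)
          have "Tw nu c = lam c" if "s \<le> c" for c using z[OF that] hyp(2) by (metis diff_is_0_eq le_antisym)
          then have "Ac cc n1" by (intro overtwisted_null[OF hyp(5) sn]) (auto simp: T')
          then show ?thesis by (simp add: Ac_def)
        next
          case False
          have sn': "s < n"
          proof (rule ccontr)
            assume "\<not> s < n" then have "lam (Suc s) = 0" using lam_out by simp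
            then show False using eq False by simp
          qed
          have Ts: "Tw nu s < lam s" using False by simp
          \<comment> \<open>\<open>mu\<close> had equal positive entries at \<open>s\<close> and
            \<open>Suc s\<close>; the new twist makes the left one smaller by one. Rows start in
            column 1 or, for \<open>l0\<close>, in column \<open>s\<close>.\<close>
          have "Ac cc n1"
          proof (rule Bc[OF _ hyp(5) sn'])
            show "VV 1 cc n1"
              unfolding VV_def
            proof (intro conjI allI impI)
              fix l assume "Rw l \<in># n1" then show "1 \<le> cc l" using R' hyp(4,5) by (cases "l = l0") auto
            next
              fix c :: nat assume "c < 1"
              then have "c = 0" by simp
              moreover have "Tw nu 0 \<le> lam 0" using hyp(2) by blast
              ultimately show "Tw n1 c = lam c" using hyp(5) by (simp add: T')
            next
              fix c :: nat assume "1 < c" show "Tw n1 c \<le> lam c" using hyp(2) Ts by (auto simp: T')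
            qed
            show "cc l = 1 \<or> cc l = s" if "Rw l \<in># n1" for l using R' that hyp(4) by (cases "l = l0") auto
            show "Tw n1 1 \<le> lam 1" "Tw n1 s \<le> lam s" using hyp(2) Ts by (auto simp: T')
            show "Suc (mu n1 s) = mu n1 (Suc s)" using eq Ts by (simp add: T')
            show "DD s n1" using hyp(5,6) by (auto simp: DD_def T')
          qed simp
          then show ?thesis by (simp add: Ac_def)
        qed
      qed
      show ?case using exo_peel[of cc l0 m "Suc k"] e1 e2 hyp(4) by (simp add: m n1_def)
    qed
    show ?case
    proof
      show "AA (Suc N)"
        unfolding AA_def
      proof (intro allI impI)
        fix cc :: "nat \<Rightarrow> nat" and nu assume a: "nrw nu = Suc N" "\<forall>c. Tw nu c \<le> lam c" "\<forall>l. Rw l \<in># nu \<longrightarrow> cc l = 1"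
          "\<forall>c\<ge>1. mu nu (Suc c) \<le> mu nu c"
        have "\<exists>l. Rw l \<in># nu"
        proof -
          have "{#x \<in># nu. \<exists>l. x = Rw l#} \<noteq> {#}" using a(1) unfolding nrw_def by (metis Suc_neq_Zero size_empty)
          then obtain x where "x \<in># {#x \<in># nu. \<exists>l. x = Rw l#}" by (meson multiset_nonemptyE)
          then show ?thesis by auto
        qed
        then obtain l where l: "Rw l \<in># nu" by blast
        show "exo cc nu (Suc k)" by (rule B[of nu l cc 1]) (use a l in auto)
      qed
      show "BB (Suc N)" unfolding BB_def by (intro allI impI) (rule B; assumption)
    qed
  qed
  have "AA (nrw nu)" using AB by blast
  from this[unfolded AA_def, rule_format, OF refl T R d] show ?thesis .
qed

end

section \<open>Matrices and pairs of words\<close>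

lemma wt_count:
  assumes "length i = length j" shows "wt i j s t = count (mset (zip i j)) (s, t)"
proof -
  have "count (mset (zip i j)) (s, t) = length (filter ((=) (s, t)) (zip i j))"
    by (simp add: count_mset count_list_eq_length_filter)
  also have "\<dots> = card {q. q < length (zip i j) \<and> (s, t) = zip i j ! q}"
    by (rule length_filter_conv_card)
  also have "{q. q < length (zip i j) \<and> (s, t) = zip i j ! q} = {q. q < length i \<and> i ! q = s \<and> j ! q = t}"
    using assms by auto
  finally show ?thesis by (simp add: wt_def)
qed

lemma wt_eq_iff:
  assumes "length x = r" "length y = r" "length x' = r" "length y' = r"
  shows "wt x y = wt x' y' \<longleftrightarrow> mset (zip x y) = mset (zip x' y')"
proof
  assume a: "wt x y = wt x' y'"
  show "mset (zip x y) = mset (zip x' y')"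
  proof (rule multiset_eqI)
    fix p :: "nat \<times> nat"
    show "count (mset (zip x y)) p = count (mset (zip x' y')) p"
      using a assms by (cases p) (metis wt_count)
  qed
next
  assume "mset (zip x y) = mset (zip x' y')"
  then show "wt x y = wt x' y'" using assms by (intro ext) (simp add: wt_count)
qed

lemma wt_perm:
  assumes "p permutes {..<r}" "length x = r" "length y = r"
  shows "wt (permute_list p x) (permute_list p y) = wt x y"
  using assms by (subst wt_eq_iff) (auto simp: permute_list_zip[symmetric])

text \<open>Matrices classify orbits of pairs of words: equal matrices mean equal multisets of
  letter pairs, and lists with equal multisets are rearrangements of each other.\<close>

lemma wt_orbit:
  assumes "length x = r" "length y = r" "length x' = r" "length y' = r" "wt x y = wt x' y'"
  shows "\<exists>p. p permutes {..<r} \<and> permute_list p x = x' \<and> permute_list p y = y'"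
proof -
  have "mset (zip x' y') = mset (zip x y)" using assms wt_eq_iff by metis
  then obtain p where p: "p permutes {..<length (zip x y)}" "permute_list p (zip x y) = zip x' y'"
    using mset_eq_permutation by blast
  have p': "p permutes {..<r}" using p assms by simp
  then have "zip (permute_list p x) (permute_list p y) = zip x' y'"
    using p(2) permute_list_zip[OF p', of x y] assms(1,2) by simp
  then have "permute_list p x = x' \<and> permute_list p y = y'"
    using assms(1-4) by (metis length_permute_list map_fst_zip map_snd_zip)
  then show ?thesis using p' by blast
qed

definition rowc :: "nat \<Rightarrow> (nat \<Rightarrow> nat \<Rightarrow> nat) \<Rightarrow> nat \<Rightarrow> nat" where
  "rowc n w s = (\<Sum>t\<in>{1..n}. w s t)"

definition colc :: "nat \<Rightarrow> (nat \<Rightarrow> nat \<Rightarrow> nat) \<Rightarrow> nat \<Rightarrow> nat" where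
  "colc n w t = (\<Sum>s\<in>{1..n}. w s t)"

lemma sum_Suc_delta:
  "finite A \<Longrightarrow> (\<Sum>c\<in>A. if P \<and> a = c then Suc (f c) else f c) = (\<Sum>c\<in>A. f c) + (if P \<and> a \<in> A then 1 else (0::nat))"
  "finite A \<Longrightarrow> (\<Sum>c\<in>A. if a = c then Suc (f c) else f c) = (\<Sum>c\<in>A. f c) + (if a \<in> A then 1 else (0::nat))"
  "finite A \<Longrightarrow> (\<Sum>c\<in>A. if a = c \<and> P then Suc (f c) else f c) = (\<Sum>c\<in>A. f c) + (if P \<and> a \<in> A then 1 else (0::nat))"
proof -
  assume A: "finite A"
  have "(\<Sum>c\<in>A. if Q \<and> a = c then Suc (f c) else f c) = (\<Sum>c\<in>A. f c + (if Q \<and> a = c then 1 else 0))" for Q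
    by (intro sum.cong) auto
  also have "(\<Sum>c\<in>A. f c + (if Q \<and> a = c then 1 else 0)) = (\<Sum>c\<in>A. f c) + (if Q \<and> a \<in> A then 1 else 0)" for Q
    using A by (cases Q) (simp_all add: sum.distrib)
  finally have *: "(\<Sum>c\<in>A. if Q \<and> a = c then Suc (f c) else f c) = (\<Sum>c\<in>A. f c) + (if Q \<and> a \<in> A then 1 else 0)" for Q .
  show "(\<Sum>c\<in>A. if P \<and> a = c then Suc (f c) else f c) = (\<Sum>c\<in>A. f c) + (if P \<and> a \<in> A then 1 else 0)"
    "(\<Sum>c\<in>A. if a = c then Suc (f c) else f c) = (\<Sum>c\<in>A. f c) + (if a \<in> A then 1 else 0)"
    "(\<Sum>c\<in>A. if a = c \<and> P then Suc (f c) else f c) = (\<Sum>c\<in>A. f c) + (if P \<and> a \<in> A then 1 else 0)"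
    using *[of P] *[of True] by (simp_all add: conj_commute)
qed

lemma rowc_wt:
  assumes "x \<in> Inr n r" "y \<in> Inr n r" shows "rowc n (wt x y) = cont x"
proof
  fix s
  have "length x = length y" "set y \<subseteq> {1..n}" using assms by (auto simp: Inr_def)
  then have "(\<Sum>t\<in>{1..n}. count (mset (zip x y)) (s, t)) = cont x s"
    by (induction x y rule: list_induct2) (auto simp: sum_Suc_delta)
  then show "rowc n (wt x y) s = cont x s" using assms by (simp add: rowc_def wt_count Inr_length)
qed

lemma colc_wt:
  assumes "x \<in> Inr n r" "y \<in> Inr n r" shows "colc n (wt x y) = cont y"
proof
  fix s
  have "length x = length y" "set x \<subseteq> {1..n}" using assms by (auto simp: Inr_def)
  then have "(\<Sum>t\<in>{1..n}. count (mset (zip x y)) (t, s)) = cont y s"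
    by (induction x y rule: list_induct2) (auto simp: sum_Suc_delta)
  then show "colc n (wt x y) s = cont y s" using assms by (simp add: colc_def wt_count Inr_length)
qed

lemma sum_cont_Inr: "j \<in> Inr n r \<Longrightarrow> (\<Sum>c\<in>{1..n}. cont j c) = r"
proof -
  assume j: "j \<in> Inr n r"
  have "set j \<subseteq> {1..n} \<Longrightarrow> (\<Sum>c\<in>{1..n}. cont j c) = length j"
    by (induction j) (auto simp: sum_Suc_delta)
  then show ?thesis using j by (auto simp: Inr_def)
qed

lemma wt_Mats:
  assumes "x \<in> Inr n r" "y \<in> Inr n r" shows "wt x y \<in> Mats n r"
proof -
  have "(\<Sum>s\<in>{1..n}. \<Sum>t\<in>{1..n}. wt x y s t) = (\<Sum>s\<in>{1..n}. rowc n (wt x y) s)" by (simp add: rowc_def)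
  also have "\<dots> = r" using rowc_wt[OF assms] sum_cont_Inr[OF assms(1)] by simp
  finally have "(\<Sum>s\<in>{1..n}. \<Sum>t\<in>{1..n}. wt x y s t) = r" .
  moreover have "wt x y s t = 0" if "s \<notin> {1..n} \<or> t \<notin> {1..n}" for s t
  proof -
    have "(s, t) \<notin> set (zip x y)" using that assms set_zip_leftD[of s t x y] set_zip_rightD[of s t x y] by (auto simp: Inr_def)
    then show ?thesis using assms by (simp add: wt_count Inr_length count_eq_zero_iff)
  qed
  ultimately show ?thesis by (auto simp: Mats_def)
qed

text \<open>Writing each index pair as often as its entry says and reading off both coordinates
  gives a pair of words in the orbit.\<close>

lemma Mats_wt:
  assumes "w \<in> Mats n r" shows "\<exists>x\<in>Inr n r. \<exists>y\<in>Inr n r. wt x y = w"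
proof -
  define M where "M = (\<Sum>s\<in>{1..n}. \<Sum>t\<in>{1..n}. replicate_mset (w s t) (s, t))"
  have cnt: "count M (s, t) = w s t" for s t
  proof -
    have "count M (s, t) = (\<Sum>a\<in>{1..n}. \<Sum>b\<in>{1..n}. if a = s \<and> b = t then w s t else 0)"
      unfolding M_def by (auto simp: count_sum intro!: sum.cong)
    also have "\<dots> = (\<Sum>a\<in>{1..n}. if a = s then (if t \<in> {1..n} then w s t else 0) else 0)"
      by (intro sum.cong refl) (auto simp: sum.delta)
    also have "\<dots> = (if s \<in> {1..n} \<and> t \<in> {1..n} then w s t else 0)" by (auto simp: sum.delta)
    also have "\<dots> = w s t" using assms by (auto simp: Mats_def)
    finally show ?thesis .
  qed
  have sz: "size M = r" using assms by (simp add: M_def size_multiset_sum Mats_def)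
  obtain zs where zs: "mset zs = M" using ex_mset by blast
  define x y where "x = map fst zs" and "y = map snd zs"
  have zip: "zip x y = zs" by (simp add: x_def y_def zip_map_fst_snd)
  have len: "length x = r" "length y = r" using sz zs by (auto simp: x_def y_def)
  have "wt x y = w"
    using len zip zs cnt by (intro ext) (simp add: wt_count)
  moreover have "a \<in> {1..n} \<and> b \<in> {1..n}" if "(a, b) \<in> set zs" for a b
  proof -
    have "count M (a, b) > 0" using that zs by auto
    then have "w a b \<noteq> 0" using cnt by auto
    moreover have "\<forall>s t. s \<notin> {1..n} \<or> t \<notin> {1..n} \<longrightarrow> w s t = 0" using assms by (simp add: Mats_def)
    ultimately show ?thesis by metis
  qed
  then have "set x \<subseteq> {1..n}" "set y \<subseteq> {1..n}" unfolding x_def y_def by fastforce+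
  then have "x \<in> Inr n r" "y \<in> Inr n r" using len by (auto simp: Inr_def)
  ultimately show ?thesis by blast
qed

lemma wt_pos_iff: "length x = length y \<Longrightarrow> wt x y k l \<noteq> 0 \<longleftrightarrow> (\<exists>q<length x. x ! q = k \<and> y ! q = l)"
  by (auto simp: wt_def card_eq_0_iff)

lemma wt_upper: "length x = length y \<Longrightarrow> (\<forall>k l. l < k \<longrightarrow> wt x y k l = 0) \<longleftrightarrow> lle x y"
proof -
  assume l: "length x = length y"
  have "(\<forall>k l. l < k \<longrightarrow> wt x y k l = 0) \<longleftrightarrow> (\<forall>q<length x. \<not> y ! q < x ! q)"
    using wt_pos_iff[OF l] by metis
  then show ?thesis using l by (auto simp: list_all2_conv_all_nth not_less)
qed

lemma MatsUp0_wt: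
  assumes "x \<in> Inr n r" "y \<in> Inr n r" shows "wt x y \<in> MatsUp n r 0 \<longleftrightarrow> lle x y"
  using wt_Mats[OF assms] wt_upper[of x y] assms by (auto simp: MatsUp_def Inr_length)

text \<open>For an upper triangular matrix the weighted sum vanishes exactly when all entries above
  the diagonal do, that is, when the two words agree at every position.\<close>

lemma MatsUp1_wt:
  assumes "x \<in> Inr n r" "y \<in> Inr n r" shows "wt x y \<in> MatsUp n r 1 \<longleftrightarrow> lle x y \<and> x \<noteq> y"
proof -
  have l: "length x = length y" using assms by (simp add: Inr_length)
  have "1 \<le> (\<Sum>k\<in>{1..n}. \<Sum>l\<in>{k..n}. (l - k) * wt x y k l) \<longleftrightarrow> x \<noteq> y" if up: "lle x y"
  proof -
    have "1 \<le> (\<Sum>k\<in>{1..n}. \<Sum>l\<in>{k..n}. (l - k) * wt x y k l) \<longleftrightarrow> (\<exists>k\<in>{1..n}. \<exists>l\<in>{k..n}. k < l \<and> wt x y k l \<noteq> 0)"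
    proof -
      have a: "1 \<le> S \<longleftrightarrow> S \<noteq> 0" for S :: nat by auto
      have b: "(\<Sum>k\<in>{1..n}. \<Sum>l\<in>{k..n}. (l - k) * wt x y k l) = 0 \<longleftrightarrow> (\<forall>k\<in>{1..n}. \<forall>l\<in>{k..n}. \<not> (k < l \<and> wt x y k l \<noteq> 0))"
        by (simp add: not_less)
      show ?thesis unfolding a b by simp
    qed
    also have "\<dots> \<longleftrightarrow> (\<exists>q<length x. x ! q < y ! q)"
    proof
      assume "\<exists>k\<in>{1..n}. \<exists>l\<in>{k..n}. k < l \<and> wt x y k l \<noteq> 0"
      then show "\<exists>q<length x. x ! q < y ! q" using wt_pos_iff[OF l] by metis
    next
      assume "\<exists>q<length x. x ! q < y ! q"
      then obtain q where q: "q < length x" "x ! q < y ! q" by blast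
      have "x ! q \<in> {1..n}" "y ! q \<in> {1..n}" using assms q l nth_mem by (auto simp: Inr_def subset_iff)
      then show "\<exists>k\<in>{1..n}. \<exists>l\<in>{k..n}. k < l \<and> wt x y k l \<noteq> 0"
        using wt_pos_iff[OF l] q by (intro bexI[of _ "x ! q"] bexI[of _ "y ! q"]) auto
    qed
    also have "\<dots> \<longleftrightarrow> x \<noteq> y"
    proof
      assume "x \<noteq> y"
      then obtain q where "q < length x" "x ! q \<noteq> y ! q" using l nth_equalityI by blast
      then show "\<exists>q<length x. x ! q < y ! q" using up by (auto simp: list_all2_conv_all_nth le_less)
    qed auto
    finally show ?thesis .
  qed
  then show ?thesis using wt_Mats[OF assms] wt_upper[OF l] by (auto simp: MatsUp_def)
qed

lemma MatsUp_sub: "MatsUp n r s \<subseteq> Mats n r" by (auto simp: MatsUp_def)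

lemma finite_Mats: "finite (Mats n r)"
proof -
  have "Mats n r \<subseteq> (\<lambda>(x, y). wt x y) ` (Inr n r \<times> Inr n r)" using Mats_wt by fastforce
  then show ?thesis by (rule finite_subset) simp
qed

lemma finite_MatsUp [simp]: "finite (MatsUp n r s)"
  using finite_subset[OF MatsUp_sub finite_Mats] .

text \<open>Lowering letters can only bring more of them into an initial segment; entrywise order on
  words thus gives the reverse dominance order on contents.\<close>

lemma lle_prefix_sums:
  assumes "lle x y" "\<forall>a\<in>set x. 1 \<le> a"
  shows "(\<Sum>c\<in>{1..m}. cont y c) \<le> (\<Sum>c\<in>{1..m}. cont x c)"
  using assms
proof (induction rule: list_all2_induct)
  case (Cons a xs b ys)
  have e: "(\<Sum>c\<in>{1..m}. cont (d # zs) c) = (\<Sum>c\<in>{1..m}. cont zs c) + (if d \<in> {1..m} then 1 else 0)" for d zs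
    by (auto simp: sum_Suc_delta)
  show ?case using Cons unfolding e by auto
qed simp

lemma lle_sum_list:
  assumes "lle x y" shows "sum_list x \<le> sum_list y" "x \<noteq> y \<Longrightarrow> sum_list x < sum_list y"
proof -
  have "sum_list x \<le> sum_list y \<and> (x \<noteq> y \<longrightarrow> sum_list x < sum_list y)"
    using assms by (induction rule: list_all2_induct) auto
  then show "sum_list x \<le> sum_list y" "x \<noteq> y \<Longrightarrow> sum_list x < sum_list y" by auto
qed

lemma sum_list_cont: "x \<in> Inr n r \<Longrightarrow> sum_list x = (\<Sum>c\<in>{1..n}. c * cont x c)"
proof -
  have "set x \<subseteq> {1..n} \<Longrightarrow> sum_list x = (\<Sum>c\<in>{1..n}. c * cont x c)"
  proof (induction x)
    case (Cons a x)
    have "(\<Sum>c\<in>{1..n}. c * cont (a # x) c) = (\<Sum>c\<in>{1..n}. c * cont x c + (if c = a then c else 0))"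
      by (intro sum.cong) auto
    also have "\<dots> = (\<Sum>c\<in>{1..n}. c * cont x c) + a" using Cons.prems by (simp add: sum.distrib)
    finally show ?case using Cons by simp
  qed simp
  then show "x \<in> Inr n r \<Longrightarrow> ?thesis" by (auto simp: Inr_def)
qed

lemma word_of_content:
  assumes "lam \<in> Comps n r" shows "\<exists>x\<in>Inr n r. cont x = lam"
proof -
  define M where "M = (\<Sum>s\<in>{1..n}. replicate_mset (lam s) s)"
  have cnt: "count M s = lam s" for s
  proof -
    have "count M s = (\<Sum>a\<in>{1..n}. if a = s then lam s else 0)"
      unfolding M_def by (auto simp: count_sum intro!: sum.cong)
    also have "\<dots> = lam s" using assms by (auto simp: sum.delta Comps_def)
    finally show ?thesis .
  qed
  obtain x where x: "mset x = M" using ex_mset by blast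
  have "size M = r" using assms by (simp add: M_def size_multiset_sum Comps_def)
  moreover have "set x \<subseteq> {1..n}"
  proof
    fix a assume "a \<in> set x"
    then have "count M a > 0" using x by auto
    then show "a \<in> {1..n}" using cnt assms by (auto simp: Comps_def)
  qed
  ultimately have "x \<in> Inr n r" using x by (auto simp: Inr_def)
  then show ?thesis using x cnt by auto
qed

section \<open>The bar complex in the basis of matrices\<close>

type_synonym mat = "nat \<Rightarrow> nat \<Rightarrow> nat"

definition Jm :: "nat \<Rightarrow> nat \<Rightarrow> mat set" where
  "Jm n r = MatsUp n r 1"

lemma Jm_sub: "Jm n r \<subseteq> Mats n r" and finite_Jm [simp]: "finite (Jm n r)"
  using MatsUp_sub by (auto simp: Jm_def)

lemma Jm_wt: "x \<in> Inr n r \<Longrightarrow> y \<in> Inr n r \<Longrightarrow> wt x y \<in> Jm n r \<longleftrightarrow> lle x y \<and> x \<noteq> y"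
  unfolding Jm_def by (rule MatsUp1_wt)

text \<open>The kernel of the basis element \<open>xi w\<close>.\<close>

definition chi :: "mat \<Rightarrow> nat list \<Rightarrow> nat list \<Rightarrow> 'a::comm_ring_1" where
  "chi w x y = (if wt x y = w then 1 else 0)"

definition rep :: "nat \<Rightarrow> nat \<Rightarrow> mat \<Rightarrow> nat list \<times> nat list" where
  "rep n r w = (SOME p. fst p \<in> Inr n r \<and> snd p \<in> Inr n r \<and> wt (fst p) (snd p) = w)"

definition kconv :: "nat \<Rightarrow> nat \<Rightarrow> ('l list \<Rightarrow> nat list \<Rightarrow> 'a::comm_ring_1) \<Rightarrow> (nat list \<Rightarrow> nat list \<Rightarrow> 'a) \<Rightarrow> 'l list \<Rightarrow> nat list \<Rightarrow> 'a" where
  "kconv n r a b x y = (\<Sum>z\<in>Inr n r. a x z * b z y)"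

text \<open>Structure constants: \<open>xi w * xi v = (\<Sum>e. cst w v e * xi e)\<close>.\<close>
definition cst :: "nat \<Rightarrow> nat \<Rightarrow> mat \<Rightarrow> mat \<Rightarrow> mat \<Rightarrow> 'a::comm_ring_1" where
  "cst n r w v e = kconv n r (chi w) (chi v) (fst (rep n r e)) (snd (rep n r e))"

text \<open>The kernel of the action map from \<open>S\<^sup>+ \<otimes> Y\<close> to \<open>Y\<close> is \<open>J \<otimes> Y\<close> with the twisted action
  \<open>a \<cdot> (b \<otimes> y) = a b \<otimes> y - a \<otimes> b y\<close>; \<open>rho w t u\<close> is the coefficient of the basis element \<open>u\<close> in \<open>xi w \<cdot> t\<close>
  for the iterated construction.\<close>
fun rho :: "nat \<Rightarrow> nat \<Rightarrow> mat \<Rightarrow> mat list \<Rightarrow> mat list \<Rightarrow> 'a::comm_ring_1" where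
  "rho n r w [] u = 0"
| "rho n r w (v # t) [] = 0"
| "rho n r w (v # t) (e # u) = (if u = t then cst n r w v e else 0) - (if e = w then rho n r v t u else 0)"

fun tsw :: "nat \<Rightarrow> (nat \<Rightarrow> nat) \<Rightarrow> mat list \<Rightarrow> nat \<Rightarrow> nat" where
  "tsw n lam [] = lam"
| "tsw n lam (w # t) = rowc n w"

text \<open>Basis chains of the tensor powers of J over L, acting on R at \<open>lam\<close>: an
  idempotent moved across a tensor sign kills every chain in which a column content differs from the
  next row content, or in which the last one differs from \<open>lam\<close>.\<close>

fun tails :: "nat \<Rightarrow> nat \<Rightarrow> (nat \<Rightarrow> nat) \<Rightarrow> nat \<Rightarrow> mat list set" where
  "tails n r lam 0 = {[]}"
| "tails n r lam (Suc k) = (\<lambda>(w, t). w # t) ` {(w, t). w \<in> Jm n r \<and> t \<in> tails n r lam k \<and> colc n w = tsw n lam t}"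

text \<open>With \<open>a\<close> the first tensor factor, the differential sends a \<otimes> w
  \<otimes> t to a w \<otimes> t minus a \<otimes> \<open>rho w t\<close>. The condition on
  \<open>cont x\<close> inserts the idempotent between \<open>a\<close> and the chain
  \<open>u\<close>.\<close>

definition bde :: "nat \<Rightarrow> nat \<Rightarrow> (nat \<Rightarrow> nat) \<Rightarrow> mat list \<Rightarrow> mat list \<Rightarrow> nat list \<Rightarrow> nat list \<Rightarrow> 'a::comm_ring_1" where
  "bde n r lam t u x y = (if x \<in> Inr n r \<and> y \<in> Inr n r \<and> t \<noteq> []
     then (if u = tl t then chi (hd t) x y else 0) - (if x = y \<and> cont x = tsw n lam u then rho n r (hd t) (tl t) u else 0)
     else 0)"

lemma tails_Cons: "w # t \<in> tails n r lam (Suc k) \<longleftrightarrow> w \<in> Jm n r \<and> t \<in> tails n r lam k \<and> colc n w = tsw n lam t"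
  by auto

lemma finite_tails [simp]: "finite (tails n r lam k)"
proof (induction k)
  case (Suc k)
  have "{(w, t). w \<in> Jm n r \<and> t \<in> tails n r lam k \<and> colc n w = tsw n lam t} \<subseteq> Jm n r \<times> tails n r lam k" by auto
  then have "finite {(w, t). w \<in> Jm n r \<and> t \<in> tails n r lam k \<and> colc n w = tsw n lam t}"
    by (rule finite_subset) (use Suc in simp)
  then show ?case by simp
qed simp

lemma sum_tails:
  "(\<Sum>t\<in>tails n r lam (Suc k). f t) = (\<Sum>w\<in>Jm n r. \<Sum>t\<in>tails n r lam k. if colc n w = tsw n lam t then f (w # t) else 0)"
proof -
  let ?A = "{(w, t). w \<in> Jm n r \<and> t \<in> tails n r lam k \<and> colc n w = tsw n lam t}"
  have "(\<Sum>t\<in>tails n r lam (Suc k). f t) = (\<Sum>(w, t)\<in>?A. f (w # t))"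
    by (simp, subst sum.reindex) (auto simp: inj_on_def case_prod_unfold)
  also have "\<dots> = (\<Sum>(w, t)\<in>Jm n r \<times> tails n r lam k. if colc n w = tsw n lam t then f (w # t) else 0)"
    by (rule sum.mono_neutral_cong_left) (auto split: if_splits)
  also have "\<dots> = (\<Sum>w\<in>Jm n r. \<Sum>t\<in>tails n r lam k. if colc n w = tsw n lam t then f (w # t) else 0)"
    by (simp add: sum.cartesian_product)
  finally show ?thesis .
qed

lemma rep_props:
  assumes "w \<in> Mats n r"
  shows "fst (rep n r w) \<in> Inr n r" "snd (rep n r w) \<in> Inr n r" "wt (fst (rep n r w)) (snd (rep n r w)) = w"
proof -
  obtain x y where "x \<in> Inr n r" "y \<in> Inr n r" "wt x y = w" using Mats_wt[OF assms] by blast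
  then have "\<exists>p. fst p \<in> Inr n r \<and> snd p \<in> Inr n r \<and> wt (fst p) (snd p) = w" by (intro exI[of _ "(x, y)"]) simp
  then show "fst (rep n r w) \<in> Inr n r" "snd (rep n r w) \<in> Inr n r" "wt (fst (rep n r w)) (snd (rep n r w)) = w"
    unfolding rep_def by (rule someI2_ex; blast)+
qed

lemma chi_inv: "linv r (chi w)"
  by (rule linvI) (simp add: chi_def wt_perm)

lemma kconv_inv:
  fixes a :: "'l list \<Rightarrow> nat list \<Rightarrow> 'a::comm_ring_1"
  assumes "linv r a" "linv r b" shows "linv r (kconv n r a b)"
proof (rule linvI)
  fix p and i :: "'l list" and j :: "nat list" assume p: "p permutes {..<r}" and l: "length i = r" "length j = r"
  have "kconv n r a b (permute_list p i) (permute_list p j)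
    = (\<Sum>z\<in>Inr n r. a (permute_list p i) (permute_list p z) * b (permute_list p z) (permute_list p j))"
    unfolding kconv_def by (rule sum_Inr_permute[OF p, symmetric])
  also have "\<dots> = kconv n r a b i j"
    unfolding kconv_def by (rule sum.cong) (use linvD[OF assms(1) p] linvD[OF assms(2) p] l in \<open>auto simp: Inr_length\<close>)
  finally show "kconv n r a b (permute_list p i) (permute_list p j) = kconv n r a b i j" .
qed

lemma linv_wt:
  assumes "linv r a" "x \<in> Inr n r" "y \<in> Inr n r" "x' \<in> Inr n r" "y' \<in> Inr n r" "wt x y = wt x' y'"
  shows "a x y = a x' y'"
proof -
  obtain p where "p permutes {..<r}" "permute_list p x = x'" "permute_list p y = y'"
    using wt_orbit[of x r y x' y'] assms by (auto simp: Inr_length)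
  then show ?thesis using linvD[OF assms(1), of p x y] assms by (simp add: Inr_length)
qed

lemma cst_wt:
  assumes "x \<in> Inr n r" "y \<in> Inr n r"
  shows "cst n r w v (wt x y) = kconv n r (chi w) (chi v) x y"
  unfolding cst_def
  using linv_wt[OF kconv_inv[OF chi_inv chi_inv]] rep_props[OF wt_Mats[OF assms]] assms by blast

lemma cst_nz:
  assumes e: "e \<in> Mats n r" and w: "w \<in> Jm n r" and v: "v \<in> Jm n r" and nz: "cst n r w v e \<noteq> (0::'a::comm_ring_1)"
  shows "e \<in> Jm n r \<and> rowc n e = rowc n w \<and> colc n e = colc n v \<and> colc n w = rowc n v"
proof -
  obtain x y where xy: "x \<in> Inr n r" "y \<in> Inr n r" "e = wt x y" using Mats_wt[OF e] by blast
  have "kconv n r (chi w) (chi v) x y \<noteq> (0::'a)" using nz xy cst_wt by metis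
  then obtain z where z: "z \<in> Inr n r" "chi w x z * chi v z y \<noteq> (0::'a)"
    unfolding kconv_def by (meson sum.not_neutral_contains_not_neutral)
  then have wv: "wt x z = w" "wt z y = v" by (auto simp: chi_def split: if_splits)
  have "lle x z" "x \<noteq> z" "lle z y" using Jm_wt[OF xy(1) z(1)] Jm_wt[OF z(1) xy(2)] wv w v by auto
  moreover have "lle x y" using list_all2_trans[OF _ \<open>lle x z\<close> \<open>lle z y\<close>] by (metis le_trans)
  moreover have "x \<noteq> y" using \<open>lle x z\<close> \<open>lle z y\<close> \<open>x \<noteq> z\<close> list_all2_antisym[of "(\<le>)" "(\<le>)" x z]
    by (metis le_antisym list_all2_antisym)
  ultimately have "e \<in> Jm n r" using Jm_wt[OF xy(1,2)] xy(3) by simp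
  then show ?thesis using rowc_wt[OF xy(1,2)] colc_wt[OF xy(1,2)] rowc_wt[OF xy(1) z(1)] colc_wt[OF xy(1) z(1)]
      rowc_wt[OF z(1) xy(2)] colc_wt[OF z(1) xy(2)] wv xy(3) by auto
qed

lemma kconv_assoc: "kconv n r (kconv n r a b) c x y = kconv n r a (kconv n r b c) x y"
proof -
  have "kconv n r (kconv n r a b) c x y = (\<Sum>z\<in>Inr n r. \<Sum>z'\<in>Inr n r. a x z' * (b z' z * c z y))"
    by (simp add: kconv_def sum_distrib_right mult.assoc)
  also have "\<dots> = (\<Sum>z'\<in>Inr n r. \<Sum>z\<in>Inr n r. a x z' * (b z' z * c z y))" by (rule sum.swap)
  also have "\<dots> = kconv n r a (kconv n r b c) x y" by (simp add: kconv_def sum_distrib_left)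
  finally show ?thesis .
qed

lemma sum_chi:
  assumes "x \<in> Inr n r" "y \<in> Inr n r" "\<And>e. e \<in> Mats n r \<Longrightarrow> f e \<noteq> 0 \<Longrightarrow> e \<in> Jm n r"
  shows "(\<Sum>e\<in>Jm n r. f e * chi e x y) = (f (wt x y) :: 'a::comm_ring_1)"
proof (cases "wt x y \<in> Jm n r")
  case True
  have "(\<Sum>e\<in>Jm n r. f e * chi e x y) = (\<Sum>e\<in>Jm n r. if e = wt x y then f e else 0)"
    by (rule sum.cong) (auto simp: chi_def)
  then show ?thesis using True by simp
next
  case False
  then have "f (wt x y) = 0" using assms(3) wt_Mats[OF assms(1,2)] by blast
  moreover have "f e * chi e x y = 0" if "e \<in> Jm n r" for e using that False by (auto simp: chi_def)
  ultimately show ?thesis by simp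
qed

text \<open>Associativity of kernel composition, evaluated at a pair of words in the orbit
  \<open>z\<close>; the sums may run over J only, since products of elements of J stay
  there.\<close>

lemma cst_assoc:
  assumes w: "w \<in> Jm n r" and v: "v \<in> Jm n r" and u: "u \<in> Jm n r" and z: "z \<in> Mats n r"
  shows "(\<Sum>e\<in>Jm n r. cst n r w v e * cst n r e u z) = (\<Sum>e\<in>Jm n r. cst n r v u e * (cst n r w e z :: 'a::comm_ring_1))"
proof -
  obtain x y where xy: "x \<in> Inr n r" "y \<in> Inr n r" "z = wt x y" using Mats_wt[OF z] by blast
  have "(\<Sum>e\<in>Jm n r. cst n r w v e * cst n r e u z)
    = (\<Sum>e\<in>Jm n r. \<Sum>a\<in>Inr n r. cst n r w v e * chi e x a * (chi u a y :: 'a))"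
    unfolding xy(3) cst_wt[OF xy(1,2), of _ u] by (simp add: kconv_def sum_distrib_left mult.assoc)
  also have "\<dots> = (\<Sum>a\<in>Inr n r. \<Sum>e\<in>Jm n r. cst n r w v e * chi e x a * chi u a y)" by (rule sum.swap)
  also have "\<dots> = (\<Sum>a\<in>Inr n r. cst n r w v (wt x a) * chi u a y)"
    by (rule sum.cong[OF refl]) (simp add: sum_distrib_right[symmetric] sum_chi[OF xy(1)] cst_nz[OF _ w v])
  also have "\<dots> = kconv n r (kconv n r (chi w) (chi v)) (chi u) x y"
    unfolding kconv_def[of n r "kconv n r (chi w) (chi v)"] by (rule sum.cong) (simp_all add: xy cst_wt)
  also have "\<dots> = kconv n r (chi w) (kconv n r (chi v) (chi u)) x y" by (rule kconv_assoc)
  also have "\<dots> = (\<Sum>a\<in>Inr n r. chi w x a * cst n r v u (wt a y))"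
    unfolding kconv_def[of n r "chi w" "kconv n r (chi v) (chi u)"] by (rule sum.cong) (simp_all add: xy cst_wt)
  also have "\<dots> = (\<Sum>a\<in>Inr n r. \<Sum>e\<in>Jm n r. chi w x a * (cst n r v u e * chi e a y))"
    by (rule sum.cong[OF refl]) (simp add: sum_distrib_left[symmetric] sum_chi[OF _ xy(2)] cst_nz[OF _ v u])
  also have "\<dots> = (\<Sum>e\<in>Jm n r. \<Sum>a\<in>Inr n r. chi w x a * (cst n r v u e * chi e a y))" by (rule sum.swap)
  also have "\<dots> = (\<Sum>e\<in>Jm n r. cst n r v u e * cst n r w e z)"
    unfolding xy(3) cst_wt[OF xy(1,2), of w] by (simp add: kconv_def sum_distrib_left ac_simps)
  finally show ?thesis .
qed

lemma rho_supp:
  assumes "w # t \<in> tails n r lam (Suc k)" "u \<in> tails n r lam k" "rho n r w t u \<noteq> (0::'a::comm_ring_1)"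
  shows "tsw n lam u = rowc n w"
proof (cases k)
  case 0
  then show ?thesis using assms by (auto simp: tails_Cons)
next
  case (Suc k')
  obtain v t' where t: "t = v # t'" "v \<in> Jm n r" using assms(1) Suc by auto
  obtain e u' where u: "u = e # u'" "e \<in> Jm n r" using assms(2) Suc by auto
  have w: "w \<in> Jm n r" using assms(1) by auto
  have "cst n r w v e \<noteq> (0::'a) \<or> e = w" using assms(3) by (auto simp: t u split: if_splits)
  then show ?thesis using cst_nz[OF subsetD[OF Jm_sub u(2)] w t(2)] u by auto
qed

text \<open>Prescribing the tail leaves a sum over the head. The composability condition disappears
  because it already holds wherever \<open>g\<close> is nonzero.\<close>

lemma sum_tails_tl:
  fixes f :: "mat list \<Rightarrow> 'a::comm_ring_1"
  assumes t: "t \<in> tails n r lam k" and g: "\<And>e. e \<in> Jm n r \<Longrightarrow> g e \<noteq> 0 \<Longrightarrow> colc n e = tsw n lam t"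
  shows "(\<Sum>t'\<in>tails n r lam (Suc k). (if tl t' = t then g (hd t') else 0) * f t') = (\<Sum>e\<in>Jm n r. g e * f (e # t))"
  unfolding sum_tails
proof (rule sum.cong[OF refl])
  fix e assume e: "e \<in> Jm n r"
  have "(\<Sum>t'\<in>tails n r lam k. if colc n e = tsw n lam t' then (if tl (e # t') = t then g (hd (e # t')) else 0) * f (e # t') else 0)
    = (\<Sum>t'\<in>tails n r lam k. if t' = t then g e * f (e # t) else 0)"
    using g[OF e] by (intro sum.cong refl) (cases "g e = 0"; auto)
  then show "(\<Sum>t'\<in>tails n r lam k. if colc n e = tsw n lam t' then (if tl (e # t') = t then g (hd (e # t')) else 0) * f (e # t') else 0)
    = g e * f (e # t)" using t by simp
qed

lemma sum_tails_hd:
  fixes f :: "mat list \<Rightarrow> 'a::comm_ring_1"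
  assumes w: "w \<in> Jm n r" and g: "\<And>u. u \<in> tails n r lam k \<Longrightarrow> g u \<noteq> 0 \<Longrightarrow> colc n w = tsw n lam u"
  shows "(\<Sum>t'\<in>tails n r lam (Suc k). (if hd t' = w then g (tl t') else 0) * f t') = (\<Sum>u\<in>tails n r lam k. g u * f (w # u))"
proof -
  have "(\<Sum>t'\<in>tails n r lam (Suc k). (if hd t' = w then g (tl t') else 0) * f t')
    = (\<Sum>e\<in>Jm n r. if e = w then (\<Sum>u\<in>tails n r lam k. g u * f (w # u)) else 0)"
    unfolding sum_tails
  proof (rule sum.cong[OF refl])
    fix e
    show "(\<Sum>t\<in>tails n r lam k. if colc n e = tsw n lam t then (if hd (e # t) = w then g (tl (e # t)) else 0) * f (e # t) else 0)
      = (if e = w then (\<Sum>u\<in>tails n r lam k. g u * f (w # u)) else 0)"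
    proof (cases "e = w")
      case True
      have "(if colc n e = tsw n lam t then (if hd (e # t) = w then g (tl (e # t)) else 0) * f (e # t) else 0) = g t * f (w # t)"
        if "t \<in> tails n r lam k" for t
        using g[OF that] True by (cases "g t = 0") auto
      then show ?thesis using True by simp
    next
      case False
      then show ?thesis by (simp, intro sum.neutral) auto
    qed
  qed
  then show ?thesis using w by simp
qed

lemma rho_tails:
  assumes "t' \<in> tails n r lam (Suc k)"
  shows "rho n r w (v # t) t' = (if tl t' = t then cst n r w v (hd t') else 0) - (if hd t' = w then rho n r v t (tl t') else 0)"
  using assms by auto

text \<open>\<open>rho\<close> is an action of J, so the product w v acts as \<open>rho w\<close>
  after \<open>rho v\<close>. On f \<otimes> t' both sides yield w v f \<otimes> t' by associativity
  and - w v \<otimes> \<open>rho f t'\<close>. The other two terms start with w and cancel by the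
  induction hypothesis for v and f.\<close>

lemma rho_module:
  assumes "w # v # t \<in> tails n r lam (Suc (Suc k))" "u \<in> tails n r lam k"
  shows "(\<Sum>e\<in>Jm n r. cst n r w v e * rho n r e t u)
     = (\<Sum>u'\<in>tails n r lam k. rho n r v t u' * (rho n r w u' u :: 'a::comm_ring_1))"
  using assms
proof (induction k arbitrary: w v t u)
  case 0
  then show ?case by auto
next
  case (Suc k)
  obtain f t' where t: "t = f # t'" "f \<in> Jm n r" "t' \<in> tails n r lam k" "colc n f = tsw n lam t'"
    using Suc.prems(1) by auto
  obtain z u' where u: "u = z # u'" "z \<in> Jm n r" "u' \<in> tails n r lam k" "colc n z = tsw n lam u'"
    using Suc.prems(2) by auto
  have w: "w \<in> Jm n r" and v: "v \<in> Jm n r" and wv: "colc n w = rowc n v" and vf: "colc n v = rowc n f"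
    and vt: "v # f # t' \<in> tails n r lam (Suc (Suc k))" and ft: "f # t' \<in> tails n r lam (Suc k)"
    using Suc.prems(1) by (auto simp: t)
  have zM: "z \<in> Mats n r" using u(2) Jm_sub by blast
  let ?rh = "rho n r :: mat \<Rightarrow> mat list \<Rightarrow> mat list \<Rightarrow> 'a" and ?cs = "cst n r :: mat \<Rightarrow> mat \<Rightarrow> mat \<Rightarrow> 'a"
  let ?r = "?rh f t' u'"
  have "(\<Sum>e\<in>Jm n r. ?cs w v e * ?rh e t u)
    = (\<Sum>e\<in>Jm n r. (if u' = t' then ?cs w v e * ?cs e f z else 0) - (if e = z then ?cs w v z * ?r else 0))"
    by (rule sum.cong) (auto simp: t u algebra_simps)
  also have "\<dots> = (if u' = t' then (\<Sum>e\<in>Jm n r. ?cs w v e * ?cs e f z) else 0) - ?cs w v z * ?r"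
    using u(2) by (simp add: sum_subtractf)
  finally have L: "(\<Sum>e\<in>Jm n r. ?cs w v e * ?rh e t u) = \<dots>" .
  have "(\<Sum>s\<in>tails n r lam (Suc k). ?rh v t s * ?rh w s u)
    = (\<Sum>s\<in>tails n r lam (Suc k). (if tl s = t' then ?cs v f (hd s) else 0) * ?rh w s u)
     - (\<Sum>s\<in>tails n r lam (Suc k). (if hd s = v then ?rh f t' (tl s) else 0) * ?rh w s u)"
    unfolding sum_subtractf[symmetric] by (rule sum.cong) (auto simp: t rho_tails left_diff_distrib)
  also have "(\<Sum>s\<in>tails n r lam (Suc k). (if tl s = t' then ?cs v f (hd s) else 0) * ?rh w s u)
    = (\<Sum>e\<in>Jm n r. ?cs v f e * ?rh w (e # t') u)"
  proof (rule sum_tails_tl[OF t(3)])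
    fix e assume "e \<in> Jm n r" "?cs v f e \<noteq> (0::'a)"
    then show "colc n e = tsw n lam t'" using cst_nz[OF _ v t(2)] t(4) Jm_sub by (metis subsetD)
  qed
  also have "\<dots> = (\<Sum>e\<in>Jm n r. (if u' = t' then ?cs v f e * ?cs w e z else 0) - (if z = w then ?cs v f e * ?rh e t' u' else 0))"
    by (rule sum.cong) (auto simp: u algebra_simps)
  also have "\<dots> = (if u' = t' then (\<Sum>e\<in>Jm n r. ?cs v f e * ?cs w e z) else 0)
     - (if z = w then (\<Sum>e\<in>Jm n r. ?cs v f e * ?rh e t' u') else 0)"
    by (simp add: sum_subtractf)
  also have "(\<Sum>s\<in>tails n r lam (Suc k). (if hd s = v then ?rh f t' (tl s) else 0) * ?rh w s u)
    = (\<Sum>s\<in>tails n r lam k. ?rh f t' s * ?rh w (v # s) u)"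
  proof (rule sum_tails_hd[OF v])
    fix s assume "s \<in> tails n r lam k" "?rh f t' s \<noteq> (0::'a)"
    then show "colc n v = tsw n lam s" using rho_supp[OF ft] vf by metis
  qed
  also have "\<dots> = (\<Sum>s\<in>tails n r lam k. (if s = u' then ?r * ?cs w v z else 0) - (if z = w then ?rh f t' s * ?rh v s u' else 0))"
    by (rule sum.cong) (auto simp: u algebra_simps)
  also have "\<dots> = ?r * ?cs w v z - (if z = w then (\<Sum>s\<in>tails n r lam k. ?rh f t' s * ?rh v s u') else 0)"
    using u(3) by (simp add: sum_subtractf)
  finally have R: "(\<Sum>s\<in>tails n r lam (Suc k). ?rh v t s * ?rh w s u) =
     (if u' = t' then (\<Sum>e\<in>Jm n r. ?cs v f e * ?cs w e z) else 0)
     - (if z = w then (\<Sum>e\<in>Jm n r. ?cs v f e * ?rh e t' u') else 0)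
     - (?r * ?cs w v z - (if z = w then (\<Sum>s\<in>tails n r lam k. ?rh f t' s * ?rh v s u') else 0))" .
  show ?case unfolding L R using Suc.IH[OF vt u(3)] cst_assoc[OF w v t(2) zM, where 'a = 'a] by (auto simp: algebra_simps)
qed

lemma bde_Cons:
  "x \<in> Inr n r \<Longrightarrow> y \<in> Inr n r \<Longrightarrow> bde n r lam (w # t) u x y
     = (if u = t then chi w x y else 0) - (if x = y \<and> cont x = tsw n lam u then rho n r w t u else 0)"
  by (auto simp: bde_def)

lemma bde_tails:
  "t \<in> tails n r lam (Suc k) \<Longrightarrow> x \<in> Inr n r \<Longrightarrow> y \<in> Inr n r \<Longrightarrow> bde n r lam t u x y
     = (if tl t = u then chi (hd t) x y else 0) - (if x = y \<and> cont x = tsw n lam u then rho n r (hd t) (tl t) u else 0)"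
  by (auto simp: bde_def)

lemma tsw_tails: "t \<in> tails n r lam (Suc k) \<Longrightarrow> tsw n lam t = rowc n (hd t)"
  by auto

lemma chi_nz: "chi w x y \<noteq> 0 \<Longrightarrow> wt x y = w"
  by (auto simp: chi_def split: if_splits)

text \<open>Applied twice to a \<otimes> w \<otimes> v \<otimes> t0, the differential leaves, after
  cancellation of a w v \<otimes> t0 and of a w \<otimes> \<open>rho v t0\<close>, only a tensored
  with the difference between the action of w v on t0 and \<open>rho w\<close> after
  \<open>rho v\<close>, which is zero by \<open>rho_module\<close>.\<close>

lemma bde_sq:
  assumes t: "t \<in> tails n r lam (Suc (Suc k))" and u: "u \<in> tails n r lam k" and x: "x \<in> Inr n r" and y: "y \<in> Inr n r"
  shows "(\<Sum>t'\<in>tails n r lam (Suc k). \<Sum>z\<in>Inr n r. bde n r lam t t' x z * (bde n r lam t' u z y :: 'a::comm_ring_1)) = 0"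
proof -
  obtain w v t0 where tt: "t = w # v # t0" "w \<in> Jm n r" "v \<in> Jm n r" "colc n w = rowc n v" "t0 \<in> tails n r lam k" "colc n v = tsw n lam t0"
    using t by auto
  have vt: "v # t0 \<in> tails n r lam (Suc k)" using tt by auto
  let ?bd = "bde n r lam :: mat list \<Rightarrow> mat list \<Rightarrow> nat list \<Rightarrow> nat list \<Rightarrow> 'a"
  let ?rh = "rho n r :: mat \<Rightarrow> mat list \<Rightarrow> mat list \<Rightarrow> 'a" and ?cs = "cst n r :: mat \<Rightarrow> mat \<Rightarrow> mat \<Rightarrow> 'a"
  define E where "E \<longleftrightarrow> x = y \<and> cont x = tsw n lam u"
  have gen: "M * ?bd (e # t') u x y = (if u = t' then M * chi e x y else 0) - (if E then M * ?rh e t' u else 0)" for M e t'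
    unfolding bde_Cons[OF x y] by (auto simp: right_diff_distrib E_def)
  have "(\<Sum>z\<in>Inr n r. ?bd t t' x z * ?bd t' u z y)
    = (if t' = v # t0 then (\<Sum>z\<in>Inr n r. chi w x z * ?bd (v # t0) u z y) else 0)
      - (if cont x = tsw n lam t' then ?rh w (v # t0) t' else 0) * ?bd t' u x y" for t'
  proof -
    have "(\<Sum>z\<in>Inr n r. ?bd t t' x z * ?bd t' u z y)
      = (\<Sum>z\<in>Inr n r. (if t' = v # t0 then chi w x z * ?bd (v # t0) u z y else 0)
         - (if x = z then (if cont x = tsw n lam t' then ?rh w (v # t0) t' else 0) * ?bd t' u x y else 0))"
      using x y by (intro sum.cong refl) (auto simp: tt(1) bde_Cons left_diff_distrib)
    then show ?thesis using x by (simp add: sum_subtractf)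
  qed
  then have "(\<Sum>t'\<in>tails n r lam (Suc k). \<Sum>z\<in>Inr n r. ?bd t t' x z * ?bd t' u z y)
    = (\<Sum>z\<in>Inr n r. chi w x z * ?bd (v # t0) u z y)
     - (\<Sum>t'\<in>tails n r lam (Suc k). (if cont x = tsw n lam t' then ?rh w (v # t0) t' else 0) * ?bd t' u x y)"
    using vt by (simp add: sum_subtractf del: tails.simps)
  also have "(\<Sum>z\<in>Inr n r. chi w x z * ?bd (v # t0) u z y)
     = (\<Sum>z\<in>Inr n r. (if u = t0 then chi w x z * chi v z y else 0) - (if z = y then chi w x y * ?rh v t0 u else 0))"
  proof (intro sum.cong refl)
    fix z assume z: "z \<in> Inr n r"
    \<comment> \<open>The idempotent condition holds automatically wherever both factors are
      nonzero, since their contents match along the chain.\<close>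
    have "chi w x y * (if cont y = tsw n lam u then ?rh v t0 u else 0) = chi w x y * ?rh v t0 u"
    proof (cases "chi w x y = (0::'a) \<or> ?rh v t0 u = 0")
      case False
      then have "cont y = colc n w" using chi_nz colc_wt[OF x y] by metis
      moreover have "tsw n lam u = rowc n v" using rho_supp[OF vt u] False by blast
      ultimately show ?thesis using tt by simp
    qed auto
    then show "chi w x z * ?bd (v # t0) u z y = (if u = t0 then chi w x z * chi v z y else 0) - (if z = y then chi w x y * ?rh v t0 u else 0)"
      using z y by (auto simp: bde_Cons right_diff_distrib)
  qed
  also have "\<dots> = (if u = t0 then ?cs w v (wt x y) else 0) - chi w x y * ?rh v t0 u"
    using y by (simp add: sum_subtractf cst_wt[OF x y] kconv_def)
  also have "(\<Sum>t'\<in>tails n r lam (Suc k). (if cont x = tsw n lam t' then ?rh w (v # t0) t' else 0) * ?bd t' u x y)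
    = (\<Sum>t'\<in>tails n r lam (Suc k). (if tl t' = t0 then (if cont x = rowc n (hd t') then ?cs w v (hd t') else 0) else 0) * ?bd t' u x y)
     - (\<Sum>t'\<in>tails n r lam (Suc k). (if hd t' = w then (if cont x = rowc n w then ?rh v t0 (tl t') else 0) else 0) * ?bd t' u x y)"
    unfolding sum_subtractf[symmetric]
  proof (intro sum.cong refl)
    fix t' assume t': "t' \<in> tails n r lam (Suc k)"
    show "(if cont x = tsw n lam t' then ?rh w (v # t0) t' else 0) * ?bd t' u x y =
       (if tl t' = t0 then (if cont x = rowc n (hd t') then ?cs w v (hd t') else 0) else 0) * ?bd t' u x y -
       (if hd t' = w then (if cont x = rowc n w then ?rh v t0 (tl t') else 0) else 0) * ?bd t' u x y"
      unfolding rho_tails[OF t'] tsw_tails[OF t'] by (auto simp: left_diff_distrib)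
  qed
  also have "(\<Sum>t'\<in>tails n r lam (Suc k). (if tl t' = t0 then (if cont x = rowc n (hd t') then ?cs w v (hd t') else 0) else 0) * ?bd t' u x y)
    = (\<Sum>e\<in>Jm n r. (if cont x = rowc n e then ?cs w v e else 0) * ?bd (e # t0) u x y)"
  proof (rule sum_tails_tl[OF tt(5)])
    fix e assume e: "e \<in> Jm n r" "(if cont x = rowc n e then ?cs w v e else 0) \<noteq> 0"
    then have "?cs w v e \<noteq> 0" by (auto split: if_splits)
    then show "colc n e = tsw n lam t0" using cst_nz[OF subsetD[OF Jm_sub e(1)] tt(2,3), where 'a = 'a] tt(6) by simp
  qed
  also have "\<dots> = (\<Sum>e\<in>Jm n r. (if u = t0 then ?cs w v e * chi e x y else 0) - (if E then ?cs w v e * ?rh e t0 u else 0))"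
  proof (intro sum.cong refl)
    fix e assume e: "e \<in> Jm n r"
    have 1: "(if cont x = rowc n e then ?cs w v e else 0) * chi e x y = ?cs w v e * chi e x y"
      using rowc_wt[OF x y] by (cases "wt x y = e") (auto simp: chi_def)
    have 2: "(if cont x = rowc n e then ?cs w v e else 0) * ?rh e t0 u = ?cs w v e * ?rh e t0 u" if "E"
    proof (cases "?cs w v e = 0 \<or> ?rh e t0 u = 0")
      case False
      then have "e # t0 \<in> tails n r lam (Suc k)" using cst_nz[OF subsetD[OF Jm_sub e] tt(2,3), where 'a = 'a] tt e by auto
      then have "tsw n lam u = rowc n e" using rho_supp u False by blast
      then show ?thesis using that by (auto simp: E_def)
    qed auto
    show "(if cont x = rowc n e then ?cs w v e else 0) * ?bd (e # t0) u x y
       = (if u = t0 then ?cs w v e * chi e x y else 0) - (if E then ?cs w v e * ?rh e t0 u else 0)"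
    proof (cases E)
      case True
      show ?thesis unfolding gen if_P[OF True] 1 2[OF True] by (rule refl)
    next
      case False
      show ?thesis unfolding gen if_not_P[OF False] 1 by (rule refl)
    qed
  qed
  also have "\<dots> = (if u = t0 then ?cs w v (wt x y) else 0) - (if E then (\<Sum>e\<in>Jm n r. ?cs w v e * ?rh e t0 u) else 0)"
    using sum_chi[OF x y, of "?cs w v"] cst_nz[OF _ tt(2,3), where 'a = 'a] by (auto simp: sum_subtractf)
  also have "(\<Sum>t'\<in>tails n r lam (Suc k). (if hd t' = w then (if cont x = rowc n w then ?rh v t0 (tl t') else 0) else 0) * ?bd t' u x y)
    = (\<Sum>u'\<in>tails n r lam k. (if cont x = rowc n w then ?rh v t0 u' else 0) * ?bd (w # u') u x y)"
  proof (rule sum_tails_hd[OF tt(2)])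
    fix s assume s: "s \<in> tails n r lam k" "(if cont x = rowc n w then ?rh v t0 s else 0) \<noteq> 0"
    then have "?rh v t0 s \<noteq> 0" by (auto split: if_splits)
    then show "colc n w = tsw n lam s" using rho_supp[OF vt s(1), where 'a = 'a] tt(4) by simp
  qed
  also have "\<dots> = (\<Sum>u'\<in>tails n r lam k. (if u' = u then ?rh v t0 u * chi w x y else 0) - (if E then ?rh v t0 u' * ?rh w u' u else 0))"
  proof (intro sum.cong refl)
    fix s assume s: "s \<in> tails n r lam k"
    have 1: "(if cont x = rowc n w then ?rh v t0 s else 0) * chi w x y = ?rh v t0 s * chi w x y"
      using rowc_wt[OF x y] by (cases "wt x y = w") (auto simp: chi_def)
    have 2: "(if cont x = rowc n w then ?rh v t0 s else 0) * ?rh w s u = ?rh v t0 s * ?rh w s u" if "E"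
    proof (cases "?rh v t0 s = 0 \<or> ?rh w s u = 0")
      case False
      then have "tsw n lam s = rowc n v" using rho_supp[OF vt s] by blast
      then have "w # s \<in> tails n r lam (Suc k)" using tt s by auto
      then have "tsw n lam u = rowc n w" using rho_supp u False by blast
      then show ?thesis using that by (auto simp: E_def)
    qed auto
    show "(if cont x = rowc n w then ?rh v t0 s else 0) * ?bd (w # s) u x y
       = (if s = u then ?rh v t0 u * chi w x y else 0) - (if E then ?rh v t0 s * ?rh w s u else 0)"
    proof (cases E)
      case True
      show ?thesis unfolding gen if_P[OF True] 1 2[OF True] by auto
    next
      case False
      show ?thesis unfolding gen if_not_P[OF False] 1 by auto
    qed
  qed
  also have "\<dots> = ?rh v t0 u * chi w x y - (if E then (\<Sum>u'\<in>tails n r lam k. ?rh v t0 u' * ?rh w u' u) else 0)"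
    using u by (simp add: sum_subtractf)
  also have "(\<Sum>e\<in>Jm n r. ?cs w v e * ?rh e t0 u) = (\<Sum>u'\<in>tails n r lam k. ?rh v t0 u' * ?rh w u' u)"
    by (rule rho_module[OF t[unfolded tt(1)] u])
  finally show ?thesis by (simp add: algebra_simps)
qed

lemma tri_complex_bar:
  assumes lam: "lam \<in> Comps n r"
  shows "tri_complex n r lam (tails n r lam) (tsw n lam) (bde n r lam :: _ \<Rightarrow> _ \<Rightarrow> _ \<Rightarrow> _ \<Rightarrow> 'a::comm_ring_1)"
proof
  show "finite (tails n r lam k)" for k by simp
  show "linv r (bde n r lam t u :: _ \<Rightarrow> _ \<Rightarrow> 'a)" for t u
  proof (rule linvI)
    fix p and x y :: "nat list" assume p: "p permutes {..<r}" and l: "length x = r" "length y = r"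
    have m: "permute_list p z \<in> Inr n r \<longleftrightarrow> z \<in> Inr n r" if "length z = r" for z
      using p that by (auto simp: Inr_def)
    have e: "permute_list p x = permute_list p y \<longleftrightarrow> x = y"
      using permute_list_inv(1)[OF p] l by metis
    show "bde n r lam t u (permute_list p x) (permute_list p y) = (bde n r lam t u x y :: 'a)"
      using m[OF l(1)] m[OF l(2)] e linvD[OF chi_inv[of r "hd t", where 'a = 'a] p l] p l by (auto simp: bde_def)
  qed
  show "lle x y \<and> cont x = tsw n lam t \<and> cont y = tsw n lam u"
    if t: "t \<in> tails n r lam (Suc k)" and u: "u \<in> tails n r lam k" and nz: "bde n r lam t u x y \<noteq> (0::'a)" for t k u x y
  proof -
    obtain w t0 where tt: "t = w # t0" "w \<in> Jm n r" "t0 \<in> tails n r lam k" "colc n w = tsw n lam t0" using t by auto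
    have xy: "x \<in> Inr n r" "y \<in> Inr n r" using nz by (auto simp: bde_def split: if_splits)
    have "(u = t0 \<and> chi w x y \<noteq> (0::'a)) \<or> (x = y \<and> cont x = tsw n lam u \<and> rho n r w t0 u \<noteq> (0::'a))"
      using nz unfolding tt bde_Cons[OF xy] by (auto split: if_splits)
    then show ?thesis
    proof
      assume a: "u = t0 \<and> chi w x y \<noteq> (0::'a)"
      then have "wt x y = w" using chi_nz by blast
      then show ?thesis using Jm_wt[OF xy] rowc_wt[OF xy] colc_wt[OF xy] tt a by auto
    next
      assume a: "x = y \<and> cont x = tsw n lam u \<and> rho n r w t0 u \<noteq> (0::'a)"
      then have "tsw n lam u = rowc n w" using rho_supp t u tt by blast
      then show ?thesis using a tt by (auto simp: list_all2_same)
    qed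
  qed
  show "(\<Sum>t'\<in>tails n r lam (Suc k). \<Sum>z\<in>Inr n r. bde n r lam t t' x z * (bde n r lam t' u z y :: 'a)) = 0"
    if "t \<in> tails n r lam (Suc (Suc k))" "u \<in> tails n r lam k" "x \<in> Inr n r" "y \<in> Inr n r" for t k u x y
    using bde_sq[OF that] .
  show "lam \<in> Comps n r" by fact
  show dom: "(\<Sum>c\<in>{1..m}. lam c) \<le> (\<Sum>c\<in>{1..m}. tsw n lam t c)" if "t \<in> tails n r lam k" for t k m
    using that
  proof (induction k arbitrary: t)
    case (Suc k)
    then obtain w t0 where tt: "t = w # t0" "w \<in> Jm n r" "t0 \<in> tails n r lam k" "colc n w = tsw n lam t0" by auto
    obtain x y where xy: "x \<in> Inr n r" "y \<in> Inr n r" "wt x y = w" using Mats_wt[OF subsetD[OF Jm_sub tt(2)]] by blast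
    have "lle x y" using Jm_wt xy tt by blast
    then have "(\<Sum>c\<in>{1..m}. cont y c) \<le> (\<Sum>c\<in>{1..m}. cont x c)"
      by (rule lle_prefix_sums) (use xy in \<open>auto simp: Inr_def\<close>)
    then have "(\<Sum>c\<in>{1..m}. tsw n lam t0 c) \<le> (\<Sum>c\<in>{1..m}. tsw n lam t c)"
      using rowc_wt[OF xy(1,2)] colc_wt[OF xy(1,2)] xy(3) tt by simp
    then show ?case using Suc.IH[OF tt(3)] by simp
  qed simp
  \<comment> \<open>Sum of the letters of a word with content \<open>f\<close>. Each matrix of J
    strictly increases it from row content to column content, so a nonempty chain starts at a weight
    of smaller potential than \<open>lam\<close>, hence different from \<open>lam\<close>.\<close>
  define pot :: "(nat \<Rightarrow> nat) \<Rightarrow> nat" where "pot f = (\<Sum>c\<in>{1..n}. c * f c)" for f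
  have step: "pot (rowc n w) < pot (colc n w)" if wJ: "w \<in> Jm n r" for w
  proof -
    obtain x y where xy: "x \<in> Inr n r" "y \<in> Inr n r" "wt x y = w" using Mats_wt[OF subsetD[OF Jm_sub wJ]] by blast
    then have "lle x y" "x \<noteq> y" using Jm_wt wJ by blast+
    then have "sum_list x < sum_list y" by (rule lle_sum_list)
    then show ?thesis using rowc_wt[OF xy(1,2)] colc_wt[OF xy(1,2)] xy sum_list_cont by (simp add: pot_def)
  qed
  have le: "pot (tsw n lam t) \<le> pot lam" if "t \<in> tails n r lam k" for t k
    using that
  proof (induction k arbitrary: t)
    case (Suc k)
    then obtain w t0 where tt: "t = w # t0" "w \<in> Jm n r" "t0 \<in> tails n r lam k" "colc n w = tsw n lam t0" by auto
    then show ?case using step[OF tt(2)] Suc.IH[OF tt(3)] by simp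
  qed simp
  show "tsw n lam t \<noteq> lam" if t: "t \<in> tails n r lam (Suc k)" for t k
  proof -
    obtain w t0 where tt: "t = w # t0" "w \<in> Jm n r" "t0 \<in> tails n r lam k" "colc n w = tsw n lam t0" using t by auto
    then have "pot (tsw n lam t) < pot lam" using step[OF tt(2)] le[OF tt(3)] by simp
    then show ?thesis by auto
  qed
qed

text \<open>The right module spanned by a staircase is projective: prepending the idempotent is a contracting homotopy.\<close>
lemma bar_staircase:
  fixes nu :: "lab multiset"
  assumes lam: "lam \<in> Comps n r" and Rw: "set_mset nu \<subseteq> range Rw" and inj: "inj_on cc {l. Rw l \<in># nu}"
    and rg: "\<And>l. Rw l \<in># nu \<Longrightarrow> cc l \<in> {1..n}" and ne: "cl cc nu \<noteq> lam"
  shows "tri_complex.Ac n r (tails n r lam) (tsw n lam) (bde n r lam :: _ \<Rightarrow> _ \<Rightarrow> _ \<Rightarrow> _ \<Rightarrow> 'a::comm_ring_1) cc nu"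
proof -
  interpret T: tri_complex n r lam "tails n r lam" "tsw n lam" "bde n r lam :: _ \<Rightarrow> _ \<Rightarrow> _ \<Rightarrow> _ \<Rightarrow> 'a"
    by (rule tri_complex_bar[OF lam])
  let ?Om = "Ome n r cc nu" and ?W = "Inr n r"
  let ?bd = "bde n r lam :: mat list \<Rightarrow> mat list \<Rightarrow> nat list \<Rightarrow> nat list \<Rightarrow> 'a"
  let ?rh = "rho n r :: mat \<Rightarrow> mat list \<Rightarrow> mat list \<Rightarrow> 'a" and ?cs = "cst n r :: mat \<Rightarrow> mat \<Rightarrow> mat \<Rightarrow> 'a"
  \<comment> \<open>\<open>c i\<close> is the least right word for \<open>i\<close>. Distinct
    starting columns let it determine \<open>i\<close>, so the module is generated by the idempotent
    of weight \<open>cl cc nu\<close>.\<close>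
  define c where "c i = map (colof cc) i" for i
  define ok where "ok i \<longleftrightarrow> mset i = nu \<and> length i = r" for i
  \<comment> \<open>Some word completing \<open>y\<close> to a pair in the orbit \<open>w\<close>;
    by \<open>L1\<close> the values of a chain do not depend on the choice.\<close>
  define X where "X y w = (SOME x. x \<in> ?W \<and> wt y x = w)" for y w
  have lab: "\<exists>l. a = Rw l \<and> Rw l \<in># nu" if "ok i" "a \<in> set i" for i a
  proof -
    have "a \<in># nu" using that by (auto simp: ok_def)
    then show ?thesis using Rw by auto
  qed
  have cW: "c i \<in> ?W" if "ok i" for i
  proof -
    have "colof cc a \<in> {1..n}" if "a \<in> set i" for a using lab[OF \<open>ok i\<close> that] rg by auto
    then show ?thesis using that by (auto simp: Inr_def ok_def c_def)
  qed
  have Om_iff: "?Om i j \<longleftrightarrow> ok i \<and> j \<in> ?W \<and> lle (c i) j" for i j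
  proof -
    have "list_all2 (al cc) i j \<longleftrightarrow> lle (c i) j" if ii: "ok i"
      unfolding c_def list_all2_map1
    proof (rule list.rel_cong[OF refl refl])
      fix a b assume "a \<in> set i"
      then obtain l where "a = Rw l" using lab[OF ii] by blast
      then show "al cc a b \<longleftrightarrow> colof cc a \<le> b" by simp
    qed
    then show ?thesis by (auto simp: Ome_def ok_def)
  qed
  have cc_cont: "cont (c i) = cl cc nu" if "ok i" for i
    using that by (simp add: c_def cl_def ok_def)
  have Xp: "X y w \<in> ?W \<and> wt y (X y w) = w" if y: "y \<in> ?W" and w: "w \<in> Jm n r" and rc: "rowc n w = cont y" for y w
  proof -
    obtain x0 y0 where xy: "x0 \<in> ?W" "y0 \<in> ?W" "wt x0 y0 = w" using Mats_wt[OF subsetD[OF Jm_sub w]] by blast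
    have "cont x0 = cont y" using rowc_wt[OF xy(1,2)] xy rc by simp
    then have "mset y = mset x0" by (intro multiset_eqI) metis
    then obtain p where p: "p permutes {..<length x0}" "permute_list p x0 = y" using mset_eq_permutation by blast
    have p': "p permutes {..<r}" using p xy by (simp add: Inr_length)
    have "permute_list p y0 \<in> ?W \<and> wt y (permute_list p y0) = w"
      using permute_list_Inr[OF p' xy(2)] wt_perm[OF p', of x0 y0] xy p(2) by (simp add: Inr_length)
    then show ?thesis unfolding X_def by (rule someI)
  qed
  \<comment> \<open>A permutation that fixes \<open>c i\<close> fixes \<open>i\<close>, because
    distinct labels of \<open>nu\<close> have distinct columns.\<close>
  have L1: "F t i x = F t i x'" if F: "F \<in> T.C ?Om k" and i: "ok i" and x: "x \<in> ?W" "x' \<in> ?W" and e: "wt (c i) x = wt (c i) x'"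
    for F k t i x x'
  proof -
    have l: "length (c i) = r" "length x = r" "length x' = r" "length i = r" using i x by (auto simp: c_def ok_def Inr_length)
    obtain p where p: "p permutes {..<r}" "permute_list p (c i) = c i" "permute_list p x = x'"
      using wt_orbit[OF l(1,2,1,3) e] by blast
    have "map (colof cc) (permute_list p i) = map (colof cc) i"
      using p(2) permute_list_map[of p i "colof cc"] p(1) l by (simp add: c_def)
    moreover have "inj_on (colof cc) (set (permute_list p i) \<union> set i)"
    proof (rule inj_onI)
      fix a b assume a: "a \<in> set (permute_list p i) \<union> set i" "b \<in> set (permute_list p i) \<union> set i" "colof cc a = colof cc b"
      have "a \<in> set i" "b \<in> set i" using a p(1) l by auto
      then obtain l l' where l: "a = Rw l" "Rw l \<in># nu" "b = Rw l'" "Rw l' \<in># nu" using lab[OF i] by metis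
      then have "cc l = cc l'" using a(3) by simp
      then have "l = l'" using inj_onD[OF inj, of l l'] l by simp
      then show "a = b" using l by simp
    qed
    ultimately have "permute_list p i = i" using inj_on_map_eq_map by metis
    then show ?thesis using linvD[OF T.C_inv[OF F] p(1), of i x t] p(3) l by simp
  qed
  have "T.ex ?Om k" for k
    unfolding T.ex_def
  proof (intro allI impI)
    fix F assume cyc: "T.cyc ?Om k F"
    then have F: "F \<in> T.C ?Om k" by (simp add: T.cyc_def)
    \<comment> \<open>The value of \<open>F\<close> at \<open>(i, x)\<close> is read as the
      coefficient of the matrix \<open>wt (c i) x\<close>, which becomes the new head of the chain
      behind the idempotent of weight \<open>cont (c i)\<close>.\<close>
    define S where "S t i j = (if t \<in> tails n r lam (Suc k) \<and> ok i \<and> j = c i \<and> cont j = tsw n lam t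
       then F (tl t) i (X j (hd t)) else 0)" for t i j
    have SC: "S \<in> T.C ?Om (Suc k)"
      unfolding T.C_def
    proof (intro CollectI conjI allI impI)
      fix t i j assume "S t i j \<noteq> 0"
      then have a: "t \<in> tails n r lam (Suc k)" "ok i" "j = c i" "cont j = tsw n lam t" by (auto simp: S_def split: if_splits)
      then show "t \<in> tails n r lam (Suc k)" "?Om i j" "cont j = tsw n lam t"
        using Om_iff cW by (auto simp: list_all2_same)
    next
      fix t show "linv r (S t)"
      proof (rule linvI)
        fix p and i :: "lab list" and j :: "nat list" assume p: "p permutes {..<r}" and l: "length i = r" "length j = r"
        have cp: "c (permute_list p i) = permute_list p (c i)"
          using permute_list_map[of p i "colof cc"] p l by (simp add: c_def)
        have lc: "length (c i) = r" using l by (simp add: c_def)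
        have e: "permute_list p j = permute_list p (c i) \<longleftrightarrow> j = c i"
          using permute_list_inv(1)[OF p] l lc by metis
        have okp: "ok (permute_list p i) \<longleftrightarrow> ok i" using p l by (simp add: ok_def)
        show "S t (permute_list p i) (permute_list p j) = S t i j"
        proof (cases "t \<in> tails n r lam (Suc k) \<and> ok i \<and> j = c i \<and> cont j = tsw n lam t")
          case True
          then have t: "t \<in> tails n r lam (Suc k)" by blast
          have w: "hd t \<in> Jm n r" using t by auto
          have w2: "rowc n (hd t) = cont j" using tsw_tails[OF t] True by metis
          have jW: "j \<in> ?W" "permute_list p j \<in> ?W" using True cW permute_list_Inr[OF p] by auto
          have x1: "X j (hd t) \<in> ?W" "wt j (X j (hd t)) = hd t" using Xp[OF jW(1) w w2] by auto
          have x2: "X (permute_list p j) (hd t) \<in> ?W" "wt (permute_list p j) (X (permute_list p j) (hd t)) = hd t"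
            using Xp[OF jW(2) w] w2 p l by simp_all
          have "F (tl t) (permute_list p i) (X (permute_list p j) (hd t)) = F (tl t) (permute_list p i) (permute_list p (X j (hd t)))"
          proof (rule L1[OF F])
            show "ok (permute_list p i)" using okp True by blast
            show "permute_list p (X j (hd t)) \<in> ?W" by (rule permute_list_Inr[OF p x1(1)])
            show "wt (c (permute_list p i)) (X (permute_list p j) (hd t)) = wt (c (permute_list p i)) (permute_list p (X j (hd t)))"
              using x1 x2 True wt_perm[OF p l(2) Inr_length[OF x1(1)]] by (simp add: cp)
          qed (rule x2)
          also have "\<dots> = F (tl t) i (X j (hd t))" using linvD[OF T.C_inv[OF F] p] l x1 by (simp add: Inr_length)
          finally show ?thesis using True okp cp p l by (simp add: S_def)
        next
          case False
          then show ?thesis using okp cp e p l by (auto simp: S_def)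
        qed
      qed
    qed
    have "T.D ?Om k S u i j = F u i j" for u i j
    proof (cases "u \<in> tails n r lam k \<and> ?Om i j")
      case False
      then show ?thesis using T.C_supp[OF F, of u i j] by (auto simp: T.D_def)
    next
      case True
      then have u: "u \<in> tails n r lam k" and i: "ok i" and j: "j \<in> ?W" "lle (c i) j" using Om_iff by auto
      let ?c = "c i"
      have c: "?c \<in> ?W" by (rule cW[OF i])
      define E where "E \<longleftrightarrow> ?c = j \<and> cont ?c = tsw n lam u"
      define G where "G t = (if cont ?c = tsw n lam t then F (tl t) i (X ?c (hd t)) else 0)" for t
      have "(\<Sum>t\<in>tails n r lam (Suc k). \<Sum>x\<in>?W. S t i x * ?bd t u x j)
        = (\<Sum>t\<in>tails n r lam (Suc k). \<Sum>x\<in>?W. if x = ?c then G t * ?bd t u ?c j else 0)"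
        by (intro sum.cong refl) (auto simp: S_def G_def i)
      also have "\<dots> = (\<Sum>t\<in>tails n r lam (Suc k). (if tl t = u then G t * chi (hd t) ?c j else 0)
          - (if E then G t * ?rh (hd t) (tl t) u else 0))"
        using c j by (intro sum.cong refl) (auto simp: bde_tails right_diff_distrib E_def simp del: tails.simps)
      also have "\<dots> = (\<Sum>t\<in>tails n r lam (Suc k). if tl t = u then G t * chi (hd t) ?c j else 0)
          - (if E then (\<Sum>t\<in>tails n r lam (Suc k). G t * ?rh (hd t) (tl t) u) else 0)"
        by (simp add: sum_subtractf del: tails.simps)
      finally have D: "T.D ?Om k S u i j = \<dots>" using True by (simp add: T.D_def del: tails.simps)
      \<comment> \<open>Off the diagonal, multiplying the idempotent by the head restores
        \<open>F\<close>. The diagonal pair does not belong to J and is missed.\<close>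
      have A: "(\<Sum>t\<in>tails n r lam (Suc k). if tl t = u then G t * chi (hd t) ?c j else 0) = (if ?c = j then 0 else F u i j)"
      proof -
        let ?w = "wt ?c j"
        have "(\<Sum>t\<in>tails n r lam (Suc k). if tl t = u then G t * chi (hd t) ?c j else 0)
          = (\<Sum>t\<in>tails n r lam (Suc k). if t = ?w # u then F u i (X ?c ?w) else 0)"
        proof (intro sum.cong refl)
          fix t assume t: "t \<in> tails n r lam (Suc k)"
          then obtain w t0 where "t = w # t0" by auto
          then show "(if tl t = u then G t * chi (hd t) ?c j else 0) = (if t = ?w # u then F u i (X ?c ?w) else 0)"
            using rowc_wt[OF c j(1)] by (auto simp: G_def chi_def)
        qed
        also have "\<dots> = (if ?w # u \<in> tails n r lam (Suc k) then F u i (X ?c ?w) else 0)"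
          by (simp del: tails.simps)
        also have "\<dots> = (if ?c = j then 0 else F u i j)"
        proof (cases "?c = j")
          case True
          then show ?thesis using Jm_wt[OF c j(1)] by (auto simp: tails_Cons)
        next
          case False
          then have w: "?w \<in> Jm n r" using Jm_wt[OF c j(1)] j by blast
          have x: "X ?c ?w \<in> ?W" "wt ?c (X ?c ?w) = ?w" using Xp[OF c w] rowc_wt[OF c j(1)] by auto
          have "F u i (X ?c ?w) = F u i j" using L1[OF F i x(1) j(1)] x by blast
          moreover have "?w # u \<in> tails n r lam (Suc k) \<longleftrightarrow> cont j = tsw n lam u"
            using w u colc_wt[OF c j(1)] by (simp add: tails_Cons del: tails.simps)
          moreover have "F u i j = 0" if "cont j \<noteq> tsw n lam u" using T.C_supp[OF F] that by blast
          ultimately show ?thesis using False by auto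
        qed
        finally show ?thesis .
      qed
      show ?thesis
      proof (cases "?c = j \<and> cont ?c = tsw n lam u")
        case False
        then have "(if ?c = j then 0 else F u i j) = F u i j" using T.C_supp[OF F, of u i j] by auto
        moreover have "\<not> E" using False by (simp add: E_def)
        ultimately show ?thesis unfolding D A by simp
      next
        case cj: True
        \<comment> \<open>The missing diagonal value has to come from the \<open>rho\<close> part.
          It is extracted from the cycle condition on \<open>F\<close> at the tail \<open>u'\<close>
          of \<open>u\<close> and a word \<open>y\<close> for which \<open>wt (c i) y\<close> is the
          head of \<open>u\<close>. In degree 0 this case is void, because \<open>cont (c i)\<close>
          is not \<open>lam\<close>.\<close>
        have "(\<Sum>t\<in>tails n r lam (Suc k). G t * ?rh (hd t) (tl t) u) = - F u i ?c"
        proof (cases k)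
          case 0
          then have "tsw n lam u = lam" using u by simp
          then show ?thesis using cj cc_cont[OF i] ne by simp
        next
          case (Suc k')
          obtain z u' where z: "u = z # u'" "z \<in> Jm n r" "u' \<in> tails n r lam k'" "colc n z = tsw n lam u'" using u Suc by auto
          have rz: "rowc n z = cont ?c" using conjunct2[OF cj] z(1) by simp
          define y where "y = X ?c z"
          have y: "y \<in> ?W" "wt ?c y = z" using Xp[OF c z(2) rz] by (auto simp: y_def)
          have cy: "cont y = tsw n lam u'" using colc_wt[OF c y(1)] y z by simp
          have "lle ?c y" using Jm_wt[OF c y(1)] y z by blast
          then have Oy: "?Om i y" using Om_iff i y by blast
          have Fsup: "x = ?c \<or> wt ?c x \<in> Jm n r" if "F s i x \<noteq> 0" for s x
            using T.C_supp[OF F that] Om_iff Jm_wt[OF c] by blast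
          have "T.D ?Om k' F u' i y = 0" using cyc Suc by (simp add: T.cyc_def)
          then have "0 = (\<Sum>s\<in>tails n r lam k. \<Sum>x\<in>?W. F s i x * ?bd s u' x y)"
            using z Oy Suc by (simp add: T.D_def del: tails.simps)
          also have "\<dots> = (\<Sum>s\<in>tails n r lam k. \<Sum>x\<in>?W. (if tl s = u' then F s i x * chi (hd s) x y else 0)
             - (if x = y then F s i y * ?rh (hd s) (tl s) u' else 0))"
            using y cy Suc by (intro sum.cong refl) (auto simp: bde_tails right_diff_distrib simp del: tails.simps)
          also have "\<dots> = (\<Sum>s\<in>tails n r lam k. if tl s = u' then (\<Sum>x\<in>?W. F s i x * chi (hd s) x y) else 0)
             - (\<Sum>s\<in>tails n r lam k. F s i y * ?rh (hd s) (tl s) u')"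
          proof -
            have "(\<Sum>x\<in>?W. if P then f x else 0) = (if P then (\<Sum>x\<in>?W. f x) else 0)" for P and f :: "nat list \<Rightarrow> 'a" by simp
            then show ?thesis using y by (simp add: sum_subtractf del: tails.simps)
          qed
          finally have EE: "(\<Sum>s\<in>tails n r lam k. F s i y * ?rh (hd s) (tl s) u')
             = (\<Sum>s\<in>tails n r lam k. if tl s = u' then (\<Sum>x\<in>?W. F s i x * chi (hd s) x y) else 0)" by simp
          define g where "g w s = (if colc n w = tsw n lam s then G (w # s) else 0)" for w s
          have "(\<Sum>t\<in>tails n r lam (Suc k). G t * ?rh (hd t) (tl t) u)
            = (\<Sum>w\<in>Jm n r. \<Sum>s\<in>tails n r lam k. g w s * ?rh w s u)"
            unfolding sum_tails by (intro sum.cong refl) (simp add: g_def)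
          also have "\<dots> = (\<Sum>w\<in>Jm n r. \<Sum>s\<in>tails n r lam k. (if tl s = u' then g w s * ?cs w (hd s) z else 0)
             - (if w = z then g z s * ?rh (hd s) (tl s) u' else 0))"
          proof (intro sum.cong refl)
            fix w s assume s: "s \<in> tails n r lam k"
            then obtain v s' where vs: "s = v # s'" using Suc by auto
            show "g w s * ?rh w s u = (if tl s = u' then g w s * ?cs w (hd s) z else 0) - (if w = z then g z s * ?rh (hd s) (tl s) u' else 0)"
              unfolding vs z(1) by (simp add: right_diff_distrib eq_commute)
          qed
          also have "\<dots> = (\<Sum>w\<in>Jm n r. \<Sum>s\<in>tails n r lam k. if tl s = u' then g w s * ?cs w (hd s) z else 0)
             - (\<Sum>w\<in>Jm n r. if w = z then (\<Sum>s\<in>tails n r lam k. g z s * ?rh (hd s) (tl s) u') else 0)"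
          proof -
            have "(\<Sum>s\<in>tails n r lam k. if w = z then g z s * ?rh (hd s) (tl s) u' else 0)
              = (if w = z then (\<Sum>s\<in>tails n r lam k. g z s * ?rh (hd s) (tl s) u') else 0)" for w by simp
            then show ?thesis by (simp add: sum_subtractf)
          qed
          also have "(\<Sum>w\<in>Jm n r. if w = z then (\<Sum>s\<in>tails n r lam k. g z s * ?rh (hd s) (tl s) u') else 0)
             = (\<Sum>s\<in>tails n r lam k. F s i y * ?rh (hd s) (tl s) u')"
          proof -
            have "g z s = F s i y" for s
              using T.C_supp[OF F, of s i y] rz colc_wt[OF c y(1)] y by (auto simp: g_def G_def y_def)
            then show ?thesis using z by simp
          qed
          also have "(\<Sum>w\<in>Jm n r. \<Sum>s\<in>tails n r lam k. if tl s = u' then g w s * ?cs w (hd s) z else 0)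
            = (\<Sum>s\<in>tails n r lam k. \<Sum>w\<in>Jm n r. if tl s = u' then g w s * ?cs w (hd s) z else 0)"
            by (rule sum.swap)
          also have "\<dots> = (\<Sum>s\<in>tails n r lam k. (if tl s = u' then (\<Sum>x\<in>?W. F s i x * chi (hd s) x y) else 0)
              - (if s = u then F u i ?c else 0))"
          proof (rule sum.cong[OF refl])
            fix s assume s: "s \<in> tails n r lam k"
            then obtain v s' where vs: "s = v # s'" using Suc by auto
            show "(\<Sum>w\<in>Jm n r. if tl s = u' then g w s * ?cs w (hd s) z else 0)
              = (if tl s = u' then (\<Sum>x\<in>?W. F s i x * chi (hd s) x y) else 0) - (if s = u then F u i ?c else 0)"
            proof (cases "tl s = u'")
              case True
              have "(\<Sum>w\<in>Jm n r. g w s * ?cs w v z) = (\<Sum>w\<in>Jm n r. \<Sum>x\<in>?W. g w s * (chi w ?c x * chi v x y))"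
                unfolding y(2)[symmetric] cst_wt[OF c y(1)] kconv_def sum_distrib_left by (rule refl)
              also have "\<dots> = (\<Sum>x\<in>?W. \<Sum>w\<in>Jm n r. g w s * (chi w ?c x * chi v x y))" by (rule sum.swap)
              also have "\<dots> = (\<Sum>x\<in>?W. F s i x * chi v x y - (if x = ?c then F s i ?c * chi v ?c y else 0))"
              proof (rule sum.cong[OF refl])
                fix x assume x: "x \<in> ?W"
                let ?w = "wt ?c x"
                have "(\<Sum>w\<in>Jm n r. g w s * (chi w ?c x * chi v x y)) = (\<Sum>w\<in>Jm n r. if w = ?w then g ?w s * chi v x y else 0)"
                  by (intro sum.cong) (auto simp: chi_def)
                also have "\<dots> = (if ?w \<in> Jm n r then g ?w s * chi v x y else 0)" by simp
                also have "\<dots> = F s i x * chi v x y - (if x = ?c then F s i ?c * chi v ?c y else 0)"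
                proof (cases "?w \<in> Jm n r")
                  case True
                  then have "x \<noteq> ?c" using Jm_wt[OF c x] by auto
                  have xx: "X ?c ?w \<in> ?W" "wt ?c (X ?c ?w) = ?w" using Xp[OF c True] rowc_wt[OF c x] by auto
                  have "F s i (X ?c ?w) = F s i x" using L1[OF F i xx(1) x] xx by blast
                  then have "g ?w s = F s i x"
                    using T.C_supp[OF F, of s i x] rowc_wt[OF c x] colc_wt[OF c x] by (auto simp: g_def G_def)
                  then show ?thesis using True \<open>x \<noteq> ?c\<close> by simp
                next
                  case False
                  then have "x \<noteq> ?c \<Longrightarrow> F s i x = 0" using Fsup by blast
                  then show ?thesis using False by auto
                qed
                finally show "(\<Sum>w\<in>Jm n r. g w s * (chi w ?c x * chi v x y)) = F s i x * chi v x y - (if x = ?c then F s i ?c * chi v ?c y else 0)" .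
              qed
              also have "\<dots> = (\<Sum>x\<in>?W. F s i x * chi v x y) - F s i ?c * chi v ?c y" using c by (simp add: sum_subtractf)
              also have "F s i ?c * chi v ?c y = (if s = u then F u i ?c else 0)"
                using True y(2) by (auto simp: vs z(1) chi_def)
              finally show ?thesis using True by (simp add: vs)
            next
              case False
              then show ?thesis using vs z(1) by auto
            qed
          qed
          also have "\<dots> = (\<Sum>s\<in>tails n r lam k. if tl s = u' then (\<Sum>x\<in>?W. F s i x * chi (hd s) x y) else 0) - F u i ?c"
            using u by (simp add: sum_subtractf)
          finally show ?thesis unfolding EE by simp
        qed
        moreover have "E" unfolding E_def by (rule cj)
        ultimately show ?thesis unfolding D A using conjunct1[OF cj] by (simp del: tails.simps)
      qed
    qed
    then show "\<exists>G\<in>T.C ?Om (Suc k). T.D ?Om k G = F" using SC by (intro bexI[of _ S]) (auto simp: fun_eq_iff)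
  qed
  then show ?thesis by (simp add: T.Ac_def)
qed

lemma acyclic_base_bar:
  assumes lam: "lam \<in> Comps n r"
  shows "acyclic_base n r lam (tails n r lam) (tsw n lam) (bde n r lam :: _ \<Rightarrow> _ \<Rightarrow> _ \<Rightarrow> _ \<Rightarrow> 'a::comm_ring_1)"
  using tri_complex_bar[OF lam] bar_staircase[OF lam] by (intro acyclic_base.intro acyclic_base_axioms.intro) blast+

text \<open>The content of the left word splits the complex. For a fixed content the left letters
  serve as row labels, all rows starting in column 1 and without twists, so \<open>mu\<close> is
  \<open>lam\<close> itself and its dominance is what \<open>dominant_exact\<close> asks
  for.\<close>

theorem bar_exact:
  assumes lam: "lam \<in> CompsDom n r"
  shows "tri_complex.ex n r (tails n r lam) (tsw n lam) (bde n r lam :: _ \<Rightarrow> _ \<Rightarrow> _ \<Rightarrow> _ \<Rightarrow> 'a::comm_ring_1)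
     (\<lambda>i j. i \<in> Inr n r \<and> j \<in> Inr n r) (Suc k)"
proof -
  have lamC: "lam \<in> Comps n r" using lam by (simp add: CompsDom_def)
  interpret T: acyclic_base n r lam "tails n r lam" "tsw n lam" "bde n r lam :: _ \<Rightarrow> _ \<Rightarrow> _ \<Rightarrow> _ \<Rightarrow> 'a"
    by (rule acyclic_base_bar[OF lamC])
  let ?W = "Inr n r"
  define Om where "Om = (\<lambda>i j. i \<in> ?W \<and> j \<in> ?W)"
  have reg: "region n r Om"
    unfolding region_def Om_def
  proof (intro conjI allI impI)
    fix i x y z assume "i \<in> ?W \<and> x \<in> ?W" "i \<in> ?W \<and> z \<in> ?W" "lle x y" "lle y z"
    then show "i \<in> ?W" "y \<in> ?W" using lle_Inr by blast+
  qed (use permute_list_Inr in \<open>auto simp: Inr_length\<close>)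
  have dom: "lam (Suc c) \<le> lam c" if "1 \<le> c" for c
  proof (cases "Suc c \<le> n")
    case True
    then show ?thesis using lam that by (auto simp: CompsDom_def)
  qed (use T.lam_out in auto)
  have e: "T.ex (\<lambda>i j. Om i j \<and> mset i = m) (Suc k)" if m: "set_mset m \<subseteq> {1..n}" for m
  proof -
    let ?O = "Ome n r (\<lambda>_. 1) (image_mset Rw m)" and ?O' = "\<lambda>i j. Om i j \<and> mset i = m"
    let ?Z = "\<lambda>(i::lab list) j i'. i = map Rw i' \<and> Om i' j \<and> mset i' = m"
    have Om_Z: "?O (map Rw i') j" if "Om i' j" "mset i' = m" for i' j
    proof -
      have "list_all2 (al (\<lambda>_. 1)) (map Rw i') j"
        using that nth_mem by (auto simp: list_all2_conv_all_nth Om_def Inr_def subset_iff)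
      then show ?thesis using that by (auto simp: Ome_def Om_def Inr_length)
    qed
    have ZI: "\<exists>i'. i = map Rw i' \<and> mset i' = m \<and> i' \<in> ?W" if "mset i = image_mset Rw m" "length i = r" for i
    proof -
      let ?u = "\<lambda>x. case x of Rw l \<Rightarrow> l | Fr c \<Rightarrow> c"
      have "mset (map ?u i) = image_mset (?u \<circ> Rw) m" using that by (simp add: image_mset.comp[symmetric])
      then have a: "mset (map ?u i) = m" by (simp add: o_def)
      have "\<exists>l. x = Rw l" if "x \<in> set i" for x
      proof -
        have "x \<in># image_mset Rw m" using that \<open>mset i = _\<close> by (metis set_mset_mset)
        then show ?thesis by auto
      qed
      then have "i = map Rw (map ?u i)" by (intro nth_equalityI) (auto, metis lab.simps(6) nth_mem)
      moreover have "set (map ?u i) \<subseteq> {1..n}" using a m by (metis set_mset_mset)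
      ultimately show ?thesis using a that by (intro exI[of _ "map ?u i"]) (simp add: Inr_def)
    qed
    have "T.ex ?O (Suc k)"
    proof (rule T.dominant_exact)
      show "Tw (image_mset Rw m) c \<le> lam c" for c
      proof -
        have "Fr c \<notin># image_mset Rw m" by auto
        then show ?thesis by (simp only: not_in_iff)
      qed
      show "lam (Suc c) - Tw (image_mset Rw m) (Suc c) \<le> lam c - Tw (image_mset Rw m) c" if "1 \<le> c" for c
      proof -
        have "Fr c \<notin># image_mset Rw m" "Fr (Suc c) \<notin># image_mset Rw m" by auto
        then show ?thesis using dom[OF that] by (simp only: not_in_iff)
      qed
    qed simp
    then show ?thesis
    proof (rule T.ex_iso[where Z = ?Z, rotated -1])
      show "region n r ?O" by (rule region_Ome)
      show "region n r ?O'" using region_split.reg''[OF T.content_split(1)[OF reg]] .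
      show "\<exists>i'. ?Z i j i'" if "?O i j" for i j
        using ZI[of i] that by (auto simp: Ome_def Om_def)
      show "\<exists>i. ?Z i j i'" if "?O' i' j" for i' j using that by blast
      show "?O i j \<and> ?O' i' j" if "?Z i j i'" for i j i' using that Om_Z by blast
      show "?Z (permute_list p i) (permute_list p j) (permute_list p i')" if p: "p permutes {..<r}" and z: "?Z i j i'" for p i j i'
        using z p region_perm[OF reg p, of i' j] permute_list_map[of p i' Rw] by (auto simp: Om_def Inr_length)
      have rI: "\<exists>p. p permutes {..<r} \<and> permute_list p i1 = i1 \<and> permute_list p j = j" for i1 :: "'z list" and j :: "nat list"
        by (intro exI[of _ id]) (simp add: permutes_id)
      show "\<exists>p. p permutes {..<r} \<and> permute_list p i1 = i2 \<and> permute_list p j = j" if "?Z i j i1" "?Z i j i2" for i j i1 i2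
      proof -
        have "i1 = i2" using that by (metis inj_map_eq_map injI lab.inject(2))
        then show ?thesis using rI by blast
      qed
      show "\<exists>p. p permutes {..<r} \<and> permute_list p i1 = i2 \<and> permute_list p j = j" if "?Z i1 j i'" "?Z i2 j i'" for i1 i2 j i'
        using that by (intro exI[of _ id]) (simp add: permutes_id)
      show "?Z i x i'" if "?Z i j i'" "lle x j" "?O i x \<or> ?O' i' x" for i x j i'
        using that by (auto simp: Ome_def Om_def)
    qed
  qed
  show ?thesis
    unfolding Om_def[symmetric] T.ex_def
  proof (intro allI impI)
    fix F assume c: "T.cyc Om (Suc k) F"
    then have F: "F \<in> T.C Om (Suc k)" and z: "T.D Om k F = 0" by (auto simp: T.cyc_def)
    let ?O = "\<lambda>m i j. Om i j \<and> mset i = m"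
    have "\<exists>G\<in>T.C (?O m) (Suc (Suc k)). T.D (?O m) (Suc k) G = T.res (?O m) F" if m: "set_mset m \<subseteq> {1..n}" for m
    proof -
      interpret a: region_split n r lam "tails n r lam" "tsw n lam" "bde n r lam :: _ \<Rightarrow> _ \<Rightarrow> _ \<Rightarrow> _ \<Rightarrow> 'a"
         Om "\<lambda>i j. Om i j \<and> mset i \<noteq> m" "?O m" by (rule T.content_split(1)[OF reg])
      have "T.D (?O m) k (T.res (?O m) F) = T.res (?O m) (T.D Om k F)" by (rule a.quo_D[OF F, symmetric])
      also have "\<dots> = 0" by (simp add: z T.res_def fun_eq_iff)
      finally have "T.cyc (?O m) (Suc k) (T.res (?O m) F)" using T.res_C[OF a.reg'' F] by (simp add: T.cyc_def)
      then show ?thesis using e[OF m] unfolding T.ex_def by blast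
    qed
    then have "\<forall>m. \<exists>G. set_mset m \<subseteq> {1..n} \<longrightarrow> G \<in> T.C (?O m) (Suc (Suc k)) \<and> T.D (?O m) (Suc k) G = T.res (?O m) F"
      by blast
    from choice[OF this] obtain G where
      G0: "\<forall>m. set_mset m \<subseteq> {1..n} \<longrightarrow> G m \<in> T.C (?O m) (Suc (Suc k)) \<and> T.D (?O m) (Suc k) (G m) = T.res (?O m) F" ..
    note G = G0[rule_format]
    \<comment> \<open>The preimages found for the single contents are glued, each used on the left
      words of its own content.\<close>
    define H where "H t i j = (if i \<in> ?W then G (mset i) t i j else 0)" for t i j
    have mW: "set_mset (mset i) \<subseteq> {1..n}" if "i \<in> ?W" for i using that by (auto simp: Inr_def)
    have "H \<in> T.C Om (Suc (Suc k))"
      unfolding T.C_def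
    proof (intro CollectI conjI allI impI)
      fix t i j assume "H t i j \<noteq> 0"
      then have "i \<in> ?W" "G (mset i) t i j \<noteq> 0" by (auto simp: H_def split: if_splits)
      then show "t \<in> tails n r lam (Suc (Suc k))" "Om i j" "cont j = tsw n lam t"
        using T.C_supp G[OF mW] by blast+
    next
      fix t show "linv r (H t)"
      proof (rule linvI)
        fix p and i j :: "nat list" assume p: "p permutes {..<r}" and l: "length i = r" "length j = r"
        have m: "permute_list p i \<in> ?W \<longleftrightarrow> i \<in> ?W" using p l by (auto simp: Inr_def)
        show "H t (permute_list p i) (permute_list p j) = H t i j"
        proof (cases "i \<in> ?W")
          case True
          then have "G (mset i) \<in> T.C (?O (mset i)) (Suc (Suc k))" using G[OF mW] by blast
          from linvD[OF T.C_inv[OF this] p l] show ?thesis using m True p l by (simp add: H_def)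
        qed (use m in \<open>simp add: H_def\<close>)
      qed
    qed
    moreover have "T.D Om (Suc k) H = F"
    proof (intro ext)
      fix u i j
      show "T.D Om (Suc k) H u i j = F u i j"
      proof (cases "u \<in> tails n r lam (Suc k) \<and> Om i j")
        case True
        then have i: "i \<in> ?W" by (simp add: Om_def)
        have "T.D Om (Suc k) H u i j = T.D (?O (mset i)) (Suc k) (G (mset i)) u i j"
          using True i by (simp add: T.D_def H_def del: tails.simps)
        also have "\<dots> = T.res (?O (mset i)) F u i j" using G[OF mW[OF i]] by simp
        also have "\<dots> = F u i j" using True by (simp add: T.res_def)
        finally show ?thesis .
      next
        case False
        then show ?thesis using T.C_supp[OF F, of u i j] by (auto simp: T.D_def simp del: tails.simps)
      qed
    qed
    ultimately show "\<exists>G\<in>T.C Om (Suc (Suc k)). T.D Om (Suc k) G = F" by blast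
  qed
qed

section \<open>The Schur algebra as an algebra of invariant kernels\<close>

definition ev :: "nat list \<Rightarrow> 'a::comm_ring_1 vec" where
  "ev j = (\<lambda>i. if i = j then 1 else 0)"

text \<open>The matrix of \<open>f\<close> in the basis of words, extended by zero so that equality
  of operators becomes equality of functions on all pairs of lists.\<close>

definition ker :: "nat \<Rightarrow> nat \<Rightarrow> 'a::comm_ring_1 endo \<Rightarrow> nat list \<Rightarrow> nat list \<Rightarrow> 'a" where
  "ker n r f i j = (if i \<in> Inr n r \<and> j \<in> Inr n r then f (ev j) i else 0)"

definition opr :: "nat \<Rightarrow> nat \<Rightarrow> (nat list \<Rightarrow> nat list \<Rightarrow> 'a::comm_ring_1) \<Rightarrow> 'a endo" where
  "opr n r a = (\<lambda>v\<in>Vsp n r. \<lambda>i. if i \<in> Inr n r then \<Sum>j\<in>Inr n r. a i j * v j else 0)"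

definition Kin :: "nat \<Rightarrow> nat \<Rightarrow> (nat list \<Rightarrow> nat list \<Rightarrow> 'a::comm_ring_1) set" where
  "Kin n r = {a. linv r a \<and> (\<forall>i j. a i j \<noteq> 0 \<longrightarrow> i \<in> Inr n r \<and> j \<in> Inr n r)}"

lemma ev_Vsp: "j \<in> Inr n r \<Longrightarrow> ev j \<in> Vsp n r"
  by (auto simp: ev_def Vsp_def)

lemma ker_nz: "ker n r f i j \<noteq> 0 \<Longrightarrow> i \<in> Inr n r \<and> j \<in> Inr n r"
  by (auto simp: ker_def split: if_splits)

lemma Kin_nz: "a \<in> Kin n r \<Longrightarrow> a i j \<noteq> 0 \<Longrightarrow> i \<in> Inr n r \<and> j \<in> Inr n r"
  by (auto simp: Kin_def)

lemma Kin_inv: "a \<in> Kin n r \<Longrightarrow> linv r a"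
  by (auto simp: Kin_def)

lemma SchurD:
  assumes "f \<in> Schur n r"
  shows "v \<in> Vsp n r \<Longrightarrow> f v \<in> Vsp n r" "v \<notin> Vsp n r \<Longrightarrow> f v = undefined"
    "v \<in> Vsp n r \<Longrightarrow> w \<in> Vsp n r \<Longrightarrow> f (\<lambda>i. v i + w i) = (\<lambda>i. f v i + f w i)"
    "v \<in> Vsp n r \<Longrightarrow> f (\<lambda>i. c * v i) = (\<lambda>i. c * f v i)"
    "s permutes {..<r} \<Longrightarrow> v \<in> Vsp n r \<Longrightarrow> f (vact n r v s) = vact n r (f v) s"
  using assms by (auto simp: Schur_def PiE_def extensional_def)

lemma Schur_apply:
  assumes f: "f \<in> Schur n r" and v: "v \<in> Vsp n r" and i: "i \<in> Inr n r"
  shows "f v i = (\<Sum>j\<in>Inr n r. ker n r f i j * v j)"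
proof -
  have "finite A \<Longrightarrow> A \<subseteq> Inr n r \<Longrightarrow> f (\<lambda>i. \<Sum>j\<in>A. v j * ev j i) = (\<lambda>i. \<Sum>j\<in>A. v j * f (ev j) i)" for A
  proof (induction A rule: finite_induct)
    case empty
    have "f (\<lambda>i. 0 * v i) = (\<lambda>i. 0 * f v i)" by (rule SchurD(4)[OF f v])
    then show ?case by simp
  next
    case (insert x A)
    have "(\<lambda>i. \<Sum>j\<in>A. v j * ev j i) \<in> Vsp n r" using insert.prems by (auto simp: Vsp_def ev_def intro!: sum.neutral)
    moreover have "(\<lambda>i. v x * ev x i) \<in> Vsp n r" using insert.prems by (auto simp: Vsp_def ev_def)
    moreover have "f (\<lambda>i. v x * ev x i) = (\<lambda>i. v x * f (ev x) i)"
      by (rule SchurD(4)[OF f]) (use ev_Vsp insert.prems in auto)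
    ultimately show ?case using insert SchurD(3)[OF f] by simp
  qed
  from this[of "Inr n r"] have e: "f (\<lambda>i. \<Sum>j\<in>Inr n r. v j * ev j i) = (\<lambda>i. \<Sum>j\<in>Inr n r. v j * f (ev j) i)" by simp
  have "(\<Sum>j\<in>Inr n r. v j * ev j i) = v i" for i
  proof -
    have "(\<Sum>j\<in>Inr n r. v j * ev j i) = (\<Sum>j\<in>Inr n r. if j = i then v j else 0)"
      by (intro sum.cong) (auto simp: ev_def)
    also have "\<dots> = v i" using v by (auto simp: Vsp_def)
    finally show ?thesis .
  qed
  then have "f v = (\<lambda>i. \<Sum>j\<in>Inr n r. v j * f (ev j) i)" using e by simp
  then show ?thesis using i by (simp add: ker_def mult.commute)
qed

lemma opr_ker:
  assumes f: "f \<in> Schur n r" shows "opr n r (ker n r f) = f"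
proof
  fix v
  show "opr n r (ker n r f) v = f v"
  proof (cases "v \<in> Vsp n r")
    case True
    then have "f v \<in> Vsp n r" by (rule SchurD(1)[OF f])
    then have "f v i = (if i \<in> Inr n r then \<Sum>j\<in>Inr n r. ker n r f i j * v j else 0)" for i
      using Schur_apply[OF f True] by (auto simp: Vsp_def)
    then show ?thesis using True by (auto simp: opr_def)
  qed (simp add: opr_def SchurD(2)[OF f])
qed

lemma ker_opr: "a \<in> Kin n r \<Longrightarrow> ker n r (opr n r a) = a"
proof (intro ext)
  fix i j assume a: "a \<in> Kin n r"
  show "ker n r (opr n r a) i j = a i j"
  proof (cases "i \<in> Inr n r \<and> j \<in> Inr n r")
    case True
    have "(\<Sum>x\<in>Inr n r. a i x * ev j x) = (\<Sum>x\<in>Inr n r. if x = j then a i j else 0)"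
      by (intro sum.cong) (auto simp: ev_def)
    then show ?thesis using True by (simp add: ker_def opr_def ev_Vsp)
  next
    case False
    then have "a i j = 0" using Kin_nz[OF a] by blast
    then show ?thesis using False by (auto simp: ker_def)
  qed
qed

lemma perm_idx_permute: "perm_idx = (\<lambda>i s. permute_list s i)"
  by (intro ext) (simp add: perm_idx_def permute_list_def)

text \<open>The sum defining the action runs over the preimages of \<open>k\<close> under a
  permutation of positions, of which there is exactly one.\<close>

lemma vact_eq:
  assumes s: "s permutes {..<r}"
  shows "vact n r v s k = (if k \<in> Inr n r then v (permute_list (inv s) k) else 0)"
proof -
  have q: "inv s permutes {..<r}" using permutes_inv[OF s] .
  have "{i \<in> Inr n r. perm_idx i s = k} = (if k \<in> Inr n r then {permute_list (inv s) k} else {})"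
  proof (cases "k \<in> Inr n r")
    case True
    have "i = permute_list (inv s) k" if "i \<in> Inr n r" "permute_list s i = k" for i
      using permute_list_inv(1)[OF s Inr_length[OF that(1)]] that by simp
    moreover have "permute_list s (permute_list (inv s) k) = k" "permute_list (inv s) k \<in> Inr n r"
      using permute_list_inv(2)[OF s Inr_length[OF True]] permute_list_Inr[OF q True] by auto
    ultimately have "{i \<in> Inr n r. permute_list s i = k} = {permute_list (inv s) k}" by blast
    then show ?thesis using True by (simp add: perm_idx_permute)
  next
    case False
    then show ?thesis using permute_list_Inr[OF s] by (auto simp: perm_idx_permute)
  qed
  then show ?thesis by (simp add: vact_def)
qed

lemma ker_Kin:
  assumes f: "f \<in> Schur n r" shows "ker n r f \<in> Kin n r"
proof -
  have "linv r (ker n r f)"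
  proof (rule linvI)
    fix p and i j :: "nat list" assume p: "p permutes {..<r}" and l: "length i = r" "length j = r"
    have m: "permute_list p z \<in> Inr n r \<longleftrightarrow> z \<in> Inr n r" if "length z = r" for z
      using p that by (auto simp: Inr_def)
    show "ker n r f (permute_list p i) (permute_list p j) = ker n r f i j"
    proof (cases "i \<in> Inr n r \<and> j \<in> Inr n r")
      case True
      have "ev (permute_list p j) = (vact n r (ev j) p :: 'a vec)"
      proof
        fix k
        have "permute_list (inv p) k = j \<longleftrightarrow> k = permute_list p j" if "k \<in> Inr n r"
          using permute_list_inv[OF p Inr_length[OF that]] permute_list_inv[OF p l(2)] by metis
        then show "ev (permute_list p j) k = (vact n r (ev j) p k :: 'a)"
          using permute_list_Inr[OF p] True by (auto simp: vact_eq[OF p] ev_def)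
      qed
      then have "f (ev (permute_list p j)) (permute_list p i) = vact n r (f (ev j)) p (permute_list p i)"
        using SchurD(5)[OF f p ev_Vsp] True by simp
      also have "\<dots> = f (ev j) i" using True m l permute_list_inv(1)[OF p l(1)] by (simp add: vact_eq[OF p])
      finally show ?thesis using True m l by (simp add: ker_def)
    qed (use m l in \<open>auto simp: ker_def\<close>)
  qed
  then show ?thesis using ker_nz[of n r f] by (auto simp: Kin_def)
qed

lemma opr_Schur:
  fixes a :: "nat list \<Rightarrow> nat list \<Rightarrow> 'a::comm_ring_1"
  assumes a: "a \<in> Kin n r" shows "opr n r a \<in> Schur n r"
  unfolding Schur_def
proof (intro CollectI conjI ballI allI impI)
  show "opr n r a \<in> Vsp n r \<rightarrow>\<^sub>E Vsp n r" by (auto simp: opr_def Vsp_def)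
  fix v :: "'a vec" assume v: "v \<in> Vsp n r"
  {
    fix w :: "'a vec" assume w: "w \<in> Vsp n r"
    have "(\<lambda>i. v i + w i) \<in> Vsp n r" using v w by (auto simp: Vsp_def)
    then show "opr n r a (\<lambda>i. v i + w i) = (\<lambda>i. opr n r a v i + opr n r a w i)"
      using v w by (auto simp: opr_def fun_eq_iff distrib_left sum.distrib)
  }
  {
    fix c
    have "(\<lambda>i. c * v i) \<in> Vsp n r" using v by (auto simp: Vsp_def)
    then show "opr n r a (\<lambda>i. c * v i) = (\<lambda>i. c * opr n r a v i)"
      using v by (auto simp: opr_def fun_eq_iff sum_distrib_left mult.left_commute)
  }
  fix p assume p: "p permutes {..<r}"
  have V: "vact n r v p \<in> Vsp n r" by (auto simp: Vsp_def vact_eq[OF p])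
  show "opr n r a (vact n r v p) = vact n r (opr n r a v) p"
  proof
    fix k
    show "opr n r a (vact n r v p) k = vact n r (opr n r a v) p k"
    proof (cases "k \<in> Inr n r")
      case True
      have q: "inv p permutes {..<r}" using permutes_inv[OF p] .
      have "opr n r a (vact n r v p) k = (\<Sum>j\<in>Inr n r. a k j * v (permute_list (inv p) j))"
        using True V by (simp add: opr_def vact_eq[OF p])
      also have "\<dots> = (\<Sum>j\<in>Inr n r. a (permute_list (inv p) k) (permute_list (inv p) j) * v (permute_list (inv p) j))"
        using linvD[OF Kin_inv[OF a] q] True by (intro sum.cong refl) (simp add: Inr_length)
      also have "\<dots> = (\<Sum>j\<in>Inr n r. a (permute_list (inv p) k) j * v j)"
        by (rule sum_Inr_permute[OF q])
      also have "\<dots> = vact n r (opr n r a v) p k"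
        using True v permute_list_Inr[OF q True] by (simp add: opr_def vact_eq[OF p])
      finally show ?thesis .
    next
      case False
      then show ?thesis using V by (simp add: opr_def vact_eq[OF p])
    qed
  qed
qed

lemma Schur_eqI: "f \<in> Schur n r \<Longrightarrow> g \<in> Schur n r \<Longrightarrow> ker n r f = ker n r g \<Longrightarrow> f = g"
  using opr_ker by metis

lemma kconv_nz: "kconv n r a b i j \<noteq> 0 \<Longrightarrow> \<exists>z\<in>Inr n r. a i z \<noteq> 0 \<and> b z j \<noteq> 0"
proof -
  assume "kconv n r a b i j \<noteq> 0"
  then have "(\<Sum>z\<in>Inr n r. a i z * b z j) \<noteq> 0" by (simp add: kconv_def)
  then obtain z where z: "z \<in> Inr n r" "a i z * b z j \<noteq> 0" by (rule sum.not_neutral_contains_not_neutral)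
  then have "a i z \<noteq> 0" "b z j \<noteq> 0" by auto
  then show ?thesis using z(1) by blast
qed

lemma kconv_Kin:
  assumes "a \<in> Kin n r" "b \<in> Kin n r" shows "kconv n r a b \<in> Kin n r"
proof -
  have "i \<in> Inr n r \<and> j \<in> Inr n r" if nzz: "kconv n r a b i j \<noteq> 0" for i j
  proof -
    obtain z where "a i z \<noteq> 0" "b z j \<noteq> 0" using kconv_nz[OF nzz] by blast
    then show ?thesis using Kin_nz[OF assms(1)] Kin_nz[OF assms(2)] by blast
  qed
  then show ?thesis using kconv_inv[OF Kin_inv[OF assms(1)] Kin_inv[OF assms(2)]] unfolding Kin_def by blast
qed

lemma smul_eq:
  assumes f: "f \<in> Schur n r" and g: "g \<in> Schur n r"
  shows "smul n r f g = opr n r (kconv n r (ker n r f) (ker n r g))"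
proof
  fix v
  show "smul n r f g v = opr n r (kconv n r (ker n r f) (ker n r g)) v"
  proof (cases "v \<in> Vsp n r")
    case True
    have gv: "g v \<in> Vsp n r" using SchurD(1)[OF g True] .
    have "f (g v) i = (if i \<in> Inr n r then \<Sum>j\<in>Inr n r. kconv n r (ker n r f) (ker n r g) i j * v j else 0)" for i
    proof (cases "i \<in> Inr n r")
      case True
      have "f (g v) i = (\<Sum>x\<in>Inr n r. \<Sum>j\<in>Inr n r. ker n r f i x * (ker n r g x j * v j))"
        using Schur_apply[OF f gv True] Schur_apply[OF g \<open>v \<in> Vsp n r\<close>] by (simp add: sum_distrib_left)
      also have "\<dots> = (\<Sum>j\<in>Inr n r. \<Sum>x\<in>Inr n r. ker n r f i x * (ker n r g x j * v j))" by (rule sum.swap)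
      finally show ?thesis using True by (simp add: kconv_def sum_distrib_right mult.assoc)
    next
      case False
      then show ?thesis using SchurD(1)[OF f gv] by (auto simp: Vsp_def)
    qed
    then show ?thesis using True by (auto simp: smul_def opr_def)
  qed (simp add: smul_def opr_def)
qed

lemma smul_Schur: "f \<in> Schur n r \<Longrightarrow> g \<in> Schur n r \<Longrightarrow> smul n r f g \<in> Schur n r"
  and ker_smul: "f \<in> Schur n r \<Longrightarrow> g \<in> Schur n r \<Longrightarrow> ker n r (smul n r f g) = kconv n r (ker n r f) (ker n r g)"
  by (simp_all add: smul_eq opr_Schur ker_opr kconv_Kin ker_Kin)

lemma Kin_add: "a \<in> Kin n r \<Longrightarrow> b \<in> Kin n r \<Longrightarrow> (\<lambda>i j. a i j + b i j) \<in> Kin n r"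
proof -
  assume a: "a \<in> Kin n r" and b: "b \<in> Kin n r"
  have "i \<in> Inr n r \<and> j \<in> Inr n r" if "a i j + b i j \<noteq> 0" for i j
    using that Kin_nz[OF a, of i j] Kin_nz[OF b, of i j] by (cases "a i j = 0") auto
  then show ?thesis using Kin_inv[OF a] Kin_inv[OF b] by (auto simp: Kin_def linv_def)
qed

lemma ker_sadd: "ker n r (sadd n r f g) = (\<lambda>i j. ker n r f i j + ker n r g i j)"
  by (intro ext) (auto simp: ker_def sadd_def ev_Vsp)

lemma sadd_Schur:
  assumes f: "f \<in> Schur n r" and g: "g \<in> Schur n r" shows "sadd n r f g \<in> Schur n r"
proof -
  have "sadd n r f g = opr n r (\<lambda>i j. ker n r f i j + ker n r g i j)"
  proof
    fix v
    show "sadd n r f g v = opr n r (\<lambda>i j. ker n r f i j + ker n r g i j) v"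
    proof (cases "v \<in> Vsp n r")
      case True
      have "f v i + g v i = (if i \<in> Inr n r then \<Sum>j\<in>Inr n r. (ker n r f i j + ker n r g i j) * v j else 0)" for i
        using Schur_apply[OF f True, of i] Schur_apply[OF g True, of i] SchurD(1)[OF f True] SchurD(1)[OF g True]
        by (auto simp: Vsp_def distrib_right sum.distrib)
      then show ?thesis using True by (auto simp: sadd_def opr_def)
    qed (simp add: sadd_def opr_def)
  qed
  then show ?thesis using opr_Schur[OF Kin_add[OF ker_Kin[OF f] ker_Kin[OF g]]] by simp
qed

definition kid :: "nat \<Rightarrow> nat \<Rightarrow> nat list \<Rightarrow> nat list \<Rightarrow> 'a::comm_ring_1" where
  "kid n r i j = (if i \<in> Inr n r \<and> i = j then 1 else 0)"

lemma kid_Kin: "kid n r \<in> Kin n r"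
proof -
  have "linv r (kid n r :: _ \<Rightarrow> _ \<Rightarrow> 'a)"
  proof (rule linvI)
    fix p and i j :: "nat list" assume p: "p permutes {..<r}" and l: "length i = r" "length j = r"
    have "permute_list p i \<in> Inr n r \<longleftrightarrow> i \<in> Inr n r" using p l by (auto simp: Inr_def)
    moreover have "permute_list p i = permute_list p j \<longleftrightarrow> i = j" using permute_list_inv(1)[OF p] l by metis
    ultimately show "kid n r (permute_list p i) (permute_list p j) = (kid n r i j :: 'a)" by (simp add: kid_def)
  qed
  then show ?thesis by (auto simp: Kin_def kid_def split: if_splits)
qed

lemma ker_sone: "ker n r (sone n r) = kid n r"
  by (intro ext) (auto simp: ker_def sone_def kid_def ev_Vsp, auto simp: ev_def)

lemma sone_eq: "sone n r = opr n r (kid n r)"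
proof
  fix v :: "'a vec"
  show "sone n r v = opr n r (kid n r) v"
  proof (cases "v \<in> Vsp n r")
    case True
    have "(\<Sum>j\<in>Inr n r. kid n r i j * v j) = v i" if "i \<in> Inr n r" for i
    proof -
      have "(\<Sum>j\<in>Inr n r. kid n r i j * v j) = (\<Sum>j\<in>Inr n r. if i = j then v j else 0)"
        using that by (intro sum.cong) (auto simp: kid_def)
      then show ?thesis using that by simp
    qed
    then show ?thesis using True by (auto simp: sone_def opr_def Vsp_def fun_eq_iff)
  qed (simp add: sone_def opr_def)
qed

lemma sone_Schur: "sone n r \<in> Schur n r"
  using sone_eq opr_Schur[OF kid_Kin] by metis

lemma kconv_kid:
  assumes "b \<in> Kin n r" shows "kconv n r (kid n r) b = b" "kconv n r b (kid n r) = b"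
proof -
  have "kconv n r (kid n r) b i j = b i j" for i j
  proof (cases "i \<in> Inr n r")
    case True
    have "kconv n r (kid n r) b i j = (\<Sum>z\<in>Inr n r. if i = z then b z j else 0)"
      unfolding kconv_def using True by (intro sum.cong) (auto simp: kid_def)
    then show ?thesis using True by simp
  next
    case False
    then have "b i j = 0" using Kin_nz[OF assms] by blast
    then show ?thesis using False by (simp add: kconv_def kid_def)
  qed
  then show "kconv n r (kid n r) b = b" by (intro ext)
  have "kconv n r b (kid n r) i j = b i j" for i j
  proof (cases "j \<in> Inr n r")
    case True
    have "kconv n r b (kid n r) i j = (\<Sum>z\<in>Inr n r. if z = j then b i z else 0)"
      unfolding kconv_def by (intro sum.cong) (auto simp: kid_def)
    then show ?thesis using True by simp
  next
    case False
    then have "b i j = 0" using Kin_nz[OF assms] by blast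
    moreover have "kid n r z j = (0::'a)" if "z \<in> Inr n r" for z using False that by (auto simp: kid_def)
    ultimately show ?thesis by (simp add: kconv_def)
  qed
  then show "kconv n r b (kid n r) = b" by (intro ext)
qed

definition kxi :: "nat \<Rightarrow> nat \<Rightarrow> mat set \<Rightarrow> (mat \<Rightarrow> 'a::comm_ring_1) \<Rightarrow> nat list \<Rightarrow> nat list \<Rightarrow> 'a" where
  "kxi n r M c i j = (if i \<in> Inr n r \<and> j \<in> Inr n r \<and> wt i j \<in> M then c (wt i j) else 0)"

lemma kxi_Kin: "kxi n r M c \<in> Kin n r"
proof -
  have "linv r (kxi n r M c)"
  proof (rule linvI)
    fix p and i j :: "nat list" assume p: "p permutes {..<r}" and l: "length i = r" "length j = r"
    have "permute_list p z \<in> Inr n r \<longleftrightarrow> z \<in> Inr n r" if "length z = r" for z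
      using p that by (auto simp: Inr_def)
    then show "kxi n r M c (permute_list p i) (permute_list p j) = kxi n r M c i j"
      using wt_perm[OF p l] l by (simp add: kxi_def)
  qed
  then show ?thesis by (auto simp: Kin_def kxi_def split: if_splits)
qed

lemma xicomb_eq:
  assumes "finite M" shows "xicomb n r M c = opr n r (kxi n r M c)"
proof
  fix v :: "'a vec"
  show "xicomb n r M c v = opr n r (kxi n r M c) v"
  proof (cases "v \<in> Vsp n r")
    case True
    have "(\<Sum>w\<in>M. c w * xi n r w v i) = (if i \<in> Inr n r then \<Sum>j\<in>Inr n r. kxi n r M c i j * v j else 0)" for i
    proof (cases "i \<in> Inr n r")
      case i: True
      have "(\<Sum>w\<in>M. c w * xi n r w v i) = (\<Sum>w\<in>M. \<Sum>j\<in>Inr n r. if wt i j = w then c w * v j else 0)"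
      proof (intro sum.cong refl)
        fix w
        have "(\<Sum>j\<in>{j \<in> Inr n r. wt i j = w}. v j) = (\<Sum>j\<in>Inr n r. if wt i j = w then v j else 0)"
          by (rule sum.inter_filter) simp
        then show "c w * xi n r w v i = (\<Sum>j\<in>Inr n r. if wt i j = w then c w * v j else 0)"
          using True i by (simp add: xi_def sum_distrib_left if_distrib cong: if_cong)
      qed
      also have "\<dots> = (\<Sum>j\<in>Inr n r. \<Sum>w\<in>M. if wt i j = w then c w * v j else 0)" by (rule sum.swap)
      also have "\<dots> = (\<Sum>j\<in>Inr n r. kxi n r M c i j * v j)"
        using assms i by (intro sum.cong refl) (simp add: kxi_def)
      finally show ?thesis using i by simp
    qed (use True in \<open>simp add: xi_def\<close>)
    then show ?thesis using True by (auto simp: xicomb_def opr_def)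
  qed (simp add: xicomb_def opr_def)
qed

text \<open>Coefficients are read off at one pair per orbit and invariance spreads them over the
  orbit. The spans defining the Borel subalgebra, J and L thereby become support conditions on
  kernels.\<close>

lemma range_xicomb:
  assumes fin: "finite M" and M: "M \<subseteq> Mats n r"
  shows "f \<in> range (xicomb n r M) \<longleftrightarrow> f \<in> Schur n r \<and> (\<forall>i j. ker n r f i j \<noteq> 0 \<longrightarrow> wt i j \<in> M)"
proof
  assume "f \<in> range (xicomb n r M)"
  then obtain c where c: "f = opr n r (kxi n r M c)" using xicomb_eq[OF fin] by auto
  then show "f \<in> Schur n r \<and> (\<forall>i j. ker n r f i j \<noteq> 0 \<longrightarrow> wt i j \<in> M)"
    by (auto simp: opr_Schur[OF kxi_Kin] ker_opr[OF kxi_Kin] kxi_def split: if_splits)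
next
  assume a: "f \<in> Schur n r \<and> (\<forall>i j. ker n r f i j \<noteq> 0 \<longrightarrow> wt i j \<in> M)"
  define c where "c w = ker n r f (fst (rep n r w)) (snd (rep n r w))" for w
  have "kxi n r M c i j = ker n r f i j" for i j
  proof (cases "i \<in> Inr n r \<and> j \<in> Inr n r \<and> wt i j \<in> M")
    case True
    have fS: "f \<in> Schur n r" using a by blast
    have ij: "i \<in> Inr n r" "j \<in> Inr n r" using True by auto
    have "c (wt i j) = ker n r f i j"
      unfolding c_def by (rule linv_wt[OF Kin_inv[OF ker_Kin[OF fS]]]) (use rep_props[OF wt_Mats[OF ij]] ij in auto)
    then show ?thesis using True by (simp add: kxi_def)
  next
    case False
    then have "ker n r f i j = 0" using a ker_nz by blast
    then show ?thesis using False by (auto simp: kxi_def)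
  qed
  then have "kxi n r M c = ker n r f" by (intro ext)
  then have "f = xicomb n r M c" using opr_ker[of f n r] a by (simp add: xicomb_eq[OF fin])
  then show "f \<in> range (xicomb n r M)" by blast
qed

lemma SchurPlus_iff: "f \<in> SchurPlus n r \<longleftrightarrow> f \<in> Schur n r \<and> (\<forall>i j. ker n r f i j \<noteq> 0 \<longrightarrow> lle i j)"
proof -
  have "wt i j \<in> MatsUp n r 0 \<longleftrightarrow> lle i j" if "ker n r f i j \<noteq> 0" for i j
    using ker_nz[OF that] MatsUp0_wt by blast
  then show ?thesis unfolding SchurPlus_def Jsp_def range_xicomb[OF finite_MatsUp MatsUp_sub] by simp
qed

lemma Jrad_iff: "f \<in> Jrad n r \<longleftrightarrow> f \<in> Schur n r \<and> (\<forall>i j. ker n r f i j \<noteq> 0 \<longrightarrow> lle i j \<and> i \<noteq> j)"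
proof -
  have "wt i j \<in> MatsUp n r 1 \<longleftrightarrow> lle i j \<and> i \<noteq> j" if "ker n r f i j \<noteq> 0" for i j
    using ker_nz[OF that] MatsUp1_wt by blast
  then show ?thesis unfolding Jrad_def Jsp_def range_xicomb[OF finite_MatsUp MatsUp_sub] by simp
qed

lemma wt_diag:
  assumes "x \<in> Inr n r" shows "wt x x = diagm (cont x)"
proof (intro ext)
  fix s t
  have "count (mset (zip x x)) (s, t) = (if s = t then cont x s else 0)" by (induction x) auto
  then show "wt x x s t = diagm (cont x) s t" by (simp add: wt_count diagm_def)
qed

lemma cont_Comps: "x \<in> Inr n r \<Longrightarrow> cont x \<in> Comps n r"
  using sum_cont_Inr[of x n r] by (auto simp: Comps_def Inr_def not_in_iff[symmetric])

lemma diag_image: "diagm ` Comps n r = (\<lambda>x. wt x x) ` Inr n r"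
proof
  show "diagm ` Comps n r \<subseteq> (\<lambda>x. wt x x) ` Inr n r"
  proof
    fix w assume "w \<in> diagm ` Comps n r"
    then obtain mu where "mu \<in> Comps n r" "w = diagm mu" by blast
    then show "w \<in> (\<lambda>x. wt x x) ` Inr n r" using word_of_content[of mu n r] wt_diag by auto
  qed
  show "(\<lambda>x. wt x x) ` Inr n r \<subseteq> diagm ` Comps n r" using wt_diag cont_Comps by auto
qed

lemma Lsp_iff: "f \<in> Lsp n r \<longleftrightarrow> f \<in> Schur n r \<and> (\<forall>i j. ker n r f i j \<noteq> 0 \<longrightarrow> i = j)"
proof -
  have "wt i j \<in> diagm ` Comps n r \<longleftrightarrow> i = j" if "i \<in> Inr n r" "j \<in> Inr n r" for i j
  proof
    assume "wt i j \<in> diagm ` Comps n r"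
    then obtain mu where m: "wt i j = diagm mu" by blast
    show "i = j"
    proof (rule nth_equalityI)
      fix q assume q: "q < length i"
      have "wt i j (i ! q) (j ! q) \<noteq> 0" using wt_pos_iff[of i j] q that by (auto simp: Inr_length)
      then show "i ! q = j ! q" by (auto simp: m diagm_def split: if_splits)
    qed (use that in \<open>simp add: Inr_length\<close>)
  qed (use that in \<open>auto simp: diag_image\<close>)
  moreover have "finite (diagm ` Comps n r)" "diagm ` Comps n r \<subseteq> Mats n r"
    unfolding diag_image using wt_Mats by auto
  moreover have "i \<in> Inr n r \<and> j \<in> Inr n r" if "ker n r f i j \<noteq> 0" for i j using ker_nz[OF that] .
  ultimately show ?thesis unfolding Lsp_def by (simp add: range_xicomb)
qed

lemma lle_refl: "lle x x"
  by (simp add: list_all2_same)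

lemma lle_trans: "lle x y \<Longrightarrow> lle y z \<Longrightarrow> lle x z"
  by (rule list_all2_trans[of "(\<le>)" "(\<le>)" "(\<le>)"]) auto

lemma Lsp_Plus: "f \<in> Lsp n r \<Longrightarrow> f \<in> SchurPlus n r" and Jrad_Plus: "f \<in> Jrad n r \<Longrightarrow> f \<in> SchurPlus n r"
  unfolding Lsp_iff SchurPlus_iff Jrad_iff using lle_refl by blast+

lemma Plus_Schur: "f \<in> SchurPlus n r \<Longrightarrow> f \<in> Schur n r" and Jrad_Schur: "f \<in> Jrad n r \<Longrightarrow> f \<in> Schur n r"
  and Lsp_Schur: "f \<in> Lsp n r \<Longrightarrow> f \<in> Schur n r"
  by (auto simp: Lsp_iff SchurPlus_iff Jrad_iff)

lemma sone_Lsp: "sone n r \<in> Lsp n r"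
  unfolding Lsp_iff using sone_Schur by (auto simp: ker_sone kid_def split: if_splits)

lemma smul_Plus:
  assumes "f \<in> SchurPlus n r" "g \<in> SchurPlus n r" shows "smul n r f g \<in> SchurPlus n r"
  unfolding SchurPlus_iff
proof (intro conjI allI impI)
  show "smul n r f g \<in> Schur n r" using assms smul_Schur Plus_Schur by blast
  fix i j assume "ker n r (smul n r f g) i j \<noteq> 0"
  then obtain z where "ker n r f i z \<noteq> 0" "ker n r g z j \<noteq> 0"
    using kconv_nz[of n r "ker n r f" "ker n r g" i j] ker_smul[OF Plus_Schur[OF assms(1)] Plus_Schur[OF assms(2)]] by auto
  then have "lle i z" "lle z j" using assms by (auto simp: SchurPlus_iff)
  then show "lle i j" by (rule lle_trans)
qed

lemma lle_antisym: "lle x y \<Longrightarrow> lle y x \<Longrightarrow> x = y"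
  by (intro nth_equalityI) (auto simp: list_all2_conv_all_nth intro: le_antisym)

lemma smul_Jrad:
  assumes "f \<in> SchurPlus n r" "g \<in> SchurPlus n r" "f \<in> Jrad n r \<or> g \<in> Jrad n r" shows "smul n r f g \<in> Jrad n r"
  unfolding Jrad_iff
proof (intro conjI allI impI)
  show "smul n r f g \<in> Schur n r" using assms smul_Schur Plus_Schur by blast
  fix i j assume nz: "ker n r (smul n r f g) i j \<noteq> 0"
  then obtain z where z: "ker n r f i z \<noteq> 0" "ker n r g z j \<noteq> 0"
    using kconv_nz[of n r "ker n r f" "ker n r g" i j] ker_smul[OF Plus_Schur[OF assms(1)] Plus_Schur[OF assms(2)]] by auto
  then have a: "lle i z" "lle z j" using assms by (auto simp: SchurPlus_iff)
  show "lle i j" using smul_Plus[OF assms(1,2)] nz by (auto simp: SchurPlus_iff)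
  have "i \<noteq> z \<or> z \<noteq> j" using assms(3) z by (auto simp: Jrad_iff)
  then show "i \<noteq> j" using a lle_antisym by blast
qed

lemma sadd_Plus: "f \<in> SchurPlus n r \<Longrightarrow> g \<in> SchurPlus n r \<Longrightarrow> sadd n r f g \<in> SchurPlus n r"
  and sadd_Jrad: "f \<in> Jrad n r \<Longrightarrow> g \<in> Jrad n r \<Longrightarrow> sadd n r f g \<in> Jrad n r"
proof -
  have nz: "ker n r f i j \<noteq> 0 \<or> ker n r g i j \<noteq> 0" if "ker n r (sadd n r f g) i j \<noteq> 0" for i j
    using that by (auto simp: ker_sadd)
  show "f \<in> SchurPlus n r \<Longrightarrow> g \<in> SchurPlus n r \<Longrightarrow> sadd n r f g \<in> SchurPlus n r"
    unfolding SchurPlus_iff using sadd_Schur nz by blast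
  show "f \<in> Jrad n r \<Longrightarrow> g \<in> Jrad n r \<Longrightarrow> sadd n r f g \<in> Jrad n r"
    unfolding Jrad_iff using sadd_Schur nz by blast
qed

text \<open>Coefficient of the idempotent of weight \<open>mu\<close>, read at a chosen word of that
  content; for elements of the Schur algebra the choice is immaterial by invariance.\<close>

definition lc :: "nat \<Rightarrow> nat \<Rightarrow> 'a::comm_ring_1 endo \<Rightarrow> (nat \<Rightarrow> nat) \<Rightarrow> 'a" where
  "lc n r a mu = (let x = SOME x. x \<in> Inr n r \<and> cont x = mu in ker n r a x x)"

lemma lc_eq:
  assumes "a \<in> Schur n r" "x \<in> Inr n r" shows "ker n r a x x = lc n r a (cont x)"
proof -
  define y where "y = (SOME y. y \<in> Inr n r \<and> cont y = cont x)"
  have y: "y \<in> Inr n r" "cont y = cont x" unfolding y_def by (rule someI2[of _ x]; use assms in simp)+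
  have "wt x x = wt y y" using wt_diag assms y by simp
  then have "ker n r a x x = ker n r a y y" using linv_wt[OF Kin_inv[OF ker_Kin[OF assms(1)]]] assms y by blast
  then show ?thesis by (simp add: lc_def y_def Let_def)
qed

text \<open>Every expansion of \<open>a\<close> has the same coefficient at
  \<open>diagm lam\<close>, namely the kernel value at a diagonal pair of content
  \<open>lam\<close>, so the choice in the action is determined.\<close>

lemma rlam_act_eq:
  assumes lam: "lam \<in> Comps n r" and a: "a \<in> SchurPlus n r"
  shows "rlam_act n r lam a m = lc n r a lam * m"
proof -
  obtain x where x: "x \<in> Inr n r" "cont x = lam" using word_of_content[OF lam] by blast
  have d: "diagm lam = wt x x" using wt_diag x by simp
  have dM: "wt x x \<in> MatsUp n r 0" using MatsUp0_wt[OF x(1) x(1)] by (simp add: list_all2_same)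
  have c: "cs (diagm lam) = lc n r a lam" if "a = xicomb n r (MatsUp n r 0) cs" for cs
  proof -
    have "ker n r a x x = cs (wt x x)"
      unfolding that xicomb_eq[OF finite_MatsUp] ker_opr[OF kxi_Kin] using x dM by (simp add: kxi_def)
    then show ?thesis using lc_eq[OF Plus_Schur[OF a] x(1)] x d by simp
  qed
  obtain cs where cs: "a = xicomb n r (MatsUp n r 0) cs" using a by (auto simp: SchurPlus_def Jsp_def)
  have "(SOME c. \<exists>cs. a = xicomb n r (MatsUp n r 0) cs \<and> cs (diagm lam) = c) = lc n r a lam"
    by (rule some_equality) (use c cs in blast)+
  then show ?thesis by (simp add: rlam_act_def)
qed

lemma lc_sone: "mu \<in> Comps n r \<Longrightarrow> lc n r (sone n r) mu = 1"
  using word_of_content[of mu n r] lc_eq[OF sone_Schur] by (auto simp: ker_sone kid_def)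

lemma lc_Jrad: "a \<in> Jrad n r \<Longrightarrow> lc n r a mu = 0"
  unfolding lc_def Let_def Jrad_iff by blast

section \<open>Quotients of free abelian groups\<close>

lemma free_on_0: "(\<lambda>_. 0) \<in> free_on G" "0 \<in> free_on G"
  by (auto simp: free_on_def zero_fun_def)

lemma free_on_add: "f \<in> free_on G \<Longrightarrow> f' \<in> free_on G \<Longrightarrow> f + f' \<in> free_on G"
proof -
  assume a: "f \<in> free_on G" "f' \<in> free_on G"
  have "{g. (f + f') g \<noteq> 0} \<subseteq> {g. f g \<noteq> 0} \<union> {g. f' g \<noteq> 0}" by (auto simp: plus_fun_def)
  moreover have "finite ({g. f g \<noteq> 0} \<union> {g. f' g \<noteq> 0})" using a by (simp add: free_on_def)
  ultimately have "finite {g. (f + f') g \<noteq> 0}" by (rule finite_subset)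
  moreover have "g \<in> G" if "(f + f') g \<noteq> 0" for g using a that by (cases "f g = 0") (auto simp: free_on_def)
  ultimately show ?thesis by (simp add: free_on_def)
qed

lemma free_on_neg: "f \<in> free_on G \<Longrightarrow> - f \<in> free_on G"
  by (simp add: free_on_def)

lemma free_on_diff: "f \<in> free_on G \<Longrightarrow> f' \<in> free_on G \<Longrightarrow> f - f' \<in> free_on G"
  using free_on_add[OF _ free_on_neg] by force

lemma free_on_gen1: "g \<in> G \<Longrightarrow> gen1 g \<in> free_on G"
  by (simp add: free_on_def gen1_def)

lemma free_on_sum: "(\<And>x. x \<in> A \<Longrightarrow> f x \<in> free_on G) \<Longrightarrow> sum f A \<in> free_on G"
  by (induction A rule: infinite_finite_induct) (auto simp: free_on_0 free_on_add)

text \<open>Induction on the sum of the absolute values of the coefficients; each step moves one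
  nonzero coefficient towards zero.\<close>

lemma free_on_induct [consumes 1, case_names zero add diff]:
  assumes "f \<in> free_on G" "P 0"
    and add: "\<And>f g. f \<in> free_on G \<Longrightarrow> P f \<Longrightarrow> g \<in> G \<Longrightarrow> P (f + gen1 g)"
    and diff: "\<And>f g. f \<in> free_on G \<Longrightarrow> P f \<Longrightarrow> g \<in> G \<Longrightarrow> P (f - gen1 g)"
  shows "P f"
  using assms(1)
proof (induction "\<Sum>g\<in>{g. f g \<noteq> 0}. nat \<bar>f g\<bar>" arbitrary: f rule: less_induct)
  case less
  show ?case
  proof (cases "f = 0")
    case True
    then show ?thesis using assms(2) by simp
  next
    case False
    then obtain g where g: "f g \<noteq> 0" by (auto simp: fun_eq_iff)
    have fin: "finite {g. f g \<noteq> 0}" and gG: "g \<in> G" using less.prems g by (auto simp: free_on_def)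
    have m: "(\<Sum>g\<in>{g. f' g \<noteq> 0}. nat \<bar>f' g\<bar>) < (\<Sum>g\<in>{g. f g \<noteq> 0}. nat \<bar>f g\<bar>)"
      if h: "\<And>h. h \<noteq> g \<Longrightarrow> f' h = f h" "\<bar>f' g\<bar> < \<bar>f g\<bar>" for f' :: "'a \<Rightarrow> int"
    proof -
      have "(\<Sum>g\<in>{g. f' g \<noteq> 0}. nat \<bar>f' g\<bar>) \<le> (\<Sum>g\<in>{g. f g \<noteq> 0}. nat \<bar>f' g\<bar>)"
      proof (rule sum_mono2[OF fin])
        show "{g. f' g \<noteq> 0} \<subseteq> {g. f g \<noteq> 0}" using h(1) g by (metis (mono_tags, lifting) Collect_mono)
      qed simp
      also have "\<dots> < (\<Sum>g\<in>{g. f g \<noteq> 0}. nat \<bar>f g\<bar>)"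
      proof (rule sum_strict_mono_ex1[OF fin])
        show "\<forall>x\<in>{g. f g \<noteq> 0}. nat \<bar>f' x\<bar> \<le> nat \<bar>f x\<bar>" using h by (metis less_imp_le nat_mono order_refl)
        show "\<exists>a\<in>{g. f g \<noteq> 0}. nat \<bar>f' a\<bar> < nat \<bar>f a\<bar>" using h(2) g by (intro bexI[of _ g]) auto
      qed
      finally show ?thesis .
    qed
    show ?thesis
    proof (cases "f g > 0")
      case True
      have F: "f - gen1 g \<in> free_on G" using less.prems free_on_gen1[OF gG] by (rule free_on_diff)
      have "P (f - gen1 g)" by (rule less.hyps[OF m F]) (use True in \<open>auto simp: gen1_def\<close>)
      then show ?thesis using add[OF F _ gG] by simp
    next
      case False
      have F: "f + gen1 g \<in> free_on G" using less.prems free_on_gen1[OF gG] by (rule free_on_add)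
      have "P (f + gen1 g)" by (rule less.hyps[OF m F]) (use False g in \<open>auto simp: gen1_def\<close>)
      then show ?thesis using diff[OF F _ gG] by simp
    qed
  qed
qed

lemma zspan_0 [simp]: "0 \<in> zspan A"
  using zspan_zero[of A] by (simp add: zero_fun_def)

lemma zspan_plus:
  assumes "x \<in> zspan A" "y \<in> zspan A" shows "x + y \<in> zspan A"
  using assms(2)
proof (induction y rule: zspan.induct)
  case (zspan_add y a)
  have "(\<lambda>g. (x + y) g + a g) \<in> zspan A" using zspan_add by (intro zspan.zspan_add) auto
  then show ?case by (simp add: plus_fun_def add.assoc)
next
  case (zspan_diff y a)
  have "(\<lambda>g. (x + y) g - a g) \<in> zspan A" using zspan_diff by (intro zspan.zspan_diff) auto
  then show ?case by (simp add: plus_fun_def add_diff_eq)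
qed (use assms(1) in \<open>simp add: plus_fun_def\<close>)

lemma zspan_base: "a \<in> A \<Longrightarrow> a \<in> zspan A"
  using zspan_add[OF zspan_zero] by force

lemma zspan_neg: "x \<in> zspan A \<Longrightarrow> - x \<in> zspan A"
proof (induction x rule: zspan.induct)
  case (zspan_add x a)
  then have "(\<lambda>g. (- x) g - a g) \<in> zspan A" by (intro zspan.zspan_diff) auto
  then show ?case by (simp add: fun_Compl_def)
next
  case (zspan_diff x a)
  then have "(\<lambda>g. (- x) g + a g) \<in> zspan A" by (intro zspan.zspan_add) auto
  moreover have "(\<lambda>g. (- x) g + a g) = - (\<lambda>g. x g - a g)" by (simp add: fun_eq_iff)
  ultimately show ?case by simp
qed (use zspan_0 in \<open>simp add: zero_fun_def fun_Compl_def\<close>)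

lemma zspan_minus: "x \<in> zspan A \<Longrightarrow> y \<in> zspan A \<Longrightarrow> x - y \<in> zspan A"
  using zspan_plus[OF _ zspan_neg] by force

lemma zspan_free:
  assumes "A \<subseteq> free_on G" shows "zspan A \<subseteq> free_on G"
proof
  fix x assume "x \<in> zspan A"
  then show "x \<in> free_on G"
  proof (induction x rule: zspan.induct)
    case (zspan_add x a)
    then show ?case using free_on_add[of x G a] assms by (auto simp: plus_fun_def)
  next
    case (zspan_diff x a)
    then show ?case using free_on_diff[of x G a] assms by (auto simp: fun_diff_def)
  qed (rule free_on_0)
qed

definition eqm :: "('g \<Rightarrow> int) set \<Rightarrow> ('g \<Rightarrow> int) \<Rightarrow> ('g \<Rightarrow> int) \<Rightarrow> bool" where
  "eqm A f f' \<longleftrightarrow> f - f' \<in> zspan A"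

lemma eqm_refl [simp]: "eqm A f f"
  by (simp add: eqm_def)

lemma eqm_sym: "eqm A f f' \<Longrightarrow> eqm A f' f"
  unfolding eqm_def using zspan_neg by fastforce

lemma eqm_trans [trans]: "eqm A f f' \<Longrightarrow> eqm A f' f'' \<Longrightarrow> eqm A f f''"
  unfolding eqm_def using zspan_plus[of "f - f'" A "f' - f''"] by simp

lemma eqm_add: "eqm A f f' \<Longrightarrow> eqm A g g' \<Longrightarrow> eqm A (f + g) (f' + g')"
  unfolding eqm_def using zspan_plus[of "f - f'" A "g - g'"] by (simp add: algebra_simps)

lemma eqm_diff: "eqm A f f' \<Longrightarrow> eqm A g g' \<Longrightarrow> eqm A (f - g) (f' - g')"
  unfolding eqm_def using zspan_minus[of "f - f'" A "g - g'"] by (simp add: algebra_simps)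

lemma eqm_sum: "(\<And>x. x \<in> I \<Longrightarrow> eqm A (f x) (f' x)) \<Longrightarrow> eqm A (sum f I) (sum f' I)"
  by (induction I rule: infinite_finite_induct) (auto simp: eqm_add)

lemma eqm_rel2: "(\<lambda>g. a g - b g) \<in> A \<Longrightarrow> eqm A a b"
  unfolding eqm_def fun_diff_def by (rule zspan_base)

lemma eqm_rel3: "(\<lambda>g. a g - b g - c g) \<in> A \<Longrightarrow> eqm A a (b + c)"
  unfolding eqm_def using zspan_base[of "\<lambda>g. a g - b g - c g" A]
  by (simp add: fun_diff_def plus_fun_def diff_diff_eq)

text \<open>The way in which additivity relations force a generator with a zero entry to vanish in
  the quotient.\<close>

lemma eqm_double: "eqm A a (a + a) \<Longrightarrow> eqm A a 0"
  unfolding eqm_def using zspan_neg[of "a - (a + a)" A] by simp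

lemma qcls_eq_iff:
  assumes "f \<in> free_on G" "f' \<in> free_on G" shows "qcls G A f = qcls G A f' \<longleftrightarrow> eqm A f f'"
proof
  assume e: "qcls G A f = qcls G A f'"
  have "f \<in> qcls G A f" using assms zspan_zero by (auto simp: qcls_def)
  then have "f \<in> qcls G A f'" using e by simp
  then show "eqm A f f'" by (simp add: qcls_def eqm_def fun_diff_def)
next
  assume e: "eqm A f f'"
  have "eqm A h f \<longleftrightarrow> eqm A h f'" for h using e eqm_trans eqm_sym by blast
  then show "qcls G A f = qcls G A f'" by (simp add: qcls_def eqm_def fun_diff_def)
qed

lemma qrep_qcls:
  assumes "f \<in> free_on G"
  shows "qrep (qcls G A f) \<in> free_on G" "eqm A (qrep (qcls G A f)) f"
proof -
  have "f \<in> qcls G A f" using assms zspan_zero by (auto simp: qcls_def)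
  then have "qrep (qcls G A f) \<in> qcls G A f" unfolding qrep_def by (rule someI[of "\<lambda>h. h \<in> qcls G A f"])
  then show "qrep (qcls G A f) \<in> free_on G" "eqm A (qrep (qcls G A f)) f"
    by (auto simp: qcls_def eqm_def fun_diff_def)
qed

lemma quotE:
  assumes "X \<in> quot G A" shows "qrep X \<in> free_on G" "qcls G A (qrep X) = X"
proof -
  obtain f where f: "f \<in> free_on G" "X = qcls G A f" using assms by (auto simp: quot_def)
  show "qrep X \<in> free_on G" "qcls G A (qrep X) = X"
    unfolding f(2) using qrep_qcls[OF f(1)] qcls_eq_iff[OF _ f(1)] by auto
qed

lemma qcls_quot: "f \<in> free_on G \<Longrightarrow> qcls G A f \<in> quot G A"
  by (auto simp: quot_def)

text \<open>The additive extension of \<open>th\<close> to formal integer combinations, with values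
  in the ring. By \<open>Lin_eqm\<close> it descends to a quotient whose relations it kills.\<close>

definition Lin :: "('g \<Rightarrow> 'a::comm_ring_1) \<Rightarrow> ('g \<Rightarrow> int) \<Rightarrow> 'a" where
  "Lin th f = (\<Sum>g\<in>{g. f g \<noteq> 0}. of_int (f g) * th g)"

lemma Lin_eq: "finite S \<Longrightarrow> {g. f g \<noteq> 0} \<subseteq> S \<Longrightarrow> Lin th f = (\<Sum>g\<in>S. of_int (f g) * th g)"
  unfolding Lin_def by (rule sum.mono_neutral_left) auto

lemma Lin_0 [simp]: "Lin th 0 = 0"
  by (simp add: Lin_def)

lemma Lin_gen1 [simp]: "Lin th (gen1 g) = th g"
proof -
  have "{h. gen1 g h \<noteq> 0} = {g}" by (auto simp: gen1_def)
  then show ?thesis by (simp add: Lin_def gen1_def)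
qed

lemma Lin_add:
  assumes "f \<in> free_on G" "f' \<in> free_on G" shows "Lin th (f + f') = Lin th f + Lin th f'"
proof -
  define S where "S = {g. f g \<noteq> 0} \<union> {g. f' g \<noteq> 0}"
  have S: "finite S" using assms by (simp add: S_def free_on_def)
  have "Lin th (f + f') = (\<Sum>g\<in>S. of_int ((f + f') g) * th g)" by (rule Lin_eq[OF S]) (auto simp: S_def)
  moreover have "Lin th f = (\<Sum>g\<in>S. of_int (f g) * th g)" by (rule Lin_eq[OF S]) (auto simp: S_def)
  moreover have "Lin th f' = (\<Sum>g\<in>S. of_int (f' g) * th g)" by (rule Lin_eq[OF S]) (auto simp: S_def)
  ultimately show ?thesis by (simp add: distrib_right sum.distrib)
qed

lemma Lin_diff:
  assumes "f \<in> free_on G" "f' \<in> free_on G" shows "Lin th (f - f') = Lin th f - Lin th f'"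
  using Lin_add[OF free_on_diff[OF assms] assms(2), of th] by (simp add: algebra_simps)

lemma Lin_sum:
  assumes "finite I" "\<And>x. x \<in> I \<Longrightarrow> f x \<in> free_on G" shows "Lin th (sum f I) = (\<Sum>x\<in>I. Lin th (f x))"
  using assms
proof (induction I rule: finite_induct)
  case (insert x I)
  then have "Lin th (f x + sum f I) = Lin th (f x) + Lin th (sum f I)" by (intro Lin_add[of _ G] free_on_sum) auto
  moreover have "Lin th (sum f I) = (\<Sum>x\<in>I. Lin th (f x))" using insert by auto
  ultimately show ?case unfolding sum.insert[OF insert(1,2)] by (simp only:)
qed simp

lemma Lin_sum_fun: "Lin (\<lambda>g. \<Sum>x\<in>I. th g x) f = (\<Sum>x\<in>I. Lin (\<lambda>g. th g x) f)"
  unfolding Lin_def by (simp add: sum_distrib_left) (rule sum.swap)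

lemma Lin_mult_left: "Lin (\<lambda>g. c * th g) f = c * Lin th f"
  unfolding Lin_def by (simp add: sum_distrib_left mult.left_commute)

lemma Lin_mult_right: "Lin (\<lambda>g. th g * c) f = Lin th f * c"
  unfolding Lin_def by (simp add: sum_distrib_right mult.assoc)

lemma Lin_cong: "f \<in> free_on G \<Longrightarrow> (\<And>g. g \<in> G \<Longrightarrow> th g = th' g) \<Longrightarrow> Lin th f = Lin th' f"
  unfolding Lin_def by (intro sum.cong refl) (auto simp: free_on_def)

lemma Lin_zspan:
  assumes A: "A \<subseteq> free_on G" and v: "\<And>a. a \<in> A \<Longrightarrow> Lin th a = 0" and x: "x \<in> zspan A"
  shows "Lin th x = 0"
  using x
proof (induction x rule: zspan.induct)
  case (zspan_add x a)
  then have "Lin th (x + a) = 0" using Lin_add[of x G a th] zspan_free[OF A] A v by auto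
  then show ?case by (simp add: plus_fun_def)
next
  case (zspan_diff x a)
  then have "Lin th (x - a) = 0" using Lin_diff[of x G a th] zspan_free[OF A] A v by auto
  then show ?case by (simp add: fun_diff_def)
qed (simp add: Lin_def)

lemma Lin_eqm:
  assumes A: "A \<subseteq> free_on G" and v: "\<And>a. a \<in> A \<Longrightarrow> Lin th a = 0"
    and f: "f \<in> free_on G" "f' \<in> free_on G" and e: "eqm A f f'"
  shows "Lin th f = Lin th f'"
  using Lin_zspan[OF A v e[unfolded eqm_def]] Lin_diff[OF f, of th] by simp

lemma lin_ext_eq: "finite S \<Longrightarrow> {g. f g \<noteq> 0} \<subseteq> S \<Longrightarrow> lin_ext D f = (\<lambda>h. \<Sum>g\<in>S. f g * D g h)"
  unfolding lin_ext_def by (intro ext sum.mono_neutral_left) auto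

lemma lin_ext_0 [simp]: "lin_ext D 0 = 0"
  by (simp add: lin_ext_def fun_eq_iff)

lemma lin_ext_gen1 [simp]: "lin_ext D (gen1 g) = D g"
proof -
  have "{h. gen1 g h \<noteq> 0} = {g}" by (auto simp: gen1_def)
  then show ?thesis by (simp add: lin_ext_def gen1_def)
qed

lemma lin_ext_add:
  assumes "f \<in> free_on G" "f' \<in> free_on G" shows "lin_ext D (f + f') = lin_ext D f + lin_ext D f'"
proof -
  define S where "S = {g. f g \<noteq> 0} \<union> {g. f' g \<noteq> 0}"
  have S: "finite S" using assms by (simp add: S_def free_on_def)
  have "lin_ext D (f + f') = (\<lambda>h. \<Sum>g\<in>S. (f + f') g * D g h)" by (rule lin_ext_eq[OF S]) (auto simp: S_def)
  moreover have "lin_ext D f = (\<lambda>h. \<Sum>g\<in>S. f g * D g h)" by (rule lin_ext_eq[OF S]) (auto simp: S_def)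
  moreover have "lin_ext D f' = (\<lambda>h. \<Sum>g\<in>S. f' g * D g h)" by (rule lin_ext_eq[OF S]) (auto simp: S_def)
  ultimately show ?thesis by (simp add: distrib_right sum.distrib plus_fun_def)
qed

lemma lin_ext_diff:
  assumes "f \<in> free_on G" "f' \<in> free_on G" shows "lin_ext D (f - f') = lin_ext D f - lin_ext D f'"
  using lin_ext_add[OF free_on_diff[OF assms] assms(2), of D] by (simp add: algebra_simps)

lemma lin_ext_free:
  assumes D: "\<And>g. g \<in> G \<Longrightarrow> D g \<in> free_on H" and f: "f \<in> free_on G" shows "lin_ext D f \<in> free_on H"
  using f
proof (induction rule: free_on_induct)
  case (add f g)
  show ?case unfolding lin_ext_add[OF add(1) free_on_gen1[OF add(2)]] lin_ext_gen1
    by (rule free_on_add[OF add(3) D[OF add(2)]])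
next
  case (diff f g)
  show ?case unfolding lin_ext_diff[OF diff(1) free_on_gen1[OF diff(2)]] lin_ext_gen1
    by (rule free_on_diff[OF diff(3) D[OF diff(2)]])
qed (simp only: lin_ext_0 free_on_0)

lemma Lin_lin_ext:
  assumes D: "\<And>g. g \<in> G \<Longrightarrow> D g \<in> free_on H" and f: "f \<in> free_on G"
  shows "Lin th (lin_ext D f) = Lin (\<lambda>g. Lin th (D g)) f"
  using f
proof (induction rule: free_on_induct)
  case (add f g)
  note g = free_on_gen1[OF add(2)]
  have l: "lin_ext D f \<in> free_on H" by (rule lin_ext_free[OF _ add(1)]) (rule D)
  show ?case unfolding lin_ext_add[OF add(1) g] Lin_add[OF add(1) g] lin_ext_gen1 Lin_gen1
    Lin_add[OF l D[OF add(2)]] add(3) ..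
next
  case (diff f g)
  note g = free_on_gen1[OF diff(2)]
  have l: "lin_ext D f \<in> free_on H" by (rule lin_ext_free[OF _ diff(1)]) (rule D)
  show ?case unfolding lin_ext_diff[OF diff(1) g] Lin_diff[OF diff(1) g] lin_ext_gen1 Lin_gen1
    Lin_diff[OF l D[OF diff(2)]] diff(3) ..
qed (simp only: lin_ext_0 Lin_0)

lemma lin_ext_eqm:
  assumes A: "A \<subseteq> free_on G" and v: "\<And>a. a \<in> A \<Longrightarrow> eqm B (lin_ext D a) 0"
    and f: "f \<in> free_on G" "f' \<in> free_on G" and e: "eqm A f f'"
  shows "eqm B (lin_ext D f) (lin_ext D f')"
proof -
  have "eqm B (lin_ext D x) 0" if "x \<in> zspan A" for x using that
  proof (induction x rule: zspan.induct)
    case (zspan_add x a)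
    then have "lin_ext D (x + a) = lin_ext D x + lin_ext D a" using lin_ext_add[of x G a D] zspan_free[OF A] A by auto
    then show ?case using eqm_add[OF zspan_add(3) v[OF zspan_add(2)]] by (simp add: plus_fun_def)
  next
    case (zspan_diff x a)
    then have "lin_ext D (x - a) = lin_ext D x - lin_ext D a" using lin_ext_diff[of x G a D] zspan_free[OF A] A by auto
    then show ?case using eqm_diff[OF zspan_diff(3) v[OF zspan_diff(2)]] by (simp add: fun_diff_def)
  qed (use lin_ext_0[of D] in \<open>simp add: zero_fun_def\<close>)
  from this[OF e[unfolded eqm_def]] show ?thesis using lin_ext_diff[OF f, of D] by (simp add: eqm_def)
qed

section \<open>The terms of the bar construction as kernels indexed by chains\<close>

definition sc :: "nat \<Rightarrow> nat \<Rightarrow> 'a::comm_ring_1 \<Rightarrow> 'a endo" where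
  "sc n r c = opr n r (\<lambda>i j. c * kid n r i j)"

definition idl :: "nat \<Rightarrow> nat \<Rightarrow> (nat \<Rightarrow> nat) \<Rightarrow> 'a::comm_ring_1 endo" where
  "idl n r mu = opr n r (\<lambda>i j. if cont i = mu then kid n r i j else 0)"

definition zop :: "nat \<Rightarrow> nat \<Rightarrow> 'a::comm_ring_1 endo" where
  "zop n r = opr n r (\<lambda>_ _. 0)"

definition X :: "nat \<Rightarrow> nat \<Rightarrow> mat \<Rightarrow> 'a::comm_ring_1 endo" where
  "X n r w = opr n r (kxi n r {w} (\<lambda>_. 1))"

definition kc :: "nat \<Rightarrow> nat \<Rightarrow> 'a::comm_ring_1 endo \<Rightarrow> mat \<Rightarrow> 'a" where
  "kc n r a w = ker n r a (fst (rep n r w)) (snd (rep n r w))"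

text \<open>Coefficient of the basis chain \<open>t\<close> in the tensor of the elements of J in
  the list; it is meaningful for lists of equal length, the other cases being defaults.\<close>

fun prodc :: "nat \<Rightarrow> nat \<Rightarrow> 'a::comm_ring_1 endo list \<Rightarrow> mat list \<Rightarrow> 'a" where
  "prodc n r [] t = 1"
| "prodc n r (a # as) [] = 1"
| "prodc n r (a # as) (w # t) = kc n r a w * prodc n r as t"

lemma kid_diag: "(\<lambda>i j. c i * kid n r i j) \<in> Kin n r" if c: "\<And>p i. p permutes {..<r} \<Longrightarrow> length i = r \<Longrightarrow> c (permute_list p i) = c i"
proof -
  have "linv r (\<lambda>i j. c i * kid n r i j)"
    by (rule linvI) (use linvD[OF Kin_inv[OF kid_Kin]] c in \<open>metis\<close>)
  then show ?thesis by (auto simp: Kin_def kid_def split: if_splits)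
qed

lemma sc_Kin: "(\<lambda>i j. c * kid n r i j) \<in> Kin n r"
  by (rule kid_diag) simp

lemma idl_Kin: "(\<lambda>i j. if cont i = mu then kid n r i j else (0::'a::comm_ring_1)) \<in> Kin n r"
proof -
  have "(\<lambda>i j. (if cont i = mu then 1 else 0) * kid n r i j :: 'a) \<in> Kin n r"
    by (rule kid_diag) simp
  moreover have "(\<lambda>i j. (if cont i = mu then 1 else 0) * kid n r i j :: 'a) = (\<lambda>i j. if cont i = mu then kid n r i j else 0)"
    by (intro ext) simp
  ultimately show ?thesis by simp
qed

lemma zop_Kin: "(\<lambda>_ _. 0) \<in> Kin n r"
  by (simp add: Kin_def linv_def)

lemma ker_sc: "ker n r (sc n r c) = (\<lambda>i j. c * kid n r i j)"
  and ker_idl: "ker n r (idl n r mu) = (\<lambda>i j. if cont i = mu then kid n r i j else 0)"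
  and ker_zop: "ker n r (zop n r) = (\<lambda>_ _. 0)"
  and ker_X: "ker n r (X n r w) = kxi n r {w} (\<lambda>_. 1)"
  unfolding sc_def idl_def zop_def X_def by (rule ker_opr[OF sc_Kin] ker_opr[OF idl_Kin] ker_opr[OF zop_Kin] ker_opr[OF kxi_Kin])+

lemma sc_Schur: "sc n r c \<in> Schur n r" and idl_Schur: "idl n r mu \<in> Schur n r"
  and zop_Schur: "zop n r \<in> Schur n r" and X_Schur: "X n r w \<in> Schur n r"
  unfolding sc_def idl_def zop_def X_def by (rule opr_Schur[OF sc_Kin] opr_Schur[OF idl_Kin] opr_Schur[OF zop_Kin] opr_Schur[OF kxi_Kin])+

lemma sc_Lsp: "sc n r c \<in> Lsp n r" and idl_Lsp: "idl n r mu \<in> Lsp n r" and zop_Jrad: "zop n r \<in> Jrad n r"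
  by (auto simp: Lsp_iff Jrad_iff sc_Schur idl_Schur zop_Schur ker_sc ker_idl ker_zop kid_def split: if_splits)

lemma X_Jrad: "w \<in> Jm n r \<Longrightarrow> X n r w \<in> Jrad n r"
  using Jm_wt by (auto simp: Jrad_iff X_Schur ker_X kxi_def split: if_splits)

lemma kconv_diag_right:
  assumes "\<And>z j. b z j = d j * kid n r z j" "a \<in> Kin n r" shows "kconv n r a b i j = a i j * d j"
proof -
  have "kconv n r a b i j = d j * kconv n r a (kid n r) i j"
    by (simp add: kconv_def assms(1) sum_distrib_left mult_ac)
  then show ?thesis using kconv_kid(2)[OF assms(2)] by simp
qed

lemma kconv_diag_left:
  assumes "\<And>i z. b i z = d i * kid n r i z" "a \<in> Kin n r" shows "kconv n r b a i j = d i * a i j"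
proof -
  have "kconv n r b a i j = d i * kconv n r (kid n r) a i j"
    by (simp add: kconv_def assms(1) sum_distrib_left mult_ac)
  then show ?thesis using kconv_kid(1)[OF assms(2)] by simp
qed

lemma ker_Lsp:
  assumes l: "l \<in> Lsp n r"
  shows "ker n r l i j = lc n r l (cont j) * kid n r i j" "ker n r l i j = lc n r l (cont i) * kid n r i j"
proof -
  have z: "ker n r l i j = 0" if "i \<noteq> j \<or> i \<notin> Inr n r" using l that ker_nz[of n r l i j] by (auto simp: Lsp_iff)
  show "ker n r l i j = lc n r l (cont j) * kid n r i j" "ker n r l i j = lc n r l (cont i) * kid n r i j"
    using z lc_eq[OF Lsp_Schur[OF l], of i] by (cases "i = j \<and> i \<in> Inr n r"; auto simp: kid_def)+
qed

lemma ker_smul_L: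
  assumes a: "a \<in> Schur n r" and l: "l \<in> Lsp n r"
  shows "ker n r (smul n r a l) i j = ker n r a i j * lc n r l (cont j)"
    and "ker n r (smul n r l a) i j = lc n r l (cont i) * ker n r a i j"
  unfolding ker_smul[OF a Lsp_Schur[OF l]] ker_smul[OF Lsp_Schur[OF l] a]
  by (rule kconv_diag_right[OF ker_Lsp(1)[OF l] ker_Kin[OF a]], rule kconv_diag_left[OF ker_Lsp(2)[OF l] ker_Kin[OF a]])

lemma lc_sc: "mu \<in> Comps n r \<Longrightarrow> lc n r (sc n r c) mu = c"
  and lc_idl: "mu \<in> Comps n r \<Longrightarrow> lc n r (idl n r nu) mu = (if mu = nu then 1 else 0)"
proof -
  assume "mu \<in> Comps n r"
  then obtain x where x: "x \<in> Inr n r" "cont x = mu" using word_of_content by blast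
  show "lc n r (sc n r c) mu = c" using lc_eq[OF sc_Schur x(1), of c] x by (simp add: ker_sc kid_def)
  show "lc n r (idl n r nu) mu = (if mu = nu then 1 else 0)"
    using lc_eq[OF idl_Schur x(1), of nu] x by (auto simp: ker_idl kid_def)
qed

lemma kc_wt:
  assumes "a \<in> Schur n r" "i \<in> Inr n r" "j \<in> Inr n r" shows "kc n r a (wt i j) = ker n r a i j"
  unfolding kc_def by (rule linv_wt[OF Kin_inv[OF ker_Kin[OF assms(1)]]]) (use rep_props[OF wt_Mats[OF assms(2,3)]] assms in auto)

lemma kc_MatsE:
  assumes "w \<in> Mats n r"
  obtains i j where "i \<in> Inr n r" "j \<in> Inr n r" "w = wt i j" "rowc n w = cont i" "colc n w = cont j"
  using Mats_wt[OF assms] rowc_wt colc_wt that by metis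

lemma kc_smul_L:
  assumes a: "a \<in> Schur n r" and l: "l \<in> Lsp n r" and w: "w \<in> Mats n r"
  shows "kc n r (smul n r a l) w = kc n r a w * lc n r l (colc n w)"
    and "kc n r (smul n r l a) w = lc n r l (rowc n w) * kc n r a w"
proof -
  obtain i j where ij: "i \<in> Inr n r" "j \<in> Inr n r" "w = wt i j" "rowc n w = cont i" "colc n w = cont j"
    using kc_MatsE[OF w] .
  note L = Lsp_Schur[OF l]
  show "kc n r (smul n r a l) w = kc n r a w * lc n r l (colc n w)"
    using ker_smul_L(1)[OF a l, of i j] kc_wt[OF a ij(1,2)] kc_wt[OF smul_Schur[OF a L] ij(1,2)] ij by simp
  show "kc n r (smul n r l a) w = lc n r l (rowc n w) * kc n r a w"
    using ker_smul_L(2)[OF a l, of i j] kc_wt[OF a ij(1,2)] kc_wt[OF smul_Schur[OF L a] ij(1,2)] ij by simp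
qed

lemma kc_sadd: "kc n r (sadd n r a b) w = kc n r a w + kc n r b w"
  by (simp add: kc_def ker_sadd)

lemma ker_kxi:
  assumes a: "a \<in> Jrad n r" shows "a = opr n r (kxi n r (Jm n r) (kc n r a))"
proof -
  have "kxi n r (Jm n r) (kc n r a) i j = ker n r a i j" for i j
  proof (cases "i \<in> Inr n r \<and> j \<in> Inr n r \<and> wt i j \<in> Jm n r")
    case True
    then show ?thesis using kc_wt[OF Jrad_Schur[OF a]] by (simp add: kxi_def)
  next
    case False
    then have "ker n r a i j = 0" using a ker_nz[of n r a i j] Jm_wt unfolding Jrad_iff by blast
    then show ?thesis using False by (auto simp: kxi_def)
  qed
  then have "kxi n r (Jm n r) (kc n r a) = ker n r a" by (intro ext)
  then show ?thesis using opr_ker[OF Jrad_Schur[OF a]] by simp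
qed

lemma smul_sc:
  assumes "x \<in> Schur n r" shows "smul n r (sc n r c) x = smul n r x (sc n r c)"
proof -
  have "kconv n r (ker n r (sc n r c)) (ker n r x) i j = kconv n r (ker n r x) (ker n r (sc n r c)) i j" for i j
    unfolding ker_sc using kconv_diag_left[OF refl ker_Kin[OF assms], where d = "\<lambda>_. c"]
      kconv_diag_right[OF refl ker_Kin[OF assms], where d = "\<lambda>_. c"] by (simp add: mult.commute)
  then have "kconv n r (ker n r (sc n r c)) (ker n r x) = kconv n r (ker n r x) (ker n r (sc n r c))" by (intro ext)
  then show ?thesis by (simp add: smul_eq[OF sc_Schur assms] smul_eq[OF assms sc_Schur])
qed

lemma sadd_zop: "sadd n r (zop n r) (zop n r) = zop n r"
  by (rule Schur_eqI[of _ n r]) (auto simp: sadd_Schur zop_Schur ker_sadd ker_zop)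

lemma X_idl: "w \<in> Jm n r \<Longrightarrow> smul n r (X n r w) (idl n r (colc n w)) = X n r w"
proof (rule Schur_eqI)
  assume w: "w \<in> Jm n r"
  show "smul n r (X n r w) (idl n r (colc n w)) \<in> Schur n r" "X n r w \<in> Schur n r"
    by (rule smul_Schur[OF X_Schur idl_Schur] X_Schur)+
  have "ker n r (X n r w) i j * lc n r (idl n r (colc n w)) (cont j) = ker n r (X n r w) i j" for i j
  proof (cases "i \<in> Inr n r \<and> j \<in> Inr n r \<and> wt i j = w")
    case True
    then show ?thesis using colc_wt[of i n r j] by (auto simp: lc_idl cont_Comps)
  next
    case False
    then show ?thesis by (auto simp: ker_X kxi_def)
  qed
  then show "ker n r (smul n r (X n r w) (idl n r (colc n w))) = ker n r (X n r w)"
    by (intro ext) (simp add: ker_smul_L(1)[OF X_Schur idl_Lsp])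
qed

lemma idl_X: "w \<in> Jm n r \<Longrightarrow> smul n r (idl n r mu) (X n r w) = (if mu = rowc n w then X n r w else zop n r)"
proof (rule Schur_eqI)
  assume w: "w \<in> Jm n r"
  show "smul n r (idl n r mu) (X n r w) \<in> Schur n r" "(if mu = rowc n w then X n r w else zop n r) \<in> Schur n r"
    using smul_Schur[OF idl_Schur X_Schur] X_Schur zop_Schur by auto
  have "lc n r (idl n r mu) (cont i) * ker n r (X n r w) i j = ker n r (if mu = rowc n w then X n r w else zop n r) i j" for i j
  proof (cases "i \<in> Inr n r \<and> j \<in> Inr n r \<and> wt i j = w")
    case True
    then show ?thesis using rowc_wt[of i n r j] by (auto simp: lc_idl cont_Comps ker_zop)
  next
    case False
    then show ?thesis by (auto simp: ker_X kxi_def ker_zop)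
  qed
  then show "ker n r (smul n r (idl n r mu) (X n r w)) = ker n r (if mu = rowc n w then X n r w else zop n r)"
    by (intro ext) (simp only: ker_smul_L(2)[OF X_Schur idl_Lsp])
qed

lemma BGen_Cons: "(a # as, m) \<in> BGen n r k \<longleftrightarrow> a \<in> SchurPlus n r \<and> length as = k \<and> set as \<subseteq> Jrad n r"
proof -
  have "(\<forall>p\<le>k. (a # as) ! p \<in> slot n r p) \<longleftrightarrow> a \<in> SchurPlus n r \<and> (\<forall>q<k. as ! q \<in> Jrad n r)"
    unfolding less_Suc_eq_le[symmetric] All_less_Suc2 by (simp add: slot_def)
  note e = this
  have e2: "(\<forall>q<length as. as ! q \<in> Jrad n r) \<longleftrightarrow> set as \<subseteq> Jrad n r" by (auto simp: set_conv_nth)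
  have "(a # as, m) \<in> BGen n r k \<longleftrightarrow> length as = k \<and> (\<forall>p\<le>k. (a # as) ! p \<in> slot n r p)" by (simp add: BGen_def)
  then show ?thesis unfolding e using e2 by (cases "length as = k") simp_all
qed

lemma BGenE:
  assumes "g \<in> BGen n r k"
  obtains a as m where "g = (a # as, m)" "a \<in> SchurPlus n r" "length as = k" "set as \<subseteq> Jrad n r"
proof -
  obtain bs m where g: "g = (bs, m)" by (cases g)
  then obtain a as where "bs = a # as" using assms by (cases bs) (auto simp: BGen_def)
  then show ?thesis using that assms g by (simp add: BGen_Cons)
qed

lemma slot_Plus: "x \<in> slot n r p \<Longrightarrow> x \<in> SchurPlus n r" and slot_Schur: "x \<in> slot n r p \<Longrightarrow> x \<in> Schur n r"
  by (auto simp: slot_def split: if_splits intro: Jrad_Plus Plus_Schur Jrad_Schur)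

lemma slot_sadd: "x \<in> slot n r p \<Longrightarrow> y \<in> slot n r p \<Longrightarrow> sadd n r x y \<in> slot n r p"
  using sadd_Plus sadd_Jrad by (auto simp: slot_def)

lemma slot_smul:
  assumes "x \<in> slot n r p" "l \<in> Lsp n r"
  shows "smul n r x l \<in> slot n r p" "smul n r l x \<in> slot n r p"
proof -
  have "smul n r x l \<in> Jrad n r \<and> smul n r l x \<in> Jrad n r" if "x \<in> Jrad n r"
    using smul_Jrad[OF Jrad_Plus[OF that] Lsp_Plus[OF assms(2)]] smul_Jrad[OF Lsp_Plus[OF assms(2)] Jrad_Plus[OF that]] that by blast
  moreover have "smul n r x l \<in> SchurPlus n r \<and> smul n r l x \<in> SchurPlus n r"
    using smul_Plus slot_Plus[OF assms(1)] Lsp_Plus[OF assms(2)] by blast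
  ultimately show "smul n r x l \<in> slot n r p" "smul n r l x \<in> slot n r p" using assms(1) by (auto simp: slot_def split: if_splits)
qed

lemma BGen_nth: "(as, m) \<in> BGen n r k \<Longrightarrow> p \<le> k \<Longrightarrow> as ! p \<in> slot n r p"
  by (simp add: BGen_def)

lemma BGen_update: "(as, m) \<in> BGen n r k \<Longrightarrow> x \<in> slot n r p \<Longrightarrow> (as[p := x], m') \<in> BGen n r k"
proof -
  assume a: "(as, m) \<in> BGen n r k" "x \<in> slot n r p"
  have "as[p := x] ! q \<in> slot n r q" if "q \<le> k" for q
    using a that by (cases "q = p") (auto simp: BGen_def)
  then show ?thesis using a by (simp add: BGen_def)
qed

lemma gen1_diff_free: "a \<in> G \<Longrightarrow> b \<in> G \<Longrightarrow> (\<lambda>g. gen1 a g - gen1 b g) \<in> free_on G"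
  using free_on_diff[OF free_on_gen1 free_on_gen1, of a G b] by (simp add: fun_diff_def)

lemma gen1_diff2_free: "a \<in> G \<Longrightarrow> b \<in> G \<Longrightarrow> c \<in> G \<Longrightarrow> (\<lambda>g. gen1 a g - gen1 b g - gen1 c g) \<in> free_on G"
  using free_on_diff[OF gen1_diff_free free_on_gen1, of a G b c] by (simp add: fun_diff_def)

lemma Lin_rel2: "Lin th (\<lambda>g. gen1 a g - gen1 b g) = th a - th b"
  using Lin_diff[of "gen1 a" UNIV "gen1 b" th] by (simp add: free_on_gen1 fun_diff_def)

lemma Lin_rel3: "Lin th (\<lambda>g. gen1 a g - gen1 b g - gen1 c g) = th a - th b - th c"
  using Lin_diff[of "\<lambda>g. gen1 a g - gen1 b g" UNIV "gen1 c" th]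
  by (simp add: free_on_gen1 gen1_diff_free Lin_rel2) (simp add: fun_diff_def)

lemma BRel_free: "BRel n r lam k \<subseteq> free_on (BGen n r k)"
proof
  fix x :: "'a bgen \<Rightarrow> int" assume "x \<in> BRel n r lam k"
  then show "x \<in> free_on (BGen n r k)"
    unfolding BRel_def
  proof (elim UnE CollectE exE conjE, goal_cases)
    case (1 as m p x y)
    then show ?case by (simp, intro gen1_diff2_free BGen_update slot_sadd) assumption+
  next
    case (2 as m m')
    then show ?case by (simp add: BGen_def gen1_diff2_free)
  next
    case (3 as m p l)
    show ?case unfolding 3(1) by (intro gen1_diff_free BGen_update[OF 3(2)] slot_smul(1)[OF BGen_nth[OF 3(2)] 3(4)]
      slot_smul(2)[OF BGen_nth[OF 3(2)] 3(4)]) (use 3(3) in auto)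
  next
    case (4 as m l)
    show ?case unfolding 4(1) by (intro gen1_diff_free BGen_update[OF 4(2)] slot_smul(1)[OF BGen_nth[OF 4(2)] 4(3)])
      (use 4(2) in \<open>auto simp: BGen_def\<close>)
  qed
qed


section \<open>Expansion of tensors in basis chains\<close>

locale bar_terms =
  fixes n r :: nat and lam :: "nat \<Rightarrow> nat"
  assumes lam: "lam \<in> Comps n r"
begin

abbreviation "eqb k \<equiv> eqm (BRel n r lam k)"

lemma rel_add:
  assumes "(pre @ x # q, m) \<in> BGen n r k" "(pre @ y # q, m) \<in> BGen n r k"
  shows "eqb k (gen1 (pre @ sadd n r x y # q, m)) (gen1 (pre @ x # q, m) + gen1 (pre @ y # q, m))"
proof -
  let ?as = "pre @ x # q" and ?p = "length pre"
  have p: "?p \<le> k" using assms by (simp add: BGen_def)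
  have "x \<in> slot n r ?p" "y \<in> slot n r ?p" using BGen_nth[OF assms(1) p] BGen_nth[OF assms(2) p] by simp_all
  then have "(\<lambda>g. gen1 (?as[?p := sadd n r x y], m) g - gen1 (?as[?p := x], m) g - gen1 (?as[?p := y], m) g) \<in> BRel n r lam k"
    unfolding BRel_def using assms(1) p by blast
  from eqm_rel3[OF this] show ?thesis by simp
qed

lemma rel_scalar_add: "(as, m) \<in> BGen n r k \<Longrightarrow> eqb k (gen1 (as, m + m')) (gen1 (as, m) + gen1 (as, m'))"
  by (rule eqm_rel3) (unfold BRel_def, blast)

lemma rel_mid:
  assumes "(pre @ x # y # q, m) \<in> BGen n r k" "l \<in> Lsp n r"
  shows "eqb k (gen1 (pre @ smul n r x l # y # q, m)) (gen1 (pre @ x # smul n r l y # q, m))"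
proof -
  let ?as = "pre @ x # y # q" and ?p = "length pre"
  have p: "?p < k" using assms by (simp add: BGen_def)
  then have "(\<lambda>g. gen1 (?as[?p := smul n r (?as ! ?p) l], m) g - gen1 (?as[Suc ?p := smul n r l (?as ! Suc ?p)], m) g) \<in> BRel n r lam k"
    unfolding BRel_def using assms by blast
  from eqm_rel2[OF this] show ?thesis by (simp add: nth_append list_update_append)
qed

lemma rel_end:
  assumes "(pre @ [x], m) \<in> BGen n r k" "l \<in> Lsp n r"
  shows "eqb k (gen1 (pre @ [smul n r x l], m)) (gen1 (pre @ [x], lc n r l lam * m))"
proof -
  let ?as = "pre @ [x]"
  have p: "k = length pre" using assms by (simp add: BGen_def)
  have "(\<lambda>g. gen1 (?as[k := smul n r (?as ! k) l], m) g - gen1 (?as, rlam_act n r lam l m) g) \<in> BRel n r lam k"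
    unfolding BRel_def using assms by blast
  from eqm_rel2[OF this] show ?thesis by (simp add: p rlam_act_eq[OF lam Lsp_Plus[OF assms(2)]])
qed

lemma BGen_app: "(pre @ x # q, m) \<in> BGen n r k \<longleftrightarrow> length pre + length q = k \<and> (\<forall>p<length pre. pre ! p \<in> slot n r p)
    \<and> x \<in> slot n r (length pre) \<and> set q \<subseteq> Jrad n r"
proof (cases pre)
  case Nil
  then show ?thesis by (auto simp: BGen_Cons slot_def)
next
  case (Cons a as)
  have "(\<forall>p<length pre. pre ! p \<in> slot n r p) \<longleftrightarrow> a \<in> SchurPlus n r \<and> (\<forall>q<length as. as ! q \<in> Jrad n r)"
    unfolding Cons list.size add_Suc_right add_0_right All_less_Suc2 by (simp add: slot_def)
  moreover have "(\<forall>q<length as. as ! q \<in> Jrad n r) \<longleftrightarrow> set as \<subseteq> Jrad n r" by (auto simp: set_conv_nth)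
  ultimately show ?thesis by (auto simp: Cons BGen_Cons slot_def)
qed

text \<open>Scalar operators lie in L and commute with every factor, so a scalar passes all tensor
  signs to its right and finally acts on the last factor.\<close>

lemma scalar_move:
  "(pre @ x # q, m) \<in> BGen n r k \<Longrightarrow> eqb k (gen1 (pre @ smul n r x (sc n r c) # q, m)) (gen1 (pre @ x # q, c * m))"
proof (induction q arbitrary: pre x)
  case Nil
  then show ?case using rel_end[OF Nil sc_Lsp, of c] by (simp add: lc_sc[OF lam])
next
  case (Cons y q)
  have "y \<in> Schur n r" using Cons.prems by (auto simp: BGen_app intro: Jrad_Schur)
  then have "eqb k (gen1 (pre @ smul n r x (sc n r c) # y # q, m)) (gen1 ((pre @ [x]) @ smul n r y (sc n r c) # q, m))"
    using rel_mid[OF Cons.prems sc_Lsp, of c] smul_sc[of y n r c] by simp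
  also have "eqb k \<dots> (gen1 ((pre @ [x]) @ y # q, c * m))" by (rule Cons.IH) (use Cons.prems in simp)
  finally show ?case by simp
qed

lemma rel_zero: "(pre @ zop n r # q, m) \<in> BGen n r k \<Longrightarrow> eqb k (gen1 (pre @ zop n r # q, m)) 0"
  by (rule eqm_double) (use rel_add[of pre "zop n r" q m k "zop n r"] sadd_zop[of n r] in metis)

lemma rel_scalar_zero: "(as, 0) \<in> BGen n r k \<Longrightarrow> eqb k (gen1 (as, 0)) 0"
  by (rule eqm_double) (use rel_scalar_add[of as 0 k 0] in simp)

lemma tails_Jm: "s \<in> tails n r lam j \<Longrightarrow> set s \<subseteq> Jm n r \<and> length s = j"
  by (induction j arbitrary: s) (auto simp: subset_iff)

lemma tails_Jrad: "s \<in> tails n r lam j \<Longrightarrow> set (map (X n r) s) \<subseteq> Jrad n r"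
  using tails_Jm X_Jrad by fastforce

text \<open>The entry is expanded in the elements \<open>X n r w\<close>. The idempotent of weight
  \<open>colc n w\<close> fixes \<open>X n r w\<close> from the right; moved across the tensor sign
  it kills the next factor unless the contents match. At the end of the chain it acts on the scalar,
  by zero unless its weight is \<open>lam\<close>.\<close>

lemma slot_basis:
  assumes g: "(pre @ b # map (X n r) s, m) \<in> BGen n r k" and pre: "pre \<noteq> []" and s: "s \<in> tails n r lam j"
  shows "eqb k (gen1 (pre @ b # map (X n r) s, m))
     (\<Sum>w\<in>Jm n r. if colc n w = tsw n lam s then gen1 (pre @ X n r w # map (X n r) s, kc n r b w * m) else 0)"
proof -
  let ?q = "map (X n r) s"
  have B: "(pre @ x # ?q, m') \<in> BGen n r k" if "x \<in> Jrad n r" for x m'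
    using g that pre by (simp add: BGen_app slot_def)
  have b: "b \<in> Jrad n r" using g pre by (auto simp: BGen_app slot_def)
  define c where "c = kc n r b"
  define Z where "Z M = opr n r (kxi n r M c)" for M
  have ZS: "Z M \<in> Schur n r" and kZ: "ker n r (Z M) = kxi n r M c" for M
    unfolding Z_def by (rule opr_Schur[OF kxi_Kin], rule ker_opr[OF kxi_Kin])
  have ZJ: "Z M \<in> Jrad n r" if "M \<subseteq> Jm n r" for M
    using that Jm_wt[of _ n r] by (auto simp: Jrad_iff ZS kZ kxi_def split: if_splits)
  have sum: "eqb k (gen1 (pre @ Z M # ?q, m)) (\<Sum>w\<in>M. gen1 (pre @ Z {w} # ?q, m))" if "finite M" "M \<subseteq> Jm n r" for M
    using that
  proof (induction M rule: finite_induct)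
    case empty
    have "Z {} = zop n r" unfolding Z_def zop_def by (rule arg_cong[of _ _ "opr n r"]) (simp add: kxi_def fun_eq_iff)
    then show ?case using rel_zero[OF B[OF zop_Jrad]] by (simp only: sum.empty)
  next
    case (insert w M)
    have "Z (insert w M) = sadd n r (Z {w}) (Z M)"
    proof (rule Schur_eqI[of _ n r])
      show "ker n r (Z (insert w M)) = ker n r (sadd n r (Z {w}) (Z M))"
        using insert.hyps by (intro ext) (auto simp: ker_sadd kZ kxi_def)
    qed (simp_all add: ZS sadd_Schur)
    then have "eqb k (gen1 (pre @ Z (insert w M) # ?q, m)) (gen1 (pre @ Z {w} # ?q, m) + gen1 (pre @ Z M # ?q, m))"
      using rel_add[OF B[OF ZJ] B[OF ZJ], of "{w}" M] insert.prems by simp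
    also have "eqb k \<dots> (gen1 (pre @ Z {w} # ?q, m) + (\<Sum>w\<in>M. gen1 (pre @ Z {w} # ?q, m)))"
      by (rule eqm_add) (use insert in auto)
    finally show ?case unfolding sum.insert[OF insert(1,2)] .
  qed
  have single: "eqb k (gen1 (pre @ Z {w} # ?q, m))
      (if colc n w = tsw n lam s then gen1 (pre @ X n r w # ?q, c w * m) else 0)" if w: "w \<in> Jm n r" for w
  proof -
    have "Z {w} = smul n r (X n r w) (sc n r (c w))"
    proof (rule Schur_eqI[of _ n r])
      have "lc n r (sc n r (c w)) (cont y) = c w" if "y \<in> Inr n r" for y using lc_sc[OF cont_Comps[OF that]] .
      then show "ker n r (Z {w}) = ker n r (smul n r (X n r w) (sc n r (c w)))"
        by (intro ext) (auto simp: ker_smul_L(1)[OF X_Schur sc_Lsp] kZ ker_X kxi_def)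
    qed (simp_all add: ZS smul_Schur X_Schur sc_Schur)
    then have e: "eqb k (gen1 (pre @ Z {w} # ?q, m)) (gen1 (pre @ X n r w # ?q, c w * m))"
      using scalar_move[OF B[OF X_Jrad[OF w]]] by simp
    show ?thesis
    proof (cases "colc n w = tsw n lam s")
      case False
      let ?i = "idl n r (colc n w)"
      have "eqb k (gen1 (pre @ smul n r (X n r w) ?i # ?q, c w * m)) 0"
      proof (cases s)
        case Nil
        have "eqb k (gen1 (pre @ [smul n r (X n r w) ?i], c w * m)) (gen1 (pre @ [X n r w], lc n r ?i lam * (c w * m)))"
          by (rule rel_end[OF _ idl_Lsp]) (use B[OF X_Jrad[OF w]] Nil in simp)
        moreover have "lc n r ?i lam * (c w * m) = 0" using False Nil by (auto simp: lc_idl[OF lam])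
        ultimately have 1: "eqb k (gen1 (pre @ [smul n r (X n r w) ?i], c w * m)) (gen1 (pre @ [X n r w], 0))" by simp
        have 2: "eqb k (gen1 (pre @ [X n r w], 0)) 0"
          by (rule rel_scalar_zero) (use B[OF X_Jrad[OF w]] Nil in simp)
        show ?thesis using eqm_trans[OF 1 2] unfolding Nil list.map .
      next
        case (Cons v s')
        have v: "v \<in> Jm n r" using tails_Jm[OF s] Cons by simp
        have z: "smul n r ?i (X n r v) = zop n r" using False Cons by (simp add: idl_X[OF v])
        have "eqb k (gen1 (pre @ smul n r (X n r w) ?i # X n r v # map (X n r) s', c w * m))
            (gen1 (pre @ X n r w # zop n r # map (X n r) s', c w * m))"
          unfolding z[symmetric] by (rule rel_mid[OF _ idl_Lsp]) (use B[OF X_Jrad[OF w]] Cons in simp)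
        also have "eqb k \<dots> 0"
        proof -
          have "((pre @ [X n r w]) @ X n r v # map (X n r) s', c w * m) \<in> BGen n r k"
            using B[OF X_Jrad[OF w]] Cons by simp
          then have "((pre @ [X n r w]) @ zop n r # map (X n r) s', c w * m) \<in> BGen n r k"
            unfolding BGen_app by (simp add: slot_def zop_Jrad)
          from rel_zero[OF this] show ?thesis by simp
        qed
        finally show ?thesis using Cons by simp
      qed
      then have "eqb k (gen1 (pre @ X n r w # ?q, c w * m)) 0" unfolding X_idl[OF w] .
      from eqm_trans[OF e this] show ?thesis unfolding if_not_P[OF False] .
    qed (use e in simp)
  qed
  have "b = Z (Jm n r)" unfolding Z_def c_def by (rule ker_kxi[OF b])
  then have "eqb k (gen1 (pre @ b # ?q, m)) (\<Sum>w\<in>Jm n r. gen1 (pre @ Z {w} # ?q, m))" using sum[of "Jm n r"] by simp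
  also have "eqb k \<dots> (\<Sum>w\<in>Jm n r. if colc n w = tsw n lam s then gen1 (pre @ X n r w # ?q, c w * m) else 0)"
    by (rule eqm_sum) (rule single)
  finally show ?thesis by (simp only: c_def)
qed

text \<open>The slots are expanded from right to left, so that each entry meets a basis chain behind
  it. A nonempty \<open>pre\<close> protects the first factor, which belongs to the Borel subalgebra
  and is kept as it is.\<close>

lemma chain_basis:
  "(pre @ as, m) \<in> BGen n r k \<Longrightarrow> pre \<noteq> [] \<Longrightarrow> length as = j \<Longrightarrow>
     eqb k (gen1 (pre @ as, m)) (\<Sum>t\<in>tails n r lam j. gen1 (pre @ map (X n r) t, prodc n r as t * m))"
proof (induction j arbitrary: pre as)
  case 0
  then show ?case by simp
next
  case (Suc j)
  then obtain b bs where as: "as = b # bs" "length bs = j" by (cases as) auto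
  have "eqb k (gen1 ((pre @ [b]) @ bs, m)) (\<Sum>t\<in>tails n r lam j. gen1 ((pre @ [b]) @ map (X n r) t, prodc n r bs t * m))"
    by (rule Suc.IH) (use Suc.prems as in auto)
  also have "eqb k \<dots> (\<Sum>t\<in>tails n r lam j. \<Sum>w\<in>Jm n r. if colc n w = tsw n lam t
      then gen1 (pre @ X n r w # map (X n r) t, kc n r b w * (prodc n r bs t * m)) else 0)"
  proof (rule eqm_sum)
    fix t assume t: "t \<in> tails n r lam j"
    have "(pre @ b # map (X n r) t, prodc n r bs t * m) \<in> BGen n r k"
      using Suc.prems(1) as tails_Jm[OF t] tails_Jrad[OF t] unfolding as(1) BGen_app by simp
    from slot_basis[OF this Suc.prems(2) t]
    show "eqb k (gen1 ((pre @ [b]) @ map (X n r) t, prodc n r bs t * m)) (\<Sum>w\<in>Jm n r. if colc n w = tsw n lam t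
      then gen1 (pre @ X n r w # map (X n r) t, kc n r b w * (prodc n r bs t * m)) else 0)" by simp
  qed
  also have "(\<Sum>t\<in>tails n r lam j. \<Sum>w\<in>Jm n r. if colc n w = tsw n lam t
      then gen1 (pre @ X n r w # map (X n r) t, kc n r b w * (prodc n r bs t * m)) else 0)
     = (\<Sum>t\<in>tails n r lam (Suc j). gen1 (pre @ map (X n r) t, prodc n r as t * m))"
    unfolding sum_tails by (subst sum.swap) (simp add: as mult.assoc cong: if_cong)
  finally show ?case by (simp only: as append_assoc append_Cons append_Nil)
qed

end

section \<open>Coordinates on the terms before and after induction to the Schur algebra\<close>

definition CC :: "nat \<Rightarrow> nat \<Rightarrow> (nat \<Rightarrow> nat) \<Rightarrow> nat \<Rightarrow> (mat list \<Rightarrow> nat list \<Rightarrow> nat list \<Rightarrow> 'a::comm_ring_1) set" where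
  "CC n r lam k = {F. (\<forall>t. F t \<in> Kin n r) \<and> (\<forall>t i j. F t i j \<noteq> 0 \<longrightarrow> t \<in> tails n r lam k \<and> cont j = tsw n lam t)}"

definition CP :: "nat \<Rightarrow> nat \<Rightarrow> (nat \<Rightarrow> nat) \<Rightarrow> nat \<Rightarrow> (mat list \<Rightarrow> nat list \<Rightarrow> nat list \<Rightarrow> 'a::comm_ring_1) set" where
  "CP n r lam k = {F \<in> CC n r lam k. \<forall>t i j. F t i j \<noteq> 0 \<longrightarrow> lle i j}"

definition DD :: "nat \<Rightarrow> nat \<Rightarrow> (nat \<Rightarrow> nat) \<Rightarrow> nat \<Rightarrow> (mat list \<Rightarrow> nat list \<Rightarrow> nat list \<Rightarrow> 'a::comm_ring_1)
    \<Rightarrow> mat list \<Rightarrow> nat list \<Rightarrow> nat list \<Rightarrow> 'a" where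
  "DD n r lam k F = (\<lambda>u i j. if u \<in> tails n r lam k \<and> i \<in> Inr n r \<and> j \<in> Inr n r
     then \<Sum>t\<in>tails n r lam (Suc k). \<Sum>x\<in>Inr n r. F t i x * bde n r lam t u x j else 0)"

lemma CC_Kin: "F \<in> CC n r lam k \<Longrightarrow> F t \<in> Kin n r"
  and CC_supp: "F \<in> CC n r lam k \<Longrightarrow> F t i j \<noteq> 0 \<Longrightarrow> t \<in> tails n r lam k \<and> cont j = tsw n lam t"
  and CP_CC: "F \<in> CP n r lam k \<Longrightarrow> F \<in> CC n r lam k"
  and CP_lle: "F \<in> CP n r lam k \<Longrightarrow> F t i j \<noteq> 0 \<Longrightarrow> lle i j"
  by (auto simp: CC_def CP_def)

lemma Kin_diff: "a \<in> Kin n r \<Longrightarrow> b \<in> Kin n r \<Longrightarrow> (\<lambda>i j. a i j - b i j) \<in> Kin n r"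
proof -
  assume a: "a \<in> Kin n r" and b: "b \<in> Kin n r"
  have "i \<in> Inr n r \<and> j \<in> Inr n r" if "a i j - b i j \<noteq> 0" for i j
    using that Kin_nz[OF a, of i j] Kin_nz[OF b, of i j] by (cases "a i j = 0") auto
  then show ?thesis using Kin_inv[OF a] Kin_inv[OF b] by (auto simp: Kin_def linv_def)
qed

lemma CC_add: "F \<in> CC n r lam k \<Longrightarrow> G \<in> CC n r lam k \<Longrightarrow> (\<lambda>t i j. F t i j + G t i j) \<in> CC n r lam k"
  and CC_diff: "F \<in> CC n r lam k \<Longrightarrow> G \<in> CC n r lam k \<Longrightarrow> (\<lambda>t i j. F t i j - G t i j) \<in> CC n r lam k"
  and CC_0: "(\<lambda>t i j. 0) \<in> CC n r lam k"
proof -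
  show "(\<lambda>t i j. 0) \<in> CC n r lam k" by (simp add: CC_def zop_Kin)
  assume a: "F \<in> CC n r lam k" and b: "G \<in> CC n r lam k"
  have s: "t \<in> tails n r lam k \<and> cont j = tsw n lam t" if "F t i j \<noteq> 0 \<or> G t i j \<noteq> 0" for t i j
    using CC_supp[OF a, of t i j] CC_supp[OF b, of t i j] that by blast
  have "F t i j \<noteq> 0 \<or> G t i j \<noteq> 0" if "F t i j + G t i j \<noteq> 0" for t i j using that by auto
  then show "(\<lambda>t i j. F t i j + G t i j) \<in> CC n r lam k"
    unfolding CC_def using Kin_add[OF CC_Kin[OF a] CC_Kin[OF b]] s by blast
  have "F t i j \<noteq> 0 \<or> G t i j \<noteq> 0" if "F t i j - G t i j \<noteq> 0" for t i j using that by auto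
  then show "(\<lambda>t i j. F t i j - G t i j) \<in> CC n r lam k"
    unfolding CC_def using Kin_diff[OF CC_Kin[OF a] CC_Kin[OF b]] s by blast
qed

lemma CP_add: "F \<in> CP n r lam k \<Longrightarrow> G \<in> CP n r lam k \<Longrightarrow> (\<lambda>t i j. F t i j + G t i j) \<in> CP n r lam k"
  and CP_diff: "F \<in> CP n r lam k \<Longrightarrow> G \<in> CP n r lam k \<Longrightarrow> (\<lambda>t i j. F t i j - G t i j) \<in> CP n r lam k"
  and CP_0: "(\<lambda>t i j. 0) \<in> CP n r lam k"
proof -
  show "(\<lambda>t i j. 0) \<in> CP n r lam k" by (simp add: CP_def CC_0)
  assume a: "F \<in> CP n r lam k" and b: "G \<in> CP n r lam k"
  have s: "lle i j" if "F t i j \<noteq> 0 \<or> G t i j \<noteq> 0" for t i j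
    using CP_lle[OF a, of t i j] CP_lle[OF b, of t i j] that by blast
  have "lle i j" if "F t i j + G t i j \<noteq> 0" for t i j by (rule s[of t]) (use that in auto)
  then show "(\<lambda>t i j. F t i j + G t i j) \<in> CP n r lam k"
    unfolding CP_def using CC_add[OF CP_CC[OF a] CP_CC[OF b]] by blast
  have "lle i j" if "F t i j - G t i j \<noteq> 0" for t i j by (rule s[of t]) (use that in auto)
  then show "(\<lambda>t i j. F t i j - G t i j) \<in> CP n r lam k"
    unfolding CP_def using CC_diff[OF CP_CC[OF a] CP_CC[OF b]] by blast
qed

lemma CC_kconv:
  assumes s: "s \<in> Kin n r" and F: "F \<in> CC n r lam k" shows "(\<lambda>t. kconv n r s (F t)) \<in> CC n r lam k"
proof -
  have "t \<in> tails n r lam k \<and> cont j = tsw n lam t" if nz: "kconv n r s (F t) i j \<noteq> 0" for t i j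
  proof -
    obtain z where "F t z j \<noteq> 0" using kconv_nz[OF nz] by blast
    then show ?thesis by (rule CC_supp[OF F])
  qed
  then show ?thesis unfolding CC_def using kconv_Kin[OF s CC_Kin[OF F]] by blast
qed

lemma prodc_sadd:
  "q < length as \<Longrightarrow> length t = length as \<Longrightarrow>
     prodc n r (as[q := sadd n r x y]) t = prodc n r (as[q := x]) t + prodc n r (as[q := y]) t"
proof (induction as arbitrary: q t)
  case (Cons a as)
  then obtain w t' where t: "t = w # t'" by (cases t) auto
  show ?case
  proof (cases q)
    case 0
    then show ?thesis by (simp add: t kc_sadd distrib_right)
  next
    case (Suc q')
    then show ?thesis using Cons.IH[of q' t'] Cons.prems by (simp add: t distrib_left)
  qed
qed simp

context bar_terms begin

lemma prodc_mid:
  "t \<in> tails n r lam j \<Longrightarrow> set as \<subseteq> Jrad n r \<Longrightarrow> length as = j \<Longrightarrow> Suc q < j \<Longrightarrow> l \<in> Lsp n r \<Longrightarrow>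
    prodc n r (as[q := smul n r (as ! q) l]) t = prodc n r (as[Suc q := smul n r l (as ! Suc q)]) t"
proof (induction as arbitrary: q t j)
  case (Cons a as)
  then obtain j' where j: "j = Suc j'" by (cases j) auto
  obtain w t' where t: "t = w # t'" using Cons.prems(1) j by auto
  have w: "w \<in> Jm n r" "t' \<in> tails n r lam j'" "colc n w = tsw n lam t'" using Cons.prems(1) unfolding t j tails_Cons by auto
  show ?case
  proof (cases q)
    case 0
    then obtain b bs where as: "as = b # bs" using Cons.prems by (cases as) auto
    obtain v t'' where t': "t' = v # t''" using tails_Jm[OF w(2)] Cons.prems j as by (cases t') auto
    have v: "v \<in> Jm n r" using tails_Jm[OF w(2)] t' by simp
    have "a \<in> Schur n r" "b \<in> Schur n r" using Cons.prems as Jrad_Schur by auto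
    then show ?thesis using w(1,3) v Jm_sub[of n r] 0 Cons.prems(5)
      by (simp add: t t' as kc_smul_L subset_iff mult_ac)
  next
    case (Suc q')
    then show ?thesis using Cons.IH[OF w(2), of q'] Cons.prems j by (simp add: t)
  qed
qed simp

lemma prodc_end:
  "t \<in> tails n r lam (Suc (length bs)) \<Longrightarrow> x \<in> Schur n r \<Longrightarrow> l \<in> Lsp n r \<Longrightarrow>
    prodc n r (bs @ [smul n r x l]) t = prodc n r (bs @ [x]) t * lc n r l lam"
proof (induction bs arbitrary: t)
  case Nil
  then obtain w where w: "t = [w]" "w \<in> Jm n r" "colc n w = lam" by auto
  then show ?case using Jm_sub[of n r] Nil by (auto simp: kc_smul_L subset_iff)
next
  case (Cons a as)
  obtain w t' where t: "t = w # t'" using Cons.prems(1) by auto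
  have "t' \<in> tails n r lam (Suc (length as))" using Cons.prems(1) unfolding t list.size add_Suc_right add_0_right tails_Cons by blast
  then show ?case using Cons by (simp add: t mult.assoc)
qed

text \<open>Coordinates of a generator: the first factor is kept as a kernel and multiplied from the
  right by the idempotent of weight \<open>tsw n lam t\<close>, which the chain \<open>t\<close>
  absorbs.\<close>

definition thp :: "nat \<Rightarrow> 'a::comm_ring_1 bgen \<Rightarrow> mat list \<Rightarrow> nat list \<Rightarrow> nat list \<Rightarrow> 'a" where
  "thp k g t i j = (if t \<in> tails n r lam k \<and> cont j = tsw n lam t
     then ker n r (hd (fst g)) i j * prodc n r (tl (fst g)) t * snd g else 0)"

lemma thp_eq: "t \<in> tails n r lam k \<Longrightarrow> cont j = tsw n lam t \<Longrightarrow>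
    thp k (a # as, m) t i j = ker n r a i j * prodc n r as t * m"
  by (simp add: thp_def)

text \<open>An element of L scales a basis matrix by a value that depends on its column content from
  the right and on its row content from the left. On a composable chain these contents agree, so
  moving it across a tensor sign changes no coordinate.\<close>

lemma thp_rel:
  assumes x: "x \<in> BRel n r lam k" shows "Lin (\<lambda>g. thp k g t i j) x = 0"
proof (cases "t \<in> tails n r lam k \<and> cont j = tsw n lam t")
  case False
  then have "(\<lambda>g::'a bgen. thp k g t i j) = (\<lambda>_. 0)" by (auto simp: thp_def)
  then show ?thesis by (simp add: Lin_def)
next
  case True
  then have t: "t \<in> tails n r lam k" and c: "cont j = tsw n lam t" by auto
  note e = thp_eq[OF t c] and len = conjunct2[OF tails_Jm[OF t]]
  show ?thesis using x unfolding BRel_def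
  proof (elim UnE CollectE exE conjE, goal_cases)
    case (1 as m p y z)
    obtain a bs where as: "as = a # bs" "length bs = k" using 1(2) by (auto elim: BGenE)
    show ?case unfolding 1(1) Lin_rel3
    proof (cases p)
      case 0
      then show "thp k (as[p := sadd n r y z], m) t i j - thp k (as[p := y], m) t i j - thp k (as[p := z], m) t i j = 0"
        by (simp add: as e ker_sadd algebra_simps)
    next
      case (Suc q)
      then show "thp k (as[p := sadd n r y z], m) t i j - thp k (as[p := y], m) t i j - thp k (as[p := z], m) t i j = 0"
        using prodc_sadd[of q bs t n r y z] 1(3) len by (simp add: as e algebra_simps)
    qed
  next
    case (2 as m m')
    obtain a bs where as: "as = a # bs" using 2(2) by (auto elim: BGenE)
    show ?case unfolding 2(1) Lin_rel3 by (simp add: as e algebra_simps)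
  next
    case (3 as m p l)
    obtain a bs where as: "as = a # bs" "length bs = k" "a \<in> SchurPlus n r" "set bs \<subseteq> Jrad n r" using 3(2) by (auto elim: BGenE)
    show ?case unfolding 3(1) Lin_rel2
    proof (cases p)
      case 0
      then obtain b ds where bs: "bs = b # ds" using as 3(3) by (cases bs) auto
      obtain w t' where t': "t = w # t'" using len 3(3) by (cases t) auto
      have w: "w \<in> Mats n r" using tails_Jm[OF t] t' Jm_sub by auto
      have b: "b \<in> Schur n r" using as bs Jrad_Schur by auto
      show "thp k (as[p := smul n r (as ! p) l], m) t i j - thp k (as[Suc p := smul n r l (as ! Suc p)], m) t i j = 0"
        using c 0 kc_smul_L(2)[OF b 3(4) w] ker_smul_L(1)[OF Plus_Schur[OF as(3)] 3(4), of i j]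
        by (simp add: as(1) bs e[unfolded t'] t' mult_ac)
    next
      case (Suc q)
      then show "thp k (as[p := smul n r (as ! p) l], m) t i j - thp k (as[Suc p := smul n r l (as ! Suc p)], m) t i j = 0"
        using prodc_mid[OF t as(4,2) _ 3(4), of q] 3(3) by (simp add: as(1) e)
    qed
  next
    case (4 as m l)
    obtain a bs where as: "as = a # bs" "length bs = k" "a \<in> SchurPlus n r" "set bs \<subseteq> Jrad n r" using 4(2) by (auto elim: BGenE)
    have rl: "rlam_act n r lam l m = lc n r l lam * m" by (rule rlam_act_eq[OF lam Lsp_Plus[OF 4(3)]])
    show ?case unfolding 4(1) Lin_rel2 rl
    proof (cases bs rule: rev_cases)
      case Nil
      then have "t = []" "k = 0" using as len by auto
      then show "thp k (as[k := smul n r (as ! k) l], m) t i j - thp k (as, lc n r l lam * m) t i j = 0"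
        using c ker_smul_L(1)[OF Plus_Schur[OF as(3)] 4(3), of i j] Nil by (simp add: as(1) thp_def mult.assoc)
    next
      case (snoc ds x)
      have k: "k = Suc (length ds)" using as snoc by simp
      have x: "x \<in> Schur n r" using as snoc Jrad_Schur by auto
      have "as[k := smul n r (as ! k) l] = a # ds @ [smul n r x l]" using k by (simp add: as(1) snoc)
      then show "thp k (as[k := smul n r (as ! k) l], m) t i j - thp k (as, lc n r l lam * m) t i j = 0"
        using prodc_end[OF t[unfolded k] x 4(3)] by (simp add: as(1) snoc e mult_ac)
    qed
  qed
qed

lemma thp_CP:
  assumes g: "g \<in> BGen n r k" shows "thp k g \<in> CP n r lam k"
proof -
  obtain a as m where g': "g = (a # as, m)" "a \<in> SchurPlus n r" using g by (auto elim: BGenE)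
  note a = ker_Kin[OF Plus_Schur[OF g'(2)]]
  have "thp k g t \<in> Kin n r" for t
  proof -
    have "linv r (thp k g t)"
    proof (rule linvI)
      fix p and i j :: "nat list" assume p: "p permutes {..<r}" and l: "length i = r" "length j = r"
      have "mset (permute_list p j) = mset j" using p l by simp
      then show "thp k g t (permute_list p i) (permute_list p j) = thp k g t i j"
        using linvD[OF Kin_inv[OF a] p l] by (simp add: thp_def g' cong: if_cong)
    qed
    moreover have "i \<in> Inr n r \<and> j \<in> Inr n r" if "thp k g t i j \<noteq> 0" for i j
    proof -
      have "ker n r a i j \<noteq> 0" using that by (auto simp: thp_def g' split: if_splits)
      then show ?thesis by (rule ker_nz)
    qed
    ultimately show ?thesis by (simp add: Kin_def)
  qed
  moreover have "lle i j" if "thp k g t i j \<noteq> 0" for t i j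
  proof -
    have "ker n r a i j \<noteq> 0" using that by (auto simp: thp_def g' split: if_splits)
    then show ?thesis using g'(2) by (auto simp: SchurPlus_iff)
  qed
  ultimately show ?thesis by (auto simp: CP_def CC_def thp_def)
qed

definition phi :: "nat \<Rightarrow> ('a::comm_ring_1 bgen \<Rightarrow> int) \<Rightarrow> mat list \<Rightarrow> nat list \<Rightarrow> nat list \<Rightarrow> 'a" where
  "phi k f t i j = Lin (\<lambda>g. thp k g t i j) f"

lemma phi_add: "f \<in> free_on G \<Longrightarrow> f' \<in> free_on G \<Longrightarrow> phi k (f + f') = (\<lambda>t i j. phi k f t i j + phi k f' t i j)"
  and phi_diff: "f \<in> free_on G \<Longrightarrow> f' \<in> free_on G \<Longrightarrow> phi k (f - f') = (\<lambda>t i j. phi k f t i j - phi k f' t i j)"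
  and phi_gen1: "phi k (gen1 g) = thp k g"
  and phi_0: "phi k 0 = (\<lambda>t i j. 0)"
  by (intro ext, simp only: phi_def Lin_add Lin_diff Lin_gen1 Lin_0)+

lemma phi_CP: "f \<in> free_on (BGen n r k) \<Longrightarrow> phi k f \<in> CP n r lam k"
proof (induction rule: free_on_induct)
  case zero
  show ?case unfolding phi_0 by (rule CP_0)
next
  case (add f g)
  show ?case unfolding phi_add[OF add(1) free_on_gen1[OF add(2)]] phi_gen1
    by (rule CP_add[OF add(3) thp_CP[OF add(2)]])
next
  case (diff f g)
  show ?case unfolding phi_diff[OF diff(1) free_on_gen1[OF diff(2)]] phi_gen1
    by (rule CP_diff[OF diff(3) thp_CP[OF diff(2)]])
qed

lemma phi_eqb:
  "f \<in> free_on (BGen n r k) \<Longrightarrow> f' \<in> free_on (BGen n r k) \<Longrightarrow> eqb k f f' \<Longrightarrow> phi k f = phi k f'"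
  unfolding phi_def by (intro ext Lin_eqm[OF BRel_free thp_rel])

text \<open>The inverse of \<open>phi\<close> modulo the relations: each coordinate kernel is put in
  front of its basis chain.\<close>

definition sigb :: "nat \<Rightarrow> (mat list \<Rightarrow> nat list \<Rightarrow> nat list \<Rightarrow> 'a::comm_ring_1) \<Rightarrow> 'a bgen \<Rightarrow> int" where
  "sigb k F = (\<Sum>t\<in>tails n r lam k. gen1 (opr n r (F t) # map (X n r) t, 1))"

lemma opr_Plus: "F \<in> CP n r lam k \<Longrightarrow> opr n r (F t) \<in> SchurPlus n r"
proof -
  assume F: "F \<in> CP n r lam k"
  note K = CC_Kin[OF CP_CC[OF F], of t]
  show ?thesis using CP_lle[OF F] by (auto simp: SchurPlus_iff opr_Schur[OF K] ker_opr[OF K])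
qed

lemma BGen_X: "a \<in> SchurPlus n r \<Longrightarrow> t \<in> tails n r lam k \<Longrightarrow> (a # map (X n r) t, m) \<in> BGen n r k"
  using tails_Jm[of t k] tails_Jrad[of t k] by (simp add: BGen_Cons)

lemma sadd_opr:
  assumes "a \<in> Kin n r" "b \<in> Kin n r"
  shows "opr n r (\<lambda>i j. a i j + b i j) = sadd n r (opr n r a) (opr n r b)"
  by (rule Schur_eqI[of _ n r])
    (simp_all add: opr_Schur sadd_Schur Kin_add assms ker_sadd ker_opr[OF Kin_add[OF assms]] ker_opr)

lemma sigb_add:
  assumes F: "F \<in> CP n r lam k" and G: "G \<in> CP n r lam k"
  shows "eqb k (sigb k (\<lambda>t i j. F t i j + G t i j)) (sigb k F + sigb k G)"
  unfolding sigb_def sum.distrib[symmetric]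
proof (rule eqm_sum)
  fix t assume t: "t \<in> tails n r lam k"
  show "eqb k (gen1 (opr n r (\<lambda>i j. F t i j + G t i j) # map (X n r) t, 1))
      (gen1 (opr n r (F t) # map (X n r) t, 1) + gen1 (opr n r (G t) # map (X n r) t, 1))"
    unfolding sadd_opr[OF CC_Kin[OF CP_CC[OF F]] CC_Kin[OF CP_CC[OF G]]]
    by (rule rel_add[of "[]", unfolded append_Nil]) (rule BGen_X[OF opr_Plus[OF F] t] BGen_X[OF opr_Plus[OF G] t])+
qed

lemma sigb_diff:
  assumes F: "F \<in> CP n r lam k" and G: "G \<in> CP n r lam k"
  shows "eqb k (sigb k (\<lambda>t i j. F t i j - G t i j)) (sigb k F - sigb k G)"
proof -
  have "eqb k (sigb k (\<lambda>t i j. F t i j - G t i j + G t i j)) (sigb k (\<lambda>t i j. F t i j - G t i j) + sigb k G)"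
    by (rule sigb_add[OF CP_diff[OF F G] G])
  then have "eqb k (sigb k F) (sigb k (\<lambda>t i j. F t i j - G t i j) + sigb k G)" by (simp only: diff_add_cancel)
  from eqm_diff[OF this eqm_refl[of _ "sigb k G"]]
  have "eqb k (sigb k F - sigb k G) (sigb k (\<lambda>t i j. F t i j - G t i j))" unfolding add_diff_cancel_right' .
  then show ?thesis by (rule eqm_sym)
qed

lemma sigb_0: "eqb k (sigb k (\<lambda>t i j. 0::'a::comm_ring_1)) 0"
proof -
  have "eqb k (sigb k (\<lambda>t i j. 0 + 0::'a)) (sigb k (\<lambda>t i j. 0) + sigb k (\<lambda>t i j. 0))"
    by (rule sigb_add[OF CP_0 CP_0])
  then have "eqb k (sigb k (\<lambda>t i j. 0::'a)) (sigb k (\<lambda>t i j. 0) + sigb k (\<lambda>t i j. 0))"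
    unfolding add_0_right .
  then show ?thesis by (rule eqm_double)
qed

text \<open>After expansion in chains, the idempotent of weight \<open>tsw n lam t\<close> can be
  drawn from the chain into the first factor, which restricts its kernel to the right columns as
  \<open>thp\<close> does; the coefficients join it as scalars.\<close>

lemma sigb_gen:
  assumes g: "g \<in> BGen n r k" shows "eqb k (gen1 g) (sigb k (thp k g))"
proof -
  obtain a as m where g': "g = (a # as, m)" "a \<in> SchurPlus n r" "length as = k" using g by (auto elim: BGenE)
  have "eqb k (gen1 ([a] @ as, m)) (\<Sum>t\<in>tails n r lam k. gen1 ([a] @ map (X n r) t, prodc n r as t * m))"
    by (rule chain_basis) (use g g' in auto)
  also have "eqb k \<dots> (sigb k (thp k g))" unfolding sigb_def
  proof (rule eqm_sum)
    fix t assume t: "t \<in> tails n r lam k"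
    define c where "c = prodc n r as t * m"
    define b where "b = smul n r a (sc n r c)"
    let ?i = "idl n r (tsw n lam t)"
    have b: "b \<in> SchurPlus n r" unfolding b_def by (rule smul_Plus[OF g'(2) Lsp_Plus[OF sc_Lsp]])
    have o: "opr n r (thp k g t) = smul n r b ?i"
    proof (rule Schur_eqI[of _ n r])
      note K = CC_Kin[OF CP_CC[OF thp_CP[OF g]], of t]
      show "opr n r (thp k g t) \<in> Schur n r" by (rule opr_Schur[OF K])
      show "smul n r b ?i \<in> Schur n r" by (rule smul_Schur[OF Plus_Schur[OF b] idl_Schur])
      have "thp k g t i j = ker n r (smul n r b ?i) i j" for i j
      proof (cases "j \<in> Inr n r")
        case True
        have 1: "ker n r b i j = ker n r a i j * c"
          unfolding b_def ker_smul_L(1)[OF Plus_Schur[OF g'(2)] sc_Lsp] lc_sc[OF cont_Comps[OF True]] ..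
        show ?thesis unfolding ker_smul_L(1)[OF Plus_Schur[OF b] idl_Lsp] lc_idl[OF cont_Comps[OF True]] 1
          using t by (simp add: thp_def g'(1) c_def mult.assoc)
      next
        case False
        then have "ker n r a i j = 0" "ker n r (smul n r b ?i) i j = 0" by (auto simp: ker_def)
        then show ?thesis by (simp add: thp_def g'(1))
      qed
      then show "ker n r (opr n r (thp k g t)) = ker n r (smul n r b ?i)" unfolding ker_opr[OF K] by (intro ext)
    qed
    have "eqb k (gen1 (smul n r b ?i # map (X n r) t, 1)) (gen1 (b # map (X n r) t, 1))"
    proof (cases t)
      case Nil
      then show ?thesis using rel_end[of "[]" b 1 k, OF _ idl_Lsp, of lam] BGen_X[OF b t] by (simp add: lc_idl[OF lam])
    next
      case (Cons w s)
      have w: "w \<in> Jm n r" using tails_Jm[OF t] Cons by simp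
      show ?thesis using rel_mid[of "[]" b "X n r w" "map (X n r) s" 1 k, OF _ idl_Lsp, of "rowc n w"] BGen_X[OF b t]
        by (simp add: Cons idl_X[OF w])
    qed
    moreover have "eqb k (gen1 (b # map (X n r) t, 1)) (gen1 (a # map (X n r) t, c))"
      using scalar_move[of "[]" a "map (X n r) t" 1 k c] BGen_X[OF g'(2) t] by (simp add: b_def)
    ultimately show "eqb k (gen1 ([a] @ map (X n r) t, prodc n r as t * m)) (gen1 (opr n r (thp k g t) # map (X n r) t, 1))"
      unfolding o c_def[symmetric] append_Cons append_Nil using eqm_trans eqm_sym by blast
  qed
  finally show ?thesis by (simp add: g'(1))
qed

lemma sigb_phi: "f \<in> free_on (BGen n r k) \<Longrightarrow> eqb k f (sigb k (phi k f))"
proof (induction rule: free_on_induct)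
  case zero
  show ?case unfolding phi_0 by (rule eqm_sym[OF sigb_0])
next
  case (add f g)
  show ?case unfolding phi_add[OF add(1) free_on_gen1[OF add(2)]] phi_gen1
    by (rule eqm_trans[OF eqm_add[OF add(3) sigb_gen[OF add(2)]] eqm_sym[OF sigb_add[OF phi_CP[OF add(1)] thp_CP[OF add(2)]]]])
next
  case (diff f g)
  show ?case unfolding phi_diff[OF diff(1) free_on_gen1[OF diff(2)]] phi_gen1
    by (rule eqm_trans[OF eqm_diff[OF diff(3) sigb_gen[OF diff(2)]] eqm_sym[OF sigb_diff[OF phi_CP[OF diff(1)] thp_CP[OF diff(2)]]]])
qed

lemma eqb_iff:
  assumes "f \<in> free_on (BGen n r k)" "f' \<in> free_on (BGen n r k)"
  shows "eqb k f f' \<longleftrightarrow> phi k f = phi k f'"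
proof
  assume "phi k f = phi k f'"
  then have "eqb k f (sigb k (phi k f'))" using sigb_phi[OF assms(1)] by simp
  then show "eqb k f f'" by (rule eqm_trans[OF _ eqm_sym[OF sigb_phi[OF assms(2)]]])
qed (rule phi_eqb[OF assms])

end

lemma kconv_Lin: "kconv n r a (\<lambda>x y. Lin (\<lambda>g. th g x y) f) i j = Lin (\<lambda>g. kconv n r a (th g) i j) f"
  unfolding kconv_def by (simp add: Lin_sum_fun Lin_mult_left)

lemma kconv_add_left: "kconv n r (\<lambda>i j. a i j + b i j) c x y = kconv n r a c x y + kconv n r b c x y"
  and kconv_add_right: "kconv n r c (\<lambda>i j. a i j + b i j) x y = kconv n r c a x y + kconv n r c b x y"
  unfolding kconv_def by (simp_all add: distrib_left distrib_right sum.distrib)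

lemma fadd_plus: "fadd f f' = f + f'"
  by (simp add: fadd_def plus_fun_def)

lemma smul_sone: "a \<in> Schur n r \<Longrightarrow> smul n r a (sone n r) = a"
  by (simp add: smul_eq sone_Schur ker_sone kconv_kid(2)[OF ker_Kin] opr_ker)

section \<open>Coordinates on the induced terms\<close>

context bar_terms begin

abbreviation "eqo k \<equiv> eqm (BRelO n r lam k)"
abbreviation "FB k \<equiv> free_on (BGen n r k)"
abbreviation "FO k \<equiv> free_on (BGenO n r lam k)"

definition ph :: "nat \<Rightarrow> 'a::comm_ring_1 bplus \<Rightarrow> mat list \<Rightarrow> nat list \<Rightarrow> nat list \<Rightarrow> 'a" where
  "ph k Y = phi k (qrep Y)"

lemma Bplus_rep: "Y \<in> Bplus n r lam k \<Longrightarrow> qrep Y \<in> FB k" "Y \<in> Bplus n r lam k \<Longrightarrow> bcls n r lam k (qrep Y) = Y"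
  unfolding Bplus_def bcls_def by (rule quotE, assumption)+

lemma bcls_Bplus: "f \<in> FB k \<Longrightarrow> bcls n r lam k f \<in> Bplus n r lam k"
  unfolding Bplus_def bcls_def by (rule qcls_quot)

lemma ph_bcls: "f \<in> FB k \<Longrightarrow> ph k (bcls n r lam k f) = phi k f"
  unfolding ph_def bcls_def by (rule phi_eqb[OF qrep_qcls(1) _ qrep_qcls(2)])

lemma Bplus_eqI:
  assumes "Y \<in> Bplus n r lam k" "Z \<in> Bplus n r lam k" "ph k Y = ph k Z" shows "Y = Z"
proof -
  have "bcls n r lam k (qrep Y) = bcls n r lam k (qrep Z)"
    unfolding bcls_def qcls_eq_iff[OF Bplus_rep(1)[OF assms(1)] Bplus_rep(1)[OF assms(2)]]
      eqb_iff[OF Bplus_rep(1)[OF assms(1)] Bplus_rep(1)[OF assms(2)]] using assms(3) by (simp only: ph_def)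
  then show ?thesis unfolding Bplus_rep(2)[OF assms(1)] Bplus_rep(2)[OF assms(2)] .
qed

lemma ph_CP: "Y \<in> Bplus n r lam k \<Longrightarrow> ph k Y \<in> CP n r lam k"
  unfolding ph_def by (rule phi_CP[OF Bplus_rep(1)])

lemma ph_add:
  assumes "Y \<in> Bplus n r lam k" "Z \<in> Bplus n r lam k"
  shows "bplus_add n r lam k Y Z \<in> Bplus n r lam k"
    "ph k (bplus_add n r lam k Y Z) = (\<lambda>t i j. ph k Y t i j + ph k Z t i j)"
proof -
  note r = Bplus_rep(1)[OF assms(1)] Bplus_rep(1)[OF assms(2)]
  show "bplus_add n r lam k Y Z \<in> Bplus n r lam k"
    unfolding bplus_add_def fadd_plus by (rule bcls_Bplus[OF free_on_add[OF r]])
  show "ph k (bplus_add n r lam k Y Z) = (\<lambda>t i j. ph k Y t i j + ph k Z t i j)"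
    unfolding bplus_add_def fadd_plus ph_bcls[OF free_on_add[OF r]] phi_add[OF r] by (simp only: ph_def)
qed

lemma thp_smul:
  assumes "a \<in> Schur n r" "b \<in> Schur n r"
  shows "thp k (smul n r a b # bs, m) t i j = kconv n r (ker n r a) (thp k (b # bs, m) t) i j"
proof (cases "t \<in> tails n r lam k \<and> cont j = tsw n lam t")
  case True
  then show ?thesis by (simp add: thp_def ker_smul[OF assms] kconv_def sum_distrib_right mult.assoc)
next
  case False
  then show ?thesis by (auto simp: thp_def kconv_def)
qed

lemma ph_act:
  assumes a: "a \<in> SchurPlus n r" and Y: "Y \<in> Bplus n r lam k"
  shows "bplus_act n r lam k a Y \<in> Bplus n r lam k"
    "ph k (bplus_act n r lam k a Y) = (\<lambda>t. kconv n r (ker n r a) (ph k Y t))"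
proof -
  note r = Bplus_rep(1)[OF Y]
  define D :: "'a bgen \<Rightarrow> 'a bgen \<Rightarrow> int" where "D = (\<lambda>(as, m). gen1 (as[0 := smul n r a (as ! 0)], m))"
  have D: "D g \<in> FB k" if "g \<in> BGen n r k" for g
    using that by (rule BGenE) (auto simp: D_def BGen_Cons smul_Plus[OF a] intro!: free_on_gen1)
  have l: "lin_ext D (qrep Y) \<in> FB k" by (rule lin_ext_free[OF _ r]) (rule D)
  have e: "bplus_act n r lam k a Y = bcls n r lam k (lin_ext D (qrep Y))" by (simp add: bplus_act_def D_def)
  show "bplus_act n r lam k a Y \<in> Bplus n r lam k" unfolding e by (rule bcls_Bplus[OF l])
  show "ph k (bplus_act n r lam k a Y) = (\<lambda>t. kconv n r (ker n r a) (ph k Y t))"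
  proof (intro ext)
    fix t i j
    have "ph k (bplus_act n r lam k a Y) t i j = Lin (\<lambda>g. Lin (\<lambda>g. thp k g t i j) (D g)) (qrep Y)"
      unfolding e ph_bcls[OF l] phi_def by (rule Lin_lin_ext[OF _ r]) (rule D)
    also have "\<dots> = Lin (\<lambda>g. kconv n r (ker n r a) (thp k g t) i j) (qrep Y)"
    proof (rule Lin_cong[OF r])
      fix g :: "'a bgen" assume "g \<in> BGen n r k"
      then show "Lin (\<lambda>g. thp k g t i j) (D g) = kconv n r (ker n r a) (thp k g t) i j"
        by (rule BGenE) (simp add: D_def thp_smul[OF Plus_Schur[OF a] Plus_Schur])
    qed
    also have "\<dots> = kconv n r (ker n r a) (ph k Y t) i j"
      unfolding ph_def phi_def[abs_def] by (rule kconv_Lin[symmetric])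
    finally show "ph k (bplus_act n r lam k a Y) t i j = kconv n r (ker n r a) (ph k Y t) i j" .
  qed
qed

text \<open>Tensoring with the Schur algebra over the Borel subalgebra only enlarges the first
  factor: s \<otimes> Y is recorded by the products of \<open>s\<close> with the coordinates of
  \<open>Y\<close>, which lose their triangularity.\<close>

definition th :: "nat \<Rightarrow> 'a::comm_ring_1 endo \<times> 'a bplus \<Rightarrow> mat list \<Rightarrow> nat list \<Rightarrow> nat list \<Rightarrow> 'a" where
  "th k g t = kconv n r (ker n r (fst g)) (ph k (snd g) t)"

lemma BGenO_iff: "(s, Y) \<in> BGenO n r lam k \<longleftrightarrow> s \<in> Schur n r \<and> Y \<in> Bplus n r lam k"
  by (simp add: BGenO_def OGen_def)

lemma BRelO_free: "BRelO n r lam k \<subseteq> FO k"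
proof
  fix x :: "'a endo \<times> 'a bplus \<Rightarrow> int" assume "x \<in> BRelO n r lam k"
  then show "x \<in> FO k"
    unfolding BRelO_def ORel_def
  proof (elim UnE CollectE exE conjE, goal_cases)
    case (1 s s' Y)
    then show ?case by (simp, intro gen1_diff2_free) (simp_all add: BGenO_iff sadd_Schur)
  next
    case (2 s Y Z)
    then show ?case by (simp, intro gen1_diff2_free) (simp_all add: BGenO_iff ph_add(1))
  next
    case (3 s a Y)
    then show ?case by (simp, intro gen1_diff_free) (simp_all add: BGenO_iff ph_act(1) smul_Schur Plus_Schur)
  qed
qed

lemma th_rel:
  assumes "x \<in> BRelO n r lam k" shows "Lin (\<lambda>g. th k g t i j) x = 0"
  using assms unfolding BRelO_def ORel_def
proof (elim UnE CollectE exE conjE, goal_cases)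
  case (1 s s' Y)
  show ?case unfolding 1(1) Lin_rel3 by (simp add: th_def ker_sadd kconv_add_left)
next
  case (2 s Y Z)
  show ?case unfolding 2(1) Lin_rel3 by (simp add: th_def ph_add(2)[OF 2(3,4)] kconv_add_right)
next
  case (3 s a Y)
  show ?case unfolding 3(1) Lin_rel2
    by (simp add: th_def ph_act(2)[OF 3(3,4)] ker_smul[OF 3(2) Plus_Schur[OF 3(3)]] kconv_assoc)
qed

lemma th_CC: "g \<in> BGenO n r lam k \<Longrightarrow> th k g \<in> CC n r lam k"
proof -
  assume "g \<in> BGenO n r lam k"
  then obtain s Y where g: "g = (s, Y)" "s \<in> Schur n r" "Y \<in> Bplus n r lam k" by (cases g) (auto simp: BGenO_iff)
  have "(\<lambda>t. kconv n r (ker n r s) (ph k Y t)) \<in> CC n r lam k"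
    by (rule CC_kconv[OF ker_Kin[OF g(2)] CP_CC[OF ph_CP[OF g(3)]]])
  moreover have "th k g = (\<lambda>t. kconv n r (ker n r s) (ph k Y t))" by (intro ext) (simp add: g(1) th_def)
  ultimately show ?thesis by (simp only:)
qed

definition Th :: "nat \<Rightarrow> ('a::comm_ring_1 endo \<times> 'a bplus \<Rightarrow> int) \<Rightarrow> mat list \<Rightarrow> nat list \<Rightarrow> nat list \<Rightarrow> 'a" where
  "Th k f t i j = Lin (\<lambda>g. th k g t i j) f"

lemma Th_add: "f \<in> free_on G \<Longrightarrow> f' \<in> free_on G \<Longrightarrow> Th k (f + f') = (\<lambda>t i j. Th k f t i j + Th k f' t i j)"
  and Th_diff: "f \<in> free_on G \<Longrightarrow> f' \<in> free_on G \<Longrightarrow> Th k (f - f') = (\<lambda>t i j. Th k f t i j - Th k f' t i j)"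
  and Th_gen1: "Th k (gen1 g) = th k g"
  and Th_0: "Th k 0 = (\<lambda>t i j. 0)"
  by (intro ext, simp only: Th_def Lin_add Lin_diff Lin_gen1 Lin_0)+

lemma Th_CC: "f \<in> FO k \<Longrightarrow> Th k f \<in> CC n r lam k"
proof (induction rule: free_on_induct)
  case zero
  show ?case unfolding Th_0 by (rule CC_0)
next
  case (add f g)
  show ?case unfolding Th_add[OF add(1) free_on_gen1[OF add(2)]] Th_gen1
    by (rule CC_add[OF add(3) th_CC[OF add(2)]])
next
  case (diff f g)
  show ?case unfolding Th_diff[OF diff(1) free_on_gen1[OF diff(2)]] Th_gen1
    by (rule CC_diff[OF diff(3) th_CC[OF diff(2)]])
qed

lemma Th_eqo: "f \<in> FO k \<Longrightarrow> f' \<in> FO k \<Longrightarrow> eqo k f f' \<Longrightarrow> Th k f = Th k f'"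
  unfolding Th_def by (intro ext Lin_eqm[OF BRelO_free th_rel])

text \<open>The generator with first factor 1, basis chain \<open>t\<close> and scalar 1; these
  elements generate the term over the Borel subalgebra.\<close>

definition yb :: "nat \<Rightarrow> mat list \<Rightarrow> 'a::comm_ring_1 bplus" where
  "yb k t = bcls n r lam k (gen1 (sone n r # map (X n r) t, 1))"

definition sig :: "nat \<Rightarrow> (mat list \<Rightarrow> nat list \<Rightarrow> nat list \<Rightarrow> 'a::comm_ring_1) \<Rightarrow> 'a endo \<times> 'a bplus \<Rightarrow> int" where
  "sig k F = (\<Sum>t\<in>tails n r lam k. gen1 (opr n r (F t), yb k t))"

lemma sone_Plus: "sone n r \<in> SchurPlus n r"
  by (rule Lsp_Plus[OF sone_Lsp])

lemma yb_Bplus: "t \<in> tails n r lam k \<Longrightarrow> yb k t \<in> Bplus n r lam k"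
  and ph_yb: "t \<in> tails n r lam k \<Longrightarrow> ph k (yb k t) = thp k (sone n r # map (X n r) t, 1)"
  unfolding yb_def by (rule bcls_Bplus[OF free_on_gen1[OF BGen_X[OF sone_Plus]]], assumption)
    (simp only: ph_bcls[OF free_on_gen1[OF BGen_X[OF sone_Plus]]] phi_gen1)

lemma sig_FO: "F \<in> CC n r lam k \<Longrightarrow> sig k F \<in> FO k"
  unfolding sig_def by (intro free_on_sum free_on_gen1) (simp add: BGenO_iff opr_Schur[OF CC_Kin] yb_Bplus)

lemma relO_sadd:
  assumes "s \<in> Schur n r" "s' \<in> Schur n r" "Y \<in> Bplus n r lam k"
  shows "eqo k (gen1 (sadd n r s s', Y)) (gen1 (s, Y) + gen1 (s', Y))"
  by (rule eqm_rel3) (unfold BRelO_def ORel_def, use assms in blast)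

lemma relO_act:
  assumes "s \<in> Schur n r" "a \<in> SchurPlus n r" "Y \<in> Bplus n r lam k"
  shows "eqo k (gen1 (smul n r s a, Y)) (gen1 (s, bplus_act n r lam k a Y))"
  by (rule eqm_rel2) (unfold BRelO_def ORel_def, use assms in blast)

lemma relO_bcls_add:
  assumes s: "s \<in> Schur n r" and f: "f \<in> FB k" "f' \<in> FB k"
  shows "eqo k (gen1 (s, bcls n r lam k (f + f'))) (gen1 (s, bcls n r lam k f) + gen1 (s, bcls n r lam k f'))"
proof -
  note b = bcls_Bplus[OF f(1)] bcls_Bplus[OF f(2)]
  have e: "bcls n r lam k (f + f') = bplus_add n r lam k (bcls n r lam k f) (bcls n r lam k f')"
    by (rule Bplus_eqI[OF bcls_Bplus[OF free_on_add[OF f]] ph_add(1)[OF b]])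
      (simp only: ph_bcls[OF free_on_add[OF f]] ph_add(2)[OF b] phi_add[OF f] ph_bcls[OF f(1)] ph_bcls[OF f(2)])
  show ?thesis unfolding e by (rule eqm_rel3) (unfold BRelO_def ORel_def, use s b in blast)
qed

lemma relO_bcls_sum:
  assumes s: "s \<in> Schur n r" and I: "finite I" "\<And>x. x \<in> I \<Longrightarrow> f x \<in> FB k"
  shows "eqo k (gen1 (s, bcls n r lam k (sum f I))) (\<Sum>x\<in>I. gen1 (s, bcls n r lam k (f x)))"
  using I
proof (induction I rule: finite_induct)
  case empty
  show ?case unfolding sum.empty
    by (rule eqm_double) (rule relO_bcls_add[OF s free_on_0(2) free_on_0(2), unfolded add_0_right])
next
  case (insert x I)
  have "eqo k (gen1 (s, bcls n r lam k (f x + sum f I))) (gen1 (s, bcls n r lam k (f x)) + gen1 (s, bcls n r lam k (sum f I)))"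
    by (rule relO_bcls_add[OF s]) (use insert.prems in \<open>auto intro: free_on_sum\<close>)
  also have "eqo k \<dots> (gen1 (s, bcls n r lam k (f x)) + (\<Sum>x\<in>I. gen1 (s, bcls n r lam k (f x))))"
    by (rule eqm_add[OF eqm_refl insert.IH]) (use insert.prems in auto)
  finally show ?case unfolding sum.insert[OF insert(1,2)] .
qed

lemma sig_add:
  assumes F: "F \<in> CC n r lam k" and G: "G \<in> CC n r lam k"
  shows "eqo k (sig k (\<lambda>t i j. F t i j + G t i j)) (sig k F + sig k G)"
  unfolding sig_def sum.distrib[symmetric] sadd_opr[OF CC_Kin[OF F] CC_Kin[OF G]]
  by (intro eqm_sum relO_sadd opr_Schur CC_Kin[OF F] CC_Kin[OF G] yb_Bplus)

lemma sig_diff: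
  assumes F: "F \<in> CC n r lam k" and G: "G \<in> CC n r lam k"
  shows "eqo k (sig k (\<lambda>t i j. F t i j - G t i j)) (sig k F - sig k G)"
proof -
  have "eqo k (sig k (\<lambda>t i j. F t i j - G t i j + G t i j)) (sig k (\<lambda>t i j. F t i j - G t i j) + sig k G)"
    by (rule sig_add[OF CC_diff[OF F G] G])
  then have "eqo k (sig k F) (sig k (\<lambda>t i j. F t i j - G t i j) + sig k G)" by (simp only: diff_add_cancel)
  from eqm_diff[OF this eqm_refl[of _ "sig k G"]]
  have "eqo k (sig k F - sig k G) (sig k (\<lambda>t i j. F t i j - G t i j))" unfolding add_diff_cancel_right' .
  then show ?thesis by (rule eqm_sym)
qed

lemma sig_0: "eqo k (sig k (\<lambda>t i j. 0::'a::comm_ring_1)) 0"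
proof -
  have "eqo k (sig k (\<lambda>t i j. 0 + 0::'a)) (sig k (\<lambda>t i j. 0) + sig k (\<lambda>t i j. 0))"
    by (rule sig_add[OF CC_0 CC_0])
  then have "eqo k (sig k (\<lambda>t i j. 0::'a)) (sig k (\<lambda>t i j. 0) + sig k (\<lambda>t i j. 0))"
    unfolding add_0_right .
  then show ?thesis by (rule eqm_double)
qed

lemma sigb_FB: "F \<in> CP n r lam k \<Longrightarrow> sigb k F \<in> FB k"
  unfolding sigb_def by (intro free_on_sum free_on_gen1 BGen_X opr_Plus)

text \<open>\<open>Y\<close> is the sum of its coordinates acting on the generators
  \<open>yb k t\<close>. The coordinates lie in the Borel subalgebra, so they cross the tensor sign
  and multiply \<open>s\<close>.\<close>

lemma sig_gen:
  fixes s :: "'a::comm_ring_1 endo"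
  assumes s: "s \<in> Schur n r" and Y: "Y \<in> Bplus n r lam k"
  shows "eqo k (gen1 (s, Y)) (sig k (th k (s, Y)))"
proof -
  define F where "F = ph k Y"
  have F: "F \<in> CP n r lam k" unfolding F_def by (rule ph_CP[OF Y])
  have g: "gen1 (opr n r (F t) # map (X n r) t, 1::'a) \<in> FB k" if "t \<in> tails n r lam k" for t
    by (rule free_on_gen1[OF BGen_X[OF opr_Plus[OF F] that]])
  have Ye: "Y = bcls n r lam k (\<Sum>t\<in>tails n r lam k. gen1 (opr n r (F t) # map (X n r) t, 1))"
  proof -
    have "eqb k (qrep Y) (sigb k F)" using sigb_phi[OF Bplus_rep(1)[OF Y]] by (simp only: F_def ph_def)
    then have "bcls n r lam k (qrep Y) = bcls n r lam k (sigb k F)"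
      unfolding bcls_def qcls_eq_iff[OF Bplus_rep(1)[OF Y] sigb_FB[OF F]] .
    then show ?thesis unfolding Bplus_rep(2)[OF Y] sigb_def .
  qed
  have "eqo k (gen1 (s, Y)) (\<Sum>t\<in>tails n r lam k. gen1 (s, bcls n r lam k (gen1 (opr n r (F t) # map (X n r) t, 1))))"
    by (subst Ye, rule relO_bcls_sum[OF s finite_tails g])
  also have "eqo k \<dots> (sig k (th k (s, Y)))" unfolding sig_def
  proof (rule eqm_sum)
    fix t assume t: "t \<in> tails n r lam k"
    note a = opr_Plus[OF F, of t] and y = yb_Bplus[OF t]
    have e: "bcls n r lam k (gen1 (opr n r (F t) # map (X n r) t, 1)) = bplus_act n r lam k (opr n r (F t)) (yb k t)"
    proof (rule Bplus_eqI[OF bcls_Bplus[OF g[OF t]] ph_act(1)[OF a y]])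
      have "thp k (opr n r (F t) # map (X n r) t, 1) u i j = kconv n r (ker n r (opr n r (F t))) (thp k (sone n r # map (X n r) t, 1) u) i j" for u i j
        using thp_smul[OF Plus_Schur[OF a] sone_Schur, of k "map (X n r) t" 1 u i j] by (simp only: smul_sone[OF Plus_Schur[OF a]])
      then show "ph k (bcls n r lam k (gen1 (opr n r (F t) # map (X n r) t, 1))) = ph k (bplus_act n r lam k (opr n r (F t)) (yb k t))"
        unfolding ph_bcls[OF g[OF t]] phi_gen1 ph_act(2)[OF a y] ph_yb[OF t] by (intro ext)
    qed
    have "opr n r (th k (s, Y) t) = smul n r s (opr n r (F t))"
      unfolding smul_eq[OF s Plus_Schur[OF a]] ker_opr[OF CC_Kin[OF CP_CC[OF F]]] by (simp add: th_def F_def)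
    then show "eqo k (gen1 (s, bcls n r lam k (gen1 (opr n r (F t) # map (X n r) t, 1)))) (gen1 (opr n r (th k (s, Y) t), yb k t))"
      unfolding e using eqm_sym[OF relO_act[OF s a y]] by (simp only:)
  qed
  finally show ?thesis .
qed

lemma sig_Th: "f \<in> FO k \<Longrightarrow> eqo k f (sig k (Th k f))"
proof (induction rule: free_on_induct)
  case zero
  show ?case unfolding Th_0 by (rule eqm_sym[OF sig_0])
next
  case (add f g)
  have g: "eqo k (gen1 g) (sig k (th k g))" using add(2) by (cases g) (simp add: BGenO_iff sig_gen)
  show ?case unfolding Th_add[OF add(1) free_on_gen1[OF add(2)]] Th_gen1
    by (rule eqm_trans[OF eqm_add[OF add(3) g] eqm_sym[OF sig_add[OF Th_CC[OF add(1)] th_CC[OF add(2)]]]])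
next
  case (diff f g)
  have g: "eqo k (gen1 g) (sig k (th k g))" using diff(2) by (cases g) (simp add: BGenO_iff sig_gen)
  show ?case unfolding Th_diff[OF diff(1) free_on_gen1[OF diff(2)]] Th_gen1
    by (rule eqm_trans[OF eqm_diff[OF diff(3) g] eqm_sym[OF sig_diff[OF Th_CC[OF diff(1)] th_CC[OF diff(2)]]]])
qed

lemma kc_X: "v \<in> Mats n r \<Longrightarrow> kc n r (X n r w) v = (if v = w then 1 else 0)"
  using rep_props[of v n r] by (simp add: kc_def ker_X kxi_def)

lemma prodc_X: "t \<in> tails n r lam k \<Longrightarrow> u \<in> tails n r lam k \<Longrightarrow> prodc n r (map (X n r) t) u = (if t = u then 1 else 0)"
proof (induction k arbitrary: t u)
  case (Suc k)
  obtain w t' v u' where e: "t = w # t'" "u = v # u'" using Suc.prems by auto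
  have m: "t' \<in> tails n r lam k" "u' \<in> tails n r lam k" "v \<in> Jm n r" using Suc.prems unfolding e tails_Cons by auto
  then have "v \<in> Mats n r" using Jm_sub by blast
  then show ?case using Suc.IH[OF m(1,2)] by (simp add: e kc_X)
qed simp

lemma th_yb:
  fixes F :: "mat list \<Rightarrow> nat list \<Rightarrow> nat list \<Rightarrow> 'a::comm_ring_1"
  assumes F: "F \<in> CC n r lam k" and t: "t \<in> tails n r lam k"
  shows "th k (opr n r (F t), yb k t) u i j = (if t = u then F u i j else 0)"
proof -
  note K = CC_Kin[OF F, of t]
  show ?thesis
  proof (cases "u \<in> tails n r lam k \<and> cont j = tsw n lam u")
    case True
    then have u: "u \<in> tails n r lam k" by blast
    have "thp k (sone n r # map (X n r) t, 1::'a) u z j = kid n r z j * (if t = u then 1 else 0)" for z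
      using True by (simp add: thp_def ker_sone prodc_X[OF t u])
    then have "th k (opr n r (F t), yb k t) u i j = kconv n r (F t) (kid n r) i j * (if t = u then 1 else 0)"
      by (simp add: th_def ph_yb[OF t] ker_opr[OF K] kconv_def sum_distrib_right mult.assoc)
    then show ?thesis by (simp add: kconv_kid(2)[OF K])
  next
    case False
    then have "F u i j = 0" using CC_supp[OF F] by blast
    moreover have "th k (opr n r (F t), yb k t) u i j = 0"
      using False by (auto simp: th_def ph_yb[OF t] kconv_def thp_def)
    ultimately show ?thesis by simp
  qed
qed

lemma Th_sig:
  assumes F: "F \<in> CC n r lam k" shows "Th k (sig k F) = F"
proof (intro ext)
  fix u i j
  have "Th k (sig k F) u i j = (\<Sum>t\<in>tails n r lam k. Lin (\<lambda>g. th k g u i j) (gen1 (opr n r (F t), yb k t)))"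
    unfolding Th_def sig_def
    by (rule Lin_sum[of _ _ "BGenO n r lam k"]) (auto simp: BGenO_iff opr_Schur[OF CC_Kin[OF F]] yb_Bplus intro!: free_on_gen1)
  also have "\<dots> = (\<Sum>t\<in>tails n r lam k. if t = u then F u i j else 0)"
    by (intro sum.cong refl) (simp add: th_yb[OF F])
  also have "\<dots> = F u i j" using CC_supp[OF F, of u i j] by auto
  finally show "Th k (sig k F) u i j = F u i j" .
qed

definition TH :: "nat \<Rightarrow> 'a::comm_ring_1 bres \<Rightarrow> mat list \<Rightarrow> nat list \<Rightarrow> nat list \<Rightarrow> 'a" where
  "TH k U = Th k (qrep U)"

lemma Bres_rep: "U \<in> Bres n r lam k \<Longrightarrow> qrep U \<in> FO k" "U \<in> Bres n r lam k \<Longrightarrow> bocls n r lam k (qrep U) = U"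
  unfolding Bres_def bocls_def by (rule quotE, assumption)+

lemma bocls_Bres: "f \<in> FO k \<Longrightarrow> bocls n r lam k f \<in> Bres n r lam k"
  unfolding Bres_def bocls_def by (rule qcls_quot)

lemma TH_bocls: "f \<in> FO k \<Longrightarrow> TH k (bocls n r lam k f) = Th k f"
  unfolding TH_def bocls_def by (rule Th_eqo[OF qrep_qcls(1) _ qrep_qcls(2)])

lemma TH_CC: "U \<in> Bres n r lam k \<Longrightarrow> TH k U \<in> CC n r lam k"
  unfolding TH_def by (rule Th_CC[OF Bres_rep(1)])

lemma bocls_sig: "U \<in> Bres n r lam k \<Longrightarrow> bocls n r lam k (sig k (TH k U)) = U"
proof -
  assume U: "U \<in> Bres n r lam k"
  have "eqo k (qrep U) (sig k (TH k U))" using sig_Th[OF Bres_rep(1)[OF U]] by (simp only: TH_def)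
  then have "bocls n r lam k (qrep U) = bocls n r lam k (sig k (TH k U))"
    unfolding bocls_def qcls_eq_iff[OF Bres_rep(1)[OF U] sig_FO[OF TH_CC[OF U]]] .
  then show ?thesis unfolding Bres_rep(2)[OF U] by (rule sym)
qed

lemma TH_inj:
  assumes "U \<in> Bres n r lam k" "V \<in> Bres n r lam k" "TH k U = TH k V" shows "U = V"
proof -
  have "bocls n r lam k (sig k (TH k U)) = bocls n r lam k (sig k (TH k V))" unfolding assms(3) ..
  then show ?thesis unfolding bocls_sig[OF assms(1)] bocls_sig[OF assms(2)] .
qed

text \<open>Together with \<open>TH_inj\<close> this identifies the induced term with
  \<open>CC\<close>, so that later identities can be checked on coordinates.\<close>

lemma TH_surj: "F \<in> CC n r lam k \<Longrightarrow> bocls n r lam k (sig k F) \<in> Bres n r lam k"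
  "F \<in> CC n r lam k \<Longrightarrow> TH k (bocls n r lam k (sig k F)) = F"
  by (rule bocls_Bres[OF sig_FO], assumption) (simp only: TH_bocls[OF sig_FO] Th_sig)

end

text \<open>Transfers the abstract complex on the region of all pairs of words to \<open>CC\<close>
  and \<open>DD\<close>, which coincide with its chains and differential.\<close>

lemma bar_CC:
  assumes lam: "lam \<in> Comps n r"
  shows DD_CC: "F \<in> CC n r lam (Suc k) \<Longrightarrow> DD n r lam k F \<in> (CC n r lam k :: (_ \<Rightarrow> _ \<Rightarrow> _ \<Rightarrow> 'a::comm_ring_1) set)"
    and DD_DD: "F' \<in> CC n r lam (Suc (Suc k)) \<Longrightarrow> DD n r lam k (DD n r lam (Suc k) F') = (\<lambda>_ _ _. 0::'a)"
    and DD_exact: "lam \<in> CompsDom n r \<Longrightarrow> F \<in> CC n r lam (Suc k) \<Longrightarrow> DD n r lam k F = (\<lambda>_ _ _. 0) \<Longrightarrow>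
      \<exists>G\<in>CC n r lam (Suc (Suc k)). DD n r lam (Suc k) G = (F :: _ \<Rightarrow> _ \<Rightarrow> _ \<Rightarrow> 'a)"
proof -
  interpret T: tri_complex n r lam "tails n r lam" "tsw n lam" "bde n r lam :: _ \<Rightarrow> _ \<Rightarrow> _ \<Rightarrow> _ \<Rightarrow> 'a"
    by (rule tri_complex_bar[OF lam])
  define Om where "Om = (\<lambda>i j. i \<in> Inr n r \<and> j \<in> Inr n r)"
  have reg: "region n r Om"
    unfolding region_def Om_def
  proof (intro conjI allI impI)
    fix i x y z assume "i \<in> Inr n r \<and> x \<in> Inr n r" "i \<in> Inr n r \<and> z \<in> Inr n r" "lle x y" "lle y z"
    then show "i \<in> Inr n r" "y \<in> Inr n r" using lle_Inr by blast+
  qed (use permute_list_Inr in \<open>auto simp: Inr_length\<close>)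
  have C: "CC n r lam k = (T.C Om k :: (_ \<Rightarrow> _ \<Rightarrow> _ \<Rightarrow> 'a) set)" for k
  proof (intro set_eqI iffI)
    fix F :: "mat list \<Rightarrow> nat list \<Rightarrow> nat list \<Rightarrow> 'a" assume F: "F \<in> CC n r lam k"
    show "F \<in> T.C Om k" unfolding T.C_def
    proof (intro CollectI conjI allI impI)
      fix t i j assume nz: "F t i j \<noteq> 0"
      show "t \<in> tails n r lam k" "cont j = tsw n lam t" using CC_supp[OF F nz] by simp_all
      show "Om i j" using Kin_nz[OF CC_Kin[OF F] nz] by (simp add: Om_def)
    qed (rule Kin_inv[OF CC_Kin[OF F]])
  next
    fix F :: "mat list \<Rightarrow> nat list \<Rightarrow> nat list \<Rightarrow> 'a" assume F: "F \<in> T.C Om k"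
    have s: "t \<in> tails n r lam k \<and> Om i j \<and> cont j = tsw n lam t" if "F t i j \<noteq> 0" for t i j
      using T.C_supp[OF F that] .
    have l: "linv r (F t)" for t using F by (simp add: T.C_def)
    show "F \<in> CC n r lam k" unfolding CC_def Kin_def
    proof (intro CollectI conjI allI impI)
      fix t show "linv r (F t)" by (rule l)
    next
      fix t i j assume "F t i j \<noteq> 0"
      from s[OF this] show "t \<in> tails n r lam k" "cont j = tsw n lam t" "i \<in> Inr n r" "j \<in> Inr n r"
        by (simp_all add: Om_def)
    qed
  qed
  have D: "DD n r lam k F = T.D Om k F" for k and F :: "mat list \<Rightarrow> nat list \<Rightarrow> nat list \<Rightarrow> 'a"
    unfolding DD_def T.D_def Om_def by (rule refl)
  show "F \<in> CC n r lam (Suc k) \<Longrightarrow> DD n r lam k F \<in> CC n r lam k"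
    unfolding C D by (rule T.D_C[OF reg])
  show "F' \<in> CC n r lam (Suc (Suc k)) \<Longrightarrow> DD n r lam k (DD n r lam (Suc k) F') = (\<lambda>_ _ _. 0::'a)"
    unfolding C D using T.D_D[OF reg, of F' k] by (simp add: zero_fun_def)
  assume a: "lam \<in> CompsDom n r" "F \<in> CC n r lam (Suc k)" "DD n r lam k F = (\<lambda>_ _ _. 0)"
  have "T.cyc Om (Suc k) F" using a(2,3) unfolding C D T.cyc_def by (simp add: zero_fun_def)
  moreover have "T.ex Om (Suc k)" unfolding Om_def by (rule bar_exact[OF a(1)])
  ultimately show "\<exists>G\<in>CC n r lam (Suc (Suc k)). DD n r lam (Suc k) G = F"
    unfolding C D T.ex_def by simp
qed

lemma DD_kconv:
  assumes s: "s \<in> Kin n r"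
  shows "DD n r lam k (\<lambda>t. kconv n r s (F t)) u i j = kconv n r s (DD n r lam k F u) i j"
proof (cases "u \<in> tails n r lam k \<and> i \<in> Inr n r \<and> j \<in> Inr n r")
  case True
  let ?A = "tails n r lam (Suc k)" and ?B = "Inr n r" and ?b = "\<lambda>t x. bde n r lam t u x j"
  have "(\<Sum>t\<in>?A. \<Sum>x\<in>?B. (\<Sum>z\<in>?B. s i z * F t z x) * ?b t x) = (\<Sum>t\<in>?A. \<Sum>x\<in>?B. \<Sum>z\<in>?B. s i z * (F t z x * ?b t x))"
    by (simp only: sum_distrib_right mult.assoc)
  also have "\<dots> = (\<Sum>t\<in>?A. \<Sum>z\<in>?B. \<Sum>x\<in>?B. s i z * (F t z x * ?b t x))" by (intro sum.cong refl sum.swap)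
  also have "\<dots> = (\<Sum>z\<in>?B. \<Sum>t\<in>?A. \<Sum>x\<in>?B. s i z * (F t z x * ?b t x))" by (rule sum.swap)
  also have "\<dots> = (\<Sum>z\<in>?B. s i z * (\<Sum>t\<in>?A. \<Sum>x\<in>?B. F t z x * ?b t x))" by (simp only: sum_distrib_left)
  finally show ?thesis using True by (simp add: DD_def kconv_def del: tails.simps)
next
  case False
  have "s i z = 0" if "i \<notin> Inr n r" for z using Kin_nz[OF s] that by blast
  then show ?thesis using False by (auto simp: DD_def kconv_def simp del: tails.simps)
qed

lemma DD_Lin:
  fixes F :: "'g \<Rightarrow> mat list \<Rightarrow> nat list \<Rightarrow> nat list \<Rightarrow> 'b::comm_ring_1"
  shows "Lin (\<lambda>g. DD n r lam k (F g) u i j) f = DD n r lam k (\<lambda>t i j. Lin (\<lambda>g. F g t i j) f) u i j"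
proof (cases "u \<in> tails n r lam k \<and> i \<in> Inr n r \<and> j \<in> Inr n r")
  case True
  then show ?thesis unfolding DD_def by (simp add: Lin_sum_fun Lin_mult_right del: tails.simps)
next
  case False
  then have z: "DD n r lam k G u i j = 0" for G :: "mat list \<Rightarrow> nat list \<Rightarrow> nat list \<Rightarrow> 'b" by (auto simp: DD_def)
  show ?thesis unfolding z by (simp add: Lin_def)
qed

lemma alt_sum:
  assumes "\<And>t. t \<le> K \<Longrightarrow> x t \<in> G"
  shows alt_sum_free: "(\<lambda>h. \<Sum>t\<le>K. (-1) ^ t * gen1 (x t) h) \<in> free_on G"
    and alt_sum_Lin: "Lin th (\<lambda>h. \<Sum>t\<le>K. (-1) ^ t * gen1 (x t) h) = (\<Sum>t\<le>K. (-1) ^ t * th (x t))"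
proof -
  have "(\<lambda>h. \<Sum>t\<le>K. (-1) ^ t * gen1 (x t) h) \<in> free_on G \<and>
    Lin th (\<lambda>h. \<Sum>t\<le>K. (-1) ^ t * gen1 (x t) h) = (\<Sum>t\<le>K. (-1) ^ t * th (x t))"
    using assms
  proof (induction K)
    case 0
    have "(\<lambda>h. \<Sum>t\<le>0. (-1) ^ t * gen1 (x t) h) = gen1 (x 0)" by (simp add: fun_eq_iff)
    then show ?case using 0 free_on_gen1[of "x 0" G] by simp
  next
    case (Suc K)
    define f where "f = (\<lambda>h. \<Sum>t\<le>K. (-1) ^ t * gen1 (x t) h)"
    have f: "f \<in> free_on G" "Lin th f = (\<Sum>t\<le>K. (-1) ^ t * th (x t))" using Suc unfolding f_def by auto
    have g: "gen1 (x (Suc K)) \<in> free_on G" by (rule free_on_gen1) (use Suc.prems in simp)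
    show ?case
    proof (cases "even K")
      case True
      then have "(\<lambda>h. \<Sum>t\<le>Suc K. (-1) ^ t * gen1 (x t) h) = f - gen1 (x (Suc K))" by (simp add: fun_eq_iff f_def)
      then show ?thesis using free_on_diff[OF f(1) g] Lin_diff[OF f(1) g, of th] f(2) True by simp
    next
      case False
      then have "(\<lambda>h. \<Sum>t\<le>Suc K. (-1) ^ t * gen1 (x t) h) = f + gen1 (x (Suc K))" by (simp add: fun_eq_iff f_def)
      then show ?thesis using free_on_add[OF f(1) g] Lin_add[OF f(1) g, of th] f(2) False by (simp only:) simp
    qed
  qed
  then show "(\<lambda>h. \<Sum>t\<le>K. (-1) ^ t * gen1 (x t) h) \<in> free_on G"
    "Lin th (\<lambda>h. \<Sum>t\<le>K. (-1) ^ t * gen1 (x t) h) = (\<Sum>t\<le>K. (-1) ^ t * th (x t))" by auto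
qed

section \<open>The bar differential in coordinates\<close>

definition iface :: "nat \<Rightarrow> nat \<Rightarrow> nat \<Rightarrow> 'a::comm_ring_1 endo list \<Rightarrow> 'a endo list" where
  "iface n r q as = take q as @ [smul n r (as ! q) (as ! Suc q)] @ drop (Suc (Suc q)) as"

lemma iface_simps: "iface n r 0 (a # b # as) = smul n r a b # as" "iface n r (Suc q) (a # as) = a # iface n r q as"
  by (simp_all add: iface_def)

lemma sum_kc_chi:
  assumes a: "a \<in> Jrad n r" and "x \<in> Inr n r" "y \<in> Inr n r"
  shows "(\<Sum>w\<in>Jm n r. kc n r a w * chi w x y) = ker n r a x y"
proof -
  have "(\<Sum>w\<in>Jm n r. kc n r a w * chi w x y) = (\<Sum>w\<in>Jm n r. if wt x y = w then kc n r a w else 0)"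
    by (intro sum.cong refl) (simp add: chi_def)
  also have "\<dots> = (if wt x y \<in> Jm n r then kc n r a (wt x y) else 0)" by simp
  also have "\<dots> = ker n r a x y"
    using kc_wt[OF Jrad_Schur[OF a] assms(2,3)] Jm_wt[OF assms(2,3)] a unfolding Jrad_iff by auto
  finally show ?thesis .
qed

lemma kc_smul:
  assumes a: "a \<in> Jrad n r" and b: "b \<in> Jrad n r" and z: "z \<in> Mats n r"
  shows "kc n r (smul n r a b) z = (\<Sum>w\<in>Jm n r. \<Sum>v\<in>Jm n r. kc n r b v * cst n r w v z * kc n r a w)"
proof -
  obtain x y where xy: "x \<in> Inr n r" "y \<in> Inr n r" "z = wt x y" using Mats_wt[OF z] by blast
  let ?W = "Inr n r" and ?J = "Jm n r"
  have "kc n r (smul n r a b) z = (\<Sum>p\<in>?W. ker n r a x p * ker n r b p y)"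
    unfolding xy(3) kc_wt[OF smul_Schur[OF Jrad_Schur[OF a] Jrad_Schur[OF b]] xy(1,2)]
      ker_smul[OF Jrad_Schur[OF a] Jrad_Schur[OF b]] kconv_def ..
  also have "\<dots> = (\<Sum>p\<in>?W. (\<Sum>w\<in>?J. kc n r a w * chi w x p) * (\<Sum>v\<in>?J. kc n r b v * chi v p y))"
    by (intro sum.cong refl) (simp add: sum_kc_chi[OF a xy(1)] sum_kc_chi[OF b _ xy(2)])
  also have "\<dots> = (\<Sum>p\<in>?W. \<Sum>w\<in>?J. \<Sum>v\<in>?J. kc n r b v * (chi w x p * chi v p y) * kc n r a w)"
    unfolding sum_product by (intro sum.cong refl) (simp add: mult_ac)
  also have "\<dots> = (\<Sum>w\<in>?J. \<Sum>p\<in>?W. \<Sum>v\<in>?J. kc n r b v * (chi w x p * chi v p y) * kc n r a w)" by (rule sum.swap)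
  also have "\<dots> = (\<Sum>w\<in>?J. \<Sum>v\<in>?J. \<Sum>p\<in>?W. kc n r b v * (chi w x p * chi v p y) * kc n r a w)"
    by (intro sum.cong refl sum.swap)
  also have "\<dots> = (\<Sum>w\<in>?J. \<Sum>v\<in>?J. kc n r b v * cst n r w v z * kc n r a w)"
    unfolding xy(3) cst_wt[OF xy(1,2)] kconv_def sum_distrib_left sum_distrib_right ..
  finally show ?thesis .
qed

context bar_terms begin

text \<open>The recursion for \<open>rho\<close> unfolds into the alternating sum of the products of
  neighbouring entries. The face at the right end is missing because J acts on the last factor by
  zero.\<close>

lemma rho_prodc:
  fixes as :: "'a::comm_ring_1 endo list"
  shows "length as = Suc k \<Longrightarrow> set as \<subseteq> Jrad n r \<Longrightarrow> u \<in> tails n r lam k \<Longrightarrow>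
    (\<Sum>t\<in>tails n r lam (Suc k). prodc n r as t * rho n r (hd t) (tl t) u) = (\<Sum>q<k. (-1) ^ q * prodc n r (iface n r q as) u)"
proof (induction k arbitrary: as u)
  case 0
  have "prodc n r as t * rho n r (hd t) (tl t) u = 0" if "t \<in> tails n r lam (Suc 0)" for t using that by auto
  then show ?case unfolding lessThan_0 sum.empty by (intro sum.neutral ballI)
next
  case (Suc k)
  obtain b d ds where as: "as = b # d # ds" "length ds = k" using Suc.prems(1) by (auto simp: length_Suc_conv)
  have bd: "b \<in> Jrad n r" "d \<in> Jrad n r" "set (d # ds) \<subseteq> Jrad n r" using Suc.prems(2) as by auto
  obtain z u' where u: "u = z # u'" using Suc.prems(3) by auto
  have z: "z \<in> Jm n r" "u' \<in> tails n r lam k" "colc n z = tsw n lam u'" using Suc.prems(3) unfolding u tails_Cons by auto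
  have zM: "z \<in> Mats n r" using z(1) Jm_sub by blast
  let ?T = "tails n r lam (Suc k)" and ?T2 = "tails n r lam (Suc (Suc k))"
  define g where "g s = prodc n r (d # ds) s * rho n r (hd s) (tl s) u'" for s
  define A where "A t = (if tl (tl t) = u' then kc n r b (hd t) * kc n r d (hd (tl t)) * prodc n r ds u' * cst n r (hd t) (hd (tl t)) z else 0)" for t
  have tl: "t \<in> ?T2 \<Longrightarrow> \<exists>w v s. t = w # v # s \<and> w \<in> Jm n r \<and> v # s \<in> ?T \<and> colc n w = rowc n v" for t
    by auto
  have "(\<Sum>t\<in>?T2. prodc n r as t * rho n r (hd t) (tl t) u) = (\<Sum>t\<in>?T2. A t - (if hd t = z then g (tl t) else 0) * kc n r b z)"
  proof (intro sum.cong refl)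
    fix t assume "t \<in> ?T2"
    then obtain w v s where t: "t = w # v # s" using tl by blast
    show "prodc n r as t * rho n r (hd t) (tl t) u = A t - (if hd t = z then g (tl t) else 0) * kc n r b z"
      by (auto simp: t as u A_def g_def algebra_simps)
  qed
  also have "\<dots> = (\<Sum>t\<in>?T2. A t) - (\<Sum>t\<in>?T2. (if hd t = z then g (tl t) else 0) * kc n r b z)"
    by (rule sum_subtractf)
  also have "(\<Sum>t\<in>?T2. (if hd t = z then g (tl t) else 0) * kc n r b z) = (\<Sum>s\<in>?T. g s * kc n r b z)"
  proof (rule sum_tails_hd[OF z(1)])
    fix s assume s: "s \<in> ?T" "g s \<noteq> 0"
    obtain v s' where e: "s = v # s'" using s(1) by auto
    have "rho n r v s' u' \<noteq> (0::'a)" using s(2) by (auto simp: g_def e)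
    from rho_supp[OF s(1)[unfolded e] z(2) this] show "colc n z = tsw n lam s" using z(3) by (simp add: e)
  qed
  also have "\<dots> = (\<Sum>s\<in>?T. g s) * kc n r b z" by (rule sum_distrib_right[symmetric])
  also have "(\<Sum>s\<in>?T. g s) = (\<Sum>q<k. (-1) ^ q * prodc n r (iface n r q (d # ds)) u')"
    unfolding g_def by (rule Suc.IH) (use as bd z in auto)
  also have "(\<Sum>t\<in>?T2. A t) = kc n r (smul n r b d) z * prodc n r ds u'"
  proof -
    have "(\<Sum>t\<in>?T2. A t) = (\<Sum>w\<in>Jm n r. \<Sum>s\<in>?T. (if tl s = u' then kc n r d (hd s) * cst n r w (hd s) z else 0) * (kc n r b w * prodc n r ds u'))"
      unfolding sum_tails[where k = "Suc k"]
    proof (intro sum.cong refl)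
      fix w s assume w: "w \<in> Jm n r" and s: "s \<in> ?T"
      obtain v s' where e: "s = v # s'" using s by auto
      have v: "v \<in> Jm n r" using tails_Jm[OF s] e by simp
      \<comment> \<open>Structure constants vanish on matrices that cannot be composed, so the
        composability condition on the chain may be dropped.\<close>
      have "cst n r w v z = (0::'a)" if "colc n w \<noteq> tsw n lam s" using cst_nz[OF zM w v, where 'a = 'a] that by (auto simp: e)
      then show "(if colc n w = tsw n lam s then A (w # s) else 0)
         = (if tl s = u' then kc n r d (hd s) * cst n r w (hd s) z else 0) * (kc n r b w * prodc n r ds u')"
        by (auto simp: A_def e mult_ac)
    qed
    also have "\<dots> = (\<Sum>w\<in>Jm n r. \<Sum>v\<in>Jm n r. kc n r d v * cst n r w v z * (kc n r b w * prodc n r ds u'))"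
    proof (intro sum.cong refl sum_tails_tl[OF z(2)])
      fix w v assume w: "w \<in> Jm n r" and v: "v \<in> Jm n r" and nz: "kc n r d v * cst n r w v z \<noteq> 0"
      have "cst n r w v z \<noteq> (0::'a)" using nz by auto
      then show "colc n v = tsw n lam u'" using cst_nz[OF zM w v, where 'a = 'a] z(3) by auto
    qed
    also have "\<dots> = kc n r (smul n r b d) z * prodc n r ds u'"
      unfolding kc_smul[OF bd(1,2) zM] sum_distrib_right mult.assoc ..
    finally show ?thesis .
  qed
  also have "kc n r (smul n r b d) z * prodc n r ds u' - (\<Sum>q<k. (-1) ^ q * prodc n r (iface n r q (d # ds)) u') * kc n r b z
      = (\<Sum>q<Suc k. (-1) ^ q * prodc n r (iface n r q as) u)"
    unfolding sum.lessThan_Suc_shift by (simp add: as u iface_simps sum_distrib_left sum_negf mult_ac)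
  finally show ?case .
qed

text \<open>The product part of \<open>bde\<close> contributes the face that multiplies
  \<open>a\<close> by the first entry of J; the \<open>rho\<close> part contributes all products
  within the chain.\<close>

lemma thp_face:
  fixes a :: "'a::comm_ring_1 endo"
  assumes g: "(a # as, m) \<in> BGen n r (Suc k)" and u: "u \<in> tails n r lam k" "i \<in> Inr n r" "j \<in> Inr n r" "cont j = tsw n lam u"
    and as: "as = b # bs"
  shows "DD n r lam k (thp (Suc k) (a # as, m)) u i j
    = kconv n r (ker n r a) (ker n r b) i j * prodc n r bs u * m - ker n r a i j * m * (\<Sum>q<k. (-1) ^ q * prodc n r (iface n r q as) u)"
proof -
  let ?T = "tails n r lam (Suc k)" and ?W = "Inr n r"
  have J: "set as \<subseteq> Jrad n r" "length as = Suc k" and b: "b \<in> Jrad n r" using g as by (auto simp: BGen_Cons)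
  define g where "g w = kc n r b w * (\<Sum>x\<in>?W. ker n r a i x * chi w x j)" for w
  have "DD n r lam k (thp (Suc k) (a # as, m)) u i j
    = (\<Sum>t\<in>?T. (if tl t = u then g (hd t) else 0) * (prodc n r bs u * m) - prodc n r as t * rho n r (hd t) (tl t) u * (ker n r a i j * m))"
    unfolding DD_def if_P[OF conjI[OF u(1) conjI[OF u(2,3)]]]
  proof (intro sum.cong refl)
    fix t assume t: "t \<in> ?T"
    obtain w s where e: "t = w # s" using t by auto
    have w: "w \<in> Jm n r" "s \<in> tails n r lam k" using t unfolding e tails_Cons by auto
    let ?f = "thp (Suc k) (a # as, m) t i"
    have "(\<Sum>x\<in>?W. ?f x * bde n r lam t u x j)
       = (\<Sum>x\<in>?W. (if tl t = u then ?f x * chi (hd t) x j else 0) - (if x = j then ?f j * rho n r (hd t) (tl t) u else 0))"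
    proof (intro sum.cong refl)
      fix x assume x: "x \<in> ?W"
      show "?f x * bde n r lam t u x j = (if tl t = u then ?f x * chi (hd t) x j else 0) - (if x = j then ?f j * rho n r (hd t) (tl t) u else 0)"
        unfolding bde_tails[OF t x u(3)] using u(4) by (auto simp: algebra_simps)
    qed
    also have "\<dots> = (if tl t = u then \<Sum>x\<in>?W. ?f x * chi (hd t) x j else 0) - ?f j * rho n r (hd t) (tl t) u"
      unfolding sum_subtractf using u(3) by simp
    also have "?f j * rho n r (hd t) (tl t) u = prodc n r as t * rho n r (hd t) (tl t) u * (ker n r a i j * m)"
    proof (cases "rho n r w s u = (0::'a)")
      case False
      have c: "cont j = tsw n lam t" using rho_supp[OF t[unfolded e] u(1) False] u(4) by (simp add: e)
      show ?thesis unfolding thp_eq[OF t c] by (simp add: mult_ac)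
    qed (simp add: e)
    also have "(if tl t = u then \<Sum>x\<in>?W. ?f x * chi (hd t) x j else 0) = (if tl t = u then g (hd t) else 0) * (prodc n r bs u * m)"
    proof (cases "s = u")
      case True
      have "?f x * chi w x j = kc n r b w * (ker n r a i x * chi w x j) * (prodc n r bs u * m)" if x: "x \<in> ?W" for x
      proof (cases "chi w x j = (0::'a)")
        case False
        have c: "cont x = tsw n lam t" using rowc_wt[OF x u(3)] chi_nz[OF False] by (simp add: e)
        show ?thesis unfolding thp_eq[OF t c] by (simp add: e as True mult_ac)
      qed simp
      then show ?thesis by (simp add: e True g_def sum_distrib_left sum_distrib_right)
    qed (simp add: e)
    finally show "(\<Sum>x\<in>?W. ?f x * bde n r lam t u x j)
      = (if tl t = u then g (hd t) else 0) * (prodc n r bs u * m) - prodc n r as t * rho n r (hd t) (tl t) u * (ker n r a i j * m)" .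
  qed
  also have "\<dots> = (\<Sum>t\<in>?T. (if tl t = u then g (hd t) else 0) * (prodc n r bs u * m))
      - (\<Sum>t\<in>?T. prodc n r as t * rho n r (hd t) (tl t) u) * (ker n r a i j * m)"
    unfolding sum_subtractf sum_distrib_right ..
  also have "(\<Sum>t\<in>?T. prodc n r as t * rho n r (hd t) (tl t) u) = (\<Sum>q<k. (-1) ^ q * prodc n r (iface n r q as) u)"
    by (rule rho_prodc[OF J(2,1) u(1)])
  also have "(\<Sum>t\<in>?T. (if tl t = u then g (hd t) else 0) * (prodc n r bs u * m)) = (\<Sum>w\<in>Jm n r. g w * (prodc n r bs u * m))"
  proof (rule sum_tails_tl[OF u(1)])
    fix w assume "w \<in> Jm n r" "g w \<noteq> 0"
    then have "(\<Sum>x\<in>?W. ker n r a i x * chi w x j) \<noteq> 0" by (auto simp: g_def)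
    then obtain x where x: "x \<in> ?W" "ker n r a i x * chi w x j \<noteq> 0" by (rule sum.not_neutral_contains_not_neutral)
    then have "chi w x j \<noteq> (0::'a)" by auto
    then show "colc n w = tsw n lam u" using chi_nz colc_wt[OF x(1) u(3)] u(4) by metis
  qed
  also have "\<dots> = (\<Sum>w\<in>Jm n r. g w) * (prodc n r bs u * m)" by (rule sum_distrib_right[symmetric])
  also have "(\<Sum>w\<in>Jm n r. g w) = kconv n r (ker n r a) (ker n r b) i j"
  proof -
    have "(\<Sum>w\<in>Jm n r. g w) = (\<Sum>w\<in>Jm n r. \<Sum>x\<in>?W. ker n r a i x * (kc n r b w * chi w x j))"
      by (simp add: g_def sum_distrib_left mult_ac)
    also have "\<dots> = (\<Sum>x\<in>?W. \<Sum>w\<in>Jm n r. ker n r a i x * (kc n r b w * chi w x j))" by (rule sum.swap)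
    also have "\<dots> = (\<Sum>x\<in>?W. ker n r a i x * ker n r b x j)"
      by (intro sum.cong refl) (simp add: sum_distrib_left[symmetric] sum_kc_chi[OF b _ u(3)])
    finally show ?thesis by (simp add: kconv_def)
  qed
  finally show ?thesis by (simp add: mult_ac)
qed

lemma face_BGen:
  assumes g: "(a # b # bs, m) \<in> BGen n r (Suc k)" and t: "t \<le> Suc k"
  shows "face n r lam (Suc k) t (a # b # bs, m) \<in> BGen n r k"
    and "face n r lam (Suc k) 0 (a # b # bs, m) = (smul n r a b # bs, m)"
    and "q < k \<Longrightarrow> face n r lam (Suc k) (Suc q) (a # b # bs, m) = (a # iface n r q (b # bs), m)"
    and "face n r lam (Suc k) (Suc k) (a # b # bs, m) = (a # butlast (b # bs), 0)"
proof -
  have a: "a \<in> SchurPlus n r" and J: "set (b # bs) \<subseteq> Jrad n r" and l: "length bs = k" using g by (auto simp: BGen_Cons)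
  show 1: "face n r lam (Suc k) 0 (a # b # bs, m) = (smul n r a b # bs, m)" by (simp add: face_def)
  show 2: "face n r lam (Suc k) (Suc q) (a # b # bs, m) = (a # iface n r q (b # bs), m)" if "q < k" for q
    using that by (simp add: face_def iface_def)
  have L: "last (b # bs) \<in> Jrad n r" using J last_in_set[of "b # bs"] by blast
  have "rlam_act n r lam (last (b # bs)) m = 0"
    unfolding rlam_act_eq[OF lam Jrad_Plus[OF L]] lc_Jrad[OF L] by (rule mult_zero_left)
  then show 3: "face n r lam (Suc k) (Suc k) (a # b # bs, m) = (a # butlast (b # bs), 0)"
    by (cases "bs = []") (simp_all add: face_def)
  show "face n r lam (Suc k) t (a # b # bs, m) \<in> BGen n r k"
  proof (cases t)
    case 0
    then show ?thesis using J l smul_Plus[OF a Jrad_Plus] by (simp add: 1 BGen_Cons)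
  next
    case (Suc q)
    show ?thesis
    proof (cases "q < k")
      case True
      have q: "(b # bs) ! q \<in> Jrad n r" "bs ! q \<in> Jrad n r" using J True l nth_mem[of q "b # bs"] nth_mem[of q bs] by auto
      have "smul n r ((b # bs) ! q) (bs ! q) \<in> Jrad n r" using smul_Jrad[OF Jrad_Plus[OF q(1)] Jrad_Plus[OF q(2)]] q by blast
      then have "set (iface n r q (b # bs)) \<subseteq> Jrad n r"
        using J set_take_subset[of q "b # bs"] set_drop_subset[of "Suc q" bs] by (auto simp: iface_def)
      moreover have "length (iface n r q (b # bs)) = k" using True l by (simp add: iface_def)
      ultimately show ?thesis using a by (simp add: Suc 2[OF True] BGen_Cons)
    next
      case False
      then have "t = Suc k" using Suc t by simp
      moreover have "set (butlast (b # bs)) \<subseteq> Jrad n r" using J by (meson in_set_butlastD subset_iff)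
      moreover have "length (butlast (b # bs)) = k" unfolding length_butlast using l by simp
      ultimately show ?thesis using a by (simp only: 3 BGen_Cons)
    qed
  qed
qed

text \<open>The product number \<open>q\<close> inside the chain is face number \<open>Suc q\<close>
  of the whole tensor; this shift produces the minus sign in front of \<open>rho\<close>. The last
  face carries the scalar 0.\<close>

lemma thp_faces:
  assumes g: "g \<in> BGen n r (Suc k)"
  shows "(\<Sum>t\<le>Suc k. (-1) ^ t * thp k (face n r lam (Suc k) t g) u i j) = DD n r lam k (thp (Suc k) g) u i j"
proof -
  obtain a as m where g': "g = (a # as, m)" "length as = Suc k" "a \<in> SchurPlus n r" using g by (auto elim: BGenE)
  obtain b bs where as: "as = b # bs" using g' by (cases as) auto
  have G: "(a # b # bs, m) \<in> BGen n r (Suc k)" using g g' as by simp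
  note F = face_BGen(1)[OF G] face_BGen(2,3,4)[OF G le0]
  have b: "b \<in> Schur n r" using G by (auto simp: BGen_Cons intro: Jrad_Schur)
  show ?thesis
  proof (cases "u \<in> tails n r lam k \<and> i \<in> Inr n r \<and> j \<in> Inr n r \<and> cont j = tsw n lam u")
    case True
    then have u: "u \<in> tails n r lam k" "i \<in> Inr n r" "j \<in> Inr n r" "cont j = tsw n lam u" by auto
    let ?f = "\<lambda>t. (-1) ^ t * thp k (face n r lam (Suc k) t g) u i j"
    have "(\<Sum>t\<le>Suc k. ?f t) = ?f 0 + (\<Sum>q\<le>k. ?f (Suc q))" by (rule sum.atMost_Suc_shift)
    also have "(\<Sum>q\<le>k. ?f (Suc q)) = (\<Sum>q<k. ?f (Suc q)) + ?f (Suc k)"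
      unfolding lessThan_Suc_atMost[symmetric] by (rule sum.lessThan_Suc)
    also have "?f (Suc k) = 0" by (simp add: g'(1) as F(4) thp_def)
    also have "?f 0 = kconv n r (ker n r a) (ker n r b) i j * prodc n r bs u * m"
      by (simp add: g'(1) as F(2) thp_eq[OF u(1,4)] ker_smul[OF Plus_Schur[OF g'(3)] b])
    also have "(\<Sum>q<k. ?f (Suc q)) = (\<Sum>q<k. - (ker n r a i j * m * ((-1) ^ q * prodc n r (iface n r q as) u)))"
      by (intro sum.cong refl) (simp add: g'(1) as F(3) thp_eq[OF u(1,4)] mult_ac)
    also have "\<dots> = - (ker n r a i j * m * (\<Sum>q<k. (-1) ^ q * prodc n r (iface n r q as) u))"
      unfolding sum_negf sum_distrib_left ..
    finally show ?thesis unfolding g'(1) thp_face[OF g[unfolded g'(1)] u as] by simp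
  next
    case False
    have "thp k (face n r lam (Suc k) t g) u i j = 0" if "t \<le> Suc k" for t
    proof -
      have "thp k (face n r lam (Suc k) t g) \<in> CP n r lam k" using thp_CP[OF F(1)[OF that]] g'(1) as by simp
      then show ?thesis using False CC_supp[OF CP_CC] Kin_nz[OF CC_Kin[OF CP_CC]] by blast
    qed
    moreover have "DD n r lam k (thp (Suc k) g) u i j = 0"
      using False CC_supp[OF DD_CC[OF lam CP_CC[OF thp_CP[OF g]]]] Kin_nz[OF CC_Kin[OF DD_CC[OF lam CP_CC[OF thp_CP[OF g]]]]] by blast
    ultimately show ?thesis by simp
  qed
qed

lemma ph_dplus:
  fixes Y :: "'a::comm_ring_1 bplus"
  assumes Y: "Y \<in> Bplus n r lam (Suc k)"
  shows "dplus n r lam (Suc k) Y \<in> Bplus n r lam k" "ph k (dplus n r lam (Suc k) Y) = DD n r lam k (ph (Suc k) Y)"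
proof -
  note r = Bplus_rep(1)[OF Y]
  define D :: "'a bgen \<Rightarrow> 'a bgen \<Rightarrow> int" where
    "D = (\<lambda>g h. \<Sum>t\<le>Suc k. (-1) ^ t * gen1 (face n r lam (Suc k) t g) h)"
  have fB: "face n r lam (Suc k) t g \<in> BGen n r k" if g: "g \<in> BGen n r (Suc k)" and t: "t \<le> Suc k" for g :: "'a bgen" and t
  proof -
    obtain a as m where g': "g = (a # as, m)" "length as = Suc k" using g by (auto elim: BGenE)
    then obtain b bs where "as = b # bs" by (cases as) auto
    then show ?thesis using face_BGen(1)[OF _ t] g g' by simp
  qed
  have D: "D g \<in> FB k" if "g \<in> BGen n r (Suc k)" for g
    unfolding D_def by (rule alt_sum_free) (rule fB[OF that])
  have l: "lin_ext D (qrep Y) \<in> FB k" by (rule lin_ext_free[OF _ r]) (rule D)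
  have e: "dplus n r lam (Suc k) Y = bcls n r lam k (lin_ext D (qrep Y))" by (simp add: dplus_def D_def)
  show "dplus n r lam (Suc k) Y \<in> Bplus n r lam k" unfolding e by (rule bcls_Bplus[OF l])
  show "ph k (dplus n r lam (Suc k) Y) = DD n r lam k (ph (Suc k) Y)"
  proof (intro ext)
    fix u i j
    have "ph k (dplus n r lam (Suc k) Y) u i j = Lin (\<lambda>g. Lin (\<lambda>g. thp k g u i j) (D g)) (qrep Y)"
      unfolding e ph_bcls[OF l] phi_def by (rule Lin_lin_ext[OF _ r]) (rule D)
    also have "\<dots> = Lin (\<lambda>g. DD n r lam k (thp (Suc k) g) u i j) (qrep Y)"
    proof (rule Lin_cong[OF r])
      fix g :: "'a bgen" assume g: "g \<in> BGen n r (Suc k)"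
      have "Lin (\<lambda>g. thp k g u i j) (D g) = (\<Sum>t\<le>Suc k. (-1) ^ t * thp k (face n r lam (Suc k) t g) u i j)"
        unfolding D_def by (rule alt_sum_Lin) (rule fB[OF g])
      then show "Lin (\<lambda>g. thp k g u i j) (D g) = DD n r lam k (thp (Suc k) g) u i j" unfolding thp_faces[OF g] .
    qed
    also have "\<dots> = DD n r lam k (ph (Suc k) Y) u i j"
      unfolding ph_def phi_def[abs_def] by (rule DD_Lin)
    finally show "ph k (dplus n r lam (Suc k) Y) u i j = DD n r lam k (ph (Suc k) Y) u i j" .
  qed
qed

lemma TH_dres:
  fixes U :: "'a::comm_ring_1 bres"
  assumes U: "U \<in> Bres n r lam (Suc k)"
  shows "dres n r lam (Suc k) U \<in> Bres n r lam k" "TH k (dres n r lam (Suc k) U) = DD n r lam k (TH (Suc k) U)"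
proof -
  note r = Bres_rep(1)[OF U]
  define D :: "'a endo \<times> 'a bplus \<Rightarrow> 'a endo \<times> 'a bplus \<Rightarrow> int" where
    "D = (\<lambda>(s, Y). gen1 (s, dplus n r lam (Suc k) Y))"
  have D: "D g \<in> FO k" if "g \<in> BGenO n r lam (Suc k)" for g
    using that by (cases g) (auto simp: D_def BGenO_iff ph_dplus(1) intro!: free_on_gen1)
  have l: "lin_ext D (qrep U) \<in> FO k" by (rule lin_ext_free[OF _ r]) (rule D)
  have e: "dres n r lam (Suc k) U = bocls n r lam k (lin_ext D (qrep U))" by (simp add: dres_def D_def)
  show "dres n r lam (Suc k) U \<in> Bres n r lam k" unfolding e by (rule bocls_Bres[OF l])
  show "TH k (dres n r lam (Suc k) U) = DD n r lam k (TH (Suc k) U)"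
  proof (intro ext)
    fix u i j
    have "TH k (dres n r lam (Suc k) U) u i j = Lin (\<lambda>g. Lin (\<lambda>g. th k g u i j) (D g)) (qrep U)"
      unfolding e TH_bocls[OF l] Th_def by (rule Lin_lin_ext[OF _ r]) (rule D)
    also have "\<dots> = Lin (\<lambda>g. DD n r lam k (th (Suc k) g) u i j) (qrep U)"
    proof (rule Lin_cong[OF r])
      fix g :: "'a endo \<times> 'a bplus" assume "g \<in> BGenO n r lam (Suc k)"
      then obtain s Y where g: "g = (s, Y)" "s \<in> Schur n r" "Y \<in> Bplus n r lam (Suc k)" by (cases g) (auto simp: BGenO_iff)
      have "Lin (\<lambda>g. th k g u i j) (D g) = kconv n r (ker n r s) (DD n r lam k (ph (Suc k) Y) u) i j"
        by (simp add: g(1) D_def th_def ph_dplus(2)[OF g(3)])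
      also have "\<dots> = DD n r lam k (\<lambda>t. kconv n r (ker n r s) (ph (Suc k) Y t)) u i j"
        by (rule DD_kconv[OF ker_Kin[OF g(2)], symmetric])
      finally show "Lin (\<lambda>g. th k g u i j) (D g) = DD n r lam k (th (Suc k) g) u i j" by (simp add: g(1) th_def[abs_def])
    qed
    also have "\<dots> = DD n r lam k (TH (Suc k) U) u i j"
      unfolding TH_def Th_def[abs_def] by (rule DD_Lin)
    finally show "TH k (dres n r lam (Suc k) U) u i j = DD n r lam k (TH (Suc k) U) u i j" .
  qed
qed

end

section \<open>Module axioms and projectivity of the terms\<close>

lemma smodD:
  assumes "is_smod n r M"
  shows "mzero M \<in> mcar M"
    and "x \<in> mcar M \<Longrightarrow> y \<in> mcar M \<Longrightarrow> madd M x y \<in> mcar M"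
    and "x \<in> mcar M \<Longrightarrow> y \<in> mcar M \<Longrightarrow> z \<in> mcar M \<Longrightarrow> madd M (madd M x y) z = madd M x (madd M y z)"
    and "x \<in> mcar M \<Longrightarrow> y \<in> mcar M \<Longrightarrow> madd M x y = madd M y x"
    and "x \<in> mcar M \<Longrightarrow> madd M (mzero M) x = x"
    and "x \<in> mcar M \<Longrightarrow> \<exists>y\<in>mcar M. madd M x y = mzero M"
    and "s \<in> Schur n r \<Longrightarrow> x \<in> mcar M \<Longrightarrow> mact M s x \<in> mcar M"
    and "s \<in> Schur n r \<Longrightarrow> x \<in> mcar M \<Longrightarrow> y \<in> mcar M \<Longrightarrow> mact M s (madd M x y) = madd M (mact M s x) (mact M s y)"
    and "s \<in> Schur n r \<Longrightarrow> t \<in> Schur n r \<Longrightarrow> x \<in> mcar M \<Longrightarrow> mact M (sadd n r s t) x = madd M (mact M s x) (mact M t x)"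
    and "s \<in> Schur n r \<Longrightarrow> t \<in> Schur n r \<Longrightarrow> x \<in> mcar M \<Longrightarrow> mact M (smul n r s t) x = mact M s (mact M t x)"
proof -
  note d = assms[unfolded is_smod_def]
  have c: "mzero M \<in> mcar M"
    "\<forall>x\<in>mcar M. \<forall>y\<in>mcar M. madd M x y \<in> mcar M"
    "\<forall>x\<in>mcar M. \<forall>y\<in>mcar M. \<forall>z\<in>mcar M. madd M (madd M x y) z = madd M x (madd M y z)"
    "\<forall>x\<in>mcar M. \<forall>y\<in>mcar M. madd M x y = madd M y x"
    "\<forall>x\<in>mcar M. madd M (mzero M) x = x"
    "\<forall>x\<in>mcar M. \<exists>y\<in>mcar M. madd M x y = mzero M"
    "\<forall>s\<in>Schur n r. \<forall>x\<in>mcar M. mact M s x \<in> mcar M"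
    "\<forall>s\<in>Schur n r. \<forall>x\<in>mcar M. \<forall>y\<in>mcar M. mact M s (madd M x y) = madd M (mact M s x) (mact M s y)"
    "\<forall>s\<in>Schur n r. \<forall>t\<in>Schur n r. \<forall>x\<in>mcar M. mact M (sadd n r s t) x = madd M (mact M s x) (mact M t x)"
    "\<forall>s\<in>Schur n r. \<forall>t\<in>Schur n r. \<forall>x\<in>mcar M. mact M (smul n r s t) x = mact M s (mact M t x)"
    by (insert d, elim conjE, assumption)+
  show "mzero M \<in> mcar M" by (rule c(1))
  show "x \<in> mcar M \<Longrightarrow> y \<in> mcar M \<Longrightarrow> madd M x y \<in> mcar M" using c(2) by blast
  show "x \<in> mcar M \<Longrightarrow> y \<in> mcar M \<Longrightarrow> z \<in> mcar M \<Longrightarrow> madd M (madd M x y) z = madd M x (madd M y z)" using c(3) by blast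
  show "x \<in> mcar M \<Longrightarrow> y \<in> mcar M \<Longrightarrow> madd M x y = madd M y x" using c(4) by blast
  show "x \<in> mcar M \<Longrightarrow> madd M (mzero M) x = x" using c(5) by blast
  show "x \<in> mcar M \<Longrightarrow> \<exists>y\<in>mcar M. madd M x y = mzero M" using c(6) by blast
  show "s \<in> Schur n r \<Longrightarrow> x \<in> mcar M \<Longrightarrow> mact M s x \<in> mcar M" using c(7) by blast
  show "s \<in> Schur n r \<Longrightarrow> x \<in> mcar M \<Longrightarrow> y \<in> mcar M \<Longrightarrow> mact M s (madd M x y) = madd M (mact M s x) (mact M s y)"
    using c(8) by blast
  show "s \<in> Schur n r \<Longrightarrow> t \<in> Schur n r \<Longrightarrow> x \<in> mcar M \<Longrightarrow> mact M (sadd n r s t) x = madd M (mact M s x) (mact M t x)"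
    using c(9) by blast
  show "s \<in> Schur n r \<Longrightarrow> t \<in> Schur n r \<Longrightarrow> x \<in> mcar M \<Longrightarrow> mact M (smul n r s t) x = mact M s (mact M t x)"
    using c(10) by blast
qed

lemma smod_cancel:
  assumes M: "is_smod n r M" and x: "x \<in> mcar M" "madd M x x = x" shows "x = mzero M"
proof -
  obtain y where y: "y \<in> mcar M" "madd M x y = mzero M" using smodD(6)[OF M x(1)] by blast
  have "mzero M = madd M (madd M x x) y" using x(2) y(2) by simp
  also have "\<dots> = madd M x (mzero M)" using smodD(3)[OF M x(1) x(1) y(1)] y(2) by simp
  also have "\<dots> = madd M (mzero M) x" by (rule smodD(4)[OF M x(1) smodD(1)[OF M]])
  also have "\<dots> = x" by (rule smodD(5)[OF M x(1)])
  finally show ?thesis by simp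
qed

text \<open>Finite sums are taken along lists, since the addition of a record module is commutative
  only on its carrier.\<close>

definition ms :: "('a::comm_ring_1, 'm) smod \<Rightarrow> 'm list \<Rightarrow> 'm" where
  "ms M xs = foldr (madd M) xs (mzero M)"

lemma ms_simps: "ms M [] = mzero M" "ms M (x # xs) = madd M x (ms M xs)"
  by (simp_all add: ms_def)

lemma ms_closed: "is_smod n r M \<Longrightarrow> set xs \<subseteq> mcar M \<Longrightarrow> ms M xs \<in> mcar M"
  by (induction xs) (auto simp: ms_simps smodD(1,2))

lemma ms_add:
  assumes M: "is_smod n r M"
  shows "(\<And>t. t \<in> set ts \<Longrightarrow> a t \<in> mcar M \<and> b t \<in> mcar M) \<Longrightarrow>
    ms M (map (\<lambda>t. madd M (a t) (b t)) ts) = madd M (ms M (map a ts)) (ms M (map b ts))"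
proof (induction ts)
  case Nil
  show ?case using smodD(5)[OF M smodD(1)[OF M]] by (simp add: ms_simps)
next
  case (Cons t ts)
  define x y z w where "x = a t" and "y = b t" and "z = ms M (map a ts)" and "w = ms M (map b ts)"
  have c: "x \<in> mcar M" "y \<in> mcar M" "z \<in> mcar M" "w \<in> mcar M"
    unfolding x_def y_def z_def w_def using Cons.prems by (auto intro!: ms_closed[OF M])
  note cl = smodD(2)[OF M]
  have "madd M (madd M x y) (madd M z w) = madd M x (madd M y (madd M z w))" by (rule smodD(3)[OF M c(1,2) cl[OF c(3,4)]])
  also have "madd M y (madd M z w) = madd M (madd M y z) w" by (rule smodD(3)[OF M c(2,3,4), symmetric])
  also have "madd M y z = madd M z y" by (rule smodD(4)[OF M c(2,3)])
  also have "madd M (madd M z y) w = madd M z (madd M y w)" by (rule smodD(3)[OF M c(3,2,4)])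
  also have "madd M x (madd M z (madd M y w)) = madd M (madd M x z) (madd M y w)" by (rule smodD(3)[OF M c(1,3) cl[OF c(2,4)], symmetric])
  finally show ?case using Cons by (simp add: ms_simps x_def y_def z_def w_def)
qed

lemma ms_hom:
  assumes M: "is_smod n r M" and N: "is_smod n r N" and h: "\<And>x. x \<in> mcar M \<Longrightarrow> h x \<in> mcar N"
    "\<And>x y. x \<in> mcar M \<Longrightarrow> y \<in> mcar M \<Longrightarrow> h (madd M x y) = madd N (h x) (h y)"
  shows "set xs \<subseteq> mcar M \<Longrightarrow> h (ms M xs) = ms N (map h xs)"
proof (induction xs)
  case Nil
  have "madd N (h (mzero M)) (h (mzero M)) = h (mzero M)"
    using h(2)[OF smodD(1)[OF M] smodD(1)[OF M]] smodD(5)[OF M smodD(1)[OF M]] by simp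
  from smod_cancel[OF N h(1)[OF smodD(1)[OF M]] this] show ?case by (simp add: ms_simps)
next
  case (Cons x xs)
  then show ?case using h(2)[of x "ms M xs"] ms_closed[OF M, of xs] by (simp add: ms_simps)
qed

context bar_terms begin

lemma Bmod_sel: "mcar (Bmod n r lam k) = Bres n r lam k" "mzero (Bmod n r lam k) = Bzero n r lam k"
  by (simp_all add: Bmod_def)

lemma TH_add:
  assumes "U \<in> Bres n r lam k" "V \<in> Bres n r lam k"
  shows "madd (Bmod n r lam k) U V \<in> Bres n r lam k"
    "TH k (madd (Bmod n r lam k) U V) = (\<lambda>t i j. TH k U t i j + TH k V t i j)"
proof -
  note r = Bres_rep(1)[OF assms(1)] Bres_rep(1)[OF assms(2)]
  have e: "madd (Bmod n r lam k) U V = bocls n r lam k (qrep U + qrep V)" by (simp add: Bmod_def fadd_plus)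
  show "madd (Bmod n r lam k) U V \<in> Bres n r lam k" unfolding e by (rule bocls_Bres[OF free_on_add[OF r]])
  show "TH k (madd (Bmod n r lam k) U V) = (\<lambda>t i j. TH k U t i j + TH k V t i j)"
    unfolding e TH_bocls[OF free_on_add[OF r]] Th_add[OF r] by (simp only: TH_def)
qed

lemma TH_act:
  fixes U :: "'a::comm_ring_1 bres"
  assumes s: "s \<in> Schur n r" and U: "U \<in> Bres n r lam k"
  shows "mact (Bmod n r lam k) s U \<in> Bres n r lam k"
    "TH k (mact (Bmod n r lam k) s U) = (\<lambda>t. kconv n r (ker n r s) (TH k U t))"
proof -
  note r = Bres_rep(1)[OF U]
  define D :: "'a endo \<times> 'a bplus \<Rightarrow> 'a endo \<times> 'a bplus \<Rightarrow> int" where "D = (\<lambda>(t, Y). gen1 (smul n r s t, Y))"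
  have D: "D g \<in> FO k" if "g \<in> BGenO n r lam k" for g
    using that by (cases g) (auto simp: D_def BGenO_iff smul_Schur[OF s] intro!: free_on_gen1)
  have l: "lin_ext D (qrep U) \<in> FO k" by (rule lin_ext_free[OF _ r]) (rule D)
  have e: "mact (Bmod n r lam k) s U = bocls n r lam k (lin_ext D (qrep U))" by (simp add: Bmod_def D_def)
  show "mact (Bmod n r lam k) s U \<in> Bres n r lam k" unfolding e by (rule bocls_Bres[OF l])
  show "TH k (mact (Bmod n r lam k) s U) = (\<lambda>t. kconv n r (ker n r s) (TH k U t))"
  proof (intro ext)
    fix u i j
    have "TH k (mact (Bmod n r lam k) s U) u i j = Lin (\<lambda>g. Lin (\<lambda>g. th k g u i j) (D g)) (qrep U)"
      unfolding e TH_bocls[OF l] Th_def by (rule Lin_lin_ext[OF _ r]) (rule D)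
    also have "\<dots> = Lin (\<lambda>g. kconv n r (ker n r s) (th k g u) i j) (qrep U)"
    proof (rule Lin_cong[OF r])
      fix g :: "'a endo \<times> 'a bplus" assume "g \<in> BGenO n r lam k"
      then obtain t Y where g: "g = (t, Y)" "t \<in> Schur n r" by (cases g) (auto simp: BGenO_iff)
      then show "Lin (\<lambda>g. th k g u i j) (D g) = kconv n r (ker n r s) (th k g u) i j"
        by (simp add: D_def th_def ker_smul[OF s g(2)] kconv_assoc)
    qed
    also have "\<dots> = kconv n r (ker n r s) (TH k U u) i j"
      unfolding TH_def Th_def[abs_def] by (rule kconv_Lin[symmetric])
    finally show "TH k (mact (Bmod n r lam k) s U) u i j = kconv n r (ker n r s) (TH k U u) i j" .
  qed
qed

lemma TH_zero: "Bzero n r lam k \<in> Bres n r lam k" "TH k (Bzero n r lam k) = (\<lambda>t i j. 0)"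
proof -
  have e: "Bzero n r lam k = bocls n r lam k 0" by (simp add: Bzero_def zero_fun_def)
  show "Bzero n r lam k \<in> Bres n r lam k" unfolding e by (rule bocls_Bres[OF free_on_0(2)])
  show "TH k (Bzero n r lam k) = (\<lambda>t i j. 0)" unfolding e TH_bocls[OF free_on_0(2)] Th_0 ..
qed

text \<open>Each axiom holds on coordinates, where addition is pointwise and the action is kernel
  composition, and is pulled back along the injective \<open>TH\<close>.\<close>

lemma Bmod_smod: "is_smod n r (Bmod n r lam k :: ('a::comm_ring_1, 'a bres) smod)"
  unfolding is_smod_def Bmod_sel
proof (intro conjI ballI)
  note M = TH_add(1) TH_act(1) TH_zero(1) sadd_Schur smul_Schur sone_Schur
  note E = TH_add(2) TH_act(2) TH_zero(2)
  show "Bzero n r lam k \<in> Bres n r lam k" by (rule TH_zero(1))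
  fix U :: "'a bres" assume U: "U \<in> Bres n r lam k"
  show "madd (Bmod n r lam k) (Bzero n r lam k) U = U"
    by (rule TH_inj[of _ k]) (simp_all add: M E U)
  show "mact (Bmod n r lam k) (sone n r) U = U"
    by (rule TH_inj[of _ k]) (simp_all add: M E U ker_sone kconv_kid(1)[OF CC_Kin[OF TH_CC[OF U]]])
  show "\<exists>V\<in>Bres n r lam k. madd (Bmod n r lam k) U V = Bzero n r lam k"
  proof -
    note r = Bres_rep(1)[OF U]
    define V where "V = bocls n r lam k (0 - qrep U)"
    have V: "V \<in> Bres n r lam k" unfolding V_def by (rule bocls_Bres[OF free_on_diff[OF free_on_0(2) r]])
    have "TH k V = (\<lambda>t i j. 0 - TH k U t i j)"
      unfolding V_def TH_bocls[OF free_on_diff[OF free_on_0(2) r]] Th_diff[OF free_on_0(2) r] Th_0 by (simp only: TH_def)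
    then have "madd (Bmod n r lam k) U V = Bzero n r lam k"
      by (intro TH_inj[OF TH_add(1)[OF U V] TH_zero(1)]) (simp add: E U V)
    then show ?thesis using V by blast
  qed
  {
    fix V :: "'a bres" assume V: "V \<in> Bres n r lam k"
    show "madd (Bmod n r lam k) U V \<in> Bres n r lam k" by (rule TH_add(1)[OF U V])
    show "madd (Bmod n r lam k) U V = madd (Bmod n r lam k) V U"
      by (rule TH_inj[of _ k]) (simp_all add: M E U V add.commute)
    fix Z :: "'a bres" assume Z: "Z \<in> Bres n r lam k"
    show "madd (Bmod n r lam k) (madd (Bmod n r lam k) U V) Z = madd (Bmod n r lam k) U (madd (Bmod n r lam k) V Z)"
      by (rule TH_inj[of _ k]) (simp_all add: M E U V Z add.assoc)
  }
next
  note M = TH_add(1) TH_act(1) TH_zero(1) sadd_Schur smul_Schur sone_Schur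
  note E = TH_add(2) TH_act(2) TH_zero(2)
  fix s :: "'a endo" and U :: "'a bres" assume s: "s \<in> Schur n r" and U: "U \<in> Bres n r lam k"
  show "mact (Bmod n r lam k) s U \<in> Bres n r lam k" by (rule TH_act(1)[OF s U])
  {
    fix V :: "'a bres" assume V: "V \<in> Bres n r lam k"
    show "mact (Bmod n r lam k) s (madd (Bmod n r lam k) U V)
       = madd (Bmod n r lam k) (mact (Bmod n r lam k) s U) (mact (Bmod n r lam k) s V)"
      by (rule TH_inj[of _ k]) (simp_all add: M E s U V fun_eq_iff kconv_add_right)
  }
next
  note M = TH_add(1) TH_act(1) TH_zero(1) sadd_Schur smul_Schur sone_Schur
  note E = TH_add(2) TH_act(2) TH_zero(2)
  fix s t :: "'a endo" and U :: "'a bres" assume s: "s \<in> Schur n r" and t: "t \<in> Schur n r" and U: "U \<in> Bres n r lam k"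
  show "mact (Bmod n r lam k) (sadd n r s t) U = madd (Bmod n r lam k) (mact (Bmod n r lam k) s U) (mact (Bmod n r lam k) t U)"
    by (rule TH_inj[of _ k]) (simp_all add: M E s t U fun_eq_iff ker_sadd kconv_add_left)
  show "mact (Bmod n r lam k) (smul n r s t) U = mact (Bmod n r lam k) s (mact (Bmod n r lam k) t U)"
    by (rule TH_inj[of _ k]) (simp_all add: M E s t U fun_eq_iff ker_smul kconv_assoc)
qed

lemma TH_ms:
  fixes Us :: "'a::comm_ring_1 bres list"
  shows "set Us \<subseteq> Bres n r lam k \<Longrightarrow> ms (Bmod n r lam k) Us \<in> Bres n r lam k \<and>
    TH k (ms (Bmod n r lam k) Us) = (\<lambda>u i j. \<Sum>U\<leftarrow>Us. TH k U u i j)"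
proof (induction Us)
  case Nil
  then show ?case by (simp add: ms_simps Bmod_sel TH_zero)
next
  case (Cons U Us)
  then show ?case by (simp add: ms_simps TH_add)
qed

text \<open>Dual basis argument: the elements \<open>x t\<close> generate, with coordinate functions
  \<open>opr n r (TH k U t)\<close>. Arbitrary preimages \<open>m t\<close> of the
  \<open>f (x t)\<close>, recombined with these coordinates, give the lift. It is well defined
  because coordinates are unique, each being already supported on the columns of weight
  \<open>tsw n lam t\<close>.\<close>

lemma Bmod_projective: "projective_smod TYPE('m) TYPE('q) n r (Bmod n r lam k :: ('a::comm_ring_1, 'a bres) smod)"
  unfolding projective_smod_def
proof (intro conjI allI impI)
  let ?P = "Bmod n r lam k :: ('a, 'a bres) smod"
  show "is_smod n r ?P" by (rule Bmod_smod)
  fix M :: "('a, 'm) smod" and N :: "('a, 'q) smod" and g f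
  assume "is_smod n r M \<and> is_smod n r N \<and> smod_hom n r M N g \<and> g ` mcar M = mcar N \<and> smod_hom n r ?P N f"
  then have M: "is_smod n r M" and N: "is_smod n r N" and g: "smod_hom n r M N g" and sur: "g ` mcar M = mcar N"
    and f: "smod_hom n r ?P N f" by auto
  have gD: "x \<in> mcar M \<Longrightarrow> g x \<in> mcar N" "x \<in> mcar M \<Longrightarrow> y \<in> mcar M \<Longrightarrow> g (madd M x y) = madd N (g x) (g y)"
    "s \<in> Schur n r \<Longrightarrow> x \<in> mcar M \<Longrightarrow> g (mact M s x) = mact N s (g x)" for x y s
    using g unfolding smod_hom_def by simp_all
  have fD: "x \<in> Bres n r lam k \<Longrightarrow> f x \<in> mcar N" "x \<in> Bres n r lam k \<Longrightarrow> y \<in> Bres n r lam k \<Longrightarrow> f (madd ?P x y) = madd N (f x) (f y)"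
    "s \<in> Schur n r \<Longrightarrow> x \<in> Bres n r lam k \<Longrightarrow> f (mact ?P s x) = mact N s (f x)" for x y s
    using f unfolding smod_hom_def Bmod_sel by simp_all
  obtain ts where ts: "set ts = tails n r lam k" "distinct ts" using finite_distinct_list[OF finite_tails] by blast
  define x where "x t = bocls n r lam k (gen1 (sone n r :: 'a endo, yb k t))" for t
  have xg: "gen1 (sone n r :: 'a endo, yb k t) \<in> FO k" if "t \<in> tails n r lam k" for t
    by (rule free_on_gen1) (simp add: BGenO_iff sone_Schur yb_Bplus[OF that])
  have x: "x t \<in> Bres n r lam k" if "t \<in> tails n r lam k" for t
    unfolding x_def by (rule bocls_Bres[OF xg[OF that]])
  have "\<forall>t\<in>tails n r lam k. \<exists>m. m \<in> mcar M \<and> g m = f (x t)"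
  proof
    fix t assume "t \<in> tails n r lam k"
    then have "f (x t) \<in> g ` mcar M" unfolding sur by (intro fD(1) x)
    then show "\<exists>m. m \<in> mcar M \<and> g m = f (x t)" by auto
  qed
  from bchoice[OF this] obtain m where m: "\<forall>t\<in>tails n r lam k. m t \<in> mcar M \<and> g (m t) = f (x t)" ..
  have mM: "m t \<in> mcar M" and gm: "g (m t) = f (x t)" if "t \<in> set ts" for t using m that ts(1) by auto
  have xs: "x t \<in> Bres n r lam k" if "t \<in> set ts" for t using x that ts(1) by simp
  define h where "h U = ms M (map (\<lambda>t. mact M (opr n r (TH k U t)) (m t)) ts)" for U
  have S: "opr n r (TH k U t) \<in> Schur n r" if "U \<in> Bres n r lam k" for U :: "'a bres" and t
    by (rule opr_Schur[OF CC_Kin[OF TH_CC[OF that]]])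
  have hM: "h U \<in> mcar M" if "U \<in> Bres n r lam k" for U
    unfolding h_def by (rule ms_closed[OF M]) (use smodD(7)[OF M S[OF that] mM] in auto)
  have "smod_hom n r ?P M h" unfolding smod_hom_def Bmod_sel
  proof (intro conjI ballI)
    fix U :: "'a bres" assume U: "U \<in> Bres n r lam k"
    show "h U \<in> mcar M" by (rule hM[OF U])
    {
      fix V :: "'a bres" assume V: "V \<in> Bres n r lam k"
      have "mact M (opr n r (TH k (madd ?P U V) t)) (m t)
         = madd M (mact M (opr n r (TH k U t)) (m t)) (mact M (opr n r (TH k V t)) (m t))" if "t \<in> set ts" for t
        unfolding TH_add(2)[OF U V] sadd_opr[OF CC_Kin[OF TH_CC[OF U]] CC_Kin[OF TH_CC[OF V]]]
        by (rule smodD(9)[OF M S[OF U] S[OF V] mM[OF that]])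
      then have "h (madd ?P U V) = ms M (map (\<lambda>t. madd M (mact M (opr n r (TH k U t)) (m t)) (mact M (opr n r (TH k V t)) (m t))) ts)"
        unfolding h_def by (intro arg_cong[of _ _ "ms M"] map_cong refl)
      also have "\<dots> = madd M (h U) (h V)" unfolding h_def
        by (rule ms_add[OF M]) (use smodD(7)[OF M S[OF U] mM] smodD(7)[OF M S[OF V] mM] in blast)
      finally show "h (madd ?P U V) = madd M (h U) (h V)" .
    }
  next
    fix s :: "'a endo" and U :: "'a bres" assume s: "s \<in> Schur n r" and U: "U \<in> Bres n r lam k"
    note K = CC_Kin[OF TH_CC[OF U]]
    have "mact M (opr n r (TH k (mact ?P s U) t)) (m t) = mact M s (mact M (opr n r (TH k U t)) (m t))" if "t \<in> set ts" for t
    proof -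
      have "opr n r (TH k (mact ?P s U) t) = smul n r s (opr n r (TH k U t))"
        unfolding TH_act(2)[OF s U] smul_eq[OF s S[OF U]] ker_opr[OF K] ..
      then show ?thesis using smodD(10)[OF M s S[OF U] mM[OF that]] by simp
    qed
    then have "h (mact ?P s U) = ms M (map (mact M s) (map (\<lambda>t. mact M (opr n r (TH k U t)) (m t)) ts))"
      unfolding h_def map_map by (intro arg_cong[of _ _ "ms M"] map_cong refl) simp
    also have "\<dots> = mact M s (h U)" unfolding h_def
      by (rule ms_hom[OF M M smodD(7)[OF M s] smodD(8)[OF M s], symmetric]) (use smodD(7)[OF M S[OF U] mM] in auto)
    finally show "h (mact ?P s U) = mact M s (h U)" .
  qed
  moreover have "\<forall>U\<in>mcar ?P. g (h U) = f U"
  proof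
    fix U assume "U \<in> mcar ?P"
    then have U: "U \<in> Bres n r lam k" by (simp add: Bmod_sel)
    note F = TH_CC[OF U]
    let ?Us = "map (\<lambda>t. mact ?P (opr n r (TH k U t)) (x t)) ts"
    have Us: "set ?Us \<subseteq> Bres n r lam k" using TH_act(1)[OF S[OF U] xs] by auto
    have "g (h U) = ms N (map g (map (\<lambda>t. mact M (opr n r (TH k U t)) (m t)) ts))"
      unfolding h_def by (rule ms_hom[OF M N gD(1,2)]) (use smodD(7)[OF M S[OF U] mM] in auto)
    also have "\<dots> = ms N (map f ?Us)" unfolding map_map
      by (intro arg_cong[of _ _ "ms N"] map_cong refl) (simp add: gD(3)[OF S[OF U] mM] fD(3)[OF S[OF U] xs] gm)
    also have "\<dots> = f (ms ?P ?Us)"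
      by (rule ms_hom[OF Bmod_smod N, symmetric]) (use fD Us in \<open>simp_all add: Bmod_sel\<close>)
    also have "ms ?P ?Us = U"
    proof (rule TH_inj)
      show "ms ?P ?Us \<in> Bres n r lam k" "U \<in> Bres n r lam k" using TH_ms[OF Us] U by blast+
      have "(\<Sum>V\<leftarrow>?Us. TH k V u i j) = TH k U u i j" for u i j
      proof -
        have "(\<Sum>V\<leftarrow>?Us. TH k V u i j) = (\<Sum>t\<in>tails n r lam k. TH k (mact ?P (opr n r (TH k U t)) (x t)) u i j)"
          using sum_list_distinct_conv_sum_set[OF ts(2), of "\<lambda>t. TH k (mact ?P (opr n r (TH k U t)) (x t)) u i j"]
          by (simp add: comp_def ts(1))
        also have "\<dots> = (\<Sum>t\<in>tails n r lam k. if t = u then TH k U u i j else 0)"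
        proof (intro sum.cong refl)
          fix t assume t: "t \<in> tails n r lam k"
          have "TH k (x t) u = ph k (yb k t) u"
            unfolding x_def TH_bocls[OF xg[OF t]] Th_gen1 using kconv_kid(1)[OF CC_Kin[OF CP_CC[OF ph_CP[OF yb_Bplus[OF t]]]]]
            by (simp add: th_def ker_sone)
          then have "TH k (mact ?P (opr n r (TH k U t)) (x t)) u i j = th k (opr n r (TH k U t), yb k t) u i j"
            unfolding TH_act(2)[OF S[OF U] x[OF t]] by (simp add: th_def)
          then show "TH k (mact ?P (opr n r (TH k U t)) (x t)) u i j = (if t = u then TH k U u i j else 0)"
            unfolding th_yb[OF F t] .
        qed
        also have "\<dots> = TH k U u i j" using CC_supp[OF F, of u i j] by auto
        finally show ?thesis .
      qed
      then show "TH k (ms ?P ?Us) = TH k U" using TH_ms[OF Us] by (intro ext) simp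
    qed
    finally show "g (h U) = f U" .
  qed
  ultimately show "\<exists>h. smod_hom n r ?P M h \<and> (\<forall>x\<in>mcar ?P. g (h x) = f x)" by blast
qed

lemma bar_exact_pos:
  assumes dom: "lam \<in> CompsDom n r"
  shows "{U \<in> (Bres n r lam (Suc k) :: 'a::comm_ring_1 bres set). dres n r lam (Suc k) U = Bzero n r lam k}
     = dres n r lam (Suc (Suc k)) ` Bres n r lam (Suc (Suc k))"
proof (intro equalityI subsetI)
  fix U :: "'a bres" assume "U \<in> {U \<in> Bres n r lam (Suc k). dres n r lam (Suc k) U = Bzero n r lam k}"
  then have U: "U \<in> Bres n r lam (Suc k)" and z: "dres n r lam (Suc k) U = Bzero n r lam k" by auto
  have "DD n r lam k (TH (Suc k) U) = (\<lambda>_ _ _. 0)" using TH_dres(2)[OF U] unfolding z TH_zero(2) by (rule sym)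
  from DD_exact[OF lam dom TH_CC[OF U] this] obtain G where
    G: "G \<in> CC n r lam (Suc (Suc k))" "DD n r lam (Suc k) G = TH (Suc k) U" by blast
  note V = TH_surj[OF G(1)]
  have "U = dres n r lam (Suc (Suc k)) (bocls n r lam (Suc (Suc k)) (sig (Suc (Suc k)) G))"
    by (rule TH_inj[OF U TH_dres(1)[OF V(1)]]) (simp only: TH_dres(2)[OF V(1)] V(2) G(2))
  then show "U \<in> dres n r lam (Suc (Suc k)) ` Bres n r lam (Suc (Suc k))" using V(1) by blast
next
  fix U :: "'a bres" assume "U \<in> dres n r lam (Suc (Suc k)) ` Bres n r lam (Suc (Suc k))"
  then obtain V where V: "V \<in> Bres n r lam (Suc (Suc k))" "U = dres n r lam (Suc (Suc k)) V" by blast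
  have U: "U \<in> Bres n r lam (Suc k)" unfolding V(2) by (rule TH_dres(1)[OF V(1)])
  have "dres n r lam (Suc k) U = Bzero n r lam k"
    by (rule TH_inj[OF TH_dres(1)[OF U] TH_zero(1)])
      (simp only: TH_dres(2)[OF U] TH_zero(2), simp only: V(2) TH_dres(2)[OF V(1)] DD_DD[OF lam TH_CC[OF V(1)]])
  then show "U \<in> {U \<in> Bres n r lam (Suc k). dres n r lam (Suc k) U = Bzero n r lam k}" using U by blast
qed

end

section \<open>The augmentation onto the Weyl module\<close>

lemma DD_add: "DD n r lam k (\<lambda>t i j. F t i j + G t i j) = (\<lambda>t i j. DD n r lam k F t i j + DD n r lam k G t i j)"
  and DD_diff: "DD n r lam k (\<lambda>t i j. F t i j - G t i j) = (\<lambda>t i j. DD n r lam k F t i j - DD n r lam k G t i j)"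
  and DD_0: "DD n r lam k (\<lambda>t i j. 0) = (\<lambda>t i j. 0)"
  by (intro ext; simp add: DD_def algebra_simps sum.distrib sum_subtractf del: tails.simps)+

context bar_terms begin

abbreviation "RW \<equiv> ORel n r UNIV (+) (rlam_act n r lam)"
abbreviation "FW \<equiv> free_on (OGen n r UNIV)"

lemma RW_free: "RW \<subseteq> FW"
proof
  fix x :: "'a endo \<times> 'a \<Rightarrow> int" assume "x \<in> RW"
  then show "x \<in> FW"
    unfolding ORel_def
  proof (elim UnE CollectE exE conjE, goal_cases)
    case (1 s s' Y)
    then show ?case by (simp, intro gen1_diff2_free) (simp_all add: OGen_def sadd_Schur)
  next
    case (2 s Y Z)
    then show ?case by (simp, intro gen1_diff2_free) (simp_all add: OGen_def)
  next
    case (3 s a Y)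
    then show ?case by (simp, intro gen1_diff_free) (simp_all add: OGen_def smul_Schur Plus_Schur)
  qed
qed

text \<open>A fixed word of weight \<open>lam\<close>; the augmentation of the Borel resolution is
  the coordinate at the diagonal pair of this word.\<close>

definition x0 :: "nat list" where
  "x0 = (SOME x. x \<in> Inr n r \<and> cont x = lam)"

lemma x0: "x0 \<in> Inr n r" "cont x0 = lam"
proof -
  have "x0 \<in> Inr n r \<and> cont x0 = lam"
    unfolding x0_def by (rule someI_ex) (use word_of_content[OF lam] in blast)
  then show "x0 \<in> Inr n r" "cont x0 = lam" by auto
qed

lemma thp0:
  assumes "a \<in> Schur n r" shows "thp 0 ([a], m) [] x0 x0 = lc n r a lam * m"
  using lc_eq[OF assms x0(1)] by (simp add: thp_def x0(2))

lemma dplus0_eq: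
  assumes Y: "Y \<in> Bplus n r lam 0" shows "dplus0 n r lam Y = ph 0 Y [] x0 x0"
proof -
  have "dplus0 n r lam Y = Lin (\<lambda>g. rlam_act n r lam (fst g ! 0) (snd g)) (qrep Y)" by (simp add: dplus0_def Lin_def)
  also have "\<dots> = Lin (\<lambda>g. thp 0 g [] x0 x0) (qrep Y)"
  proof (rule Lin_cong[OF Bplus_rep(1)[OF Y]])
    fix g :: "'a bgen" assume "g \<in> BGen n r 0"
    then obtain a as m where g: "g = (a # as, m)" "a \<in> SchurPlus n r" "length as = 0" by (rule BGenE)
    then show "rlam_act n r lam (fst g ! 0) (snd g) = thp 0 g [] x0 x0"
      by (simp add: rlam_act_eq[OF lam g(2)] thp0[OF Plus_Schur[OF g(2)]])
  qed
  finally show ?thesis by (simp add: ph_def phi_def)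
qed

text \<open>Both kernels are upper triangular, so the diagonal entry of their product is the product
  of the diagonal entries.\<close>

lemma dplus0_act:
  assumes a: "a \<in> SchurPlus n r" and Y: "Y \<in> Bplus n r lam 0"
  shows "dplus0 n r lam (bplus_act n r lam 0 a Y) = rlam_act n r lam a (dplus0 n r lam Y)"
proof -
  note P = ph_CP[OF Y]
  have "dplus0 n r lam (bplus_act n r lam 0 a Y) = (\<Sum>z\<in>Inr n r. ker n r a x0 z * ph 0 Y [] z x0)"
    unfolding dplus0_eq[OF ph_act(1)[OF a Y]] ph_act(2)[OF a Y] kconv_def ..
  also have "\<dots> = (\<Sum>z\<in>Inr n r. if z = x0 then ker n r a x0 x0 * ph 0 Y [] x0 x0 else 0)"
  proof (intro sum.cong refl)
    fix z
    have "z = x0" if "ker n r a x0 z \<noteq> 0" "ph 0 Y [] z x0 \<noteq> 0"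
      using that CP_lle[OF P] a lle_antisym[of z x0] unfolding SchurPlus_iff by blast
    then show "ker n r a x0 z * ph 0 Y [] z x0 = (if z = x0 then ker n r a x0 x0 * ph 0 Y [] x0 x0 else 0)"
      by (cases "ker n r a x0 z = 0"; cases "ph 0 Y [] z x0 = 0") auto
  qed
  also have "\<dots> = ker n r a x0 x0 * ph 0 Y [] x0 x0" using x0(1) by simp
  finally show ?thesis unfolding rlam_act_eq[OF lam a] dplus0_eq[OF Y] lc_eq[OF Plus_Schur[OF a] x0(1)] x0(2) .
qed

text \<open>A nonzero term needs \<open>x0 \<le> x\<close> from the chain and
  \<open>x \<le> x0\<close> with \<open>x \<noteq> x0\<close> from a matrix of J, which is
  impossible.\<close>

lemma dplus0_dplus:
  fixes Y :: "'a::comm_ring_1 bplus"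
  assumes Y: "Y \<in> Bplus n r lam (Suc 0)" shows "dplus0 n r lam (dplus n r lam (Suc 0) Y) = 0"
proof -
  have "ph (Suc 0) Y t x0 x * bde n r lam t [] x x0 = 0" if t: "t \<in> tails n r lam (Suc 0)" and x: "x \<in> Inr n r" for t x
  proof -
    obtain w where w: "t = [w]" "w \<in> Jm n r" using t by auto
    have b: "bde n r lam t [] x x0 = chi w x x0" unfolding bde_tails[OF t x x0(1)] by (simp add: w)
    have "lle x x0 \<and> x \<noteq> x0" if "chi w x x0 \<noteq> (0::'a)" using chi_nz[OF that] w(2) Jm_wt[OF x x0(1)] by auto
    note c = this
    show ?thesis
    proof (cases "chi w x x0 = (0::'a)")
      case True
      then show ?thesis by (simp add: b)
    next
      case False
      have "\<not> lle x0 x" using c[OF False] lle_antisym[of x0 x] by blast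
      then have "ph (Suc 0) Y t x0 x = 0" using CP_lle[OF ph_CP[OF Y], of t x0 x] by blast
      then show ?thesis by simp
    qed
  qed
  then show ?thesis
    unfolding dplus0_eq[OF ph_dplus(1)[OF Y]] ph_dplus(2)[OF Y] DD_def by (simp del: tails.simps(2))
qed

definition D0 :: "'a::comm_ring_1 endo \<times> 'a bplus \<Rightarrow> 'a endo \<times> 'a \<Rightarrow> int" where
  "D0 = (\<lambda>(s, Y). gen1 (s, dplus0 n r lam Y))"

lemma D0_free: "g \<in> BGenO n r lam 0 \<Longrightarrow> D0 g \<in> FW"
  by (cases g) (auto simp: D0_def BGenO_iff OGen_def intro!: free_on_gen1)

lemma lin_ext_rel2: "lin_ext D (\<lambda>g. gen1 a g - gen1 b g) = D a - D b"
  using lin_ext_diff[of "gen1 a" UNIV "gen1 b" D] by (simp add: free_on_gen1 fun_diff_def)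

lemma lin_ext_rel3: "lin_ext D (\<lambda>g. gen1 a g - gen1 b g - gen1 c g) = D a - D b - D c"
  using lin_ext_diff[of "\<lambda>g. gen1 a g - gen1 b g" UNIV "gen1 c" D]
  by (simp add: free_on_gen1 gen1_diff_free lin_ext_rel2) (simp add: fun_diff_def)

lemma eqm_0I: "x \<in> A \<Longrightarrow> eqm A x 0"
  by (simp only: eqm_def diff_0_right zspan_base)

lemma D0_rel:
  assumes "x \<in> BRelO n r lam 0" shows "eqm RW (lin_ext D0 x) 0"
  using assms unfolding BRelO_def ORel_def[of _ _ "Bplus n r lam 0"]
proof (elim UnE CollectE exE conjE, goal_cases)
  case (1 s s' Y)
  show ?case unfolding 1(1) lin_ext_rel3 D0_def prod.case fun_diff_def
    by (rule eqm_0I) (unfold ORel_def, use 1 in blast)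
next
  case (2 s Y Z)
  have e: "dplus0 n r lam (bplus_add n r lam 0 Y Z) = dplus0 n r lam Y + dplus0 n r lam Z"
    unfolding dplus0_eq[OF ph_add(1)[OF 2(3,4)]] ph_add(2)[OF 2(3,4)] dplus0_eq[OF 2(3)] dplus0_eq[OF 2(4)] ..
  show ?case unfolding 2(1) lin_ext_rel3 D0_def prod.case fun_diff_def e
    by (rule eqm_0I) (unfold ORel_def, use 2 in blast)
next
  case (3 s a Y)
  show ?case unfolding 3(1) lin_ext_rel2 D0_def prod.case fun_diff_def dplus0_act[OF 3(3,4)]
    by (rule eqm_0I) (unfold ORel_def, use 3 in blast)
qed

lemma lin_ext_D0_FW: "f \<in> FO 0 \<Longrightarrow> lin_ext D0 f \<in> FW"
  by (rule lin_ext_free[OF D0_free])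

lemma dres0_bocls:
  assumes f: "f \<in> FO 0" shows "dres0 n r lam (bocls n r lam 0 f) = wcls n r lam (lin_ext D0 f)"
proof -
  note q = qrep_qcls[OF f, where A = "BRelO n r lam 0", folded bocls_def]
  have "eqm RW (lin_ext D0 (qrep (bocls n r lam 0 f))) (lin_ext D0 f)"
    by (rule lin_ext_eqm[OF BRelO_free D0_rel q(1) f q(2)])
  then show ?thesis
    unfolding dres0_def wcls_def D0_def[symmetric] qcls_eq_iff[OF lin_ext_D0_FW[OF q(1)] lin_ext_D0_FW[OF f]] .
qed

lemma dres0_onto: "dres0 n r lam ` Bres n r lam 0 = (Wlam n r lam :: ('a::comm_ring_1 endo \<times> 'a \<Rightarrow> int) set set)"
proof (intro equalityI subsetI)
  fix w :: "'a endo \<times> 'a \<Rightarrow> int" fix Z :: "('a endo \<times> 'a \<Rightarrow> int) set" assume "Z \<in> dres0 n r lam ` Bres n r lam 0"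
  then obtain U where U: "U \<in> Bres n r lam 0" "Z = dres0 n r lam U" by blast
  have "Z = wcls n r lam (lin_ext D0 (qrep U))" unfolding U(2) by (simp add: dres0_def D0_def)
  then show "Z \<in> Wlam n r lam"
    unfolding Wlam_def wcls_def by (simp only: qcls_quot[OF lin_ext_D0_FW[OF Bres_rep(1)[OF U(1)]]])
next
  fix Z :: "('a endo \<times> 'a \<Rightarrow> int) set" assume "Z \<in> Wlam n r lam"
  then obtain f where f: "f \<in> FW" "Z = wcls n r lam f" unfolding Wlam_def wcls_def quot_def by blast
  \<comment> \<open>A section of \<open>D0\<close> on free generators: s \<otimes> m is lifted to s
    \<otimes> (1 \<otimes> m).\<close>
  define E :: "'a endo \<times> 'a \<Rightarrow> 'a endo \<times> 'a bplus \<Rightarrow> int" where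
    "E = (\<lambda>(s, m). gen1 (s, bcls n r lam 0 (gen1 ([sone n r], m))))"
  have B: "gen1 ([sone n r], m) \<in> FB 0" for m :: 'a
    by (rule free_on_gen1) (simp add: BGen_Cons sone_Plus)
  have E: "E g \<in> FO 0" if "g \<in> OGen n r UNIV" for g
    using that by (cases g) (auto simp: E_def OGen_def BGenO_iff bcls_Bplus[OF B] intro!: free_on_gen1)
  have e: "lin_ext D0 (E g) = gen1 g" for g
  proof (cases g)
    case (Pair s m)
    have "dplus0 n r lam (bcls n r lam 0 (gen1 ([sone n r], m))) = m"
      unfolding dplus0_eq[OF bcls_Bplus[OF B]] ph_bcls[OF B] phi_gen1 thp0[OF sone_Schur] lc_sone[OF lam] by simp
    then show ?thesis unfolding Pair E_def prod.case lin_ext_gen1 D0_def by simp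
  qed
  have l: "lin_ext E h \<in> FO 0" if "h \<in> FW" for h by (rule lin_ext_free[OF _ that]) (rule E)
  have "lin_ext D0 (lin_ext E f) = f" using f(1)
  proof (induction rule: free_on_induct)
    case (add f g)
    show ?case unfolding lin_ext_add[OF add(1) free_on_gen1[OF add(2)]] lin_ext_gen1 lin_ext_add[OF l[OF add(1)] E[OF add(2)]] add(3) e ..
  next
    case (diff f g)
    show ?case unfolding lin_ext_diff[OF diff(1) free_on_gen1[OF diff(2)]] lin_ext_gen1 lin_ext_diff[OF l[OF diff(1)] E[OF diff(2)]] diff(3) e ..
  qed (simp only: lin_ext_0)
  then have "Z = dres0 n r lam (bocls n r lam 0 (lin_ext E f))" unfolding dres0_bocls[OF l[OF f(1)]] f(2) by (simp only:)
  then show "Z \<in> dres0 n r lam ` Bres n r lam 0" using bocls_Bres[OF l[OF f(1)]] by blast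
qed

lemma dres0_dres:
  assumes U: "U \<in> Bres n r lam (Suc 0)"
  shows "dres0 n r lam (dres n r lam (Suc 0) U) = (Wzero n r lam :: ('a::comm_ring_1 endo \<times> 'a \<Rightarrow> int) set)"
proof -
  note r = Bres_rep(1)[OF U]
  define D :: "'a endo \<times> 'a bplus \<Rightarrow> 'a endo \<times> 'a bplus \<Rightarrow> int" where
    "D = (\<lambda>(s, Y). gen1 (s, dplus n r lam (Suc 0) Y))"
  have D: "D g \<in> FO 0" if "g \<in> BGenO n r lam (Suc 0)" for g
    using that by (cases g) (auto simp: D_def BGenO_iff ph_dplus(1) intro!: free_on_gen1)
  have l: "lin_ext D h \<in> FO 0" if "h \<in> FO (Suc 0)" for h by (rule lin_ext_free[OF _ that]) (rule D)
  have z: "eqm RW (lin_ext D0 (D g)) 0" if gB: "g \<in> BGenO n r lam (Suc 0)" for g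
  proof -
    obtain s Y where g: "g = (s, Y)" "s \<in> Schur n r" "Y \<in> Bplus n r lam (Suc 0)" using gB by (cases g) (auto simp: BGenO_iff)
    have "(\<lambda>g. gen1 (s, 0 + 0) g - gen1 (s, 0) g - gen1 (s, 0) g) \<in> RW"
      unfolding ORel_def using g(2) by blast
    from eqm_double[OF eqm_rel3[OF this, unfolded add_0_right]]
    show ?thesis unfolding g(1) D_def prod.case lin_ext_gen1 D0_def dplus0_dplus[OF g(3)] .
  qed
  have "eqm RW (lin_ext D0 (lin_ext D (qrep U))) 0" using r
  proof (induction rule: free_on_induct)
    case (add f g)
    show ?case unfolding lin_ext_add[OF add(1) free_on_gen1[OF add(2)]] lin_ext_gen1 lin_ext_add[OF l[OF add(1)] D[OF add(2)]]
      using eqm_add[OF add(3) z[OF add(2)]] by (simp only: add_0_right)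
  next
    case (diff f g)
    show ?case unfolding lin_ext_diff[OF diff(1) free_on_gen1[OF diff(2)]] lin_ext_gen1 lin_ext_diff[OF l[OF diff(1)] D[OF diff(2)]]
      using eqm_diff[OF diff(3) z[OF diff(2)]] by (simp only: diff_0_right)
  qed (simp only: lin_ext_0 eqm_refl)
  then have "wcls n r lam (lin_ext D0 (lin_ext D (qrep U))) = wcls n r lam 0"
    unfolding wcls_def qcls_eq_iff[OF lin_ext_D0_FW[OF l[OF r]] free_on_0(2)] .
  moreover have "dres n r lam (Suc 0) U = bocls n r lam 0 (lin_ext D (qrep U))" by (simp add: dres_def D_def)
  ultimately show ?thesis by (simp only: dres0_bocls[OF l[OF r]] Wzero_def zero_fun_def)
qed

text \<open>Coordinates of formal combinations of generators of the Weyl module. They descend only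
  modulo boundaries: relations of the Weyl module are sent into \<open>IM\<close>, which is what the
  kernel computation uses.\<close>

definition XI :: "('a::comm_ring_1 endo \<times> 'a \<Rightarrow> int) \<Rightarrow> mat list \<Rightarrow> nat list \<Rightarrow> nat list \<Rightarrow> 'a" where
  "XI f t i j = Lin (\<lambda>g. if t = [] \<and> cont j = lam then ker n r (fst g) i j * snd g else 0) f"

definition IM :: "(mat list \<Rightarrow> nat list \<Rightarrow> nat list \<Rightarrow> 'a::comm_ring_1) set" where
  "IM = DD n r lam 0 ` CC n r lam (Suc 0)"

lemma IM_add: "F \<in> IM \<Longrightarrow> G \<in> IM \<Longrightarrow> (\<lambda>t i j. F t i j + G t i j) \<in> IM"
  and IM_diff: "F \<in> IM \<Longrightarrow> G \<in> IM \<Longrightarrow> (\<lambda>t i j. F t i j - G t i j) \<in> IM"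
  and IM_0: "(\<lambda>t i j. 0) \<in> IM"
proof -
  show "(\<lambda>t i j. 0) \<in> IM" unfolding IM_def by (rule image_eqI[of _ "DD n r lam 0" "\<lambda>t i j. 0"]) (rule DD_0[symmetric] CC_0)+
  assume "F \<in> IM" "G \<in> IM"
  then obtain F' G' where e: "F' \<in> CC n r lam (Suc 0)" "F = DD n r lam 0 F'" "G' \<in> CC n r lam (Suc 0)" "G = DD n r lam 0 G'"
    by (auto simp: IM_def)
  show "(\<lambda>t i j. F t i j + G t i j) \<in> IM" unfolding IM_def e(2,4) 
    by (rule image_eqI[of _ "DD n r lam 0" "\<lambda>t i j. F' t i j + G' t i j"]) (rule DD_add[symmetric] CC_add[OF e(1,3)])+
  show "(\<lambda>t i j. F t i j - G t i j) \<in> IM" unfolding IM_def e(2,4) 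
    by (rule image_eqI[of _ "DD n r lam 0" "\<lambda>t i j. F' t i j - G' t i j"]) (rule DD_diff[symmetric] CC_diff[OF e(1,3)])+
qed

text \<open>The relation is the boundary of s \<otimes> (1 \<otimes> a' \<otimes> m), where
  \<open>a'\<close> is the part of \<open>a\<close> in J. The remaining diagonal part of
  \<open>a\<close> acts on columns of weight \<open>lam\<close> by the same scalar as on the module
  of rank one.\<close>

lemma XI_smul:
  fixes s a :: "'a::comm_ring_1 endo"
  assumes s: "s \<in> Schur n r" and a: "a \<in> SchurPlus n r"
  shows "XI (\<lambda>g. gen1 (smul n r s a, m) g - gen1 (s, rlam_act n r lam a m) g) \<in> IM"
proof -
  define a' where "a' = opr n r (kxi n r (Jm n r) (kc n r a))"
  have ka: "ker n r a' = kxi n r (Jm n r) (kc n r a)" unfolding a'_def by (rule ker_opr[OF kxi_Kin])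
  have aJ: "a' \<in> Jrad n r"
    using Jm_wt[of _ n r] by (auto simp: Jrad_iff a'_def opr_Schur[OF kxi_Kin] ker_opr[OF kxi_Kin] kxi_def split: if_splits)
  have ka': "ker n r a' z j = ker n r a z j - (if z = j then ker n r a j j else 0)" if "z \<in> Inr n r" "j \<in> Inr n r" for z j
  proof -
    have "ker n r a z j = 0" if "\<not> lle z j" using a that unfolding SchurPlus_iff by blast
    then show ?thesis using that kc_wt[OF Plus_Schur[OF a] that] Jm_wt[OF that] by (auto simp: ka kxi_def)
  qed
  have B: "([sone n r, a'], m) \<in> BGen n r (Suc 0)" by (simp add: BGen_Cons sone_Plus aJ)
  define Y where "Y = bcls n r lam (Suc 0) (gen1 ([sone n r, a'], m))"
  have Y: "Y \<in> Bplus n r lam (Suc 0)" unfolding Y_def by (rule bcls_Bplus[OF free_on_gen1[OF B]])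
  have pY: "ph (Suc 0) Y = thp (Suc 0) ([sone n r, a'], m)" unfolding Y_def ph_bcls[OF free_on_gen1[OF B]] phi_gen1 ..
  have tC: "th (Suc 0) (s, Y) \<in> CC n r lam (Suc 0)" by (rule th_CC) (simp add: BGenO_iff s Y)
  note CD = DD_CC[OF lam tC]
  have "XI (\<lambda>g. gen1 (smul n r s a, m) g - gen1 (s, rlam_act n r lam a m) g) = DD n r lam 0 (th (Suc 0) (s, Y))"
  proof (intro ext)
    fix t i j
    have d: "DD n r lam 0 (th (Suc 0) (s, Y)) t i j = kconv n r (ker n r s) (DD n r lam 0 (thp (Suc 0) ([sone n r, a'], m)) t) i j"
      using DD_kconv[OF ker_Kin[OF s], of lam 0 "ph (Suc 0) Y" t i j] by (simp add: th_def[abs_def] pY)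
    show "XI (\<lambda>g. gen1 (smul n r s a, m) g - gen1 (s, rlam_act n r lam a m) g) t i j = DD n r lam 0 (th (Suc 0) (s, Y)) t i j"
    proof (cases "t = [] \<and> i \<in> Inr n r \<and> j \<in> Inr n r \<and> cont j = lam")
      case True
      then have t: "t = []" and i: "i \<in> Inr n r" and j: "j \<in> Inr n r" and c: "cont j = lam" by auto
      have h: "DD n r lam 0 (thp (Suc 0) ([sone n r, a'], m)) [] z j = (ker n r a z j - (if z = j then ker n r a j j else 0)) * m"
        if z: "z \<in> Inr n r" for z
        using thp_face[OF B _ z j, of "[]" a' "[]"] c ka'[OF z j]
        by (simp add: ker_sone kconv_kid(1)[OF ker_Kin[OF Jrad_Schur[OF aJ]]])
      have "DD n r lam 0 (th (Suc 0) (s, Y)) t i j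
          = (\<Sum>z\<in>Inr n r. ker n r s i z * ((ker n r a z j - (if z = j then ker n r a j j else 0)) * m))"
        unfolding d kconv_def by (intro sum.cong refl) (simp only: t h)
      also have "\<dots> = (\<Sum>z\<in>Inr n r. ker n r s i z * ker n r a z j * m - (if z = j then ker n r s i j * ker n r a j j * m else 0))"
        by (intro sum.cong refl) (simp add: algebra_simps)
      also have "\<dots> = (\<Sum>z\<in>Inr n r. ker n r s i z * ker n r a z j) * m - ker n r s i j * ker n r a j j * m"
        unfolding sum_subtractf sum_distrib_right using j by simp
      finally show ?thesis
        using t c ker_smul[OF s Plus_Schur[OF a]] lc_eq[OF Plus_Schur[OF a] j]
        by (simp add: XI_def Lin_rel2 kconv_def rlam_act_eq[OF lam a] mult.assoc)
    next
      case False
      have "DD n r lam 0 (th (Suc 0) (s, Y)) t i j = 0"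
      proof (rule ccontr)
        assume nz: "DD n r lam 0 (th (Suc 0) (s, Y)) t i j \<noteq> 0"
        show False using CC_supp[OF CD nz] Kin_nz[OF CC_Kin[OF CD] nz] False by simp
      qed
      moreover have "ker n r (smul n r s a) i j = 0 \<and> ker n r s i j = 0" if "i \<notin> Inr n r \<or> j \<notin> Inr n r" using that by (auto simp: ker_def)
      ultimately show ?thesis using False by (auto simp: XI_def Lin_rel2)
    qed
  qed
  then show ?thesis unfolding IM_def using tC by (rule image_eqI)
qed

lemma XI_rel:
  assumes "x \<in> RW" shows "XI x \<in> IM"
  using assms unfolding ORel_def
proof (elim UnE CollectE exE conjE, goal_cases)
  case (1 s s' m)
  have "XI x = (\<lambda>t i j. 0)" unfolding 1(1) XI_def Lin_rel3 by (auto simp: fun_eq_iff ker_sadd algebra_simps)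
  then show ?case using IM_0 by (simp only:)
next
  case (2 s m m')
  have "XI x = (\<lambda>t i j. 0)" unfolding 2(1) XI_def Lin_rel3 by (auto simp: fun_eq_iff algebra_simps)
  then show ?case using IM_0 by (simp only:)
next
  case (3 s a m)
  show ?case unfolding 3(1) by (rule XI_smul[OF 3(2,3)])
qed

lemma XI_zspan:
  fixes x :: "'a::comm_ring_1 endo \<times> 'a \<Rightarrow> int"
  shows "x \<in> zspan RW \<Longrightarrow> XI x \<in> IM"
proof (induction x rule: zspan.induct)
  case zspan_zero
  have "XI (\<lambda>g::'a endo \<times> 'a. 0) = (\<lambda>t i j. 0)" by (auto simp: fun_eq_iff XI_def Lin_def)
  then show ?case using IM_0 by (simp only:)
next
  case (zspan_add x a)
  have f: "x \<in> FW" "a \<in> FW" using zspan_free[OF RW_free] RW_free zspan_add(1,2) by blast+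
  have "XI (\<lambda>g. x g + a g) = (\<lambda>t i j. XI x t i j + XI a t i j)"
  proof -
    have p: "(\<lambda>g. x g + a g) = x + a" by (simp add: fun_eq_iff)
    show ?thesis unfolding p XI_def Lin_add[OF f] ..
  qed
  then show ?case using IM_add[OF zspan_add(3) XI_rel[OF zspan_add(2)]] by (simp only:)
next
  case (zspan_diff x a)
  have f: "x \<in> FW" "a \<in> FW" using zspan_free[OF RW_free] RW_free zspan_diff(1,2) by blast+
  have "XI (\<lambda>g. x g - a g) = (\<lambda>t i j. XI x t i j - XI a t i j)"
  proof -
    have p: "(\<lambda>g. x g - a g) = x - a" by (simp add: fun_eq_iff)
    show ?thesis unfolding p XI_def Lin_diff[OF f] ..
  qed
  then show ?case using IM_diff[OF zspan_diff(3) XI_rel[OF zspan_diff(2)]] by (simp only:)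
qed

text \<open>If \<open>U\<close> dies in the Weyl module, its image in the free group is a
  combination of relations. \<open>XI\<close> sends that image to the coordinates of
  \<open>U\<close> on the one hand and into the boundaries on the other.\<close>

lemma dres0_kernel:
  fixes U :: "'a::comm_ring_1 bres"
  assumes U: "U \<in> Bres n r lam 0" and z: "dres0 n r lam U = (Wzero n r lam :: ('a endo \<times> 'a \<Rightarrow> int) set)"
  shows "U \<in> dres n r lam (Suc 0) ` Bres n r lam (Suc 0)"
proof -
  define F where "F = TH 0 U"
  have F: "F \<in> CC n r lam 0" unfolding F_def by (rule TH_CC[OF U])
  note K = CC_Kin[OF F, of "[]"]
  have t0: "[] \<in> tails n r lam 0" by simp
  have y: "dplus0 n r lam (yb 0 [] :: 'a bplus) = 1"
    unfolding dplus0_eq[OF yb_Bplus[OF t0]] ph_yb[OF t0] list.map thp0[OF sone_Schur] lc_sone[OF lam] by (rule mult_1_left)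
  have "sig 0 F = gen1 (opr n r (F []), yb 0 [])" unfolding sig_def tails.simps(1)
    by (subst sum.insert) (simp_all only: finite.emptyI empty_iff not_False_eq_True sum.empty add_0_right)
  then have l: "lin_ext D0 (sig 0 F) = gen1 (opr n r (F []), 1)" by (simp only: lin_ext_gen1 D0_def prod.case y)
  have Ue: "bocls n r lam 0 (sig 0 F) = U" unfolding F_def by (rule bocls_sig[OF U])
  have "wcls n r lam (gen1 (opr n r (F []), 1)) = Wzero n r lam"
    using dres0_bocls[OF sig_FO[OF F]] unfolding Ue z l by (rule sym)
  then have "wcls n r lam (gen1 (opr n r (F []), 1)) = wcls n r lam 0" by (simp only: Wzero_def zero_fun_def)
  moreover have g: "gen1 (opr n r (F []), 1) \<in> FW" by (rule free_on_gen1) (simp add: OGen_def opr_Schur[OF K])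
  ultimately have "eqm RW (gen1 (opr n r (F []), 1)) 0" unfolding wcls_def using qcls_eq_iff[OF g free_on_0(2)] by blast
  then have "gen1 (opr n r (F []), 1) \<in> zspan RW" by (simp only: eqm_def diff_0_right)
  from XI_zspan[OF this] have "XI (gen1 (opr n r (F []), 1)) \<in> IM" .
  moreover have "XI (gen1 (opr n r (F []), 1)) = F"
  proof (intro ext)
    fix t i j
    show "XI (gen1 (opr n r (F []), 1)) t i j = F t i j"
    proof (cases "t = [] \<and> cont j = lam")
      case True
      then show ?thesis by (simp add: XI_def ker_opr[OF K])
    next
      case False
      then have "F t i j = 0" using CC_supp[OF F, of t i j] by force
      then show ?thesis using False by (auto simp: XI_def)
    qed
  qed
  ultimately obtain G where G: "G \<in> CC n r lam (Suc 0)" "F = DD n r lam 0 G" unfolding IM_def by auto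
  note V = TH_surj[OF G(1)]
  have "U = dres n r lam (Suc 0) (bocls n r lam (Suc 0) (sig (Suc 0) G))"
    by (rule TH_inj[OF U TH_dres(1)[OF V(1)]]) (simp only: TH_dres(2)[OF V(1)] V(2) G(2)[symmetric] F_def)
  then show ?thesis using V(1) by blast
qed

end

theorem theorem5p2:
  fixes n r :: nat and lam :: "nat \<Rightarrow> nat"
  assumes "0 < n" and "0 < r" and "lam \<in> CompsDom n r"
  shows "(\<forall>k. projective_smod TYPE('m) TYPE('q) n r
                 (Bmod n r lam k :: ('a::comm_ring_1, 'a bres) smod))
       \<and> dres0 n r lam ` Bres n r lam 0 = (Wlam n r lam :: ('a endo \<times> 'a \<Rightarrow> int) set set)
       \<and> {X \<in> Bres n r lam 0. dres0 n r lam X = (Wzero n r lam :: ('a endo \<times> 'a \<Rightarrow> int) set)}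
           = dres n r lam 1 ` Bres n r lam 1
       \<and> (\<forall>k\<ge>1. {X \<in> (Bres n r lam k :: 'a bres set). dres n r lam k X = Bzero n r lam (k - 1)}
           = dres n r lam (Suc k) ` Bres n r lam (Suc k))"
proof -
  interpret bar_terms n r lam by unfold_locales (use assms(3) in \<open>simp add: CompsDom_def\<close>)
  show ?thesis
  proof (intro conjI allI impI)
    fix k
    show "projective_smod TYPE('m) TYPE('q) n r (Bmod n r lam k :: ('a, 'a bres) smod)" by (rule Bmod_projective)
  next
    show "dres0 n r lam ` Bres n r lam 0 = (Wlam n r lam :: ('a endo \<times> 'a \<Rightarrow> int) set set)" by (rule dres0_onto)
  next
    show "{U \<in> Bres n r lam 0. dres0 n r lam U = (Wzero n r lam :: ('a endo \<times> 'a \<Rightarrow> int) set)}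
        = dres n r lam 1 ` Bres n r lam 1" unfolding One_nat_def
    proof (intro equalityI subsetI)
      fix U :: "'a bres"
      assume "U \<in> {U \<in> Bres n r lam 0. dres0 n r lam U = (Wzero n r lam :: ('a endo \<times> 'a \<Rightarrow> int) set)}"
      then have "U \<in> Bres n r lam 0" "dres0 n r lam U = Wzero n r lam" by simp_all
      then show "U \<in> dres n r lam (Suc 0) ` Bres n r lam (Suc 0)" by (rule dres0_kernel)
    next
      fix U :: "'a bres" assume "U \<in> dres n r lam (Suc 0) ` Bres n r lam (Suc 0)"
      then show "U \<in> {U \<in> Bres n r lam 0. dres0 n r lam U = (Wzero n r lam :: ('a endo \<times> 'a \<Rightarrow> int) set)}"
        by (auto simp: dres0_dres TH_dres(1))
    qed
  next
    fix k :: nat assume "1 \<le> k"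
    then obtain k' where k: "k = Suc k'" by (cases k) auto
    show "{U \<in> (Bres n r lam k :: 'a bres set). dres n r lam k U = Bzero n r lam (k - 1)}
           = dres n r lam (Suc k) ` Bres n r lam (Suc k)"
      unfolding k using bar_exact_pos[OF assms(3)] by simp
  qed
qed

end
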